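(* Let $F$ be a field of characteristic zero and $k\ge2$. The $T_{L,U}$-ideal $\operatorname{Id}^{L,U}(M_k(F))$ of $(L,U)$-identities of $M_k(F)$ is generated, as a $T_{L,U}$-ideal, by the following identities: (1) $[x^{gg},y^{gg}]$; (2) $[x^{gg},y^{e_{12}e_{12}}]$; (3) $x^{e_{12}e_{12}}y^{e_{12}e_{21}}-y^{e_{12}e_{12}}x^{e_{12}e_{21}}$; (4) $x^{e_{12}e_{12}}y^{e_{12}e_{31}}$, if $k\ge3$. Moreover, $\operatorname{Id}^{L,U}(M_k(F))$ is principal: it is generated as a $T_{L,U}$-ideal by the sum of the identities (1)–(4) (where (4) is present only for $k\ge3$).
   Context: $L=\operatorname{Der}(M_k(F))$, identified with $\mathrm{sl}_k(F)$ via $c\mapsto\operatorname{ad}_c$, $\operatorname{ad}_c(x)=cx-xc$; $\phi:U(L)\to\operatorname{End}_F(M_k(F))$ is the unital algebra homomorphism from the universal enveloping algebra extending this action, and $U:=\phi(U(L))$. $e_{ij}$ are matrix units, $h_i:=e_{ii}-e_{i+1,i+1}$ ($1\le i<k$), $g:=I_k$, $\mathcal S:=\{e_{ij}\mid i\neq j\}\cup\{h_1,\dots,h_{k-1}\}$, $\mathcal M:=\mathcal S\cup\{g\}$ (a basis of $M_k(F)$). For $a,b\in\mathcal M$, $\varphi_{ab}$ is the linear endomorphism of $M_k(F)$ sending $a$ to $b$ and the other elements of $\mathcal M$ to $0$; $\{\varphi_{ab}\}_{a,b\in\mathcal S}\cup\{\varphi_{gg}\}$ is a basis of $U$. Algebras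 are associative, not necessarily unital. An $L$-algebra is an algebra $B$ with a Lie algebra homomorphism $L\to\operatorname{Der}(B)$, extended to a unital homomorphism $\phi_B:U(L)\to\operatorname{End}_F(B)$; one writes $b^u:=\phi_B(u)(b)$ for $u\in U(L)$. Exponents are multiplied in the opposite algebra, i.e. $(b^u)^v=b^{uv}$ with $uv$ the product in $U(L)^{\mathrm{op}}$. An $(L,U)$-algebra is an $L$-algebra $B$ endowed with a right action of the unital algebra $U^{\mathrm{op}}$ (written exponentially) such that $b^u=b^{\phi(u)}$ for all $u\in U(L)$, $b\in B$; equivalently, $\ker\phi$ acts as zero on $B$. The free $L$-algebra $F\langle X|L\rangle$ on $X=\{x_1,x_2,\dots\}$ is the nonunital associative algebra generated by symbols $x_i^u$ ($u\in U(L)$), linear in $u$, with $x_i^1=x_i$, free on $\{x_i^e\}$ for $e$ in a basis of $U(L)$, on which $\delta\in L$ acts as the derivation with $x_i^u\mapsto x_i^{u\delta}$ (opposite product). The free $(L,U)$-algebra is $F^{L,U}\langle X\rangle=F\langle X|L\rangle/I$, $I$ the two-sided ideal generated by all $f^z$ with $f\in F\langle X|L\rangle$, $z\in\ker\phi$. In it one writes $x^{ab}:=x^{\varphi_{ab}}$ ($x^{w}$ for $w\in U$ is the class of $x^u$ for any $u$ with $\phi(u)=w$). A $T_{L,U}$-ideal is a two-sided ideal of $F^{L,U}\langle X\rangle$ invariant under the $L$-action and under all algebra endomorphisms of $F^{L,U}\langle X\rangle$ commuting with the action. $\operatorname{Id}^{L,U}(B)$ is the set of elements of $F^{L,U}\langle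 X\rangle$ vanishing under all evaluations $x_i\mapsto b_i\in B$, $x_i^w\mapsto b_i^w$. $x,y$ are distinct variables; $[f,h]=fh-hf$. *)

theory Defs
  imports "Jordan_Normal_Form.Matrix" "HOL-Library.Poly_Mapping" "HOL-Algebra.QuotRing"
begin

text \<open>
  An algebra over a field is a \<^type>\<open>module\<close> record whose scalars are the elements of a type of
  class \<^class>\<open>field\<close>. The same record type is used for Lie algebras, the multiplication being
  the bracket. The component \<^const>\<open>one\<close> has a meaning for unital associative algebras only; in
  the other cases it is set to zero and never used.
\<close>

text \<open>Linear maps are extensional, so that equality of linear maps is equality of functions.\<close>

definition lin_maps :: "('a, 'v) module \<Rightarrow> ('a, 'w) module \<Rightarrow> ('v \<Rightarrow> 'w) set" where
  "lin_maps A B = {f \<in> carrier A \<rightarrow>\<^sub>E carrier B.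
     (\<forall>x\<in>carrier A. \<forall>y\<in>carrier A. f (x \<oplus>\<^bsub>A\<^esub> y) = f x \<oplus>\<^bsub>B\<^esub> f y) \<and>
     (\<forall>c. \<forall>x\<in>carrier A. f (c \<odot>\<^bsub>A\<^esub> x) = c \<odot>\<^bsub>B\<^esub> f x)}"

definition alg_hom :: "('a, 'v) module \<Rightarrow> ('a, 'w) module \<Rightarrow> ('v \<Rightarrow> 'w) set" where
  "alg_hom A B = {f \<in> lin_maps A B.
     \<forall>x\<in>carrier A. \<forall>y\<in>carrier A. f (x \<otimes>\<^bsub>A\<^esub> y) = f x \<otimes>\<^bsub>B\<^esub> f y}"

definition derivations :: "('a, 'v) module \<Rightarrow> ('v \<Rightarrow> 'v) set" where
  "derivations A = {d \<in> lin_maps A A.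
     \<forall>x\<in>carrier A. \<forall>y\<in>carrier A. d (x \<otimes>\<^bsub>A\<^esub> y) = d x \<otimes>\<^bsub>A\<^esub> y \<oplus>\<^bsub>A\<^esub> x \<otimes>\<^bsub>A\<^esub> d y}"

definition derivation_algebra :: "('a, 'v) module \<Rightarrow> ('a, 'v \<Rightarrow> 'v) module" where
  "derivation_algebra A = \<lparr>
     carrier = derivations A,
     mult = (\<lambda>d e. \<lambda>x\<in>carrier A. d (e x) \<ominus>\<^bsub>A\<^esub> e (d x)),
     one = (\<lambda>x\<in>carrier A. \<zero>\<^bsub>A\<^esub>),
     zero = (\<lambda>x\<in>carrier A. \<zero>\<^bsub>A\<^esub>),
     add = (\<lambda>d e. \<lambda>x\<in>carrier A. d x \<oplus>\<^bsub>A\<^esub> e x),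
     smult = (\<lambda>c d. \<lambda>x\<in>carrier A. c \<odot>\<^bsub>A\<^esub> d x)\<rparr>"

definition alg_ideal :: "('a, 'v) module \<Rightarrow> 'v set \<Rightarrow> bool" where
  "alg_ideal A J \<longleftrightarrow> J \<subseteq> carrier A \<and> \<zero>\<^bsub>A\<^esub> \<in> J \<and>
     (\<forall>x\<in>J. \<forall>y\<in>J. x \<oplus>\<^bsub>A\<^esub> y \<in> J) \<and>
     (\<forall>c. \<forall>x\<in>J. c \<odot>\<^bsub>A\<^esub> x \<in> J) \<and>
     (\<forall>a\<in>carrier A. \<forall>x\<in>J. a \<otimes>\<^bsub>A\<^esub> x \<in> J \<and> x \<otimes>\<^bsub>A\<^esub> a \<in> J)"

definition alg_ideal_gen :: "('a, 'v) module \<Rightarrow> 'v set \<Rightarrow> 'v set" where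
  "alg_ideal_gen A S = \<Inter>{J. alg_ideal A J \<and> S \<subseteq> J}"

text \<open>This is \<^const>\<open>FactRing\<close> together with the scalar multiplication of cosets.\<close>

definition quot_alg :: "('a, 'v) module \<Rightarrow> 'v set \<Rightarrow> ('a, 'v set) module" where
  "quot_alg A J = \<lparr>
     carrier = a_rcosets\<^bsub>A\<^esub> J,
     mult = rcoset_mult A J,
     one = J +>\<^bsub>A\<^esub> \<one>\<^bsub>A\<^esub>,
     zero = J,
     add = set_add A,
     smult = (\<lambda>c X. \<Union>x\<in>X. J +>\<^bsub>A\<^esub> (c \<odot>\<^bsub>A\<^esub> x))\<rparr>"

text \<open>
  The lists over a type form the free monoid, so that \<open>'b list \<Rightarrow>\<^sub>0 'a\<close>, with the convolution
  product of \<^theory>\<open>HOL-Library.Poly_Mapping\<close>, is the free unital associative algebra on the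
  letters \<open>'b\<close>.
\<close>

instantiation list :: (type) monoid_add
begin

definition zero_list :: "'a list" where "zero_list = []"
definition plus_list :: "'a list \<Rightarrow> 'a list \<Rightarrow> 'a list" where "plus_list = (@)"

instance by standard (auto simp: zero_list_def plus_list_def)

end

definition free_alg :: "'b set \<Rightarrow> ('a::field, 'b list \<Rightarrow>\<^sub>0 'a) module" where
  "free_alg S = \<lparr>
     carrier = {p. \<forall>w\<in>Poly_Mapping.keys p. set w \<subseteq> S},
     mult = (*), one = 1, zero = 0, add = (+),
     smult = (\<lambda>c p. Poly_Mapping.map ((*) c) p)\<rparr>"

definition free_nonunital_alg :: "'b set \<Rightarrow> ('a::field, 'b list \<Rightarrow>\<^sub>0 'a) module" where
  "free_nonunital_alg S =
     (free_alg S)\<lparr>carrier := {p \<in> carrier (free_alg S). [] \<notin> Poly_Mapping.keys p}, one := 0\<rparr>"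

definition letter :: "'b \<Rightarrow> ('b list \<Rightarrow>\<^sub>0 'a::field)" where
  "letter b = Poly_Mapping.single [b] 1"

type_synonym ('a, 'l) uea = "('l list \<Rightarrow>\<^sub>0 'a) set"

definition uea_ideal :: "('a::field, 'l) module \<Rightarrow> ('l list \<Rightarrow>\<^sub>0 'a) set" where
  "uea_ideal L = alg_ideal_gen (free_alg (carrier L))
     ({letter (x \<oplus>\<^bsub>L\<^esub> y) - letter x - letter y | x y. x \<in> carrier L \<and> y \<in> carrier L} \<union>
      {letter (c \<odot>\<^bsub>L\<^esub> x) - Poly_Mapping.map ((*) c) (letter x) | c x. x \<in> carrier L} \<union>
      {letter x * letter y - letter y * letter x - letter (x \<otimes>\<^bsub>L\<^esub> y) | x y.
         x \<in> carrier L \<and> y \<in> carrier L})"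

definition uea_alg :: "('a::field, 'l) module \<Rightarrow> ('a, ('a, 'l) uea) module" where
  "uea_alg L = quot_alg (free_alg (carrier L)) (uea_ideal L)"

definition uea_inj :: "('a::field, 'l) module \<Rightarrow> 'l \<Rightarrow> ('a, 'l) uea" where
  "uea_inj L x = uea_ideal L +>\<^bsub>free_alg (carrier L)\<^esub> letter x"

text \<open>
  For a representation \<open>\<rho>\<close> of a Lie algebra on the space underlying \<open>B\<close>, the endomorphism of
  \<open>B\<close> given by an element \<open>u\<close> of the enveloping algebra: a product \<open>d\<^sub>1 \<cdots> d\<^sub>n\<close> acts as
  \<open>\<rho> d\<^sub>1 \<circ> \<cdots> \<circ> \<rho> d\<^sub>n\<close>, and \<open>u\<close> acts as any of its representatives does. In exponential notation
  \<open>uea_act B \<rho> u b\<close> is \<open>b\<^sup>u\<close>; since the product of the enveloping algebra is the composition of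
  endomorphisms, \<open>(b\<^sup>u)\<^sup>v\<close> is the result of acting by \<open>v \<otimes> u\<close>.
\<close>

definition uea_act :: "('a::field, 'v) module \<Rightarrow> ('l \<Rightarrow> 'v \<Rightarrow> 'v) \<Rightarrow> ('a, 'l) uea \<Rightarrow> 'v \<Rightarrow> 'v" where
  "uea_act B \<rho> u = (let p = (SOME p. p \<in> u) in
     (\<lambda>b\<in>carrier B. \<Oplus>\<^bsub>B\<^esub>w\<in>Poly_Mapping.keys p. Poly_Mapping.lookup p w \<odot>\<^bsub>B\<^esub> foldr \<rho> w b))"

text \<open>
  The letter \<open>(i, u)\<close> stands for the symbol \<open>x\<^sub>i\<^sup>u\<close>; the ideal makes these symbols linear in \<open>u\<close>.
\<close>

type_synonym ('a, 'l) fla = "((nat \<times> ('a, 'l) uea) list \<Rightarrow>\<^sub>0 'a) set"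

definition free_L_ideal :: "('a::field, 'l) module \<Rightarrow> ((nat \<times> ('a, 'l) uea) list \<Rightarrow>\<^sub>0 'a) set" where
  "free_L_ideal L = alg_ideal_gen (free_nonunital_alg (UNIV \<times> carrier (uea_alg L)))
     ({letter (i, u \<oplus>\<^bsub>uea_alg L\<^esub> v) - letter (i, u) - letter (i, v) | i u v.
         u \<in> carrier (uea_alg L) \<and> v \<in> carrier (uea_alg L)} \<union>
      {letter (i, c \<odot>\<^bsub>uea_alg L\<^esub> u) - Poly_Mapping.map ((*) c) (letter (i, u)) | i c u.
         u \<in> carrier (uea_alg L)})"

definition free_L_alg :: "('a::field, 'l) module \<Rightarrow> ('a, ('a, 'l) fla) module" where
  "free_L_alg L =
     quot_alg (free_nonunital_alg (UNIV \<times> carrier (uea_alg L))) (free_L_ideal L)"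

definition free_L_var :: "('a::field, 'l) module \<Rightarrow> nat \<Rightarrow> ('a, 'l) uea \<Rightarrow> ('a, 'l) fla" where
  "free_L_var L i u =
     free_L_ideal L +>\<^bsub>free_nonunital_alg (UNIV \<times> carrier (uea_alg L))\<^esub> letter (i, u)"

definition free_L_act ::
    "('a::field, 'l) module \<Rightarrow> 'l \<Rightarrow> ('a, 'l) fla \<Rightarrow> ('a, 'l) fla" where
  "free_L_act L d = (THE D. D \<in> derivations (free_L_alg L) \<and>
     (\<forall>i. \<forall>u\<in>carrier (uea_alg L).
        D (free_L_var L i u) = free_L_var L i (uea_inj L d \<otimes>\<^bsub>uea_alg L\<^esub> u)))"

definition mat_alg :: "nat \<Rightarrow> ('a::field, 'a mat) module" where
  "mat_alg k = \<lparr>carrier = carrier_mat k k, mult = (*), one = 1\<^sub>m k, zero = 0\<^sub>m k k,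
     add = (+), smult = (\<cdot>\<^sub>m)\<rparr>"

abbreviation der_mat :: "nat \<Rightarrow> ('a::field, 'a mat \<Rightarrow> 'a mat) module" where
  "der_mat k \<equiv> derivation_algebra (mat_alg k)"

definition phi :: "nat \<Rightarrow> ('a::field, 'a mat \<Rightarrow> 'a mat) uea \<Rightarrow> 'a mat \<Rightarrow> 'a mat" where
  "phi k = uea_act (mat_alg k) (\<lambda>d. d)"

definition ker_phi :: "nat \<Rightarrow> ('a::field, 'a mat \<Rightarrow> 'a mat) uea set" where
  "ker_phi k = {z \<in> carrier (uea_alg (der_mat k)). \<forall>b\<in>carrier_mat k k. phi k z b = 0\<^sub>m k k}"

text \<open>Matrix units \<open>e\<^sub>i\<^sub>j\<close> are numbered from 1, while the entries of a \<^type>\<open>mat\<close> are numbered from 0.\<close>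

definition mat_unit :: "nat \<Rightarrow> nat \<Rightarrow> nat \<Rightarrow> 'a::field mat" where
  "mat_unit k i j = mat k k (\<lambda>(r, s). if Suc r = i \<and> Suc s = j then 1 else 0)"

definition basis_S :: "nat \<Rightarrow> 'a::field mat set" where
  "basis_S k =
     {mat_unit k i j | i j. i \<in> {1..k} \<and> j \<in> {1..k} \<and> i \<noteq> j} \<union>
     {mat_unit k i i - mat_unit k (i + 1) (i + 1) | i. 1 \<le> i \<and> i < k}"

definition basis_M :: "nat \<Rightarrow> 'a::field mat set" where
  "basis_M k = insert (1\<^sub>m k) (basis_S k)"

definition phi_ab :: "nat \<Rightarrow> 'a::field mat \<Rightarrow> 'a mat \<Rightarrow> 'a mat \<Rightarrow> 'a mat" where
  "phi_ab k a b = (THE f. f \<in> lin_maps (mat_alg k) (mat_alg k) \<and>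
     f a = b \<and> (\<forall>c \<in> basis_M k - {a}. f c = 0\<^sub>m k k))"

type_synonym 'a flu = "('a, 'a mat \<Rightarrow> 'a mat) fla set"

definition free_LU_ideal :: "nat \<Rightarrow> ('a::field, 'a mat \<Rightarrow> 'a mat) fla set" where
  "free_LU_ideal k = (let A = free_L_alg (der_mat k) in
     alg_ideal_gen A {uea_act A (free_L_act (der_mat k)) z f | f z. f \<in> carrier A \<and> z \<in> ker_phi k})"

definition free_LU_alg :: "nat \<Rightarrow> ('a::field, 'a flu) module" where
  "free_LU_alg k = quot_alg (free_L_alg (der_mat k)) (free_LU_ideal k)"

definition free_LU_act :: "nat \<Rightarrow> ('a::field mat \<Rightarrow> 'a mat) \<Rightarrow> 'a flu \<Rightarrow> 'a flu" where
  "free_LU_act k d X =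
     (\<Union>f\<in>X. free_LU_ideal k +>\<^bsub>free_L_alg (der_mat k)\<^esub> free_L_act (der_mat k) d f)"

definition free_LU_var :: "nat \<Rightarrow> nat \<Rightarrow> ('a::field, 'a mat \<Rightarrow> 'a mat) uea \<Rightarrow> 'a flu" where
  "free_LU_var k i u =
     free_LU_ideal k +>\<^bsub>free_L_alg (der_mat k)\<^esub> free_L_var (der_mat k) i u"

text \<open>\<open>x\<^sub>i\<^sup>w\<close> for \<open>w\<close> in the image of \<^const>\<open>phi\<close>; the class does not depend on the chosen \<open>u\<close>.\<close>

definition free_LU_pow :: "nat \<Rightarrow> nat \<Rightarrow> ('a::field mat \<Rightarrow> 'a mat) \<Rightarrow> 'a flu" where
  "free_LU_pow k i w =
     free_LU_var k i (SOME u. u \<in> carrier (uea_alg (der_mat k)) \<and> phi k u = w)"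

definition TLU_ideal :: "nat \<Rightarrow> 'a::field flu set \<Rightarrow> bool" where
  "TLU_ideal k J \<longleftrightarrow> alg_ideal (free_LU_alg k) J \<and>
     (\<forall>d\<in>carrier (der_mat k). \<forall>f\<in>J. free_LU_act k d f \<in> J) \<and>
     (\<forall>\<psi>\<in>alg_hom (free_LU_alg k) (free_LU_alg k).
        (\<forall>d\<in>carrier (der_mat k). \<forall>f\<in>carrier (free_LU_alg k).
           \<psi> (free_LU_act k d f) = free_LU_act k d (\<psi> f)) \<longrightarrow>
        \<psi> ` J \<subseteq> J)"

definition TLU_ideal_gen :: "nat \<Rightarrow> 'a::field flu set \<Rightarrow> 'a flu set" where
  "TLU_ideal_gen k S = \<Inter>{J. TLU_ideal k J \<and> S \<subseteq> J}"

text \<open>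
  The identities of an algebra \<open>B\<close> on which \<open>L\<close> acts by \<open>\<rho>\<close>. The evaluation at \<open>b\<close> is the
  unique homomorphism \<open>\<psi>\<close> with \<open>x\<^sub>i\<^sup>u \<mapsto> b\<^sub>i\<^sup>u\<close>.
\<close>

definition LU_identities ::
    "nat \<Rightarrow> ('a::field, 'v) module \<Rightarrow> (('a mat \<Rightarrow> 'a mat) \<Rightarrow> 'v \<Rightarrow> 'v) \<Rightarrow> 'a flu set" where
  "LU_identities k B \<rho> = {f \<in> carrier (free_LU_alg k).
     \<forall>b \<in> UNIV \<rightarrow> carrier B. \<forall>\<psi> \<in> alg_hom (free_LU_alg k) B.
       (\<forall>i. \<forall>u\<in>carrier (uea_alg (der_mat k)). \<psi> (free_LU_var k i u) = uea_act B \<rho> u (b i)) \<longrightarrow>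
       \<psi> f = \<zero>\<^bsub>B\<^esub>}"

definition Id_LU_mat :: "nat \<Rightarrow> 'a::field flu set" where
  "Id_LU_mat k = LU_identities k (mat_alg k) (\<lambda>d. d)"

definition commutator :: "('a, 'v) module \<Rightarrow> 'v \<Rightarrow> 'v \<Rightarrow> 'v" where
  "commutator A f h = f \<otimes>\<^bsub>A\<^esub> h \<ominus>\<^bsub>A\<^esub> h \<otimes>\<^bsub>A\<^esub> f"

abbreviation var_gg :: "nat \<Rightarrow> nat \<Rightarrow> 'a::field flu" where
  "var_gg k x \<equiv> free_LU_pow k x (phi_ab k (1\<^sub>m k) (1\<^sub>m k))"

text \<open>\<open>var_e12 k x i j\<close> is \<open>x\<^sup>a\<^sup>b\<close> with \<open>a = e\<^sub>1\<^sub>2\<close> and \<open>b = e\<^sub>i\<^sub>j\<close>.\<close>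

abbreviation var_e12 :: "nat \<Rightarrow> nat \<Rightarrow> nat \<Rightarrow> nat \<Rightarrow> 'a::field flu" where
  "var_e12 k x i j \<equiv> free_LU_pow k x (phi_ab k (mat_unit k 1 2) (mat_unit k i j))"

definition identity1 :: "nat \<Rightarrow> nat \<Rightarrow> nat \<Rightarrow> 'a::field flu" where
  "identity1 k x y = commutator (free_LU_alg k) (var_gg k x) (var_gg k y)"

definition identity2 :: "nat \<Rightarrow> nat \<Rightarrow> nat \<Rightarrow> 'a::field flu" where
  "identity2 k x y = commutator (free_LU_alg k) (var_gg k x) (var_e12 k y 1 2)"

definition identity3 :: "nat \<Rightarrow> nat \<Rightarrow> nat \<Rightarrow> 'a::field flu" where
  "identity3 k x y =
     var_e12 k x 1 2 \<otimes>\<^bsub>free_LU_alg k\<^esub> var_e12 k y 2 1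
       \<ominus>\<^bsub>free_LU_alg k\<^esub> var_e12 k y 1 2 \<otimes>\<^bsub>free_LU_alg k\<^esub> var_e12 k x 2 1"

definition identity4 :: "nat \<Rightarrow> nat \<Rightarrow> nat \<Rightarrow> 'a::field flu" where
  "identity4 k x y = var_e12 k x 1 2 \<otimes>\<^bsub>free_LU_alg k\<^esub> var_e12 k y 3 1"

end

theory Submission
  imports Defs
begin

text \<open>
  Write \<open>A\<close> for the free \<open>(L,U)\<close>-algebra and let \<open>J\<close> be a \<open>T\<close>-ideal of \<open>A\<close> that contains the
  identities (1)--(4). That the four elements are identities of \<open>M\<^sub>k\<close> is seen by evaluating them, so
  what has to be shown is that every identity of \<open>M\<^sub>k\<close> lies in \<open>J\<close>.

  The operators that \<open>U(L)\<close> induces on \<open>M\<^sub>k = F 1 \<oplus> sl\<^sub>k\<close> are all those preserving both summands, and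
  the kernel of \<open>\<phi>\<close> acts as zero on \<open>A/J\<close>. So \<open>x\<^sup>u\<close> is a combination of the element \<open>x\<^sup>g\<^sup>g\<close>, which is
  killed by \<open>L\<close>, and of the elements \<open>x\<^sup>w\<close> where \<open>w\<close> is a coordinate of \<open>sl\<^sub>k\<close> times a basis matrix
  \<open>b\<close> of \<open>sl\<^sub>k\<close>. For a fixed variable and a fixed coordinate, \<open>b \<mapsto> x\<^sup>w\<close> is an equivariant map from
  \<open>sl\<^sub>k\<close> to \<open>A/J\<close>. Hence \<open>A/J\<close> is spanned by words whose letters are invariants or pairs of an
  equivariant map and a matrix (\<open>words_span\<close>, \<open>tok_z_inv\<close>, \<open>tok_v_hom\<close>).

  Two equivariant maps \<open>v, w\<close> multiply like matrices: \<open>v(a) w(b) = S(ab)\<close> for an equivariant map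
  \<open>S\<close> on \<open>M\<^sub>k\<close> that depends on \<open>v\<close> and \<open>w\<close> only (\<open>bval_bval\<close>). The reason is that
  \<open>v(e\<^sub>i\<^sub>j) w(e\<^sub>p\<^sub>q) = 0\<close> for \<open>j \<noteq> p\<close>. If \<open>q \<noteq> i\<close>, the product has eigenvalue 2 under the derivation given
  by some diagonal idempotent, whereas the eigenvalues on \<open>M\<^sub>k\<close>, and therefore on \<open>A/J\<close>, are \<open>0, 1, -1\<close>
  (\<open>weight_zero\<close>). If \<open>q = i\<close>, it vanishes by (4), which the action of \<open>L\<close> transports from one triple of
  indices to all others (\<open>loop_zero_all\<close>). The remaining relations follow by applying derivations to
  these zero products. Identity (3) says that the maps \<open>S\<close> for \<open>(v, w)\<close> and \<open>(w, v)\<close> agree at \<open>e\<^sub>1\<^sub>1\<close>,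
  hence everywhere (\<open>S_sym\<close>); (1) and (2) say that invariants commute with everything. It follows that
  modulo \<open>J\<close> the value of a word is a linear function of the product of its matrices, and that this
  linear function depends only on the multiset of the labels (variable and coordinate) of its letters
  (\<open>word_value_mset\<close>).

  Now evaluate an identity at matrices with arbitrary coordinates. Every word becomes a monomial in
  these coordinates times the product of its matrices. Distinct monomials are linearly independent
  functions (\<open>monomials_independent\<close>), so that for each multiset of labels the corresponding
  combination of products of matrices is zero, and with it the combination of the values of these
  words modulo \<open>J\<close> (\<open>identities_in_T_ideal\<close>).

  For the generation by the sum of the identities, the four summands are separated
  (\<open>idt_sum_split\<close>): substituting \<open>x\<^sup>g\<^sup>g\<close> or the component with \<open>a = b = e\<^sub>1\<^sub>2\<close> for the variables isolates
  (1), then (2), then the sum of (3) and (4), and \<open>ad e\<^sub>3\<^sub>3\<close> annihilates (3) and fixes (4).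
\<close>

section \<open>Nonunital algebras and their quotients\<close>

text \<open>
  The nonunital associative algebras of this development as a locale, so that facts about the record
  components become available with its interpretation.
\<close>

locale nalg = abelian_group A for A :: "('a::field, 'v) module" (structure) +
  assumes m_closed [intro, simp]: "\<lbrakk>x \<in> carrier A; y \<in> carrier A\<rbrakk> \<Longrightarrow> x \<otimes> y \<in> carrier A"
    and m_assoc: "\<lbrakk>x \<in> carrier A; y \<in> carrier A; z \<in> carrier A\<rbrakk> \<Longrightarrow> (x \<otimes> y) \<otimes> z = x \<otimes> (y \<otimes> z)"
    and l_distr: "\<lbrakk>x \<in> carrier A; y \<in> carrier A; z \<in> carrier A\<rbrakk> \<Longrightarrow> (x \<oplus> y) \<otimes> z = x \<otimes> z \<oplus> y \<otimes> z"
    and r_distr: "\<lbrakk>x \<in> carrier A; y \<in> carrier A; z \<in> carrier A\<rbrakk> \<Longrightarrow> z \<otimes> (x \<oplus> y) = z \<otimes> x \<oplus> z \<otimes> y"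
    and smult_closed [intro, simp]: "x \<in> carrier A \<Longrightarrow> c \<odot> x \<in> carrier A"
    and smult_l_distr: "x \<in> carrier A \<Longrightarrow> (c + d) \<odot> x = c \<odot> x \<oplus> d \<odot> x"
    and smult_r_distr: "\<lbrakk>x \<in> carrier A; y \<in> carrier A\<rbrakk> \<Longrightarrow> c \<odot> (x \<oplus> y) = c \<odot> x \<oplus> c \<odot> y"
    and smult_smult: "x \<in> carrier A \<Longrightarrow> (c * d) \<odot> x = c \<odot> (d \<odot> x)"
    and smult_one [simp]: "x \<in> carrier A \<Longrightarrow> 1 \<odot> x = x"
    and smult_mult_l: "\<lbrakk>x \<in> carrier A; y \<in> carrier A\<rbrakk> \<Longrightarrow> (c \<odot> x) \<otimes> y = c \<odot> (x \<otimes> y)"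
    and smult_mult_r: "\<lbrakk>x \<in> carrier A; y \<in> carrier A\<rbrakk> \<Longrightarrow> x \<otimes> (c \<odot> y) = c \<odot> (x \<otimes> y)"
begin

lemma add_self_zero: "x \<in> carrier A \<Longrightarrow> x = x \<oplus> x \<Longrightarrow> x = \<zero>"
  by (metis local.add.l_cancel_one')

lemma smult_zero_left [simp]: "x \<in> carrier A \<Longrightarrow> 0 \<odot> x = \<zero>"
  using smult_l_distr[of x 0 0] by (intro add_self_zero) auto

lemma smult_zero_right [simp]: "c \<odot> \<zero> = \<zero>"
  using smult_r_distr[of \<zero> \<zero> c] by (intro add_self_zero) auto

lemma l_null [simp]: "x \<in> carrier A \<Longrightarrow> \<zero> \<otimes> x = \<zero>"
  using l_distr[of \<zero> \<zero> x] by (intro add_self_zero) auto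

lemma r_null [simp]: "x \<in> carrier A \<Longrightarrow> x \<otimes> \<zero> = \<zero>"
  using r_distr[of \<zero> \<zero> x] by (intro add_self_zero) auto

lemma minus_smult: "x \<in> carrier A \<Longrightarrow> \<ominus> x = (-1) \<odot> x"
  using smult_l_distr[of x "-1" 1] by (intro minus_equality) auto

lemma diff_smult: "x \<in> carrier A \<Longrightarrow> y \<in> carrier A \<Longrightarrow> x \<ominus> y = x \<oplus> (-1) \<odot> y"
  by (simp add: a_minus_def minus_smult)

lemma diff_eq_zero_iff: "x \<in> carrier A \<Longrightarrow> y \<in> carrier A \<Longrightarrow> x \<ominus> y = \<zero> \<longleftrightarrow> x = y"
  by (metis a_minus_def minus_equality local.minus_minus a_inv_closed r_neg)

lemma alg_ideal_carrier: "alg_ideal A (carrier A)"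
  by (auto simp: alg_ideal_def)

lemma alg_ideal_gen_ideal: "S \<subseteq> carrier A \<Longrightarrow> alg_ideal A (alg_ideal_gen A S)"
  using alg_ideal_carrier by (auto simp: alg_ideal_gen_def alg_ideal_def)

end

lemma alg_ideal_gen_least: "alg_ideal A J \<Longrightarrow> S \<subseteq> J \<Longrightarrow> alg_ideal_gen A S \<subseteq> J"
  by (auto simp: alg_ideal_gen_def)

lemma alg_ideal_gen_incl: "S \<subseteq> alg_ideal_gen A S"
  by (auto simp: alg_ideal_gen_def)

lemma nalgI:
  fixes A :: "('a::field, 'v) module" (structure)
  assumes "\<And>x y. \<lbrakk>x \<in> carrier A; y \<in> carrier A\<rbrakk> \<Longrightarrow> x \<oplus> y \<in> carrier A"
    and "\<zero> \<in> carrier A"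
    and "\<And>x y z. \<lbrakk>x \<in> carrier A; y \<in> carrier A; z \<in> carrier A\<rbrakk> \<Longrightarrow> (x \<oplus> y) \<oplus> z = x \<oplus> (y \<oplus> z)"
    and "\<And>x y. \<lbrakk>x \<in> carrier A; y \<in> carrier A\<rbrakk> \<Longrightarrow> x \<oplus> y = y \<oplus> x"
    and "\<And>x. x \<in> carrier A \<Longrightarrow> \<zero> \<oplus> x = x"
    and neg: "\<And>x. x \<in> carrier A \<Longrightarrow> (-1) \<odot> x \<oplus> x = \<zero>"
    and sc: "\<And>c x. x \<in> carrier A \<Longrightarrow> c \<odot> x \<in> carrier A"
    and ax: "nalg_axioms A"
  shows "nalg A"
proof -
  have "abelian_group A"
  proof (rule abelian_groupI)
    show "\<exists>y\<in>carrier A. y \<oplus> x = \<zero>" if "x \<in> carrier A" for x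
      using neg[OF that] sc[OF that] by blast
  qed (rule assms(1-5); assumption)+
  then show ?thesis using ax by (simp add: nalg_def)
qed

context nalg
begin

lemma ideal_subgroup:
  assumes J: "alg_ideal A J"
  shows "abelian_subgroup J A"
proof (rule abelian_subgroupI3)
  have inv: "\<ominus> x \<in> J" if "x \<in> J" for x
    using J that by (auto simp: alg_ideal_def minus_smult subset_iff)
  show "additive_subgroup J A"
    by (rule additive_subgroupI, rule add.subgroupI)
       (use J inv in \<open>auto simp: alg_ideal_def a_inv_def[symmetric]\<close>)
qed (rule abelian_group_axioms)

lemma in_coset_iff:
  assumes J: "alg_ideal A J" and x: "x \<in> carrier A"
  shows "a \<in> J +> x \<longleftrightarrow> a \<in> carrier A \<and> a \<ominus> x \<in> J"
proof
  assume "a \<in> J +> x"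
  then obtain j where j: "j \<in> J" "a = j \<oplus> x" by (auto simp: a_r_coset_def')
  have "j \<in> carrier A" using J j by (auto simp: alg_ideal_def)
  moreover have "a \<ominus> x = j" using x \<open>j \<in> carrier A\<close>
    by (simp add: j a_minus_def add.m_assoc r_neg)
  ultimately show "a \<in> carrier A \<and> a \<ominus> x \<in> J" using j x by auto
next
  assume a: "a \<in> carrier A \<and> a \<ominus> x \<in> J"
  then have "(a \<ominus> x) \<oplus> x = a" using x by (simp add: a_minus_def add.m_assoc l_neg)
  then show "a \<in> J +> x" using a by (force simp: a_r_coset_def')
qed

lemma coset_eq_iff:
  assumes J: "alg_ideal A J" and x: "x \<in> carrier A" and y: "y \<in> carrier A"
  shows "J +> x = J +> y \<longleftrightarrow> x \<ominus> y \<in> J"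
proof -
  interpret abelian_subgroup J A by (rule ideal_subgroup[OF J])
  show ?thesis
    by (metis J a_rcos_self a_repr_independence' in_coset_iff x y)
qed

lemma coset_self: "alg_ideal A J \<Longrightarrow> x \<in> carrier A \<Longrightarrow> x \<in> J +> x"
  by (simp add: in_coset_iff alg_ideal_def a_minus_def r_neg)

lemma quot_carrier: "carrier (quot_alg A J) = (\<lambda>x. J +> x) ` carrier A"
  by (auto simp: quot_alg_def A_RCOSETS_def')

lemma quot_carrierI: "x \<in> carrier A \<Longrightarrow> J +> x \<in> carrier (quot_alg A J)"
  by (simp add: quot_carrier)

lemma quot_zero: "alg_ideal A J \<Longrightarrow> \<zero>\<^bsub>quot_alg A J\<^esub> = J +> \<zero>"
  by (simp add: quot_alg_def a_coset_add_zero alg_ideal_def)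

lemma quot_add:
  assumes J: "alg_ideal A J" and "x \<in> carrier A" "y \<in> carrier A"
  shows "(J +> x) \<oplus>\<^bsub>quot_alg A J\<^esub> (J +> y) = J +> (x \<oplus> y)"
  using abelian_subgroup.a_rcos_sum[OF ideal_subgroup[OF J]] assms by (simp add: quot_alg_def)

lemma UN_const: "\<lbrakk>B \<noteq> {}; \<And>x. x \<in> B \<Longrightarrow> f x = (c :: 'z set)\<rbrakk> \<Longrightarrow> (\<Union>x\<in>B. f x) = c"
  by auto

lemma quot_smult:
  assumes J: "alg_ideal A J" and x: "x \<in> carrier A"
  shows "c \<odot>\<^bsub>quot_alg A J\<^esub> (J +> x) = J +> (c \<odot> x)"
proof -
  have const: "J +> (c \<odot> a) = J +> (c \<odot> x)" if "a \<in> J +> x" for a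
  proof -
    have a: "a \<in> carrier A" "a \<ominus> x \<in> J" using that J x by (auto simp: in_coset_iff)
    have "c \<odot> a \<ominus> c \<odot> x = c \<odot> (a \<ominus> x)"
      using a x by (simp add: diff_smult smult_r_distr smult_smult[symmetric] mult.commute)
    then show ?thesis using a x J by (simp add: coset_eq_iff alg_ideal_def)
  qed
  have "J +> x \<noteq> {}" using coset_self[OF J x] by blast
  then have "(\<Union>a\<in>J +> x. J +> (c \<odot> a)) = J +> (c \<odot> x)"
    by (rule UN_const) (rule const)
  then show ?thesis by (simp add: quot_alg_def)
qed

text \<open>
  The product in \<^const>\<open>quot_alg\<close> is the union of the cosets of all products of representatives; it is
  a single coset because \<open>J\<close> is two-sided.
\<close>

lemma quot_mult:
  assumes J: "alg_ideal A J" and x: "x \<in> carrier A" and y: "y \<in> carrier A"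
  shows "(J +> x) \<otimes>\<^bsub>quot_alg A J\<^esub> (J +> y) = J +> (x \<otimes> y)"
proof -
  have const: "J +> (a \<otimes> b) = J +> (x \<otimes> y)" if "a \<in> J +> x" "b \<in> J +> y" for a b
  proof -
    have a: "a \<in> carrier A" "a \<ominus> x \<in> J" and b: "b \<in> carrier A" "b \<ominus> y \<in> J"
      using that J x y by (auto simp: in_coset_iff)
    have "(a \<ominus> x) \<otimes> b \<oplus> x \<otimes> (b \<ominus> y) \<in> J"
      using a b x y J by (auto simp: alg_ideal_def)
    also have "(a \<ominus> x) \<otimes> b \<oplus> x \<otimes> (b \<ominus> y) =
        (a \<otimes> b \<oplus> (-1) \<odot> (x \<otimes> b)) \<oplus> (x \<otimes> b \<oplus> (-1) \<odot> (x \<otimes> y))"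
      using a b x y by (simp add: diff_smult l_distr r_distr smult_mult_l smult_mult_r)
    also have "\<dots> = a \<otimes> b \<oplus> ((-1) \<odot> (x \<otimes> b) \<oplus> x \<otimes> b) \<oplus> (-1) \<odot> (x \<otimes> y)"
      using a b x y by (simp add: a_ac)
    also have "(-1) \<odot> (x \<otimes> b) \<oplus> x \<otimes> b = \<zero>"
      using smult_l_distr[of "x \<otimes> b" "-1" 1] x b by simp
    also have "a \<otimes> b \<oplus> \<zero> \<oplus> (-1) \<odot> (x \<otimes> y) = a \<otimes> b \<ominus> x \<otimes> y"
      using a b x y by (simp add: diff_smult)
    finally show ?thesis using a b x y J by (simp add: coset_eq_iff)
  qed
  have ne: "J +> x \<noteq> {}" "J +> y \<noteq> {}" using coset_self[OF J] x y by blast+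
  have "(\<Union>a\<in>J +> x. \<Union>b\<in>J +> y. J +> (a \<otimes> b)) = J +> (x \<otimes> y)"
    by (rule UN_const[OF ne(1)], rule UN_const[OF ne(2)], rule const)
  then show ?thesis by (simp add: quot_alg_def rcoset_mult_def)
qed

lemma quot_carrierE:
  assumes "X \<in> carrier (quot_alg A J)"
  obtains x where "x \<in> carrier A" "X = J +> x"
  using assms by (auto simp: quot_carrier)

lemma quot_nalg:
  assumes J: "alg_ideal A J"
  shows "nalg (quot_alg A J)"
proof -
  note simps = quot_carrierI quot_add[OF J] quot_mult[OF J] quot_smult[OF J] quot_zero[OF J]
  show ?thesis
  proof (rule nalgI, goal_cases)
    case 8
    show ?case
      unfolding nalg_axioms_def
      by (intro conjI allI impI; elim quot_carrierE; simp add: simps l_distr r_distr m_assoc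
          smult_l_distr smult_r_distr smult_smult smult_mult_l smult_mult_r)
  next
    case (6 x)
    then show ?case by (elim quot_carrierE) (simp add: simps l_neg flip: minus_smult)
  qed (auto elim!: quot_carrierE simp: simps a_ac)
qed

end

lemma alg_homI:
  assumes "\<And>x. x \<in> carrier A \<Longrightarrow> f x \<in> carrier B"
    and "\<And>x y. x \<in> carrier A \<Longrightarrow> y \<in> carrier A \<Longrightarrow> f (x \<oplus>\<^bsub>A\<^esub> y) = f x \<oplus>\<^bsub>B\<^esub> f y"
    and "\<And>c x. x \<in> carrier A \<Longrightarrow> f (c \<odot>\<^bsub>A\<^esub> x) = c \<odot>\<^bsub>B\<^esub> f x"
    and "\<And>x y. x \<in> carrier A \<Longrightarrow> y \<in> carrier A \<Longrightarrow> f (x \<otimes>\<^bsub>A\<^esub> y) = f x \<otimes>\<^bsub>B\<^esub> f y"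
    and "nalg A"
  shows "restrict f (carrier A) \<in> alg_hom A B"
proof -
  interpret nalg A by fact
  show ?thesis using assms by (auto simp: alg_hom_def lin_maps_def)
qed

lemma
  assumes "f \<in> lin_maps A B"
  shows lin_closed: "x \<in> carrier A \<Longrightarrow> f x \<in> carrier B"
    and lin_add: "x \<in> carrier A \<Longrightarrow> y \<in> carrier A \<Longrightarrow> f (x \<oplus>\<^bsub>A\<^esub> y) = f x \<oplus>\<^bsub>B\<^esub> f y"
    and lin_smult: "x \<in> carrier A \<Longrightarrow> f (c \<odot>\<^bsub>A\<^esub> x) = c \<odot>\<^bsub>B\<^esub> f x"
  using assms by (auto simp: lin_maps_def)

lemma nalg_zero_closed: "nalg A \<Longrightarrow> \<zero>\<^bsub>A\<^esub> \<in> carrier A"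
proof -
  assume "nalg A"
  then interpret nalg A .
  show ?thesis by simp
qed

lemma lin_zero:
  assumes f: "f \<in> lin_maps A B" and A: "nalg A" and B: "nalg B"
  shows "f \<zero>\<^bsub>A\<^esub> = \<zero>\<^bsub>B\<^esub>"
  using lin_smult[OF f nalg_zero_closed[OF A], of 0] lin_closed[OF f nalg_zero_closed[OF A]]
  by (simp add: nalg.smult_zero_left[OF B] nalg.smult_zero_right[OF A])

lemma lin_diff: "f \<in> lin_maps A B \<Longrightarrow> nalg A \<Longrightarrow> nalg B \<Longrightarrow> x \<in> carrier A \<Longrightarrow> y \<in> carrier A \<Longrightarrow>
    f (x \<ominus>\<^bsub>A\<^esub> y) = f x \<ominus>\<^bsub>B\<^esub> f y"
  by (simp add: nalg.diff_smult nalg.smult_closed lin_add lin_smult lin_closed)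

lemma hom_lin: "f \<in> alg_hom A B \<Longrightarrow> f \<in> lin_maps A B"
  and hom_mult: "f \<in> alg_hom A B \<Longrightarrow> x \<in> carrier A \<Longrightarrow> y \<in> carrier A \<Longrightarrow>
    f (x \<otimes>\<^bsub>A\<^esub> y) = f x \<otimes>\<^bsub>B\<^esub> f y"
  by (auto simp: alg_hom_def)

lemma der_lin: "f \<in> derivations A \<Longrightarrow> f \<in> lin_maps A A"
  and der_mult: "f \<in> derivations A \<Longrightarrow> x \<in> carrier A \<Longrightarrow> y \<in> carrier A \<Longrightarrow>
    f (x \<otimes>\<^bsub>A\<^esub> y) = f x \<otimes>\<^bsub>A\<^esub> y \<oplus>\<^bsub>A\<^esub> x \<otimes>\<^bsub>A\<^esub> f y"
  by (auto simp: derivations_def)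

lemma hom_kernel_ideal:
  assumes A: "nalg A" and B: "nalg B" and f: "f \<in> alg_hom A B"
  shows "alg_ideal A {x \<in> carrier A. f x = \<zero>\<^bsub>B\<^esub>}"
proof -
  interpret A: nalg A by fact
  interpret B: nalg B by fact
  show ?thesis using hom_lin[OF f] hom_mult[OF f] lin_zero[OF hom_lin[OF f] A B]
    by (auto simp: alg_ideal_def lin_add lin_smult lin_closed)
qed

lemma quot_lift:
  assumes A: "nalg A" and B: "nalg B" and J: "alg_ideal A J" and f: "f \<in> alg_hom A B"
    and van: "\<And>x. x \<in> J \<Longrightarrow> f x = \<zero>\<^bsub>B\<^esub>"
  shows "\<exists>h \<in> alg_hom (quot_alg A J) B. \<forall>x \<in> carrier A. h (J +>\<^bsub>A\<^esub> x) = f x"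
proof -
  interpret A: nalg A by fact
  interpret B: nalg B by fact
  note fl = hom_lin[OF f]
  have wd: "f a = f x" if "x \<in> carrier A" "a \<in> J +>\<^bsub>A\<^esub> x" for a x
  proof -
    have a: "a \<in> carrier A" "a \<ominus>\<^bsub>A\<^esub> x \<in> J" using that J by (auto simp: A.in_coset_iff)
    then have "f a \<ominus>\<^bsub>B\<^esub> f x = \<zero>\<^bsub>B\<^esub>" using van lin_diff[OF fl A B] that by metis
    then show ?thesis using a that by (simp add: B.diff_eq_zero_iff lin_closed[OF fl])
  qed
  define h where "h X = f (SOME x. x \<in> X)" for X
  have h: "h (J +>\<^bsub>A\<^esub> x) = f x" if "x \<in> carrier A" for x
    unfolding h_def by (rule wd[OF that], rule someI, rule A.coset_self[OF J that])
  have "restrict h (carrier (quot_alg A J)) \<in> alg_hom (quot_alg A J) B"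
    by (rule alg_homI) (use J fl in \<open>auto simp: A.quot_carrier A.quot_add A.quot_smult A.quot_mult h
      lin_add lin_smult lin_closed hom_mult[OF f] A.quot_nalg\<close>)
  then show ?thesis using h by (intro bexI) (auto simp: A.quot_carrierI)
qed

lemma restrict_der:
  fixes A :: "('a::field, 'v) module"
  assumes "nalg A"
    and "\<And>x. x \<in> carrier A \<Longrightarrow> f x \<in> carrier A"
    and "\<And>x y. x \<in> carrier A \<Longrightarrow> y \<in> carrier A \<Longrightarrow> f (x \<oplus>\<^bsub>A\<^esub> y) = f x \<oplus>\<^bsub>A\<^esub> f y"
    and "\<And>c x. x \<in> carrier A \<Longrightarrow> f (c \<odot>\<^bsub>A\<^esub> x) = c \<odot>\<^bsub>A\<^esub> f x"
    and "\<And>x y. x \<in> carrier A \<Longrightarrow> y \<in> carrier A \<Longrightarrow>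
      f (x \<otimes>\<^bsub>A\<^esub> y) = f x \<otimes>\<^bsub>A\<^esub> y \<oplus>\<^bsub>A\<^esub> x \<otimes>\<^bsub>A\<^esub> f y"
  shows "restrict f (carrier A) \<in> derivations A"
proof -
  interpret nalg A by fact
  show ?thesis using assms by (auto simp: derivations_def lin_maps_def)
qed

section \<open>Free algebras\<close>

text \<open>
  Linear extension from words to the free algebra. Its summation range is the support of \<open>p\<close>, which
  agrees with the way \<^const>\<open>uea_act\<close> evaluates a representative.
\<close>

definition lext :: "('a::field, 'v) module \<Rightarrow> ('w \<Rightarrow> 'v) \<Rightarrow> ('w \<Rightarrow>\<^sub>0 'a) \<Rightarrow> 'v" where
  "lext B \<tau> p = (\<Oplus>\<^bsub>B\<^esub>w\<in>Poly_Mapping.keys p. Poly_Mapping.lookup p w \<odot>\<^bsub>B\<^esub> \<tau> w)"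

abbreviation scl :: "'a::field \<Rightarrow> ('w \<Rightarrow>\<^sub>0 'a) \<Rightarrow> ('w \<Rightarrow>\<^sub>0 'a)" where
  "scl c p \<equiv> Poly_Mapping.map ((*) c) p"

lemma lookup_scl [simp]: "Poly_Mapping.lookup (scl c p) w = c * Poly_Mapping.lookup p w"
  by (simp add: Poly_Mapping.map.rep_eq when_def)

lemma keys_scl: "Poly_Mapping.keys (scl c p) \<subseteq> Poly_Mapping.keys p"
  by (auto simp: in_keys_iff)

lemma keys_minus_subset: "Poly_Mapping.keys (p - q :: 'w \<Rightarrow>\<^sub>0 'a::field) \<subseteq> Poly_Mapping.keys p \<union> Poly_Mapping.keys q"
  by (auto simp: in_keys_iff lookup_minus)

text \<open>
  Induction on the support; the coefficient \<open>c\<close> may be zero and the word \<open>w\<close> may already occur in \<open>p\<close>,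
  which is harmless for additive properties.
\<close>

lemma pm_induct [consumes 1, case_names zero add]:
  assumes "Poly_Mapping.keys p \<subseteq> W" and "P 0"
    and step: "\<And>w c p. w \<in> W \<Longrightarrow> Poly_Mapping.keys p \<subseteq> W \<Longrightarrow> P p \<Longrightarrow> P (Poly_Mapping.single w c + p)"
  shows "P (p :: 'w \<Rightarrow>\<^sub>0 'a::field)"
  using assms(1)
proof (induction p rule: Poly_Mapping.update_induct)
  case const
  then show ?case using assms(2) by simp
next
  case (update f a b)
  have *: "Poly_Mapping.update a b f = Poly_Mapping.single a b + f"
    using update(1) by (intro poly_mapping_eqI) (auto simp: lookup_update lookup_add lookup_single when_def in_keys_iff)
  have "a \<in> W" "Poly_Mapping.keys f \<subseteq> W" using update by (auto simp: keys_update split: if_splits)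
  then show ?case using step update * by simp
qed

context nalg
begin

lemma lext_superset:
  assumes "finite K" "Poly_Mapping.keys p \<subseteq> K" "\<And>w. w \<in> K \<Longrightarrow> \<tau> w \<in> carrier A"
  shows "lext A \<tau> p = (\<Oplus>w\<in>K. Poly_Mapping.lookup p w \<odot> \<tau> w)"
  unfolding lext_def
  by (rule add.finprod_mono_neutral_cong_left) (use assms in \<open>auto simp: in_keys_iff\<close>)

lemma lext_closed: "(\<And>w. w \<in> Poly_Mapping.keys p \<Longrightarrow> \<tau> w \<in> carrier A) \<Longrightarrow> lext A \<tau> p \<in> carrier A"
  unfolding lext_def by (rule finsum_closed) auto

lemma lext_zero [simp]: "lext A \<tau> 0 = \<zero>"
  by (simp add: lext_def)

lemma lext_add:
  assumes "\<And>w. w \<in> Poly_Mapping.keys p \<union> Poly_Mapping.keys q \<Longrightarrow> \<tau> w \<in> carrier A"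
  shows "lext A \<tau> (p + q) = lext A \<tau> p \<oplus> lext A \<tau> q"
proof -
  let ?K = "Poly_Mapping.keys p \<union> Poly_Mapping.keys q"
  have "lext A \<tau> (p + q) = (\<Oplus>w\<in>?K. Poly_Mapping.lookup (p + q) w \<odot> \<tau> w)"
    by (rule lext_superset) (use assms Poly_Mapping.keys_add[of p q] in auto)
  also have "\<dots> = (\<Oplus>w\<in>?K. Poly_Mapping.lookup p w \<odot> \<tau> w \<oplus> Poly_Mapping.lookup q w \<odot> \<tau> w)"
    by (rule finsum_cong') (use assms in \<open>auto simp: lookup_add smult_l_distr\<close>)
  also have "\<dots> = (\<Oplus>w\<in>?K. Poly_Mapping.lookup p w \<odot> \<tau> w) \<oplus> (\<Oplus>w\<in>?K. Poly_Mapping.lookup q w \<odot> \<tau> w)"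
    by (rule finsum_addf) (use assms in auto)
  also have "(\<Oplus>w\<in>?K. Poly_Mapping.lookup p w \<odot> \<tau> w) = lext A \<tau> p"
    by (rule lext_superset[symmetric]) (use assms in auto)
  also have "(\<Oplus>w\<in>?K. Poly_Mapping.lookup q w \<odot> \<tau> w) = lext A \<tau> q"
    by (rule lext_superset[symmetric]) (use assms in auto)
  finally show ?thesis .
qed

lemma lext_single: "\<tau> w \<in> carrier A \<Longrightarrow> lext A \<tau> (Poly_Mapping.single w c) = c \<odot> \<tau> w"
  by (subst lext_superset[where K = "{w}"]) auto

lemma lext_scl:
  assumes "\<And>w. w \<in> Poly_Mapping.keys p \<Longrightarrow> \<tau> w \<in> carrier A"
  shows "lext A \<tau> (scl c p) = c \<odot> lext A \<tau> p"
proof -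
  have t: "\<tau> \<in> Poly_Mapping.keys p \<rightarrow> carrier A" using assms by auto
  have fin: "finite K \<Longrightarrow> K \<subseteq> Poly_Mapping.keys p \<Longrightarrow>
      (\<Oplus>w\<in>K. (c * Poly_Mapping.lookup p w) \<odot> \<tau> w) = c \<odot> (\<Oplus>w\<in>K. Poly_Mapping.lookup p w \<odot> \<tau> w)" for K
  proof (induction K rule: finite_induct)
    case (insert x K)
    have "(\<lambda>w. Poly_Mapping.lookup p w \<odot> \<tau> w) \<in> K \<rightarrow> carrier A"
      "(\<lambda>w. (c * Poly_Mapping.lookup p w) \<odot> \<tau> w) \<in> K \<rightarrow> carrier A" "\<tau> x \<in> carrier A"
      using insert t by auto
    then show ?case using insert by (simp add: smult_r_distr smult_smult)
  qed simp
  have "lext A \<tau> (scl c p) = (\<Oplus>w\<in>Poly_Mapping.keys p. Poly_Mapping.lookup (scl c p) w \<odot> \<tau> w)"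
    by (rule lext_superset) (use assms keys_scl[of c p] in auto)
  then show ?thesis using fin[of "Poly_Mapping.keys p"] by (simp add: lext_def)
qed

lemma lext_mult:
  assumes W: "\<And>w v. w \<in> W \<Longrightarrow> v \<in> W \<Longrightarrow> w + v \<in> W \<and> \<tau> (w + v) = \<tau> w \<otimes> \<tau> v"
    and t: "\<And>w. w \<in> W \<Longrightarrow> \<tau> w \<in> carrier A"
    and p: "Poly_Mapping.keys p \<subseteq> W" and q: "Poly_Mapping.keys q \<subseteq> W"
  shows "lext A \<tau> (p * q) = lext A \<tau> p \<otimes> lext A \<tau> q"
  using p
proof (induction p rule: pm_induct)
  case zero
  then show ?case using q t by (simp add: lext_closed subset_iff)
next
  case (add w c p)
  have sing: "Poly_Mapping.keys (Poly_Mapping.single w c * q) \<subseteq> W \<and>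
      lext A \<tau> (Poly_Mapping.single w c * q) = c \<odot> \<tau> w \<otimes> lext A \<tau> q"
    using q
  proof (induction q rule: pm_induct)
    case zero
    then show ?case using add t by simp
  next
    case (add v d q)
    have wv: "w + v \<in> W" using W \<open>w \<in> W\<close> \<open>v \<in> W\<close> by blast
    have k: "Poly_Mapping.keys (Poly_Mapping.single (w + v) (c * d)) \<subseteq> W"
      "Poly_Mapping.keys (Poly_Mapping.single v d) \<subseteq> W" "Poly_Mapping.keys (Poly_Mapping.single w c) \<subseteq> W"
      using wv \<open>v \<in> W\<close> \<open>w \<in> W\<close> by auto
    have c: "lext A \<tau> q \<in> carrier A" using add t by (intro lext_closed) auto
    have "lext A \<tau> (Poly_Mapping.single (w + v) (c * d) + Poly_Mapping.single w c * q) =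
        (c * d) \<odot> (\<tau> w \<otimes> \<tau> v) \<oplus> c \<odot> \<tau> w \<otimes> lext A \<tau> q"
      using add k t wv W[OF \<open>w \<in> W\<close> \<open>v \<in> W\<close>] lext_single[of \<tau> "w + v" "c * d", OF t[OF wv]]
      by (subst lext_add) auto
    also have "\<dots> = c \<odot> \<tau> w \<otimes> (d \<odot> \<tau> v \<oplus> lext A \<tau> q)"
      using t \<open>w \<in> W\<close> \<open>v \<in> W\<close> c by (simp add: r_distr smult_mult_l smult_mult_r mult.commute flip: smult_smult)
    also have "d \<odot> \<tau> v \<oplus> lext A \<tau> q = lext A \<tau> (Poly_Mapping.single v d + q)"
      using add k t by (subst lext_add) (auto simp: lext_single)
    finally have "lext A \<tau> (Poly_Mapping.single (w + v) (c * d) + Poly_Mapping.single w c * q) =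
        c \<odot> \<tau> w \<otimes> lext A \<tau> (Poly_Mapping.single v d + q)" .
    moreover have "Poly_Mapping.keys (Poly_Mapping.single (w + v) (c * d) + Poly_Mapping.single w c * q) \<subseteq> W"
      using keys_add[of "Poly_Mapping.single (w + v) (c * d)" "Poly_Mapping.single w c * q"] k(1)
        conjunct1[OF add(3)] by (meson Un_least order_trans)
    ultimately show ?case by (simp add: distrib_left mult_single)
  qed
  have pq: "Poly_Mapping.keys (p * q) \<subseteq> W"
  proof -
    have "Poly_Mapping.keys p \<subseteq> W" using add by simp
    then have "{a + b |a b. a \<in> Poly_Mapping.keys p \<and> b \<in> Poly_Mapping.keys q} \<subseteq> W" using q W by blast
    with keys_mult[of p q] show ?thesis by (rule order_trans)
  qed
  have c: "lext A \<tau> q \<in> carrier A" "lext A \<tau> p \<in> carrier A" using q add t by (auto intro!: lext_closed)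
  have k: "Poly_Mapping.keys (Poly_Mapping.single w c) \<subseteq> W" using add by auto
  have "lext A \<tau> (Poly_Mapping.single w c * q + p * q) = c \<odot> \<tau> w \<otimes> lext A \<tau> q \<oplus> lext A \<tau> (p * q)"
    using sing pq t by (subst lext_add) auto
  also have "\<dots> = (c \<odot> \<tau> w \<oplus> lext A \<tau> p) \<otimes> lext A \<tau> q"
    using add c t by (simp add: l_distr)
  also have "c \<odot> \<tau> w \<oplus> lext A \<tau> p = lext A \<tau> (Poly_Mapping.single w c + p)"
    using add k t by (subst lext_add) (auto simp: lext_single)
  finally show ?case by (simp add: distrib_right)
qed

end

lemma nalg_word_span:
  fixes W :: "'w::monoid_add set" and e :: "'w \<Rightarrow>\<^sub>0 'a::field"
  assumes W: "\<And>w v. w \<in> W \<Longrightarrow> v \<in> W \<Longrightarrow> w + v \<in> W"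
  shows "nalg \<lparr>carrier = {p. Poly_Mapping.keys p \<subseteq> W}, mult = (*), one = e, zero = 0, add = (+),
     smult = (\<lambda>c p. scl c p)\<rparr>"
proof (rule nalgI, goal_cases)
  case 1 then show ?case using Poly_Mapping.keys_add by fastforce
next
  case (6 x) then show ?case by (auto intro!: poly_mapping_eqI simp: lookup_add)
next
  case (7 c x) then show ?case using keys_scl by fastforce
next
  case 8
  have m: "Poly_Mapping.keys (p * q) \<subseteq> W" if "Poly_Mapping.keys p \<subseteq> W" "Poly_Mapping.keys q \<subseteq> W"
    for p q :: "'w \<Rightarrow>\<^sub>0 'a"
  proof -
    have "{a + b |a b. a \<in> Poly_Mapping.keys p \<and> b \<in> Poly_Mapping.keys q} \<subseteq> W" using that W by blast
    with keys_mult[of p q] show ?thesis by (rule order_trans)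
  qed
  have s: "scl c p = Poly_Mapping.single 0 c * p" for c and p :: "'w \<Rightarrow>\<^sub>0 'a"
    by (rule mult_map_scale_conv_mult)
  have central: "p * Poly_Mapping.single 0 c = Poly_Mapping.single 0 c * p" for c and p :: "'w \<Rightarrow>\<^sub>0 'a"
    using subset_UNIV by (induction p rule: pm_induct) (simp_all add: distrib_left distrib_right mult_single mult.commute)
  have l: "scl c p * q = scl c (p * q)" for c and p q :: "'w \<Rightarrow>\<^sub>0 'a"
    by (simp add: s mult.assoc)
  have r: "p * scl c q = scl c (p * q)" for c and p q :: "'w \<Rightarrow>\<^sub>0 'a"
    unfolding s by (metis central mult.assoc)
  have sl: "scl (c + d) p = scl c p + scl d p" "scl c (p + q) = scl c p + scl c q" "scl (c * d) p = scl c (scl d p)"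
    "scl 1 p = p" for c d and p q :: "'w \<Rightarrow>\<^sub>0 'a"
    by (intro poly_mapping_eqI; simp add: lookup_add algebra_simps)+
  have k: "Poly_Mapping.keys (scl c p) \<subseteq> W" if "Poly_Mapping.keys p \<subseteq> W" for c and p :: "'w \<Rightarrow>\<^sub>0 'a"
    by (rule order_trans[OF keys_scl that])
  show ?case
    unfolding nalg_axioms_def by (simp add: m k l r sl distrib_left distrib_right mult.assoc)
qed (simp_all add: ac_simps)

lemma free_alg_eq: "free_alg S = \<lparr>carrier = {p. Poly_Mapping.keys p \<subseteq> {w. set w \<subseteq> S}}, mult = (*), one = 1, zero = 0, add = (+),
     smult = (\<lambda>c p. scl c p)\<rparr>"
  by (auto simp: free_alg_def)

lemma free_nonunital_alg_eq: "free_nonunital_alg S =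
    \<lparr>carrier = {p. Poly_Mapping.keys p \<subseteq> {w. w \<noteq> [] \<and> set w \<subseteq> S}}, mult = (*), one = 0, zero = 0, add = (+),
     smult = (\<lambda>c p. scl c p)\<rparr>"
  by (auto simp: free_nonunital_alg_def free_alg_def)

lemma free_alg_nalg: "nalg (free_alg S)"
  unfolding free_alg_eq by (rule nalg_word_span) (auto simp: plus_list_def)

lemma free_nonunital_nalg: "nalg (free_nonunital_alg S)"
  unfolding free_nonunital_alg_eq by (rule nalg_word_span) (auto simp: plus_list_def)

lemma free_alg_sel [simp]:
  "p \<otimes>\<^bsub>free_alg S\<^esub> q = p * q" "p \<oplus>\<^bsub>free_alg S\<^esub> q = p + q"
  "\<zero>\<^bsub>free_alg S\<^esub> = 0" "\<one>\<^bsub>free_alg S\<^esub> = 1" "c \<odot>\<^bsub>free_alg S\<^esub> p = scl c p"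
  "p \<otimes>\<^bsub>free_nonunital_alg S\<^esub> q = p * q" "p \<oplus>\<^bsub>free_nonunital_alg S\<^esub> q = p + q"
  "\<zero>\<^bsub>free_nonunital_alg S\<^esub> = 0" "c \<odot>\<^bsub>free_nonunital_alg S\<^esub> p = scl c p"
  by (simp_all add: free_alg_eq free_nonunital_alg_eq)

text \<open>
  Without a unit, only nonempty words have a product; the value at the empty word is a dummy.
\<close>

fun prodl :: "('a, 'v) module \<Rightarrow> ('s \<Rightarrow> 'v) \<Rightarrow> 's list \<Rightarrow> 'v" where
  "prodl B g [] = \<zero>\<^bsub>B\<^esub>"
| "prodl B g [x] = g x"
| "prodl B g (x # y # ws) = g x \<otimes>\<^bsub>B\<^esub> prodl B g (y # ws)"

context nalg
begin

lemma prodl_closed: "(\<And>s. s \<in> set ws \<Longrightarrow> g s \<in> carrier A) \<Longrightarrow> prodl A g ws \<in> carrier A"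
  by (induction ws rule: induct_list012) auto

lemma prodl_Cons: "ws \<noteq> [] \<Longrightarrow> prodl A g (x # ws) = g x \<otimes> prodl A g ws"
  by (cases ws) auto

lemma prodl_append:
  assumes "\<And>s. s \<in> set (ws @ vs) \<Longrightarrow> g s \<in> carrier A" "ws \<noteq> []" "vs \<noteq> []"
  shows "prodl A g (ws @ vs) = prodl A g ws \<otimes> prodl A g vs"
  using assms
proof (induction ws)
  case (Cons x ws)
  show ?case
  proof (cases "ws = []")
    case True
    then show ?thesis using Cons by (simp add: prodl_Cons)
  next
    case False
    then show ?thesis using Cons by (simp add: prodl_Cons m_assoc prodl_closed)
  qed
qed simp

lemma lext_prodl_hom:
  assumes g: "\<And>s. s \<in> S \<Longrightarrow> g s \<in> carrier A"
  shows "restrict (lext A (prodl A g)) (carrier (free_nonunital_alg S)) \<in> alg_hom (free_nonunital_alg S) A"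
proof -
  let ?W = "{w. w \<noteq> [] \<and> set w \<subseteq> S}"
  have t: "prodl A g w \<in> carrier A" if "w \<in> ?W" for w
    using that g by (auto intro!: prodl_closed)
  have m: "w + v \<in> ?W \<and> prodl A g (w + v) = prodl A g w \<otimes> prodl A g v" if "w \<in> ?W" "v \<in> ?W" for w v
    using that g by (auto simp: plus_list_def subset_iff intro!: prodl_append)
  have sub: "\<And>p w. Poly_Mapping.keys p \<subseteq> ?W \<Longrightarrow> w \<in> Poly_Mapping.keys p \<Longrightarrow> prodl A g w \<in> carrier A"
    using t by blast
  show ?thesis
    by (rule alg_homI[OF _ _ _ _ free_nonunital_nalg])
       (auto simp: free_nonunital_alg_eq intro!: lext_closed lext_add lext_scl lext_mult[OF m t] dest: sub)
qed

lemma lext_prodl_letter: "g s \<in> carrier A \<Longrightarrow> lext A (prodl A g) (letter s) = g s"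
  by (simp add: letter_def lext_single)

end

lemma letter_closed:
  "s \<in> S \<Longrightarrow> letter s \<in> carrier (free_alg S)" "s \<in> S \<Longrightarrow> letter s \<in> carrier (free_nonunital_alg S)"
  by (auto simp: letter_def free_alg_eq free_nonunital_alg_eq)

text \<open>
  Sums, scalar multiples and products of letters exhaust the free algebra; no coefficients and words
  appear in a proof by this rule.
\<close>

lemma free_nonunital_induct [consumes 1, case_names zero letter add scl mult]:
  fixes p :: "'s list \<Rightarrow>\<^sub>0 'a::field"
  assumes p: "p \<in> carrier (free_nonunital_alg S)"
    and zero: "P 0"
    and letter: "\<And>s. s \<in> S \<Longrightarrow> P (letter s)"
    and add: "\<And>p q. p \<in> carrier (free_nonunital_alg S) \<Longrightarrow> q \<in> carrier (free_nonunital_alg S) \<Longrightarrow> P p \<Longrightarrow> P q \<Longrightarrow> P (p + q)"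
    and scl: "\<And>c p. p \<in> carrier (free_nonunital_alg S) \<Longrightarrow> P p \<Longrightarrow> P (scl c p)"
    and mult: "\<And>p q. p \<in> carrier (free_nonunital_alg S) \<Longrightarrow> q \<in> carrier (free_nonunital_alg S) \<Longrightarrow> P p \<Longrightarrow> P q \<Longrightarrow> P (p * q)"
  shows "P p"
proof -
  let ?W = "{w. w \<noteq> [] \<and> set w \<subseteq> S}"
  let ?N = "carrier (free_nonunital_alg S) :: ('s list \<Rightarrow>\<^sub>0 'a) set"
  have sc: "Poly_Mapping.single w c \<in> ?N" if "w \<in> ?W" for w c
    using that by (auto simp: free_nonunital_alg_eq)
  have one: "P (Poly_Mapping.single w 1)" if "w \<noteq> []" "set w \<subseteq> S" for w
    using that
  proof (induction w)
    case (Cons s w)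
    show ?case
    proof (cases "w = []")
      case True
      then show ?thesis using letter[of s] Cons by (simp add: letter_def)
    next
      case False
      have "P (letter s * Poly_Mapping.single w 1)"
        using Cons False by (intro mult letter letter_closed sc) auto
      then show ?thesis by (simp add: letter_def mult_single plus_list_def)
    qed
  qed simp
  have sing: "P (Poly_Mapping.single w c)" if "w \<in> ?W" for w c
  proof -
    have "P (scl c (Poly_Mapping.single w 1))"
      using that by (intro scl one sc) auto
    moreover have "scl c (Poly_Mapping.single w 1) = Poly_Mapping.single w c"
      by (intro poly_mapping_eqI) (simp add: lookup_single when_def)
    ultimately show ?thesis by simp
  qed
  have "Poly_Mapping.keys p \<subseteq> ?W" using p by (auto simp: free_nonunital_alg_eq)
  then show ?thesis
  proof (induction p rule: pm_induct)
    case (add w c p)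
    then show ?case using sing sc \<open>\<And>p q. p \<in> ?N \<Longrightarrow> q \<in> ?N \<Longrightarrow> P p \<Longrightarrow> P q \<Longrightarrow> P (p + q)\<close>
      by (simp add: free_nonunital_alg_eq)
  qed (rule zero)
qed

text \<open>
  Homomorphisms into the algebra of dual numbers over \<open>B\<close> are pairs of a homomorphism into \<open>B\<close> and
  a derivation along it, so that free objects have derivations because they have homomorphisms.
\<close>

definition dual_numbers :: "('a::field, 'v) module \<Rightarrow> ('a, 'v \<times> 'v) module" where
  "dual_numbers B = \<lparr>carrier = carrier B \<times> carrier B,
     mult = (\<lambda>x y. (fst x \<otimes>\<^bsub>B\<^esub> fst y, snd x \<otimes>\<^bsub>B\<^esub> fst y \<oplus>\<^bsub>B\<^esub> fst x \<otimes>\<^bsub>B\<^esub> snd y)),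
     one = (\<zero>\<^bsub>B\<^esub>, \<zero>\<^bsub>B\<^esub>), zero = (\<zero>\<^bsub>B\<^esub>, \<zero>\<^bsub>B\<^esub>),
     add = (\<lambda>x y. (fst x \<oplus>\<^bsub>B\<^esub> fst y, snd x \<oplus>\<^bsub>B\<^esub> snd y)),
     smult = (\<lambda>c x. (c \<odot>\<^bsub>B\<^esub> fst x, c \<odot>\<^bsub>B\<^esub> snd x))\<rparr>"

lemma dual_numbers_nalg:
  assumes "nalg B"
  shows "nalg (dual_numbers B)"
proof -
  interpret nalg B by fact
  have neg: "x \<oplus>\<^bsub>B\<^esub> -1 \<odot>\<^bsub>B\<^esub> x = \<zero>\<^bsub>B\<^esub>" if "x \<in> carrier B" for x
    using smult_l_distr[of x 1 "-1"] that by simp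
  show ?thesis
  proof (rule nalgI, goal_cases)
    case 8
    show ?case
      unfolding nalg_axioms_def dual_numbers_def
      by (auto simp: l_distr r_distr m_assoc smult_l_distr smult_r_distr smult_smult
          smult_mult_l smult_mult_r a_ac)
  qed (auto simp: dual_numbers_def a_ac neg)
qed

section \<open>The enveloping algebra and its action\<close>

text \<open>
  An action of \<open>L\<close> on the algebra \<open>B\<close> by derivations. The Lie algebra laws are those of the operators
  \<open>\<rho> d\<close>; \<open>L\<close> itself enters through its closure properties.
\<close>

locale lie_rep = nalg B for B :: "('a::field, 'v) module" (structure) and L :: "('a, 'l) module"
    and \<rho> :: "'l \<Rightarrow> 'v \<Rightarrow> 'v" +
  assumes L_closed: "\<And>d e. d \<in> carrier L \<Longrightarrow> e \<in> carrier L \<Longrightarrow> d \<oplus>\<^bsub>L\<^esub> e \<in> carrier L"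
      "\<And>c d. d \<in> carrier L \<Longrightarrow> c \<odot>\<^bsub>L\<^esub> d \<in> carrier L"
      "\<And>d e. d \<in> carrier L \<Longrightarrow> e \<in> carrier L \<Longrightarrow> d \<otimes>\<^bsub>L\<^esub> e \<in> carrier L"
    and rho_der: "\<And>d. d \<in> carrier L \<Longrightarrow> \<rho> d \<in> derivations B"
    and rho_add: "\<And>d e b. d \<in> carrier L \<Longrightarrow> e \<in> carrier L \<Longrightarrow> b \<in> carrier B \<Longrightarrow>
      \<rho> (d \<oplus>\<^bsub>L\<^esub> e) b = \<rho> d b \<oplus> \<rho> e b"
    and rho_smult: "\<And>c d b. d \<in> carrier L \<Longrightarrow> b \<in> carrier B \<Longrightarrow> \<rho> (c \<odot>\<^bsub>L\<^esub> d) b = c \<odot> \<rho> d b"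
    and rho_bracket: "\<And>d e b. d \<in> carrier L \<Longrightarrow> e \<in> carrier L \<Longrightarrow> b \<in> carrier B \<Longrightarrow>
      \<rho> (d \<otimes>\<^bsub>L\<^esub> e) b = \<rho> d (\<rho> e b) \<ominus> \<rho> e (\<rho> d b)"

definition lie_closed :: "('a::field, 'l) module \<Rightarrow> bool" where
  "lie_closed L \<longleftrightarrow> (\<forall>d\<in>carrier L. \<forall>e\<in>carrier L. d \<oplus>\<^bsub>L\<^esub> e \<in> carrier L \<and> d \<otimes>\<^bsub>L\<^esub> e \<in> carrier L) \<and>
     (\<forall>c. \<forall>d\<in>carrier L. c \<odot>\<^bsub>L\<^esub> d \<in> carrier L)"

lemma (in lie_rep) lie_closed_L: "lie_closed L"
  using L_closed by (auto simp: lie_closed_def)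

lemma free_alg_mem: "p \<in> carrier (free_alg S) \<longleftrightarrow> Poly_Mapping.keys p \<subseteq> {w. set w \<subseteq> S}"
  by (simp add: free_alg_eq)

lemma free_alg_diff_closed:
  fixes p q :: "'s list \<Rightarrow>\<^sub>0 'a::field"
  shows "p \<in> carrier (free_alg S) \<Longrightarrow> q \<in> carrier (free_alg S) \<Longrightarrow> p - q \<in> carrier (free_alg S)"
    "p \<in> carrier (free_nonunital_alg S) \<Longrightarrow> q \<in> carrier (free_nonunital_alg S) \<Longrightarrow>
      p - q \<in> carrier (free_nonunital_alg S)"
  unfolding free_alg_eq free_nonunital_alg_eq using keys_minus_subset[of p q] by auto

lemma free_alg_minus:
  fixes p q :: "'s list \<Rightarrow>\<^sub>0 'a::field"
  shows "p \<in> carrier (free_alg S) \<Longrightarrow> q \<in> carrier (free_alg S) \<Longrightarrow> p \<ominus>\<^bsub>free_alg S\<^esub> q = p - q"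
    "p \<in> carrier (free_nonunital_alg S) \<Longrightarrow> q \<in> carrier (free_nonunital_alg S) \<Longrightarrow>
      p \<ominus>\<^bsub>free_nonunital_alg S\<^esub> q = p - q"
proof -
  have "p + scl (-1) q = p - q"
    by (intro poly_mapping_eqI) (simp add: lookup_add lookup_minus)
  then show "p \<in> carrier (free_alg S) \<Longrightarrow> q \<in> carrier (free_alg S) \<Longrightarrow> p \<ominus>\<^bsub>free_alg S\<^esub> q = p - q"
    "p \<in> carrier (free_nonunital_alg S) \<Longrightarrow> q \<in> carrier (free_nonunital_alg S) \<Longrightarrow>
      p \<ominus>\<^bsub>free_nonunital_alg S\<^esub> q = p - q"
    by (simp_all add: nalg.diff_smult[OF free_alg_nalg] nalg.diff_smult[OF free_nonunital_nalg])
qed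

lemma uea_ideal_ideal:
  assumes "lie_closed L"
  shows "alg_ideal (free_alg (carrier L)) (uea_ideal L)"
proof -
  interpret F: nalg "free_alg (carrier L)" by (rule free_alg_nalg)
  have m: "p * q \<in> carrier (free_alg (carrier L))"
    if "p \<in> carrier (free_alg (carrier L))" "q \<in> carrier (free_alg (carrier L))" for p q
    using F.m_closed[OF that] by simp
  have s: "scl c p \<in> carrier (free_alg (carrier L))"
    if "p \<in> carrier (free_alg (carrier L))" for p c
    using F.smult_closed[OF that] by simp
  show ?thesis unfolding uea_ideal_def
    by (rule F.alg_ideal_gen_ideal)
       (use assms in \<open>auto simp: lie_closed_def intro!: free_alg_diff_closed letter_closed m s\<close>)
qed

lemma uea_nalg: "lie_closed L \<Longrightarrow> nalg (uea_alg L)"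
  unfolding uea_alg_def by (rule nalg.quot_nalg[OF free_alg_nalg uea_ideal_ideal])

definition uea_cls :: "('a::field, 'l) module \<Rightarrow> ('l list \<Rightarrow>\<^sub>0 'a) \<Rightarrow> ('a, 'l) uea" where
  "uea_cls L p = uea_ideal L +>\<^bsub>free_alg (carrier L)\<^esub> p"

lemma uea_one_aux: "\<one>\<^bsub>quot_alg (free_alg S) J\<^esub> = J +>\<^bsub>free_alg S\<^esub> 1"
  unfolding quot_alg_def by simp

lemma
  assumes "lie_closed L"
  shows uea_cls_add: "p \<in> carrier (free_alg (carrier L)) \<Longrightarrow> q \<in> carrier (free_alg (carrier L)) \<Longrightarrow>
      uea_cls L p \<oplus>\<^bsub>uea_alg L\<^esub> uea_cls L q = uea_cls L (p + q)"
    and uea_cls_mult: "p \<in> carrier (free_alg (carrier L)) \<Longrightarrow> q \<in> carrier (free_alg (carrier L)) \<Longrightarrow>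
      uea_cls L p \<otimes>\<^bsub>uea_alg L\<^esub> uea_cls L q = uea_cls L (p * q)"
    and uea_cls_smult: "p \<in> carrier (free_alg (carrier L)) \<Longrightarrow>
      c \<odot>\<^bsub>uea_alg L\<^esub> uea_cls L p = uea_cls L (scl c p)"
    and uea_cls_carrier: "carrier (uea_alg L) = uea_cls L ` carrier (free_alg (carrier L))"
    and uea_cls_one: "\<one>\<^bsub>uea_alg L\<^esub> = uea_cls L 1"
    and uea_cls_inj: "uea_inj L d = uea_cls L (letter d)"
  using nalg.quot_add[OF free_alg_nalg uea_ideal_ideal[OF assms]]
    nalg.quot_mult[OF free_alg_nalg uea_ideal_ideal[OF assms]]
    nalg.quot_smult[OF free_alg_nalg uea_ideal_ideal[OF assms]]
    nalg.quot_carrier[OF free_alg_nalg]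
    free_alg_sel(4)[of "carrier L"]
  by (simp_all add: uea_alg_def uea_cls_def uea_inj_def uea_one_aux)

lemma free_alg_one_closed: "1 \<in> carrier (free_alg S)"
  by (simp add: free_alg_mem keys_one) (simp add: zero_list_def)

lemma
  assumes "lie_closed L"
  shows uea_one_closed: "\<one>\<^bsub>uea_alg L\<^esub> \<in> carrier (uea_alg L)"
    and uea_inj_closed: "d \<in> carrier L \<Longrightarrow> uea_inj L d \<in> carrier (uea_alg L)"
    and uea_mult_one: "u \<in> carrier (uea_alg L) \<Longrightarrow> u \<otimes>\<^bsub>uea_alg L\<^esub> \<one>\<^bsub>uea_alg L\<^esub> = u"
  by (auto simp: uea_cls_carrier[OF assms] uea_cls_one[OF assms] uea_cls_inj[OF assms] uea_cls_mult[OF assms]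
      free_alg_one_closed intro!: imageI letter_closed)

text \<open>
  Every element of the enveloping algebra is obtained from 1 by left multiplication with elements of
  \<open>L\<close>, addition and scaling. This rule turns facts about the action of \<open>L\<close> into facts about the action
  of the enveloping algebra.
\<close>

lemma uea_induct [consumes 2, case_names one inj add smult]:
  assumes L: "lie_closed L" and u: "u \<in> carrier (uea_alg L)"
    and one: "P \<one>\<^bsub>uea_alg L\<^esub>"
    and inj: "\<And>d v. d \<in> carrier L \<Longrightarrow> v \<in> carrier (uea_alg L) \<Longrightarrow> P v \<Longrightarrow> P (uea_inj L d \<otimes>\<^bsub>uea_alg L\<^esub> v)"
    and add: "\<And>v w. v \<in> carrier (uea_alg L) \<Longrightarrow> w \<in> carrier (uea_alg L) \<Longrightarrow> P v \<Longrightarrow> P w \<Longrightarrow> P (v \<oplus>\<^bsub>uea_alg L\<^esub> w)"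
    and smult: "\<And>c v. v \<in> carrier (uea_alg L) \<Longrightarrow> P v \<Longrightarrow> P (c \<odot>\<^bsub>uea_alg L\<^esub> v)"
  shows "P u"
proof -
  note c = uea_cls_carrier[OF L]
  obtain p where p: "p \<in> carrier (free_alg (carrier L))" and u: "u = uea_cls L p"
    using u by (auto simp: c)
  have sc: "Poly_Mapping.single w a \<in> carrier (free_alg (carrier L))" if "set w \<subseteq> carrier L" for w a
    using that by (auto simp: free_alg_mem)
  have one': "P (uea_cls L (Poly_Mapping.single w 1))" if "set w \<subseteq> carrier L" for w
    using that
  proof (induction w)
    case Nil
    then show ?case using one by (simp add: uea_cls_one[OF L] flip: single_one zero_list_def)
  next
    case (Cons d w)
    have "P (uea_inj L d \<otimes>\<^bsub>uea_alg L\<^esub> uea_cls L (Poly_Mapping.single w 1))"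
      using Cons by (intro inj) (auto simp: c intro!: imageI sc)
    then show ?case
      using Cons by (simp add: uea_cls_inj[OF L] uea_cls_mult[OF L] letter_closed sc)
        (simp add: letter_def mult_single plus_list_def)
  qed
  have sing: "P (uea_cls L (Poly_Mapping.single w a))" if w: "set w \<subseteq> carrier L" for w a
  proof -
    have "P (a \<odot>\<^bsub>uea_alg L\<^esub> uea_cls L (Poly_Mapping.single w 1))"
      using w by (intro smult one') (auto simp: c intro!: imageI sc)
    moreover have "scl a (Poly_Mapping.single w 1) = Poly_Mapping.single w a"
      by (intro poly_mapping_eqI) (simp add: lookup_single when_def)
    ultimately show ?thesis using w by (simp add: uea_cls_smult[OF L] sc)
  qed
  have "Poly_Mapping.keys p \<subseteq> {w. set w \<subseteq> carrier L}" using p by (simp add: free_alg_mem)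
  then have "P (uea_cls L p)"
  proof (induction p rule: pm_induct)
    case zero
    then show ?case using sing[of "[]" 0] by simp
  next
    case (add w a p)
    have pc: "p \<in> carrier (free_alg (carrier L))" using add by (simp add: free_alg_mem)
    have "P (uea_cls L (Poly_Mapping.single w a) \<oplus>\<^bsub>uea_alg L\<^esub> uea_cls L p)"
      using add sing sc pc by (intro assms(5)) (auto simp: c intro!: imageI)
    also have "uea_cls L (Poly_Mapping.single w a) \<oplus>\<^bsub>uea_alg L\<^esub> uea_cls L p = uea_cls L (Poly_Mapping.single w a + p)"
      by (rule uea_cls_add[OF L sc pc]) (use add in simp)
    finally show ?case .
  qed
  then show ?thesis by (simp add: u)
qed

context lie_rep
begin

abbreviation "Lw \<equiv> {w. set w \<subseteq> carrier L}"

lemma rho_closed: "d \<in> carrier L \<Longrightarrow> b \<in> carrier B \<Longrightarrow> \<rho> d b \<in> carrier B"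
  by (rule lin_closed[OF der_lin[OF rho_der]])

lemma foldr_closed: "set w \<subseteq> carrier L \<Longrightarrow> b \<in> carrier B \<Longrightarrow> foldr \<rho> w b \<in> carrier B"
  by (induction w) (auto intro: rho_closed)

lemma foldr_lin:
  assumes "set w \<subseteq> carrier L"
  shows "b \<in> carrier B \<Longrightarrow> c \<in> carrier B \<Longrightarrow> foldr \<rho> w (b \<oplus> c) = foldr \<rho> w b \<oplus> foldr \<rho> w c"
    and "b \<in> carrier B \<Longrightarrow> foldr \<rho> w (a \<odot> b) = a \<odot> foldr \<rho> w b"
  using assms
  by (induction w) (auto simp: foldr_closed lin_add[OF der_lin[OF rho_der]] lin_smult[OF der_lin[OF rho_der]])

text \<open>
  The action of a chosen representative; it descends to the enveloping algebra by \<open>wact_uea_ideal\<close>.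
\<close>

definition wact :: "('l list \<Rightarrow>\<^sub>0 'a) \<Rightarrow> 'v \<Rightarrow> 'v" where
  "wact p b = lext B (\<lambda>w. foldr \<rho> w b) p"

lemma wact_closed: "Poly_Mapping.keys p \<subseteq> Lw \<Longrightarrow> b \<in> carrier B \<Longrightarrow> wact p b \<in> carrier B"
  unfolding wact_def by (rule lext_closed) (auto intro: foldr_closed)

lemma wact_add: "Poly_Mapping.keys p \<subseteq> Lw \<Longrightarrow> Poly_Mapping.keys q \<subseteq> Lw \<Longrightarrow> b \<in> carrier B \<Longrightarrow>
    wact (p + q) b = wact p b \<oplus> wact q b"
  unfolding wact_def by (rule lext_add) (auto intro: foldr_closed)

lemma wact_scl: "Poly_Mapping.keys p \<subseteq> Lw \<Longrightarrow> b \<in> carrier B \<Longrightarrow> wact (scl c p) b = c \<odot> wact p b"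
  unfolding wact_def by (rule lext_scl) (auto intro: foldr_closed)

lemma wact_diff:
  assumes "Poly_Mapping.keys p \<subseteq> Lw" "Poly_Mapping.keys q \<subseteq> Lw" "b \<in> carrier B"
  shows "wact (p - q) b = wact p b \<ominus> wact q b"
proof -
  have e: "p - q = p + scl (-1) q"
    by (intro poly_mapping_eqI) (simp add: lookup_add lookup_minus)
  show ?thesis unfolding e using assms keys_scl[of "-1" q]
    by (subst wact_add) (auto simp: wact_scl diff_smult wact_closed)
qed

lemma wact_single: "set w \<subseteq> carrier L \<Longrightarrow> b \<in> carrier B \<Longrightarrow>
    wact (Poly_Mapping.single w c) b = c \<odot> foldr \<rho> w b"
  unfolding wact_def by (rule lext_single) (rule foldr_closed)

lemma wact_letter: "d \<in> carrier L \<Longrightarrow> b \<in> carrier B \<Longrightarrow> wact (letter d) b = \<rho> d b"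
  by (simp add: letter_def wact_single rho_closed)

lemma wact_mult:
  assumes p: "Poly_Mapping.keys p \<subseteq> Lw" and q: "Poly_Mapping.keys q \<subseteq> Lw" and b: "b \<in> carrier B"
  shows "wact (p * q) b = wact p (wact q b)"
  using p
proof (induction p rule: pm_induct)
  case zero
  then show ?case by (simp add: wact_def)
next
  case (add w c p)
  have w: "set w \<subseteq> carrier L" using add by simp
  have sing: "Poly_Mapping.keys (Poly_Mapping.single w c * q) \<subseteq> Lw \<and>
      wact (Poly_Mapping.single w c * q) b = c \<odot> foldr \<rho> w (wact q b)"
    using q
  proof (induction q rule: pm_induct)
    case zero
    have "foldr \<rho> w \<zero> = \<zero>" using foldr_lin(2)[OF w zero_closed, of 0] foldr_closed[OF w zero_closed] by simp
    then show ?case by (simp add: wact_def)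
  next
    case (add v d q)
    have k: "Poly_Mapping.keys (Poly_Mapping.single (w + v) (c * d)) \<subseteq> Lw"
      "Poly_Mapping.keys (Poly_Mapping.single v d) \<subseteq> Lw"
      using w add by (auto simp: plus_list_def)
    have "wact (Poly_Mapping.single (w + v) (c * d) + Poly_Mapping.single w c * q) b =
        (c * d) \<odot> foldr \<rho> w (foldr \<rho> v b) \<oplus> c \<odot> foldr \<rho> w (wact q b)"
      using add k b w wact_single[of "w + v" b "c * d"] by (simp add: wact_add plus_list_def)
    also have "\<dots> = c \<odot> foldr \<rho> w (d \<odot> foldr \<rho> v b \<oplus> wact q b)"
      using add b w by (simp add: foldr_lin foldr_closed wact_closed smult_r_distr smult_smult)
    also have "d \<odot> foldr \<rho> v b \<oplus> wact q b = wact (Poly_Mapping.single v d + q) b"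
      using add k b by (simp add: wact_add wact_single)
    finally have "wact (Poly_Mapping.single (w + v) (c * d) + Poly_Mapping.single w c * q) b =
        c \<odot> foldr \<rho> w (wact (Poly_Mapping.single v d + q) b)" .
    moreover have "Poly_Mapping.keys (Poly_Mapping.single (w + v) (c * d) + Poly_Mapping.single w c * q) \<subseteq> Lw"
      using keys_add[of "Poly_Mapping.single (w + v) (c * d)" "Poly_Mapping.single w c * q"] k(1)
        conjunct1[OF add(3)] by (meson Un_least order_trans)
    ultimately show ?case by (simp add: distrib_left mult_single)
  qed
  have pq: "Poly_Mapping.keys (p * q) \<subseteq> Lw"
    using add q keys_mult[of p q] by (fastforce simp: plus_list_def)
  have k: "Poly_Mapping.keys (Poly_Mapping.single w c) \<subseteq> Lw" using w by auto
  show ?case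
    using add sing pq k b q w by (simp add: distrib_right wact_add wact_single wact_closed)
qed

text \<open>
  The elements that act as zero form an ideal containing the defining relations of the enveloping
  algebra, because \<open>\<rho>\<close> is linear and respects brackets.
\<close>

lemma wact_uea_ideal:
  assumes "p \<in> uea_ideal L"
  shows "Poly_Mapping.keys p \<subseteq> Lw \<and> (\<forall>b\<in>carrier B. wact p b = \<zero>)"
proof -
  let ?K = "{p. Poly_Mapping.keys p \<subseteq> Lw \<and> (\<forall>b\<in>carrier B. wact p b = \<zero>)}"
  interpret F: nalg "free_alg (carrier L)" by (rule free_alg_nalg)
  have cl: "Poly_Mapping.keys (p * q) \<subseteq> Lw" "Poly_Mapping.keys (p + q) \<subseteq> Lw"
      "Poly_Mapping.keys (scl c p) \<subseteq> Lw" "Poly_Mapping.keys (p - q) \<subseteq> Lw"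
    if "Poly_Mapping.keys p \<subseteq> Lw" "Poly_Mapping.keys q \<subseteq> Lw" for p q :: "'l list \<Rightarrow>\<^sub>0 'a" and c
    using F.m_closed[of p q] F.a_closed[of p q] F.smult_closed[of p c] that free_alg_diff_closed(1)[of p _ q]
    by (simp_all add: free_alg_mem)
  have zero: "wact p \<zero> = \<zero>" if "Poly_Mapping.keys p \<subseteq> Lw" for p
    using that
  proof (induction p rule: pm_induct)
    case (add w c p)
    have w: "set w \<subseteq> carrier L" using add by simp
    have "foldr \<rho> w \<zero> = \<zero>" using foldr_lin(2)[OF w zero_closed, of 0] foldr_closed[OF w zero_closed] by simp
    then show ?case using add w
      by (subst wact_add) (auto simp: wact_single)
  qed (simp add: wact_def)
  have "alg_ideal (free_alg (carrier L)) ?K"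
    unfolding alg_ideal_def
    by (auto simp: free_alg_mem wact_add wact_scl wact_mult cl zero wact_closed)
       (auto simp: wact_def cl subset_iff dest!: subsetD[OF keys_scl])
  moreover have lk: "Poly_Mapping.keys (letter d) \<subseteq> Lw" if "d \<in> carrier L" for d
    using that by (simp add: letter_def)
  have ks: "Poly_Mapping.keys (scl c p) \<subseteq> Lw" if "Poly_Mapping.keys p \<subseteq> Lw" for c and p :: "'l list \<Rightarrow>\<^sub>0 'a"
    by (rule order_trans[OF keys_scl that])
  note wl = ks wact_letter rho_add rho_smult rho_bracket L_closed lk wact_diff wact_scl wact_mult cl rho_closed
  have self: "x \<ominus> x = \<zero>" if "x \<in> carrier B" for x using that by (simp add: a_minus_def r_neg)
  have self2: "x \<oplus> y \<ominus> x \<ominus> y = \<zero>" if "x \<in> carrier B" "y \<in> carrier B" for x y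
    using that by (simp add: a_minus_def a_assoc[symmetric] r_neg a_comm[of x y])
      (simp add: a_assoc r_neg)
  have "uea_ideal L \<subseteq> ?K"
    unfolding uea_ideal_def
  proof (rule alg_ideal_gen_least[OF calculation], intro Un_least subsetI; elim CollectE exE conjE; intro CollectI conjI ballI)
  qed (simp_all add: wl self self2)
  then show ?thesis using assms by blast
qed

lemma uea_act_cls:
  assumes p: "p \<in> carrier (free_alg (carrier L))" and b: "b \<in> carrier B"
  shows "uea_act B \<rho> (uea_cls L p) b = wact p b"
proof -
  interpret F: nalg "free_alg (carrier L)" by (rule free_alg_nalg)
  define q where "q = (SOME q. q \<in> uea_cls L p)"
  have I: "alg_ideal (free_alg (carrier L)) (uea_ideal L)" by (rule uea_ideal_ideal[OF lie_closed_L])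
  have "q \<in> uea_cls L p" unfolding q_def uea_cls_def by (rule someI, rule F.coset_self[OF I p])
  then have q: "q \<in> carrier (free_alg (carrier L))" "q - p \<in> uea_ideal L"
    using p by (auto simp: uea_cls_def F.in_coset_iff[OF I p] free_alg_minus)
  have "wact (q - p) b = \<zero>" using wact_uea_ideal[OF q(2)] b by blast
  then have "wact q b = wact p b"
    using q p b by (simp add: wact_diff free_alg_mem diff_eq_zero_iff wact_closed)
  then show ?thesis
    using b by (simp add: uea_act_def Let_def q_def[symmetric] wact_def lext_def)
qed

lemma
  assumes b: "b \<in> carrier B"
  shows act_closed: "u \<in> carrier (uea_alg L) \<Longrightarrow> uea_act B \<rho> u b \<in> carrier B"
    and act_add: "u \<in> carrier (uea_alg L) \<Longrightarrow> v \<in> carrier (uea_alg L) \<Longrightarrow>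
      uea_act B \<rho> (u \<oplus>\<^bsub>uea_alg L\<^esub> v) b = uea_act B \<rho> u b \<oplus> uea_act B \<rho> v b"
    and act_smult: "u \<in> carrier (uea_alg L) \<Longrightarrow>
      uea_act B \<rho> (c \<odot>\<^bsub>uea_alg L\<^esub> u) b = c \<odot> uea_act B \<rho> u b"
    and act_mult: "u \<in> carrier (uea_alg L) \<Longrightarrow> v \<in> carrier (uea_alg L) \<Longrightarrow>
      uea_act B \<rho> (u \<otimes>\<^bsub>uea_alg L\<^esub> v) b = uea_act B \<rho> u (uea_act B \<rho> v b)"
    and act_one: "uea_act B \<rho> \<one>\<^bsub>uea_alg L\<^esub> b = b"
    and act_inj: "d \<in> carrier L \<Longrightarrow> uea_act B \<rho> (uea_inj L d) b = \<rho> d b"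
proof -
  note L = lie_closed_L
  interpret F: nalg "free_alg (carrier L)" by (rule free_alg_nalg)
  have cl: "p * q \<in> carrier (free_alg (carrier L))" "p + q \<in> carrier (free_alg (carrier L))"
      "scl c p \<in> carrier (free_alg (carrier L))"
    if "p \<in> carrier (free_alg (carrier L))" "q \<in> carrier (free_alg (carrier L))" for p q :: "'l list \<Rightarrow>\<^sub>0 'a" and c
    using F.m_closed[OF that] F.a_closed[OF that] F.smult_closed[OF that(1)] by simp_all
  note k = free_alg_mem[THEN iffD1]
  show "u \<in> carrier (uea_alg L) \<Longrightarrow> uea_act B \<rho> u b \<in> carrier B"
    using b by (auto simp: uea_cls_carrier[OF L] uea_act_cls k wact_closed)
  show "u \<in> carrier (uea_alg L) \<Longrightarrow> v \<in> carrier (uea_alg L) \<Longrightarrow>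
      uea_act B \<rho> (u \<oplus>\<^bsub>uea_alg L\<^esub> v) b = uea_act B \<rho> u b \<oplus> uea_act B \<rho> v b"
    using b by (auto simp: uea_cls_carrier[OF L] uea_act_cls uea_cls_add[OF L] k wact_add cl)
  show "u \<in> carrier (uea_alg L) \<Longrightarrow>
      uea_act B \<rho> (c \<odot>\<^bsub>uea_alg L\<^esub> u) b = c \<odot> uea_act B \<rho> u b"
    using b by (auto simp: uea_cls_carrier[OF L] uea_act_cls uea_cls_smult[OF L] k wact_scl cl)
  show "u \<in> carrier (uea_alg L) \<Longrightarrow> v \<in> carrier (uea_alg L) \<Longrightarrow>
      uea_act B \<rho> (u \<otimes>\<^bsub>uea_alg L\<^esub> v) b = uea_act B \<rho> u (uea_act B \<rho> v b)"
    using b by (auto simp: uea_cls_carrier[OF L] uea_act_cls uea_cls_mult[OF L] k wact_mult cl wact_closed)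
  show "uea_act B \<rho> \<one>\<^bsub>uea_alg L\<^esub> b = b"
  proof -
    have "(1 :: 'l list \<Rightarrow>\<^sub>0 'a) = Poly_Mapping.single [] 1" by (simp flip: zero_list_def)
    then have "wact 1 b = b" using b wact_single[of "[]" b 1] by simp
    then show ?thesis using b by (simp add: uea_cls_one[OF L] uea_act_cls free_alg_one_closed)
  qed
  show "d \<in> carrier L \<Longrightarrow> uea_act B \<rho> (uea_inj L d) b = \<rho> d b"
    using b by (simp add: uea_cls_inj[OF L] uea_act_cls letter_closed wact_letter)
qed

lemma act_lin:
  assumes u: "u \<in> carrier (uea_alg L)"
  shows "b \<in> carrier B \<Longrightarrow> c \<in> carrier B \<Longrightarrow> uea_act B \<rho> u (b \<oplus> c) = uea_act B \<rho> u b \<oplus> uea_act B \<rho> u c"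
    and "b \<in> carrier B \<Longrightarrow> uea_act B \<rho> u (a \<odot> b) = a \<odot> uea_act B \<rho> u b"
  using lie_closed_L u
  by (induction u rule: uea_induct)
     (simp_all add: act_one act_mult act_inj act_add act_smult act_closed uea_inj_closed[OF lie_closed_L]
        lin_add[OF der_lin[OF rho_der]] lin_smult[OF der_lin[OF rho_der]]
        smult_r_distr a_ac mult.commute flip: smult_smult)

end

text \<open>
  A linear map that intertwines two actions of \<open>L\<close> intertwines the actions of the enveloping algebra.
\<close>

lemma act_natural:
  assumes B: "lie_rep B L \<rho>" and C: "lie_rep C L \<sigma>" and h: "h \<in> lin_maps B C"
    and eq: "\<And>d b. d \<in> carrier L \<Longrightarrow> b \<in> carrier B \<Longrightarrow> h (\<rho> d b) = \<sigma> d (h b)"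
    and u: "u \<in> carrier (uea_alg L)" and b: "b \<in> carrier B"
  shows "h (uea_act B \<rho> u b) = uea_act C \<sigma> u (h b)"
proof -
  interpret B: lie_rep B L \<rho> by fact
  interpret C: lie_rep C L \<sigma> by fact
  note hc = lin_closed[OF h]
  show ?thesis
    using B.lie_closed_L u
    by (induction u rule: uea_induct)
       (use b hc in \<open>simp_all add: B.act_one C.act_one B.act_mult C.act_mult B.act_inj C.act_inj
         B.act_add C.act_add B.act_smult C.act_smult B.act_closed C.act_closed
         uea_inj_closed[OF B.lie_closed_L] eq lin_add[OF h] lin_smult[OF h]\<close>)
qed

lemma
  fixes L :: "('a::field, 'l) module"
  assumes L: "lie_closed L"
  shows uea_inj_add: "d \<in> carrier L \<Longrightarrow> e \<in> carrier L \<Longrightarrow>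
      uea_inj L (d \<oplus>\<^bsub>L\<^esub> e) = uea_inj L d \<oplus>\<^bsub>uea_alg L\<^esub> uea_inj L e"
    and uea_inj_smult: "d \<in> carrier L \<Longrightarrow>
      uea_inj L (c \<odot>\<^bsub>L\<^esub> d) = c \<odot>\<^bsub>uea_alg L\<^esub> uea_inj L d"
    and uea_inj_bracket: "d \<in> carrier L \<Longrightarrow> e \<in> carrier L \<Longrightarrow> uea_inj L (d \<otimes>\<^bsub>L\<^esub> e) =
      uea_inj L d \<otimes>\<^bsub>uea_alg L\<^esub> uea_inj L e \<ominus>\<^bsub>uea_alg L\<^esub> uea_inj L e \<otimes>\<^bsub>uea_alg L\<^esub> uea_inj L d"
proof -
  interpret F: nalg "free_alg (carrier L)" by (rule free_alg_nalg)
  interpret U: nalg "uea_alg L" by (rule uea_nalg[OF L])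
  note I = uea_ideal_ideal[OF L]
  have cl: "p * q \<in> carrier (free_alg (carrier L))" "p + q \<in> carrier (free_alg (carrier L))"
    if "p \<in> carrier (free_alg (carrier L))" "q \<in> carrier (free_alg (carrier L))" for p q
    using F.m_closed[OF that] F.a_closed[OF that] by simp_all
  have sc: "scl c p \<in> carrier (free_alg (carrier L))" if "p \<in> carrier (free_alg (carrier L))" for c p
    using F.smult_closed[OF that] by simp
  have eq: "uea_cls L p = uea_cls L q" if "p \<in> carrier (free_alg (carrier L))"
    "q \<in> carrier (free_alg (carrier L))" "p - q \<in> uea_ideal L" for p q
    using F.coset_eq_iff[OF I that(1,2)] that by (simp add: uea_cls_def free_alg_minus)
  have e: "p + scl (-1) q = p - q" for p q :: "'l list \<Rightarrow>\<^sub>0 'a"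
    by (intro poly_mapping_eqI) (simp add: lookup_add lookup_minus)
  note lc = letter_closed(1)
  have Lc: "d \<in> carrier L \<Longrightarrow> e \<in> carrier L \<Longrightarrow> d \<oplus>\<^bsub>L\<^esub> e \<in> carrier L"
      "d \<in> carrier L \<Longrightarrow> c \<odot>\<^bsub>L\<^esub> d \<in> carrier L"
      "d \<in> carrier L \<Longrightarrow> e \<in> carrier L \<Longrightarrow> d \<otimes>\<^bsub>L\<^esub> e \<in> carrier L" for c d e
    using L by (auto simp: lie_closed_def)
  note incl = alg_ideal_gen_incl[THEN subsetD, of _ _ "free_alg (carrier L)"]
  show "d \<in> carrier L \<Longrightarrow> e \<in> carrier L \<Longrightarrow>
      uea_inj L (d \<oplus>\<^bsub>L\<^esub> e) = uea_inj L d \<oplus>\<^bsub>uea_alg L\<^esub> uea_inj L e"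
    unfolding uea_cls_inj[OF L]
    by (subst uea_cls_add[OF L], simp add: lc, simp add: lc, rule eq)
       (auto simp: lc Lc cl uea_ideal_def diff_diff_eq[symmetric] intro!: incl)
  show "d \<in> carrier L \<Longrightarrow>
      uea_inj L (c \<odot>\<^bsub>L\<^esub> d) = c \<odot>\<^bsub>uea_alg L\<^esub> uea_inj L d"
    unfolding uea_cls_inj[OF L]
    by (subst uea_cls_smult[OF L], simp add: lc, rule eq)
       (auto simp: lc Lc sc uea_ideal_def intro!: incl)
  assume de: "d \<in> carrier L" "e \<in> carrier L"
  have "uea_inj L d \<otimes>\<^bsub>uea_alg L\<^esub> uea_inj L e \<ominus>\<^bsub>uea_alg L\<^esub> uea_inj L e \<otimes>\<^bsub>uea_alg L\<^esub> uea_inj L d =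
      uea_cls L (letter d * letter e - letter e * letter d)"
  proof -
    have cc: "p \<in> carrier (free_alg (carrier L)) \<Longrightarrow> uea_cls L p \<in> carrier (uea_alg L)" for p
      by (simp add: uea_cls_carrier[OF L])
    have "uea_cls L p \<ominus>\<^bsub>uea_alg L\<^esub> uea_cls L q = uea_cls L (p - q)"
      if "p \<in> carrier (free_alg (carrier L))" "q \<in> carrier (free_alg (carrier L))" for p q
      using that by (simp add: U.diff_smult[OF cc cc] uea_cls_smult[OF L] uea_cls_add[OF L] sc e)
    then show ?thesis using de by (simp add: uea_cls_inj[OF L] uea_cls_mult[OF L] lc cl)
  qed
  also have "\<dots> = uea_cls L (letter (d \<otimes>\<^bsub>L\<^esub> e))"
    by (rule eq) (use de in \<open>auto simp: lc Lc cl uea_ideal_def intro!: incl free_alg_diff_closed\<close>)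
  finally show "uea_inj L (d \<otimes>\<^bsub>L\<^esub> e) =
      uea_inj L d \<otimes>\<^bsub>uea_alg L\<^esub> uea_inj L e \<ominus>\<^bsub>uea_alg L\<^esub> uea_inj L e \<otimes>\<^bsub>uea_alg L\<^esub> uea_inj L d"
    by (simp add: uea_cls_inj[OF L])
qed

lemma derivation_algebra_sel [simp]:
  "carrier (derivation_algebra A) = derivations A"
  "d \<otimes>\<^bsub>derivation_algebra A\<^esub> e = (\<lambda>x\<in>carrier A. d (e x) \<ominus>\<^bsub>A\<^esub> e (d x))"
  "d \<oplus>\<^bsub>derivation_algebra A\<^esub> e = (\<lambda>x\<in>carrier A. d x \<oplus>\<^bsub>A\<^esub> e x)"
  "c \<odot>\<^bsub>derivation_algebra A\<^esub> d = (\<lambda>x\<in>carrier A. c \<odot>\<^bsub>A\<^esub> d x)"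
  by (simp_all add: derivation_algebra_def)

lemma derivations_lie_closed:
  assumes "nalg A"
  shows "lie_closed (derivation_algebra A)"
proof -
  interpret nalg A by fact
  note dl = der_lin[THEN lin_closed] der_lin[THEN lin_add] der_lin[THEN lin_smult] der_mult
  have "(\<lambda>x\<in>carrier A. d (e x) \<ominus>\<^bsub>A\<^esub> e (d x)) \<in> derivations A"
    if d: "d \<in> derivations A" and e: "e \<in> derivations A" for d e
  proof (rule restrict_der)
    have canc: "a \<oplus>\<^bsub>A\<^esub> (p \<oplus>\<^bsub>A\<^esub> (q \<oplus>\<^bsub>A\<^esub> b)) \<oplus>\<^bsub>A\<^esub> (-1) \<odot>\<^bsub>A\<^esub> (a' \<oplus>\<^bsub>A\<^esub> (q \<oplus>\<^bsub>A\<^esub> (p \<oplus>\<^bsub>A\<^esub> b'))) =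
        (a \<oplus>\<^bsub>A\<^esub> (-1) \<odot>\<^bsub>A\<^esub> a') \<oplus>\<^bsub>A\<^esub> (b \<oplus>\<^bsub>A\<^esub> (-1) \<odot>\<^bsub>A\<^esub> b')"
      if "a \<in> carrier A" "a' \<in> carrier A" "b \<in> carrier A" "b' \<in> carrier A" "p \<in> carrier A" "q \<in> carrier A"
      for a a' b b' p q
    proof -
      have "p \<oplus>\<^bsub>A\<^esub> (-1) \<odot>\<^bsub>A\<^esub> p = \<zero>\<^bsub>A\<^esub>" "q \<oplus>\<^bsub>A\<^esub> (-1) \<odot>\<^bsub>A\<^esub> q = \<zero>\<^bsub>A\<^esub>"
        using that by (simp_all add: r_neg flip: minus_smult)
      then have pq: "p \<oplus>\<^bsub>A\<^esub> ((-1) \<odot>\<^bsub>A\<^esub> p \<oplus>\<^bsub>A\<^esub> z) = z" "q \<oplus>\<^bsub>A\<^esub> ((-1) \<odot>\<^bsub>A\<^esub> q \<oplus>\<^bsub>A\<^esub> z) = z" if "z \<in> carrier A" for z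
        using that \<open>p \<in> carrier A\<close> \<open>q \<in> carrier A\<close> by (simp_all flip: a_assoc)
      have "a \<oplus>\<^bsub>A\<^esub> (p \<oplus>\<^bsub>A\<^esub> (q \<oplus>\<^bsub>A\<^esub> b)) \<oplus>\<^bsub>A\<^esub> (-1) \<odot>\<^bsub>A\<^esub> (a' \<oplus>\<^bsub>A\<^esub> (q \<oplus>\<^bsub>A\<^esub> (p \<oplus>\<^bsub>A\<^esub> b'))) =
          p \<oplus>\<^bsub>A\<^esub> ((-1) \<odot>\<^bsub>A\<^esub> p \<oplus>\<^bsub>A\<^esub> (q \<oplus>\<^bsub>A\<^esub> ((-1) \<odot>\<^bsub>A\<^esub> q \<oplus>\<^bsub>A\<^esub>
          ((a \<oplus>\<^bsub>A\<^esub> (-1) \<odot>\<^bsub>A\<^esub> a') \<oplus>\<^bsub>A\<^esub> (b \<oplus>\<^bsub>A\<^esub> (-1) \<odot>\<^bsub>A\<^esub> b')))))"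
        using that by (simp add: smult_r_distr a_ac)
      then show ?thesis using that by (simp add: pq)
    qed
    fix x y assume x: "x \<in> carrier A" and y: "y \<in> carrier A"
    show "d (e (x \<oplus>\<^bsub>A\<^esub> y)) \<ominus>\<^bsub>A\<^esub> e (d (x \<oplus>\<^bsub>A\<^esub> y)) =
        d (e x) \<ominus>\<^bsub>A\<^esub> e (d x) \<oplus>\<^bsub>A\<^esub> (d (e y) \<ominus>\<^bsub>A\<^esub> e (d y))"
      using d e x y by (simp add: diff_smult dl smult_r_distr a_ac)
    have "d (e (x \<otimes>\<^bsub>A\<^esub> y)) = d (e x) \<otimes>\<^bsub>A\<^esub> y \<oplus>\<^bsub>A\<^esub> (e x \<otimes>\<^bsub>A\<^esub> d y \<oplus>\<^bsub>A\<^esub> (d x \<otimes>\<^bsub>A\<^esub> e y \<oplus>\<^bsub>A\<^esub> x \<otimes>\<^bsub>A\<^esub> d (e y)))"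
      "e (d (x \<otimes>\<^bsub>A\<^esub> y)) = e (d x) \<otimes>\<^bsub>A\<^esub> y \<oplus>\<^bsub>A\<^esub> (d x \<otimes>\<^bsub>A\<^esub> e y \<oplus>\<^bsub>A\<^esub> (e x \<otimes>\<^bsub>A\<^esub> d y \<oplus>\<^bsub>A\<^esub> x \<otimes>\<^bsub>A\<^esub> e (d y)))"
      using d e x y by (simp_all add: dl a_assoc)
    then show "d (e (x \<otimes>\<^bsub>A\<^esub> y)) \<ominus>\<^bsub>A\<^esub> e (d (x \<otimes>\<^bsub>A\<^esub> y)) =
        (d (e x) \<ominus>\<^bsub>A\<^esub> e (d x)) \<otimes>\<^bsub>A\<^esub> y \<oplus>\<^bsub>A\<^esub> x \<otimes>\<^bsub>A\<^esub> (d (e y) \<ominus>\<^bsub>A\<^esub> e (d y))"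
      using d e x y by (simp add: diff_smult dl canc l_distr r_distr smult_mult_l smult_mult_r)
  next
    fix x c assume x: "x \<in> carrier A"
    show "d (e (c \<odot>\<^bsub>A\<^esub> x)) \<ominus>\<^bsub>A\<^esub> e (d (c \<odot>\<^bsub>A\<^esub> x)) = c \<odot>\<^bsub>A\<^esub> (d (e x) \<ominus>\<^bsub>A\<^esub> e (d x))"
      using d e x by (simp add: diff_smult dl smult_r_distr mult.commute flip: smult_smult)
  qed (use d e in \<open>auto simp: dl nalg_axioms nalg.intro intro: assms\<close>)
  moreover have "(\<lambda>x\<in>carrier A. d x \<oplus>\<^bsub>A\<^esub> e x) \<in> derivations A"
    if "d \<in> derivations A" "e \<in> derivations A" for d e
    by (rule restrict_der) (use that in \<open>simp_all add: assms dl smult_r_distr l_distr r_distr a_ac\<close>)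
  moreover have "(\<lambda>x\<in>carrier A. c \<odot>\<^bsub>A\<^esub> d x) \<in> derivations A" if "d \<in> derivations A" for c d
    by (rule restrict_der) (use that in \<open>simp_all add: assms dl smult_r_distr smult_mult_l smult_mult_r
      mult.commute flip: smult_smult\<close>)
  ultimately show ?thesis by (simp add: lie_closed_def)
qed

section \<open>The free algebra with an action of a Lie algebra\<close>

abbreviation "Llet L \<equiv> (UNIV :: nat set) \<times> carrier (uea_alg L)"

lemma free_L_ideal_ideal:
  assumes L: "lie_closed L"
  shows "alg_ideal (free_nonunital_alg (Llet L)) (free_L_ideal L)"
proof -
  interpret N: nalg "free_nonunital_alg (Llet L)" by (rule free_nonunital_nalg)
  interpret U: nalg "uea_alg L" by (rule uea_nalg[OF L])
  have s: "scl c p \<in> carrier (free_nonunital_alg (Llet L))"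
    if "p \<in> carrier (free_nonunital_alg (Llet L))" for p c
    using N.smult_closed[OF that] by simp
  show ?thesis unfolding free_L_ideal_def
    by (rule N.alg_ideal_gen_ideal) (auto intro!: free_alg_diff_closed letter_closed s)
qed

lemma free_L_nalg: "lie_closed L \<Longrightarrow> nalg (free_L_alg L)"
  unfolding free_L_alg_def by (rule nalg.quot_nalg[OF free_nonunital_nalg free_L_ideal_ideal])

definition free_L_cls where
  "free_L_cls L p = free_L_ideal L +>\<^bsub>free_nonunital_alg (Llet L)\<^esub> p"

context
  fixes L :: "('a::field, 'l) module"
  assumes L: "lie_closed L"
begin

lemma
  shows free_L_cls_add: "p \<in> carrier (free_nonunital_alg (Llet L)) \<Longrightarrow> q \<in> carrier (free_nonunital_alg (Llet L)) \<Longrightarrow>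
      free_L_cls L p \<oplus>\<^bsub>free_L_alg L\<^esub> free_L_cls L q = free_L_cls L (p + q)"
    and free_L_cls_mult: "p \<in> carrier (free_nonunital_alg (Llet L)) \<Longrightarrow> q \<in> carrier (free_nonunital_alg (Llet L)) \<Longrightarrow>
      free_L_cls L p \<otimes>\<^bsub>free_L_alg L\<^esub> free_L_cls L q = free_L_cls L (p * q)"
    and free_L_cls_smult: "p \<in> carrier (free_nonunital_alg (Llet L)) \<Longrightarrow>
      c \<odot>\<^bsub>free_L_alg L\<^esub> free_L_cls L p = free_L_cls L (scl c p)"
    and free_L_cls_carrier: "carrier (free_L_alg L) = free_L_cls L ` carrier (free_nonunital_alg (Llet L))"
    and free_L_cls_zero: "\<zero>\<^bsub>free_L_alg L\<^esub> = free_L_cls L 0"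
    and free_L_cls_var: "free_L_var L i u = free_L_cls L (letter (i, u))"
  using nalg.quot_add[OF free_nonunital_nalg free_L_ideal_ideal[OF L]]
    nalg.quot_mult[OF free_nonunital_nalg free_L_ideal_ideal[OF L]]
    nalg.quot_smult[OF free_nonunital_nalg free_L_ideal_ideal[OF L]]
    nalg.quot_zero[OF free_nonunital_nalg free_L_ideal_ideal[OF L]]
    nalg.quot_carrier[OF free_nonunital_nalg]
  by (simp_all add: free_L_alg_def free_L_cls_def free_L_var_def)

lemma free_L_var_closed: "u \<in> carrier (uea_alg L) \<Longrightarrow> free_L_var L i u \<in> carrier (free_L_alg L)"
  by (auto simp: free_L_cls_carrier free_L_cls_var intro!: imageI letter_closed)

lemma free_L_induct [consumes 1, case_names zero var add smult mult]:
  assumes f: "f \<in> carrier (free_L_alg L)"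
    and zero: "P \<zero>\<^bsub>free_L_alg L\<^esub>"
    and var: "\<And>i u. u \<in> carrier (uea_alg L) \<Longrightarrow> P (free_L_var L i u)"
    and add: "\<And>f g. f \<in> carrier (free_L_alg L) \<Longrightarrow> g \<in> carrier (free_L_alg L) \<Longrightarrow> P f \<Longrightarrow> P g \<Longrightarrow> P (f \<oplus>\<^bsub>free_L_alg L\<^esub> g)"
    and smult: "\<And>c f. f \<in> carrier (free_L_alg L) \<Longrightarrow> P f \<Longrightarrow> P (c \<odot>\<^bsub>free_L_alg L\<^esub> f)"
    and mult: "\<And>f g. f \<in> carrier (free_L_alg L) \<Longrightarrow> g \<in> carrier (free_L_alg L) \<Longrightarrow> P f \<Longrightarrow> P g \<Longrightarrow> P (f \<otimes>\<^bsub>free_L_alg L\<^esub> g)"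
  shows "P f"
proof -
  obtain p where p: "p \<in> carrier (free_nonunital_alg (Llet L))" and f: "f = free_L_cls L p"
    using f by (auto simp: free_L_cls_carrier)
  have c: "q \<in> carrier (free_nonunital_alg (Llet L)) \<Longrightarrow> free_L_cls L q \<in> carrier (free_L_alg L)" for q
    by (auto simp: free_L_cls_carrier)
  from p have "P (free_L_cls L p)"
  proof (induction p rule: free_nonunital_induct)
    case zero then show ?case using assms(2) by (simp add: free_L_cls_zero)
  next
    case (letter s)
    then show ?case using var[of "snd s" "fst s"] by (auto simp: free_L_cls_var)
  next
    case (add p q) then show ?case using assms(4)[OF c c, of p q] by (simp add: free_L_cls_add)
  next
    case (scl a p) then show ?case using assms(5)[OF c, of p a] by (simp add: free_L_cls_smult)
  next
    case (mult p q) then show ?case using assms(6)[OF c c, of p q] by (simp add: free_L_cls_mult)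
  qed
  then show ?thesis by (simp add: f)
qed

lemma
  shows free_L_var_add: "u \<in> carrier (uea_alg L) \<Longrightarrow> v \<in> carrier (uea_alg L) \<Longrightarrow>
      free_L_var L i (u \<oplus>\<^bsub>uea_alg L\<^esub> v) = free_L_var L i u \<oplus>\<^bsub>free_L_alg L\<^esub> free_L_var L i v"
    and free_L_var_smult: "u \<in> carrier (uea_alg L) \<Longrightarrow>
      free_L_var L i (c \<odot>\<^bsub>uea_alg L\<^esub> u) = c \<odot>\<^bsub>free_L_alg L\<^esub> free_L_var L i u"
proof -
  interpret N: nalg "free_nonunital_alg (Llet L)" by (rule free_nonunital_nalg)
  interpret U: nalg "uea_alg L" by (rule uea_nalg[OF L])
  note I = free_L_ideal_ideal[OF L]
  have cl: "p + q \<in> carrier (free_nonunital_alg (Llet L))"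
    if "p \<in> carrier (free_nonunital_alg (Llet L))" "q \<in> carrier (free_nonunital_alg (Llet L))" for p q
    using N.a_closed[OF that] by simp_all
  have sc: "scl c p \<in> carrier (free_nonunital_alg (Llet L))" if "p \<in> carrier (free_nonunital_alg (Llet L))" for c p
    using N.smult_closed[OF that] by simp
  have eq: "free_L_cls L p = free_L_cls L q" if "p \<in> carrier (free_nonunital_alg (Llet L))"
    "q \<in> carrier (free_nonunital_alg (Llet L))" "p - q \<in> free_L_ideal L" for p q
    using N.coset_eq_iff[OF I that(1,2)] that by (simp add: free_L_cls_def free_alg_minus)
  have lc: "letter (i, u) \<in> carrier (free_nonunital_alg (Llet L))" if "u \<in> carrier (uea_alg L)" for i u
    using that by (auto intro: letter_closed)
  note incl = alg_ideal_gen_incl[THEN subsetD, of _ _ "free_nonunital_alg (Llet L)"]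
  show "u \<in> carrier (uea_alg L) \<Longrightarrow> v \<in> carrier (uea_alg L) \<Longrightarrow>
      free_L_var L i (u \<oplus>\<^bsub>uea_alg L\<^esub> v) = free_L_var L i u \<oplus>\<^bsub>free_L_alg L\<^esub> free_L_var L i v"
    unfolding free_L_cls_var
    by (subst free_L_cls_add, simp add: lc, simp add: lc, rule eq)
       (auto simp: lc cl free_L_ideal_def diff_diff_eq[symmetric] intro!: incl)
  show "u \<in> carrier (uea_alg L) \<Longrightarrow>
      free_L_var L i (c \<odot>\<^bsub>uea_alg L\<^esub> u) = c \<odot>\<^bsub>free_L_alg L\<^esub> free_L_var L i u"
    unfolding free_L_cls_var
    by (subst free_L_cls_smult, simp add: lc, rule eq)
       (auto simp: lc sc free_L_ideal_def intro!: incl)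
qed

text \<open>
  Prescribed values at the symbols \<open>x\<^sub>i\<^sup>u\<close> extend to the free nonunital algebra, and the extension
  vanishes on the relations if the values are linear in \<open>u\<close>.
\<close>

lemma free_L_universal:
  fixes B :: "('a, 'w) module"
  assumes B: "nalg B"
    and g: "\<And>i u. u \<in> carrier (uea_alg L) \<Longrightarrow> g i u \<in> carrier B"
    and ga: "\<And>i u v. u \<in> carrier (uea_alg L) \<Longrightarrow> v \<in> carrier (uea_alg L) \<Longrightarrow>
      g i (u \<oplus>\<^bsub>uea_alg L\<^esub> v) = g i u \<oplus>\<^bsub>B\<^esub> g i v"
    and gs: "\<And>i c u. u \<in> carrier (uea_alg L) \<Longrightarrow> g i (c \<odot>\<^bsub>uea_alg L\<^esub> u) = c \<odot>\<^bsub>B\<^esub> g i u"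
  shows "\<exists>h \<in> alg_hom (free_L_alg L) B. \<forall>i. \<forall>u \<in> carrier (uea_alg L). h (free_L_var L i u) = g i u"
proof -
  interpret B: nalg B by fact
  interpret U: nalg "uea_alg L" by (rule uea_nalg[OF L])
  interpret N: nalg "free_nonunital_alg (Llet L)" by (rule free_nonunital_nalg)
  define g' where "g' s = g (fst s) (snd s)" for s
  let ?N = "free_nonunital_alg (Llet L) :: ('a, (nat \<times> ('a, 'l) uea) list \<Rightarrow>\<^sub>0 'a) module"
  define e where "e = restrict (lext B (prodl B g')) (carrier ?N)"
  have e: "e \<in> alg_hom ?N B"
    unfolding e_def by (rule B.lext_prodl_hom) (auto simp: g'_def g)
  have lc: "letter (i, u) \<in> carrier ?N" if "u \<in> carrier (uea_alg L)" for i u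
    using that by (auto intro: letter_closed)
  have el: "e (letter (i, u)) = g i u" if "u \<in> carrier (uea_alg L)" for i u
    using lc[OF that] B.lext_prodl_letter[of g' "(i, u)"] g[OF that] by (simp add: e_def g'_def)
  have e_diff: "e (p - q) = e p \<ominus>\<^bsub>B\<^esub> e q" if "p \<in> carrier ?N" "q \<in> carrier ?N" for p q
    using lin_diff[OF hom_lin[OF e] N.nalg_axioms B.nalg_axioms that] free_alg_minus(2)[OF that] by simp
  have e_scl: "e (scl c p) = c \<odot>\<^bsub>B\<^esub> e p" if "p \<in> carrier ?N" for p c
    using lin_smult[OF hom_lin[OF e] that] by simp
  have sc: "scl c p \<in> carrier ?N" if "p \<in> carrier ?N" for c p
    using N.smult_closed[OF that] by simp
  have self: "x \<ominus>\<^bsub>B\<^esub> x = \<zero>\<^bsub>B\<^esub>" if "x \<in> carrier B" for x using that by (simp add: a_minus_def B.r_neg)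
  have self2: "x \<oplus>\<^bsub>B\<^esub> y \<ominus>\<^bsub>B\<^esub> x \<ominus>\<^bsub>B\<^esub> y = \<zero>\<^bsub>B\<^esub>" if "x \<in> carrier B" "y \<in> carrier B" for x y
    using that by (simp add: a_minus_def B.a_assoc[symmetric] B.r_neg B.a_comm[of x y])
      (simp add: B.a_assoc B.r_neg)
  have "free_L_ideal L \<subseteq> {p \<in> carrier ?N. e p = \<zero>\<^bsub>B\<^esub>}"
    unfolding free_L_ideal_def
    by (rule alg_ideal_gen_least[OF hom_kernel_ideal[OF N.nalg_axioms B e]])
       (auto simp: e_diff lc free_alg_diff_closed el ga gs g self self2 e_scl sc)
  then have "\<exists>h \<in> alg_hom (quot_alg ?N (free_L_ideal L)) B. \<forall>x \<in> carrier ?N. h (free_L_ideal L +>\<^bsub>?N\<^esub> x) = e x"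
    by (intro quot_lift[OF N.nalg_axioms B free_L_ideal_ideal[OF L] e]) auto
  then show ?thesis
    unfolding free_L_alg_def free_L_var_def using lc el by metis
qed

lemma free_L_der_eqI:
  assumes D: "D \<in> derivations (free_L_alg L)" and E: "E \<in> derivations (free_L_alg L)"
    and eq: "\<And>i u. u \<in> carrier (uea_alg L) \<Longrightarrow> D (free_L_var L i u) = E (free_L_var L i u)"
  shows "D = E"
proof
  interpret A: nalg "free_L_alg L" by (rule free_L_nalg[OF L])
  have "D f = E f" if "f \<in> carrier (free_L_alg L)" for f
    using that
  proof (induction f rule: free_L_induct)
    case zero
    then show ?case using lin_zero[OF der_lin[OF D]] lin_zero[OF der_lin[OF E]] A.nalg_axioms by simp
  qed (simp_all add: eq lin_add[OF der_lin[OF D]] lin_add[OF der_lin[OF E]] lin_smult[OF der_lin[OF D]]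
      lin_smult[OF der_lin[OF E]] der_mult[OF D] der_mult[OF E])
  moreover have "D f = E f" if "f \<notin> carrier (free_L_alg L)" for f
    using der_lin[OF D] der_lin[OF E] that by (auto simp: lin_maps_def PiE_def extensional_def)
  ultimately show "D f = E f" for f by blast
qed

text \<open>
  The prescription \<open>x\<^sub>i\<^sup>u \<mapsto> (x\<^sub>i\<^sup>u, x\<^sub>i\<^sup>d\<^sup>u)\<close> extends to a homomorphism into the dual numbers whose first
  component is the identity, so that its second component is the required derivation. In particular the
  description defining \<^const>\<open>free_L_act\<close> has a referent.
\<close>

lemma free_L_act_exists:
  assumes d: "d \<in> carrier L"
  shows "\<exists>D \<in> derivations (free_L_alg L). \<forall>i. \<forall>u \<in> carrier (uea_alg L).
    D (free_L_var L i u) = free_L_var L i (uea_inj L d \<otimes>\<^bsub>uea_alg L\<^esub> u)"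
proof -
  let ?A = "free_L_alg L"
  interpret A: nalg ?A by (rule free_L_nalg[OF L])
  interpret U: nalg "uea_alg L" by (rule uea_nalg[OF L])
  note dc = uea_inj_closed[OF L d]
  define g where "g i u = (free_L_var L i u, free_L_var L i (uea_inj L d \<otimes>\<^bsub>uea_alg L\<^esub> u))" for i u
  have "\<exists>h \<in> alg_hom ?A (dual_numbers ?A). \<forall>i. \<forall>u \<in> carrier (uea_alg L). h (free_L_var L i u) = g i u"
    by (rule free_L_universal[OF dual_numbers_nalg[OF A.nalg_axioms]])
       (simp_all add: g_def dual_numbers_def free_L_var_closed dc free_L_var_add free_L_var_smult
         U.r_distr U.smult_mult_r)
  then obtain h where h: "h \<in> alg_hom ?A (dual_numbers ?A)"
    and hg: "\<And>i u. u \<in> carrier (uea_alg L) \<Longrightarrow> h (free_L_var L i u) = g i u" by blast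
  note hl = lin_closed[OF hom_lin[OF h]] lin_add[OF hom_lin[OF h]] lin_smult[OF hom_lin[OF h]] hom_mult[OF h]
  have hz: "h \<zero>\<^bsub>?A\<^esub> = (\<zero>\<^bsub>?A\<^esub>, \<zero>\<^bsub>?A\<^esub>)"
    using lin_zero[OF hom_lin[OF h] A.nalg_axioms dual_numbers_nalg[OF A.nalg_axioms]]
    by (simp add: dual_numbers_def)
  have hc: "snd (h f) \<in> carrier ?A" if "f \<in> carrier ?A" for f
    using hl(1)[OF that] by (auto simp: dual_numbers_def)
  have fst: "fst (h f) = f" if "f \<in> carrier ?A" for f
    using that by (induction f rule: free_L_induct) (auto simp: hl hz hg g_def dual_numbers_def)
  have "restrict (\<lambda>f. snd (h f)) (carrier ?A) \<in> derivations ?A"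
    by (rule restrict_der[OF A.nalg_axioms]) (simp_all add: hl hc fst, simp_all add: dual_numbers_def fst)
  then show ?thesis
    by (rule bexI[rotated]) (simp add: free_L_var_closed hg g_def)
qed

lemma
  assumes d: "d \<in> carrier L"
  shows free_L_act_der: "free_L_act L d \<in> derivations (free_L_alg L)"
    and free_L_act_var: "u \<in> carrier (uea_alg L) \<Longrightarrow>
      free_L_act L d (free_L_var L i u) = free_L_var L i (uea_inj L d \<otimes>\<^bsub>uea_alg L\<^esub> u)"
proof -
  have "\<exists>!D. D \<in> derivations (free_L_alg L) \<and> (\<forall>i. \<forall>u \<in> carrier (uea_alg L).
    D (free_L_var L i u) = free_L_var L i (uea_inj L d \<otimes>\<^bsub>uea_alg L\<^esub> u))"
    using free_L_act_exists[OF d] by (auto intro: free_L_der_eqI)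
  from theI'[OF this] show "free_L_act L d \<in> derivations (free_L_alg L)"
    "u \<in> carrier (uea_alg L) \<Longrightarrow>
      free_L_act L d (free_L_var L i u) = free_L_var L i (uea_inj L d \<otimes>\<^bsub>uea_alg L\<^esub> u)"
    unfolding free_L_act_def by blast+
qed

lemma free_L_lie_rep: "lie_rep (free_L_alg L) L (free_L_act L)"
proof -
  let ?A = "free_L_alg L"
  interpret A: nalg ?A by (rule free_L_nalg[OF L])
  interpret U: nalg "uea_alg L" by (rule uea_nalg[OF L])
  have Lc: "d \<in> carrier L \<Longrightarrow> e \<in> carrier L \<Longrightarrow> d \<oplus>\<^bsub>L\<^esub> e \<in> carrier L"
      "d \<in> carrier L \<Longrightarrow> c \<odot>\<^bsub>L\<^esub> d \<in> carrier L"
      "d \<in> carrier L \<Longrightarrow> e \<in> carrier L \<Longrightarrow> d \<otimes>\<^bsub>L\<^esub> e \<in> carrier L" for c d e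
    using L by (auto simp: lie_closed_def)
  have Dc: "d \<in> derivations ?A \<Longrightarrow> e \<in> derivations ?A \<Longrightarrow> d \<oplus>\<^bsub>derivation_algebra ?A\<^esub> e \<in> derivations ?A"
      "d \<in> derivations ?A \<Longrightarrow> c \<odot>\<^bsub>derivation_algebra ?A\<^esub> d \<in> derivations ?A"
      "d \<in> derivations ?A \<Longrightarrow> e \<in> derivations ?A \<Longrightarrow> d \<otimes>\<^bsub>derivation_algebra ?A\<^esub> e \<in> derivations ?A" for c d e
    using derivations_lie_closed[OF A.nalg_axioms] by (auto simp only: lie_closed_def derivation_algebra_sel(1))
  note ic = uea_inj_closed[OF L]
  have var_diff: "free_L_var L i (u \<ominus>\<^bsub>uea_alg L\<^esub> v) = free_L_var L i u \<ominus>\<^bsub>?A\<^esub> free_L_var L i v"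
    if "u \<in> carrier (uea_alg L)" "v \<in> carrier (uea_alg L)" for i u v
    using that by (simp add: U.diff_smult A.diff_smult free_L_var_add free_L_var_smult free_L_var_closed)
  have a: "free_L_act L (d \<oplus>\<^bsub>L\<^esub> e) = free_L_act L d \<oplus>\<^bsub>derivation_algebra ?A\<^esub> free_L_act L e"
    if "d \<in> carrier L" "e \<in> carrier L" for d e
    by (rule free_L_der_eqI)
       (use that in \<open>simp_all add: Lc Dc[simplified] free_L_act_der free_L_act_var uea_inj_add[OF L] U.l_distr ic
         free_L_var_add free_L_var_closed\<close>)
  have s: "free_L_act L (c \<odot>\<^bsub>L\<^esub> d) = c \<odot>\<^bsub>derivation_algebra ?A\<^esub> free_L_act L d"
    if "d \<in> carrier L" for c d
    by (rule free_L_der_eqI)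
       (use that in \<open>simp_all add: Lc Dc[simplified] free_L_act_der free_L_act_var uea_inj_smult[OF L] U.smult_mult_l ic
         free_L_var_smult free_L_var_closed\<close>)
  have b: "free_L_act L (d \<otimes>\<^bsub>L\<^esub> e) = free_L_act L d \<otimes>\<^bsub>derivation_algebra ?A\<^esub> free_L_act L e"
    if de: "d \<in> carrier L" "e \<in> carrier L" for d e
  proof (rule free_L_der_eqI)
    fix i u assume u: "u \<in> carrier (uea_alg L)"
    have "(uea_inj L d \<otimes>\<^bsub>uea_alg L\<^esub> uea_inj L e \<ominus>\<^bsub>uea_alg L\<^esub> uea_inj L e \<otimes>\<^bsub>uea_alg L\<^esub> uea_inj L d) \<otimes>\<^bsub>uea_alg L\<^esub> u =
        uea_inj L d \<otimes>\<^bsub>uea_alg L\<^esub> (uea_inj L e \<otimes>\<^bsub>uea_alg L\<^esub> u) \<ominus>\<^bsub>uea_alg L\<^esub> uea_inj L e \<otimes>\<^bsub>uea_alg L\<^esub> (uea_inj L d \<otimes>\<^bsub>uea_alg L\<^esub> u)"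
      using de u by (simp add: U.diff_smult U.l_distr U.smult_mult_l U.m_assoc ic)
    then show "free_L_act L (d \<otimes>\<^bsub>L\<^esub> e) (free_L_var L i u) =
        (free_L_act L d \<otimes>\<^bsub>derivation_algebra ?A\<^esub> free_L_act L e) (free_L_var L i u)"
      using de u by (simp add: Lc free_L_act_var uea_inj_bracket[OF L] ic var_diff free_L_var_closed)
  qed (use de in \<open>simp_all add: Lc Dc[simplified] free_L_act_der\<close>)
  show ?thesis
    by (intro lie_rep.intro A.nalg_axioms lie_rep_axioms.intro) (simp_all add: Lc free_L_act_der a s b)
qed

end

section \<open>The free \<open>(L,U)\<close>-algebra\<close>

lemma mat_alg_sel [simp]:
  "carrier (mat_alg k) = carrier_mat k k" "x \<otimes>\<^bsub>mat_alg k\<^esub> y = x * y" "x \<oplus>\<^bsub>mat_alg k\<^esub> y = x + y"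
  "\<zero>\<^bsub>mat_alg k\<^esub> = 0\<^sub>m k k" "c \<odot>\<^bsub>mat_alg k\<^esub> x = c \<cdot>\<^sub>m x"
  by (simp_all add: mat_alg_def)

lemma mat_alg_nalg: "nalg (mat_alg k)"
proof (rule nalgI, goal_cases)
  case 8
  have "(c * d) \<cdot>\<^sub>m x = c \<cdot>\<^sub>m (d \<cdot>\<^sub>m x)" "1 \<cdot>\<^sub>m x = x" for c d and x :: "'a mat" by (auto simp: mult.assoc)
  then show ?case
    unfolding nalg_axioms_def
    by (auto simp: add_mult_distrib_mat[of _ k k] mult_add_distrib_mat[of _ k k]
       add_smult_distrib_right_mat[of _ k k] add_smult_distrib_left_mat[of _ k k] mult_smult_distrib[of _ k k]
       mult_smult_assoc_mat[of _ k k] assoc_mult_mat[of _ k k _ k])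
qed (auto simp: comm_add_mat[of _ k k])

lemma mat_alg_minus:
  assumes "x \<in> carrier_mat k k" "y \<in> carrier_mat k k"
  shows "x \<ominus>\<^bsub>mat_alg k\<^esub> y = x - y"
proof -
  have "x \<ominus>\<^bsub>mat_alg k\<^esub> y = x + (-1) \<cdot>\<^sub>m y"
    using assms by (simp add: nalg.diff_smult[OF mat_alg_nalg])
  also have "\<dots> = x - y" using assms by (intro eq_matI) auto
  finally show ?thesis .
qed

lemma derivation_rep:
  assumes "nalg B"
  shows "lie_rep B (derivation_algebra B) (\<lambda>d. d)"
proof -
  have L: "lie_closed (derivation_algebra B)" by (rule derivations_lie_closed[OF assms])
  then have Lc: "d \<in> carrier (derivation_algebra B) \<Longrightarrow> e \<in> carrier (derivation_algebra B) \<Longrightarrow>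
        d \<oplus>\<^bsub>derivation_algebra B\<^esub> e \<in> carrier (derivation_algebra B)"
      "d \<in> carrier (derivation_algebra B) \<Longrightarrow> c \<odot>\<^bsub>derivation_algebra B\<^esub> d \<in> carrier (derivation_algebra B)"
      "d \<in> carrier (derivation_algebra B) \<Longrightarrow> e \<in> carrier (derivation_algebra B) \<Longrightarrow>
        d \<otimes>\<^bsub>derivation_algebra B\<^esub> e \<in> carrier (derivation_algebra B)" for c d e
    by (auto simp only: lie_closed_def)
  show ?thesis
    by (intro lie_rep.intro assms lie_rep_axioms.intro Lc; simp)
qed

lemmas mat_rep = derivation_rep[OF mat_alg_nalg]
lemmas der_mat_closed = derivations_lie_closed[OF mat_alg_nalg]

lemmas FL_induct = free_L_induct[OF der_mat_closed, consumes 1, case_names zero var add smult mult]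

text \<open>Finite sums are carried over by maps that are linear on the carrier only.\<close>

lemma linear_finsum:
  assumes A: "nalg A" and B: "nalg B" and I: "finite I" and m: "\<And>j. j \<in> I \<Longrightarrow> m j \<in> carrier A"
    and hc: "\<And>x. x \<in> carrier A \<Longrightarrow> h x \<in> carrier B"
    and ha: "\<And>x y. x \<in> carrier A \<Longrightarrow> y \<in> carrier A \<Longrightarrow> h (x \<oplus>\<^bsub>A\<^esub> y) = h x \<oplus>\<^bsub>B\<^esub> h y"
    and hs: "\<And>c x. x \<in> carrier A \<Longrightarrow> h (c \<odot>\<^bsub>A\<^esub> x) = c \<odot>\<^bsub>B\<^esub> h x"
  shows "h (\<Oplus>\<^bsub>A\<^esub>j\<in>I. a j \<odot>\<^bsub>A\<^esub> m j) = (\<Oplus>\<^bsub>B\<^esub>j\<in>I. a j \<odot>\<^bsub>B\<^esub> h (m j))"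
proof -
  interpret A: nalg A by fact
  interpret B: nalg B by fact
  have hz: "h \<zero>\<^bsub>A\<^esub> = \<zero>\<^bsub>B\<^esub>"
    using hs[of "\<zero>\<^bsub>A\<^esub>" 0] hc[of "\<zero>\<^bsub>A\<^esub>"] by simp
  show ?thesis
    using I m
  proof (induction I rule: finite_induct)
    case (insert i I)
    have "(\<lambda>j. a j \<odot>\<^bsub>A\<^esub> m j) \<in> I \<rightarrow> carrier A" "(\<lambda>j. a j \<odot>\<^bsub>B\<^esub> h (m j)) \<in> I \<rightarrow> carrier B"
      using insert by (auto simp: hc)
    then show ?case using insert by (simp add: ha hs hc A.finsum_closed)
  qed (simp add: hz)
qed

context
  fixes k :: nat
begin

abbreviation "Lk \<equiv> der_mat k :: ('a::field, 'a mat \<Rightarrow> 'a mat) module"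
abbreviation "Uk \<equiv> uea_alg Lk :: ('a::field, _) module"
abbreviation "FL \<equiv> free_L_alg Lk :: ('a::field, _) module"

lemma
  assumes "b \<in> carrier_mat k k"
  shows phi_closed: "u \<in> carrier Uk \<Longrightarrow> phi k u b \<in> carrier_mat k k"
    and phi_add: "u \<in> carrier Uk \<Longrightarrow> v \<in> carrier Uk \<Longrightarrow> phi k (u \<oplus>\<^bsub>Uk\<^esub> v) b = phi k u b + phi k v b"
    and phi_smult: "u \<in> carrier Uk \<Longrightarrow> phi k (c \<odot>\<^bsub>Uk\<^esub> u) b = c \<cdot>\<^sub>m phi k u b"
    and phi_mult: "u \<in> carrier Uk \<Longrightarrow> v \<in> carrier Uk \<Longrightarrow> phi k (u \<otimes>\<^bsub>Uk\<^esub> v) b = phi k u (phi k v b)"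
    and phi_one: "phi k \<one>\<^bsub>Uk\<^esub> b = b"
    and phi_inj: "d \<in> derivations (mat_alg k) \<Longrightarrow> phi k (uea_inj Lk d) b = d b"
  using assms lie_rep.act_closed[OF mat_rep, of b k u] lie_rep.act_add[OF mat_rep, of b k u v]
    lie_rep.act_smult[OF mat_rep, of b k u c] lie_rep.act_mult[OF mat_rep, of b k u v]
    lie_rep.act_one[OF mat_rep, of b k] lie_rep.act_inj[OF mat_rep, of b k d]
  by (simp_all add: phi_def)

lemma
  assumes u: "u \<in> carrier Uk"
  shows phi_add_right: "b \<in> carrier_mat k k \<Longrightarrow> c \<in> carrier_mat k k \<Longrightarrow> phi k u (b + c) = phi k u b + phi k u c"
    and phi_smult_right: "b \<in> carrier_mat k k \<Longrightarrow> phi k u (a \<cdot>\<^sub>m b) = a \<cdot>\<^sub>m phi k u b"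
  using lie_rep.act_lin[OF mat_rep, of u k] u by (simp_all add: phi_def)

lemma phi_restrict: "restrict (phi k u) (carrier_mat k k) = phi k u"
  unfolding phi_def uea_act_def Let_def by (auto simp: fun_eq_iff)

lemma FL_nalg: "nalg FL"
  by (rule free_L_nalg[OF der_mat_closed])

lemma FL_rep: "lie_rep FL Lk (free_L_act Lk)"
  by (rule free_L_lie_rep[OF der_mat_closed])

lemma ker_phi_carrier: "z \<in> ker_phi k \<Longrightarrow> z \<in> carrier Uk"
  by (simp add: ker_phi_def)

lemma free_LU_ideal_ideal: "alg_ideal FL (free_LU_ideal k)"
  unfolding free_LU_ideal_def Let_def
  by (rule nalg.alg_ideal_gen_ideal[OF FL_nalg]) (auto intro: lie_rep.act_closed[OF FL_rep] ker_phi_carrier)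

lemma free_LU_nalg: "nalg (free_LU_alg k :: ('a::field, _) module)"
  unfolding free_LU_alg_def by (rule nalg.quot_nalg[OF FL_nalg free_LU_ideal_ideal])

definition LU_cls :: "('a::field, 'a mat \<Rightarrow> 'a mat) fla \<Rightarrow> 'a flu" where
  "LU_cls f = free_LU_ideal k +>\<^bsub>FL\<^esub> f"

abbreviation "FU \<equiv> free_LU_alg k :: ('a::field, _) module"

lemma
  shows LU_cls_add: "f \<in> carrier FL \<Longrightarrow> g \<in> carrier FL \<Longrightarrow> LU_cls f \<oplus>\<^bsub>FU\<^esub> LU_cls g = LU_cls (f \<oplus>\<^bsub>FL\<^esub> g)"
    and LU_cls_mult: "f \<in> carrier FL \<Longrightarrow> g \<in> carrier FL \<Longrightarrow> LU_cls f \<otimes>\<^bsub>FU\<^esub> LU_cls g = LU_cls (f \<otimes>\<^bsub>FL\<^esub> g)"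
    and LU_cls_smult: "f \<in> carrier FL \<Longrightarrow> c \<odot>\<^bsub>FU\<^esub> LU_cls f = LU_cls (c \<odot>\<^bsub>FL\<^esub> f)"
    and LU_cls_carrier: "carrier FU = LU_cls ` carrier FL"
    and LU_cls_zero: "\<zero>\<^bsub>FU\<^esub> = LU_cls \<zero>\<^bsub>FL\<^esub>"
    and LU_cls_var: "free_LU_var k i u = LU_cls (free_L_var Lk i u)"
  using nalg.quot_add[OF FL_nalg free_LU_ideal_ideal] nalg.quot_mult[OF FL_nalg free_LU_ideal_ideal]
    nalg.quot_smult[OF FL_nalg free_LU_ideal_ideal] nalg.quot_carrier[OF FL_nalg]
    nalg.quot_zero[OF FL_nalg free_LU_ideal_ideal]
  by (simp_all add: free_LU_alg_def LU_cls_def free_LU_var_def)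

lemma LU_cls_closed: "f \<in> carrier FL \<Longrightarrow> LU_cls f \<in> carrier FU"
  by (simp add: LU_cls_carrier)

lemma LU_var_closed: "u \<in> carrier Uk \<Longrightarrow> free_LU_var k i u \<in> carrier FU"
  by (simp add: LU_cls_var LU_cls_closed free_L_var_closed[OF der_mat_closed])

lemma LU_cls_lin: "restrict LU_cls (carrier FL) \<in> lin_maps FL FU"
proof -
  interpret nalg FL by (rule FL_nalg)
  show ?thesis by (simp add: lin_maps_def LU_cls_closed LU_cls_add LU_cls_smult)
qed

text \<open>
  The kernel is a left ideal, which makes \<^const>\<open>free_LU_ideal\<close> invariant under \<open>L\<close>: applying \<open>d\<close> to \<open>f\<^sup>z\<close> is
  acting on \<open>f\<close> by the product of \<open>d\<close> and \<open>z\<close> in the enveloping algebra.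
\<close>

lemma ker_phi_inj:
  assumes "d \<in> derivations (mat_alg k)" and "z \<in> ker_phi k"
  shows "uea_inj Lk d \<otimes>\<^bsub>Uk\<^esub> z \<in> ker_phi k"
proof -
  interpret U: nalg Uk by (rule uea_nalg[OF der_mat_closed])
  have "d (0\<^sub>m k k) = 0\<^sub>m k k"
    using lin_zero[OF der_lin[OF assms(1)] mat_alg_nalg mat_alg_nalg] by simp
  then show ?thesis
    using assms uea_inj_closed[OF der_mat_closed, of d k]
    by (auto simp: ker_phi_def phi_mult phi_inj)
qed

lemma free_LU_ideal_act:
  assumes d: "d \<in> derivations (mat_alg k)" and f: "f \<in> free_LU_ideal k"
  shows "free_L_act Lk d f \<in> free_LU_ideal k"
proof -
  interpret A: lie_rep FL Lk "free_L_act Lk" by (rule FL_rep)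
  let ?I = "free_LU_ideal k" and ?D = "free_L_act Lk d"
  have dc: "d \<in> carrier Lk" using d by simp
  note Dl = der_lin[OF A.rho_der[OF dc]]
  have zero: "?D \<zero>\<^bsub>FL\<^esub> = \<zero>\<^bsub>FL\<^esub>" by (rule lin_zero[OF Dl FL_nalg FL_nalg])
  have I: "alg_ideal FL ?I" by (rule free_LU_ideal_ideal)
  then have K: "alg_ideal FL {f \<in> ?I. ?D f \<in> ?I}"
    by (auto simp: alg_ideal_def zero lin_add[OF Dl] lin_smult[OF Dl] der_mult[OF A.rho_der[OF dc]]
        subset_iff lin_closed[OF Dl])
  let ?G = "{uea_act FL (free_L_act Lk) z f | f z. f \<in> carrier FL \<and> z \<in> ker_phi k}"
  have gen: "?I = alg_ideal_gen FL ?G" by (simp add: free_LU_ideal_def Let_def)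
  have "?D (uea_act FL (free_L_act Lk) z f) = uea_act FL (free_L_act Lk) (uea_inj Lk d \<otimes>\<^bsub>Uk\<^esub> z) f"
    if "f \<in> carrier FL" "z \<in> ker_phi k" for f z
    using that dc uea_inj_closed[OF der_mat_closed dc]
    by (simp add: A.act_mult A.act_inj A.act_closed ker_phi_carrier)
  then have "?D g \<in> ?G" if "g \<in> ?G" for g
    using that ker_phi_inj[OF d] by blast
  then have "?G \<subseteq> {f \<in> ?I. ?D f \<in> ?I}"
    unfolding gen using alg_ideal_gen_incl[of ?G FL] by blast
  from alg_ideal_gen_least[OF K this] have "?I \<subseteq> {f \<in> ?I. ?D f \<in> ?I}"
    by (simp only: gen[symmetric])
  then show ?thesis using f by blast
qed

lemma free_LU_act_cls:
  assumes d: "d \<in> derivations (mat_alg k)" and f: "f \<in> carrier FL"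
  shows "free_LU_act k d (LU_cls f) = LU_cls (free_L_act Lk d f)"
proof -
  interpret A: lie_rep FL Lk "free_L_act Lk" by (rule FL_rep)
  let ?I = "free_LU_ideal k" and ?D = "free_L_act Lk d"
  have dc: "d \<in> carrier Lk" using d by simp
  note Dl = der_lin[OF A.rho_der[OF dc]]
  have c: "?I +>\<^bsub>FL\<^esub> ?D g = ?I +>\<^bsub>FL\<^esub> ?D f" if "g \<in> ?I +>\<^bsub>FL\<^esub> f" for g
  proof -
    have g: "g \<in> carrier FL" "g \<ominus>\<^bsub>FL\<^esub> f \<in> ?I" using that f by (auto simp: A.in_coset_iff[OF free_LU_ideal_ideal])
    show ?thesis
      using free_LU_ideal_act[OF d g(2)] g f
      by (simp add: A.coset_eq_iff[OF free_LU_ideal_ideal] lin_closed[OF Dl] lin_diff[OF Dl FL_nalg FL_nalg])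
  qed
  have "?I +>\<^bsub>FL\<^esub> f \<noteq> {}" using A.coset_self[OF free_LU_ideal_ideal f] by blast
  then show ?thesis unfolding free_LU_act_def LU_cls_def by (rule A.UN_const) (rule c)
qed

text \<open>
  The action of \<open>L\<close>, cut down to the carrier: derivations are extensional functions.
\<close>

definition LU_act :: "('a::field mat \<Rightarrow> 'a mat) \<Rightarrow> 'a flu \<Rightarrow> 'a flu" where
  "LU_act d = restrict (free_LU_act k d) (carrier FU)"

lemma LU_act_cls:
  "d \<in> derivations (mat_alg k) \<Longrightarrow> f \<in> carrier FL \<Longrightarrow> LU_act d (LU_cls f) = LU_cls (free_L_act Lk d f)"
  by (simp add: LU_act_def LU_cls_closed free_LU_act_cls)

lemma FU_rep: "lie_rep FU Lk LU_act"
proof -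
  interpret A: lie_rep FL Lk "free_L_act Lk" by (rule FL_rep)
  note Lc = A.L_closed[simplified]
  note rc = A.rho_closed[simplified]
  note lins = lin_add[OF der_lin[OF A.rho_der[simplified]]] lin_smult[OF der_lin[OF A.rho_der[simplified]]]
    der_mult[OF A.rho_der[simplified]]
  interpret F: nalg FU by (rule free_LU_nalg)
  have dr: "LU_act d \<in> derivations FU" if "d \<in> derivations (mat_alg k)" for d
  proof -
    have "restrict (LU_act d) (carrier FU) \<in> derivations FU"
      by (rule restrict_der[OF F.nalg_axioms])
         (use that in \<open>auto simp: LU_cls_carrier LU_act_cls LU_cls_closed rc LU_cls_add LU_cls_smult LU_cls_mult lins\<close>)
    then show ?thesis by (simp add: LU_act_def)
  qed
  have diff: "LU_cls f \<ominus>\<^bsub>FU\<^esub> LU_cls g = LU_cls (f \<ominus>\<^bsub>FL\<^esub> g)" if "f \<in> carrier FL" "g \<in> carrier FL" for f g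
    using that by (simp add: F.diff_smult A.diff_smult LU_cls_closed LU_cls_add LU_cls_smult)
  note simps = LU_act_cls LU_cls_add LU_cls_smult diff rc
    A.rho_add[simplified] A.rho_smult[simplified] A.rho_bracket[simplified]
  show ?thesis
    by (intro lie_rep.intro F.nalg_axioms lie_rep_axioms.intro)
       (auto simp: dr LU_cls_carrier simps Lc)
qed

lemma LU_ker_act:
  assumes z: "z \<in> ker_phi k" and f: "f \<in> carrier FU"
  shows "uea_act FU LU_act z f = \<zero>\<^bsub>FU\<^esub>"
proof -
  obtain g where g: "g \<in> carrier FL" "f = LU_cls g" using f by (auto simp: LU_cls_carrier)
  interpret A: lie_rep FL Lk "free_L_act Lk" by (rule FL_rep)
  have c: "uea_act FL (free_L_act Lk) z g \<in> carrier FL"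
    using g z by (simp add: A.act_closed ker_phi_carrier)
  have "restrict LU_cls (carrier FL) (uea_act FL (free_L_act Lk) z g) = uea_act FU LU_act z (restrict LU_cls (carrier FL) g)"
    by (rule act_natural[OF FL_rep FU_rep LU_cls_lin _ ker_phi_carrier[OF z] g(1)])
       (simp add: LU_act_cls A.rho_closed[simplified])
  then have "uea_act FU LU_act z f = LU_cls (uea_act FL (free_L_act Lk) z g)"
    using g c by simp
  also have "uea_act FL (free_L_act Lk) z g \<in> free_LU_ideal k"
    using z g by (auto simp: free_LU_ideal_def Let_def intro!: alg_ideal_gen_incl[THEN subsetD])
  then have "LU_cls (uea_act FL (free_L_act Lk) z g) = \<zero>\<^bsub>FU\<^esub>"
    using c A.coset_eq_iff[OF free_LU_ideal_ideal c A.zero_closed]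
    by (simp add: LU_cls_def LU_cls_zero[unfolded LU_cls_def] A.diff_smult)
  finally show ?thesis .
qed

lemma LU_var_act:
  "d \<in> derivations (mat_alg k) \<Longrightarrow> u \<in> carrier Uk \<Longrightarrow>
    LU_act d (free_LU_var k i u) = free_LU_var k i (uea_inj Lk d \<otimes>\<^bsub>Uk\<^esub> u)"
  by (simp add: LU_cls_var LU_act_cls free_L_var_closed[OF der_mat_closed] free_L_act_var[OF der_mat_closed])

lemma
  assumes "u \<in> carrier Uk"
  shows LU_var_add: "v \<in> carrier Uk \<Longrightarrow>
      free_LU_var k i (u \<oplus>\<^bsub>Uk\<^esub> v) = free_LU_var k i u \<oplus>\<^bsub>FU\<^esub> free_LU_var k i v"
    and LU_var_smult: "free_LU_var k i (c \<odot>\<^bsub>Uk\<^esub> u) = c \<odot>\<^bsub>FU\<^esub> free_LU_var k i u"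
  using assms by (simp_all add: LU_cls_var LU_cls_add LU_cls_smult free_L_var_closed[OF der_mat_closed]
      free_L_var_add[OF der_mat_closed] free_L_var_smult[OF der_mat_closed])

lemma LU_var_eq_act:
  assumes "u \<in> carrier Uk"
  shows "free_LU_var k i u = uea_act FU LU_act u (free_LU_var k i \<one>\<^bsub>Uk\<^esub>)"
proof -
  interpret F: lie_rep FU Lk LU_act by (rule FU_rep)
  note L = der_mat_closed
  show ?thesis
    using L assms
    by (induction u rule: uea_induct)
       (simp_all add: F.act_one F.act_mult F.act_inj F.act_add F.act_smult LU_var_closed uea_one_closed[OF L]
         uea_inj_closed[OF L] F.act_closed LU_var_add LU_var_smult flip: LU_var_act)
qed

text \<open>
  The kernel of \<open>\<phi>\<close> acts as zero, so \<open>x\<^sup>u\<close> depends on the operator \<open>\<phi>(u)\<close> only.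
\<close>

lemma LU_var_cong:
  assumes u: "u \<in> carrier Uk" and v: "v \<in> carrier Uk" and eq: "\<And>b. b \<in> carrier_mat k k \<Longrightarrow> phi k u b = phi k v b"
  shows "free_LU_var k i u = free_LU_var k i v"
proof -
  interpret F: lie_rep FU Lk LU_act by (rule FU_rep)
  interpret U: nalg Uk by (rule uea_nalg[OF der_mat_closed])
  have neg: "x + (-1) \<cdot>\<^sub>m x = 0\<^sub>m k k" if "x \<in> carrier_mat k k" for x :: "'a mat"
    using that by (intro eq_matI) auto
  have "u \<ominus>\<^bsub>Uk\<^esub> v \<in> ker_phi k"
    using u v eq by (auto simp: ker_phi_def U.diff_smult phi_add phi_smult phi_closed neg)
  then have "uea_act FU LU_act (u \<ominus>\<^bsub>Uk\<^esub> v) (free_LU_var k i \<one>\<^bsub>Uk\<^esub>) = \<zero>\<^bsub>FU\<^esub>"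
    by (intro LU_ker_act) (simp_all add: LU_var_closed uea_one_closed[OF der_mat_closed])
  then have "free_LU_var k i (u \<ominus>\<^bsub>Uk\<^esub> v) = \<zero>\<^bsub>FU\<^esub>"
    using u v by (subst LU_var_eq_act) (simp_all add: U.diff_smult)
  then have "free_LU_var k i u \<ominus>\<^bsub>FU\<^esub> free_LU_var k i v = \<zero>\<^bsub>FU\<^esub>"
    using u v by (simp add: U.diff_smult F.diff_smult LU_var_add LU_var_smult LU_var_closed)
  then show ?thesis using u v by (simp add: F.diff_eq_zero_iff LU_var_closed)
qed

lemma LU_act_cong:
  assumes u: "u \<in> carrier Uk" and v: "v \<in> carrier Uk" and eq: "\<And>b. b \<in> carrier_mat k k \<Longrightarrow> phi k u b = phi k v b"
    and f: "f \<in> carrier FU"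
  shows "uea_act FU LU_act u f = uea_act FU LU_act v f"
proof -
  interpret F: lie_rep FU Lk LU_act by (rule FU_rep)
  interpret U: nalg Uk by (rule uea_nalg[OF der_mat_closed])
  have neg: "x + (-1) \<cdot>\<^sub>m x = 0\<^sub>m k k" if "x \<in> carrier_mat k k" for x :: "'a mat"
    using that by (intro eq_matI) auto
  have "u \<ominus>\<^bsub>Uk\<^esub> v \<in> ker_phi k"
    using u v eq by (auto simp: ker_phi_def U.diff_smult phi_add phi_smult phi_closed neg)
  then have "uea_act FU LU_act (u \<ominus>\<^bsub>Uk\<^esub> v) f = \<zero>\<^bsub>FU\<^esub>"
    by (intro LU_ker_act f)
  then have "uea_act FU LU_act u f \<ominus>\<^bsub>FU\<^esub> uea_act FU LU_act v f = \<zero>\<^bsub>FU\<^esub>"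
    using u v f by (simp add: U.diff_smult F.diff_smult F.act_add F.act_smult F.act_closed)
  then show ?thesis using u v f by (simp add: F.diff_eq_zero_iff F.act_closed)
qed

text \<open>
  Linear relations among operators on \<open>M\<^sub>k\<close> hold for the symbols \<open>x\<^sup>u\<close> as well. They are stated entry by
  entry, which is the form in which operators on matrices are compared below.
\<close>

lemma LU_var_lincomb:
  assumes I: "finite I" and m: "\<And>j. j \<in> I \<Longrightarrow> m j \<in> carrier Uk" and u: "u \<in> carrier Uk"
    and eq: "\<And>b r s. b \<in> carrier_mat k k \<Longrightarrow> r < k \<Longrightarrow> s < k \<Longrightarrow>
      phi k u b $$ (r, s) = (\<Sum>j\<in>I. a j * phi k (m j) b $$ (r, s))"
  shows "free_LU_var k i u = (\<Oplus>\<^bsub>FU\<^esub>j\<in>I. a j \<odot>\<^bsub>FU\<^esub> free_LU_var k i (m j))"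
proof -
  interpret U: nalg Uk by (rule uea_nalg[OF der_mat_closed])
  define u' where "u' = (\<Oplus>\<^bsub>Uk\<^esub>j\<in>I. a j \<odot>\<^bsub>Uk\<^esub> m j)"
  have u': "u' \<in> carrier Uk" unfolding u'_def using m by (intro U.finsum_closed) auto
  have "phi k u' b $$ (r, s) = (\<Sum>j\<in>I. a j * phi k (m j) b $$ (r, s))"
    if b: "b \<in> carrier_mat k k" and rs: "r < k" "s < k" for b r s
    unfolding u'_def using I m
  proof (induction I rule: finite_induct)
    case empty
    have "phi k \<zero>\<^bsub>Uk\<^esub> b = 0 \<cdot>\<^sub>m phi k \<zero>\<^bsub>Uk\<^esub> b"
      using phi_smult[OF b U.zero_closed, of 0] by simp
    then have "phi k \<zero>\<^bsub>Uk\<^esub> b $$ (r, s) = (0 \<cdot>\<^sub>m phi k \<zero>\<^bsub>Uk\<^esub> b) $$ (r, s)" by simp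
    also have "\<dots> = 0" using phi_closed[OF b U.zero_closed] rs by simp
    finally show ?case by simp
  next
    case (insert j I)
    have c: "(\<lambda>j. a j \<odot>\<^bsub>Uk\<^esub> m j) \<in> I \<rightarrow> carrier Uk" using insert by auto
    have d: "phi k (m j) b \<in> carrier_mat k k" "phi k (\<Oplus>\<^bsub>Uk\<^esub>j\<in>I. a j \<odot>\<^bsub>Uk\<^esub> m j) b \<in> carrier_mat k k"
      using insert c b by (auto intro!: phi_closed U.finsum_closed)
    show ?case using insert c d b rs
      by (simp add: phi_add phi_smult U.finsum_closed)
  qed
  then have "phi k u b = phi k u' b" if "b \<in> carrier_mat k k" for b
    using phi_closed[OF that u] phi_closed[OF that u'] that by (intro eq_matI) (auto simp: eq)
  then have "free_LU_var k i u = free_LU_var k i u'" by (rule LU_var_cong[OF u u'])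
  also have "\<dots> = (\<Oplus>\<^bsub>FU\<^esub>j\<in>I. a j \<odot>\<^bsub>FU\<^esub> free_LU_var k i (m j))"
    unfolding u'_def
    by (rule linear_finsum[OF U.nalg_axioms free_LU_nalg I])
       (simp_all add: m LU_var_closed LU_var_add LU_var_smult)
  finally show ?thesis .
qed

lemma free_LU_induct [consumes 1, case_names zero var add smult mult]:
  assumes f: "f \<in> carrier FU"
    and zero: "P \<zero>\<^bsub>FU\<^esub>"
    and var: "\<And>i u. u \<in> carrier Uk \<Longrightarrow> P (free_LU_var k i u)"
    and add: "\<And>f g. f \<in> carrier FU \<Longrightarrow> g \<in> carrier FU \<Longrightarrow> P f \<Longrightarrow> P g \<Longrightarrow> P (f \<oplus>\<^bsub>FU\<^esub> g)"
    and smult: "\<And>c f. f \<in> carrier FU \<Longrightarrow> P f \<Longrightarrow> P (c \<odot>\<^bsub>FU\<^esub> f)"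
    and mult: "\<And>f g. f \<in> carrier FU \<Longrightarrow> g \<in> carrier FU \<Longrightarrow> P f \<Longrightarrow> P g \<Longrightarrow> P (f \<otimes>\<^bsub>FU\<^esub> g)"
  shows "P f"
proof -
  obtain g where g: "g \<in> carrier FL" and f: "f = LU_cls g" using f by (auto simp: LU_cls_carrier)
  from g have "P (LU_cls g)"
  proof (induction g rule: FL_induct)
    case zero then show ?case using assms(2) by (simp add: LU_cls_zero)
  next
    case (var i u) then show ?case using assms(3) by (simp add: LU_cls_var)
  next
    case (add p q) then show ?case using assms(4)[OF LU_cls_closed LU_cls_closed, of p q] by (simp add: LU_cls_add)
  next
    case (smult c p) then show ?case using assms(5)[OF LU_cls_closed, of p c] by (simp add: LU_cls_smult)
  next
    case (mult p q) then show ?case using assms(6)[OF LU_cls_closed LU_cls_closed, of p q] by (simp add: LU_cls_mult)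
  qed
  then show ?thesis by (simp add: f)
qed

text \<open>
  A homomorphism that sends \<open>x\<^sub>i\<^sup>u\<close> to \<open>b\<^sub>i\<^sup>u\<close> commutes with \<open>L\<close> on generators, hence everywhere. Both
  evaluations and substitutions are of this kind.
\<close>

lemma LU_hom_equivariant:
  assumes B: "lie_rep B Lk \<rho>" and h: "h \<in> alg_hom FU B" and b: "\<And>i. b i \<in> carrier B"
    and hv: "\<And>i u. u \<in> carrier Uk \<Longrightarrow> h (free_LU_var k i u) = uea_act B \<rho> u (b i)"
    and d: "d \<in> derivations (mat_alg k)" and f: "f \<in> carrier FU"
  shows "h (LU_act d f) = \<rho> d (h f)"
proof -
  interpret F: lie_rep FU Lk LU_act by (rule FU_rep)
  interpret B: lie_rep B Lk \<rho> by fact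
  have dL: "d \<in> carrier Lk" using d by simp
  note hl = lin_closed[OF hom_lin[OF h]] lin_add[OF hom_lin[OF h]] lin_smult[OF hom_lin[OF h]] hom_mult[OF h]
  note Dl = lin_closed[OF der_lin[OF F.rho_der[OF dL]]] lin_add[OF der_lin[OF F.rho_der[OF dL]]]
    lin_smult[OF der_lin[OF F.rho_der[OF dL]]] der_mult[OF F.rho_der[OF dL]]
  note Rl = lin_closed[OF der_lin[OF B.rho_der[OF dL]]] lin_add[OF der_lin[OF B.rho_der[OF dL]]]
    lin_smult[OF der_lin[OF B.rho_der[OF dL]]] der_mult[OF B.rho_der[OF dL]]
  interpret U: nalg Uk by (rule uea_nalg[OF der_mat_closed])
  show ?thesis
    using f
  proof (induction f rule: free_LU_induct)
    case zero
    then show ?case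
      using lin_zero[OF der_lin[OF F.rho_der[OF dL]] F.nalg_axioms F.nalg_axioms]
        lin_zero[OF hom_lin[OF h] F.nalg_axioms B.nalg_axioms]
        lin_zero[OF der_lin[OF B.rho_der[OF dL]] B.nalg_axioms B.nalg_axioms] by simp
  next
    case (var i u)
    then show ?case
      using uea_inj_closed[OF der_mat_closed dL] dL
      by (simp add: LU_var_act[OF d] hv B.act_mult b B.act_inj B.act_closed)
  qed (simp_all add: hl Dl Rl)
qed

text \<open>
  The universal property of the free \<open>(L,U)\<close>-algebra: elements of an algebra with an action on which the
  kernel of \<open>\<phi>\<close> acts as zero can be substituted for the variables.
\<close>

lemma free_LU_universal:
  fixes B :: "('a::field, 'v) module"
  assumes B: "lie_rep B Lk \<rho>" and b: "\<And>i. b i \<in> carrier B"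
    and ker: "\<And>z c. z \<in> ker_phi k \<Longrightarrow> c \<in> carrier B \<Longrightarrow> uea_act B \<rho> z c = \<zero>\<^bsub>B\<^esub>"
  shows "\<exists>h \<in> alg_hom FU B. \<forall>i. \<forall>u \<in> carrier Uk. h (free_LU_var k i u) = uea_act B \<rho> u (b i)"
proof -
  interpret B: lie_rep B Lk \<rho> by fact
  interpret A: lie_rep FL Lk "free_L_act Lk" by (rule FL_rep)
  interpret U: nalg Uk by (rule uea_nalg[OF der_mat_closed])
  have "\<exists>h \<in> alg_hom FL B. \<forall>i. \<forall>u \<in> carrier Uk. h (free_L_var Lk i u) = uea_act B \<rho> u (b i)"
    by (rule free_L_universal[OF der_mat_closed B.nalg_axioms])
       (simp_all add: B.act_closed b B.act_add B.act_smult)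
  then obtain h where h: "h \<in> alg_hom FL B"
    and hv: "\<And>i u. u \<in> carrier Uk \<Longrightarrow> h (free_L_var Lk i u) = uea_act B \<rho> u (b i)" by blast
  note hl = lin_closed[OF hom_lin[OF h]] lin_add[OF hom_lin[OF h]] lin_smult[OF hom_lin[OF h]] hom_mult[OF h]
  have eq: "h (free_L_act Lk d f) = \<rho> d (h f)" if dL: "d \<in> carrier Lk" and f: "f \<in> carrier FL" for d f
  proof -
    note Dl = lin_closed[OF der_lin[OF A.rho_der[OF dL]]] lin_add[OF der_lin[OF A.rho_der[OF dL]]]
      lin_smult[OF der_lin[OF A.rho_der[OF dL]]] der_mult[OF A.rho_der[OF dL]]
    note Rl = lin_closed[OF der_lin[OF B.rho_der[OF dL]]] lin_add[OF der_lin[OF B.rho_der[OF dL]]]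
      lin_smult[OF der_lin[OF B.rho_der[OF dL]]] der_mult[OF B.rho_der[OF dL]]
    show ?thesis
      using f
    proof (induction f rule: FL_induct)
      case zero
      then show ?case
        using lin_zero[OF der_lin[OF A.rho_der[OF dL]] A.nalg_axioms A.nalg_axioms]
          lin_zero[OF hom_lin[OF h] A.nalg_axioms B.nalg_axioms]
          lin_zero[OF der_lin[OF B.rho_der[OF dL]] B.nalg_axioms B.nalg_axioms] by simp
    next
      case (var i u)
      then show ?case
        using uea_inj_closed[OF der_mat_closed dL] dL
        by (simp add: free_L_act_var[OF der_mat_closed dL] hv B.act_mult b B.act_inj[OF _ dL] B.act_closed)
    qed (simp_all add: hl Dl Rl)
  qed
  have "h (uea_act FL (free_L_act Lk) z f) = \<zero>\<^bsub>B\<^esub>" if "f \<in> carrier FL" "z \<in> ker_phi k" for f z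
  proof -
    have "h (uea_act FL (free_L_act Lk) z f) = uea_act B \<rho> z (h f)"
      by (rule act_natural[OF FL_rep B hom_lin[OF h]]) (use that ker_phi_carrier in \<open>simp_all add: eq\<close>)
    then show ?thesis using ker[OF that(2) hl(1)[OF that(1)]] by simp
  qed
  then have "free_LU_ideal k \<subseteq> {f \<in> carrier FL. h f = \<zero>\<^bsub>B\<^esub>}"
    unfolding free_LU_ideal_def Let_def
    by (intro alg_ideal_gen_least[OF hom_kernel_ideal[OF A.nalg_axioms B.nalg_axioms h]])
       (auto simp: A.act_closed ker_phi_carrier)
  then have "\<exists>g \<in> alg_hom (quot_alg FL (free_LU_ideal k)) B. \<forall>x \<in> carrier FL. g (free_LU_ideal k +>\<^bsub>FL\<^esub> x) = h x"
    by (intro quot_lift[OF A.nalg_axioms B.nalg_axioms free_LU_ideal_ideal h]) auto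
  then obtain g where g: "g \<in> alg_hom FU B" and gh: "\<And>x. x \<in> carrier FL \<Longrightarrow> g (LU_cls x) = h x"
    unfolding free_LU_alg_def[symmetric] LU_cls_def[symmetric] by blast
  have "g (free_LU_var k i u) = uea_act B \<rho> u (b i)" if "u \<in> carrier Uk" for i u
    using gh[OF free_L_var_closed[OF der_mat_closed that]] hv[OF that] by (simp add: LU_cls_var)
  then show ?thesis using g by blast
qed

end

section \<open>Matrix units\<close>

text \<open>Matrix units with rows and columns numbered from 0, like the entries of a matrix.\<close>

definition eu :: "nat \<Rightarrow> nat \<Rightarrow> nat \<Rightarrow> 'a::field mat" where
  "eu k p q = mat k k (\<lambda>(r, s). if r = p \<and> s = q then 1 else 0)"

text \<open>
  For \<open>(p, q)\<close> in \<open>fb_index k\<close> these matrices form a basis of \<open>sl\<^sub>k\<close>. With the last diagonal entry as a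
  reference, the coefficients of a traceless matrix in this basis are its entries at the same positions
  (\<open>traceless_expand\<close>), which is not the case for the basis of the \<open>h\<^sub>i\<close>.
\<close>

definition fb :: "nat \<Rightarrow> nat \<Rightarrow> nat \<Rightarrow> 'a::field mat" where
  "fb k p q = (if p = q then eu k p p - eu k (k - 1) (k - 1) else eu k p q)"

definition fb_index :: "nat \<Rightarrow> (nat \<times> nat) set" where
  "fb_index k = {(p, q). p < k \<and> q < k \<and> (p, q) \<noteq> (k - 1, k - 1)}"

lemma eu_carrier [simp]: "eu k p q \<in> carrier_mat k k"
  by (simp add: eu_def)

lemma fb_carrier [simp]: "fb k p q \<in> carrier_mat k k"
  by (simp add: fb_def minus_carrier_mat)

lemma eu_index [simp]: "r < k \<Longrightarrow> s < k \<Longrightarrow> eu k p q $$ (r, s) = (if r = p \<and> s = q then 1 else 0)"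
  by (simp add: eu_def)

lemma eu_dim [simp]: "dim_row (eu k p q) = k" "dim_col (eu k p q) = k"
  by (simp_all add: eu_def)

lemma fb_entry: "r < k \<Longrightarrow> s < k \<Longrightarrow> fb k p q $$ (r, s) =
    (if r = p \<and> s = q then 1 else 0) - (if p = q \<and> r = k - 1 \<and> s = k - 1 then 1 else 0)"
  by (auto simp: fb_def)

lemma finite_fb_index: "finite (fb_index k)"
  by (rule finite_subset[of _ "{..<k} \<times> {..<k}"]) (auto simp: fb_index_def)

lemma mult_entry:
  assumes "M \<in> carrier_mat k k" "N \<in> carrier_mat k k" "r < k" "s < k"
  shows "(M * N) $$ (r, s) = (\<Sum>l<k. M $$ (r, l) * N $$ (l, s))"
  using assms by (simp add: scalar_prod_def atLeast0LessThan)

lemma eu_mult_entry: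
  assumes "M \<in> carrier_mat k k" "p < k" "q < k" "r < k" "s < k"
  shows "(eu k p q * M) $$ (r, s) = (if r = p then M $$ (q, s) else 0)"
    and "(M * eu k p q) $$ (r, s) = (if s = q then M $$ (r, p) else 0)"
proof -
  have "(eu k p q * M) $$ (r, s) = (\<Sum>l<k. if l = q then (if r = p then M $$ (l, s) else 0) else 0)"
    unfolding mult_entry[OF eu_carrier assms(1,4,5)] by (rule sum.cong) (use assms in auto)
  then show "(eu k p q * M) $$ (r, s) = (if r = p then M $$ (q, s) else 0)"
    using assms by simp
  have "(M * eu k p q) $$ (r, s) = (\<Sum>l<k. if l = p then (if s = q then M $$ (r, l) else 0) else 0)"
    unfolding mult_entry[OF assms(1) eu_carrier assms(4,5)] by (rule sum.cong) (use assms in auto)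
  then show "(M * eu k p q) $$ (r, s) = (if s = q then M $$ (r, p) else 0)"
    using assms by simp
qed

section \<open>The derivations of a matrix algebra and the operators they generate\<close>

lemma mat_induct [consumes 1, case_names zero unit add]:
  assumes M: "M \<in> carrier_mat k k" and zero: "P (0\<^sub>m k k)"
    and unit: "\<And>c p q. p < k \<Longrightarrow> q < k \<Longrightarrow> P (c \<cdot>\<^sub>m eu k p q)"
    and add: "\<And>A B. A \<in> carrier_mat k k \<Longrightarrow> B \<in> carrier_mat k k \<Longrightarrow> P A \<Longrightarrow> P B \<Longrightarrow> P (A + B)"
  shows "P (M :: 'a::field mat)"
proof -
  define cut where "cut N = mat k k (\<lambda>ij. if ij \<in> N then M $$ ij else 0)" for N
  have "P (cut N)" if "finite N" "N \<subseteq> {..<k} \<times> {..<k}" for N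
    using that
  proof (induction N rule: finite_induct)
    case empty
    have "cut {} = 0\<^sub>m k k" by (auto simp: cut_def)
    then show ?case using zero by simp
  next
    case (insert x N)
    obtain p q where x: "x = (p, q)" by fastforce
    have "cut (insert x N) = M $$ x \<cdot>\<^sub>m eu k p q + cut N"
      using insert(2) by (intro eq_matI) (auto simp: cut_def x)
    moreover have "P (M $$ x \<cdot>\<^sub>m eu k p q + cut N)"
      using insert x by (intro add unit) (auto simp: cut_def)
    ultimately show ?case by simp
  qed
  then have "P (cut ({..<k} \<times> {..<k}))" by simp
  moreover have "cut ({..<k} \<times> {..<k}) = M" using M by (auto simp: cut_def)
  ultimately show ?thesis by simp
qed

definition ad :: "nat \<Rightarrow> 'a::field mat \<Rightarrow> 'a mat \<Rightarrow> 'a mat" where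
  "ad k c = (\<lambda>x\<in>carrier_mat k k. c * x - x * c)"

lemma ad_apply: "x \<in> carrier_mat k k \<Longrightarrow> ad k c x = c * x - x * c"
  by (simp add: ad_def)

lemma commutator_closed:
  "c \<in> carrier_mat k k \<Longrightarrow> x \<in> carrier_mat k k \<Longrightarrow> c * x - x * (c :: 'a::field mat) \<in> carrier_mat k k"
  by (intro minus_carrier_mat mult_carrier_mat)

lemma commutator_add_right:
  assumes "c \<in> carrier_mat k k" "x \<in> carrier_mat k k" "y \<in> carrier_mat k k"
  shows "c * (x + y) - (x + y) * c = (c * x - x * c) + (c * y - y * (c :: 'a::field mat))"
proof -
  have "c * (x + y) = c * x + c * y" "(x + y) * c = x * c + y * c"
    using assms by (simp_all add: mult_add_distrib_mat[of _ k k] add_mult_distrib_mat[of _ k k])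
  then show ?thesis using assms by (intro eq_matI) (auto simp del: index_mult_mat(1))
qed

lemma commutator_add_left:
  assumes "c \<in> carrier_mat k k" "x \<in> carrier_mat k k" "y \<in> carrier_mat k k"
  shows "(x + y) * c - c * (x + y) = (x * c - c * x) + (y * c - (c :: 'a::field mat) * y)"
proof -
  have "c * (x + y) = c * x + c * y" "(x + y) * c = x * c + y * c"
    using assms by (simp_all add: mult_add_distrib_mat[of _ k k] add_mult_distrib_mat[of _ k k])
  then show ?thesis using assms by (intro eq_matI) (auto simp del: index_mult_mat(1))
qed

lemma commutator_smult_right:
  assumes "c \<in> carrier_mat k k" "x \<in> carrier_mat k k"
  shows "c * (a \<cdot>\<^sub>m x) - (a \<cdot>\<^sub>m x) * c = a \<cdot>\<^sub>m (c * x - x * (c :: 'a::field mat))"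
proof -
  have "c * (a \<cdot>\<^sub>m x) = a \<cdot>\<^sub>m (c * x)" "(a \<cdot>\<^sub>m x) * c = a \<cdot>\<^sub>m (x * c)"
    using assms by (simp_all add: mult_smult_distrib[of _ k k] mult_smult_assoc_mat[of _ k k])
  then show ?thesis using assms
    by (intro eq_matI) (auto simp: right_diff_distrib simp del: index_mult_mat(1))
qed

lemma ad_derivation:
  assumes c: "c \<in> carrier_mat k k"
  shows "ad k c \<in> derivations (mat_alg k :: ('a::field, 'a mat) module)"
proof -
  have "(\<lambda>x\<in>carrier (mat_alg k). c * x - x * c) \<in> derivations (mat_alg k)"
  proof (rule restrict_der[OF mat_alg_nalg], unfold mat_alg_sel)
    fix x y :: "'a mat" assume x: "x \<in> carrier_mat k k" and y: "y \<in> carrier_mat k k"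
    have a: "(c * x - x * c) * y = c * (x * y) - x * (c * y)" "x * (c * y - y * c) = x * (c * y) - x * (y * c)"
      "x * y * c = x * (y * c)"
      using c x y by (simp_all add: minus_mult_distrib_mat[of _ k k _ _ k] mult_minus_distrib_mat[of _ k k _ k] assoc_mult_mat[of _ k k _ k _ k])
    have "C - A + (A - B) = C - B" if "A \<in> carrier_mat k k" "B \<in> carrier_mat k k" "C \<in> carrier_mat k k" for A B C :: "'a mat"
      using that by (intro eq_matI) auto
    then show "c * (x * y) - x * y * c = (c * x - x * c) * y + x * (c * y - y * c)"
      unfolding a using c x y by simp
  qed (use c in \<open>simp_all add: commutator_add_right[of _ k] commutator_smult_right[of _ k] minus_carrier_mat\<close>)
  then show ?thesis by (simp add: ad_def)
qed

lemma mult_eu: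
  assumes "p < k" "q < k" "r < k" "s < k"
  shows "eu k p q * eu k r s = (if q = r then eu k p s else 0\<^sub>m k k)"
  using assms by (intro eq_matI) (auto simp: eu_mult_entry simp del: index_mult_mat(1))

text \<open>
  Comparing \<open>d(e\<^sub>p\<^sub>q e\<^sub>s\<^sub>0)\<close> with the product rule expresses \<open>d(e\<^sub>p\<^sub>q)\<close> by the values \<open>d(e\<^sub>s\<^sub>0)\<close>.
\<close>

lemma derivation_inner:
  assumes d: "d \<in> derivations (mat_alg k :: ('a::field, 'a mat) module)" and k: "0 < k"
  shows "\<exists>c\<in>carrier_mat k k. d = ad k c"
proof -
  note dl = lin_closed[OF der_lin[OF d], simplified] lin_add[OF der_lin[OF d], simplified]
    lin_smult[OF der_lin[OF d], simplified] der_mult[OF d, simplified]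
  \<comment> \<open>the classical choice \<open>c = \<Sum>\<^sub>s d(e\<^sub>s\<^sub>0) e\<^sub>0\<^sub>s\<close>, which differs from any other choice by a scalar\<close>
  define c where "c = mat k k (\<lambda>(r, s). d (eu k s 0) $$ (r, 0))"
  have c: "c \<in> carrier_mat k k" by (simp add: c_def)
  note al = lin_add[OF der_lin[OF ad_derivation[OF c]], simplified]
    lin_smult[OF der_lin[OF ad_derivation[OF c]], simplified]
  have d0: "d (0\<^sub>m k k) = 0\<^sub>m k k" using lin_zero[OF der_lin[OF d] mat_alg_nalg mat_alg_nalg] by simp
  have unit: "d (eu k p q) = ad k c (eu k p q)" if pq: "p < k" "q < k" for p q
  proof (rule eq_matI)
    fix r s assume "r < dim_row (ad k c (eu k p q))" "s < dim_col (ad k c (eu k p q))"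
    then have rs: "r < k" "s < k" using c by (auto simp: ad_apply)
    have dc: "d (eu k a b) \<in> carrier_mat k k" for a b by (simp add: dl)
    have "d (eu k p q * eu k s 0) = (if q = s then d (eu k p 0) else 0\<^sub>m k k)"
      using pq rs k by (simp add: mult_eu d0)
    then have "(if q = s then d (eu k p 0) else 0\<^sub>m k k) $$ (r, 0) = (d (eu k p q) * eu k s 0 + eu k p q * d (eu k s 0)) $$ (r, 0)"
      by (simp add: dl)
    also have "\<dots> = d (eu k p q) $$ (r, s) + (if r = p then d (eu k s 0) $$ (q, 0) else 0)"
      using pq rs k dc dc[THEN carrier_matD(1)] dc[THEN carrier_matD(2)] by (simp add: eu_mult_entry del: index_mult_mat(1))
    finally have e: "d (eu k p q) $$ (r, s) = (if q = s then d (eu k p 0) $$ (r, 0) else 0) - (if r = p then d (eu k s 0) $$ (q, 0) else 0)"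
      using rs k by (auto split: if_splits simp: algebra_simps)
    have "ad k c (eu k p q) $$ (r, s) = (c * eu k p q) $$ (r, s) - (eu k p q * c) $$ (r, s)"
      using c rs by (simp add: ad_apply)
    also have "\<dots> = (if q = s then d (eu k p 0) $$ (r, 0) else 0) - (if r = p then d (eu k s 0) $$ (q, 0) else 0)"
      using pq rs c by (simp add: eu_mult_entry del: index_mult_mat(1)) (simp add: c_def)
    finally show "d (eu k p q) $$ (r, s) = ad k c (eu k p q) $$ (r, s)" using e by simp
  next
    have "d (eu k p q) \<in> carrier_mat k k" by (simp add: dl)
    then show "dim_row (d (eu k p q)) = dim_row (ad k c (eu k p q))" "dim_col (d (eu k p q)) = dim_col (ad k c (eu k p q))"
      using c by (simp_all add: ad_apply)
  qed
  have "d x = ad k c x" if "x \<in> carrier_mat k k" for x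
    using that
  proof (induction x rule: mat_induct)
    case zero
    then show ?case using d0 c lin_zero[OF der_lin[OF ad_derivation[OF c]] mat_alg_nalg mat_alg_nalg] by simp
  qed (simp_all add: dl al unit)
  moreover have "d x = ad k c x" if "x \<notin> carrier_mat k k" for x
    using der_lin[OF d] that by (auto simp: lin_maps_def ad_def PiE_def extensional_def)
  ultimately have "d = ad k c" by blast
  then show ?thesis using c by blast
qed

definition mtr :: "nat \<Rightarrow> 'a::field mat \<Rightarrow> 'a" where
  "mtr k x = (\<Sum>i<k. x $$ (i, i))"

lemma mtr_commutator:
  assumes "c \<in> carrier_mat k k" "x \<in> carrier_mat k k"
  shows "mtr k (c * x - x * c) = 0"
proof -
  have "mtr k (c * x - x * c) = (\<Sum>i<k. (c * x) $$ (i, i)) - (\<Sum>i<k. (x * c) $$ (i, i))"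
    using assms by (simp add: mtr_def sum_subtractf del: index_mult_mat(1))
  also have "(\<Sum>i<k. (c * x) $$ (i, i)) = (\<Sum>i<k. \<Sum>l<k. c $$ (i, l) * x $$ (l, i))"
    using assms by (intro sum.cong refl) (simp add: mult_entry del: index_mult_mat(1))
  also have "\<dots> = (\<Sum>l<k. \<Sum>i<k. x $$ (l, i) * c $$ (i, l))"
    by (subst sum.swap) (simp add: mult.commute)
  also have "\<dots> = (\<Sum>i<k. (x * c) $$ (i, i))"
    using assms by (intro sum.cong refl) (simp add: mult_entry del: index_mult_mat(1))
  finally show ?thesis by simp
qed

lemma mtr_add: "x \<in> carrier_mat k k \<Longrightarrow> y \<in> carrier_mat k k \<Longrightarrow> mtr k (x + y) = mtr k x + mtr k y"
  and mtr_smult: "x \<in> carrier_mat k k \<Longrightarrow> mtr k (a \<cdot>\<^sub>m x) = a * mtr k x"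
  by (auto simp: mtr_def sum.distrib sum_distrib_left)

lemma mtr_fb: "\<beta> \<in> fb_index k \<Longrightarrow> mtr k (fb k (fst \<beta>) (snd \<beta>) :: 'a::field mat) = 0"
proof -
  assume \<beta>: "\<beta> \<in> fb_index k"
  have "mtr k (fb k (fst \<beta>) (snd \<beta>) :: 'a mat) = (\<Sum>r<k. (if r = fst \<beta> then (if fst \<beta> = snd \<beta> then 1 else 0) else 0)
     - (if r = k - 1 then (if fst \<beta> = snd \<beta> then 1 else 0) else 0))"
    unfolding mtr_def by (intro sum.cong refl) (auto simp: fb_entry)
  then show "mtr k (fb k (fst \<beta>) (snd \<beta>) :: 'a mat) = 0"
    using \<beta> by (auto simp: sum_subtractf fb_index_def)
qed

text \<open>
  Half of the description of \<open>\<phi>(U(L))\<close>: inner derivations kill the scalars and have traceless values.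
  The other half is \<open>realized_rank_one\<close> and \<open>realized_cent\<close>.
\<close>

lemma phi_structure:
  assumes u: "u \<in> carrier (Uk k :: ('a::field, _) module)" and k: "0 < k"
  shows "(\<exists>\<gamma>. phi k u (1\<^sub>m k) = \<gamma> \<cdot>\<^sub>m 1\<^sub>m k) \<and>
    (\<forall>x\<in>carrier_mat k k. mtr k x = 0 \<longrightarrow> mtr k (phi k u x) = 0)"
  using der_mat_closed u
proof (induction u rule: uea_induct)
  case one
  have "1\<^sub>m k = (1::'a) \<cdot>\<^sub>m 1\<^sub>m k" by auto
  then show ?case by (auto simp: phi_one)
next
  case (inj d v)
  then obtain c where c: "c \<in> carrier_mat k k" "d = ad k c" using derivation_inner k by auto
  from inj obtain \<gamma> where g: "phi k v (1\<^sub>m k) = \<gamma> \<cdot>\<^sub>m 1\<^sub>m k" by blast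
  have "phi k (uea_inj (der_mat k) d \<otimes>\<^bsub>Uk k\<^esub> v) x = c * phi k v x - phi k v x * c" if "x \<in> carrier_mat k k" for x
    using inj that c by (simp add: phi_mult phi_inj phi_closed uea_inj_closed[OF der_mat_closed] ad_apply)
  moreover have "c * (\<gamma> \<cdot>\<^sub>m 1\<^sub>m k) - (\<gamma> \<cdot>\<^sub>m 1\<^sub>m k) * c = 0 \<cdot>\<^sub>m 1\<^sub>m k"
    using c by (simp add: commutator_smult_right[of _ k]) (intro eq_matI, auto)
  ultimately show ?case using c g by (auto simp: mtr_commutator phi_closed inj)
next
  case (add v w)
  then obtain \<gamma> \<delta> where g: "phi k v (1\<^sub>m k) = \<gamma> \<cdot>\<^sub>m 1\<^sub>m k" "phi k w (1\<^sub>m k) = \<delta> \<cdot>\<^sub>m 1\<^sub>m k" by blast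
  have "\<gamma> \<cdot>\<^sub>m 1\<^sub>m k + \<delta> \<cdot>\<^sub>m 1\<^sub>m k = (\<gamma> + \<delta>) \<cdot>\<^sub>m (1\<^sub>m k :: 'a mat)" by (intro eq_matI) auto
  then show ?case using add g by (auto simp: phi_add mtr_add phi_closed)
next
  case (smult a v)
  then obtain \<gamma> where g: "phi k v (1\<^sub>m k) = \<gamma> \<cdot>\<^sub>m 1\<^sub>m k" by blast
  have "a \<cdot>\<^sub>m (\<gamma> \<cdot>\<^sub>m 1\<^sub>m k) = (a * \<gamma>) \<cdot>\<^sub>m (1\<^sub>m k :: 'a mat)" by (intro eq_matI) auto
  then show ?case using smult g by (auto simp: phi_smult mtr_smult phi_closed)
qed

text \<open>
  Membership in \<open>\<phi>(U(L))\<close>. Operators are compared on \<open>k \<times> k\<close> matrices only, so that they can be given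
  by lambda terms although \<^const>\<open>phi\<close> is extensional.
\<close>

definition realized :: "nat \<Rightarrow> ('a::field mat \<Rightarrow> 'a mat) \<Rightarrow> bool" where
  "realized k w \<longleftrightarrow> (\<exists>u\<in>carrier (Uk k). \<forall>x\<in>carrier_mat k k. phi k u x = w x)"

lemma realized_cong: "realized k w \<Longrightarrow> (\<And>x. x \<in> carrier_mat k k \<Longrightarrow> w x = w' x) \<Longrightarrow> realized k w'"
  by (auto simp: realized_def)

lemma realized_closed: "realized k w \<Longrightarrow> x \<in> carrier_mat k k \<Longrightarrow> w x \<in> carrier_mat k k"
  by (metis realized_def phi_closed)

lemma realized_id: "realized k (\<lambda>x. x)"
  unfolding realized_def by (intro bexI[of _ "\<one>\<^bsub>Uk k\<^esub>"]) (auto simp: phi_one uea_one_closed[OF der_mat_closed])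

lemma realized_ad: "c \<in> carrier_mat k k \<Longrightarrow> realized k (\<lambda>x. c * x - x * c)"
  unfolding realized_def
  by (intro bexI[of _ "uea_inj (der_mat k) (ad k c)"])
     (auto simp: phi_inj uea_inj_closed[OF der_mat_closed] ad_derivation ad_apply)

lemma realized_comp:
  assumes "realized k v" "realized k w" shows "realized k (\<lambda>x. v (w x))"
proof -
  interpret U: nalg "Uk k" by (rule uea_nalg[OF der_mat_closed])
  obtain a b where "a \<in> carrier (Uk k)" "\<forall>x\<in>carrier_mat k k. phi k a x = v x"
      "b \<in> carrier (Uk k)" "\<forall>x\<in>carrier_mat k k. phi k b x = w x"
    using assms unfolding realized_def by blast
  then show ?thesis unfolding realized_def
    by (intro bexI[of _ "a \<otimes>\<^bsub>Uk k\<^esub> b"]) (auto simp: phi_mult realized_closed[OF assms(2)])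
qed

lemma realized_add:
  assumes "realized k v" "realized k w" shows "realized k (\<lambda>x. v x + w x)"
proof -
  interpret U: nalg "Uk k" by (rule uea_nalg[OF der_mat_closed])
  obtain a b where "a \<in> carrier (Uk k)" "\<forall>x\<in>carrier_mat k k. phi k a x = v x"
      "b \<in> carrier (Uk k)" "\<forall>x\<in>carrier_mat k k. phi k b x = w x"
    using assms unfolding realized_def by blast
  then show ?thesis unfolding realized_def
    by (intro bexI[of _ "a \<oplus>\<^bsub>Uk k\<^esub> b"]) (auto simp: phi_add)
qed

lemma realized_smult:
  assumes "realized k v" shows "realized k (\<lambda>x. c \<cdot>\<^sub>m v x)"
proof -
  interpret U: nalg "Uk k" by (rule uea_nalg[OF der_mat_closed])
  obtain a where "a \<in> carrier (Uk k)" "\<forall>x\<in>carrier_mat k k. phi k a x = v x"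
    using assms unfolding realized_def by blast
  then show ?thesis unfolding realized_def
    by (intro bexI[of _ "c \<odot>\<^bsub>Uk k\<^esub> a"]) (auto simp: phi_smult)
qed

text \<open>Linear combinations are given by their entries, which avoids sums of matrices.\<close>

lemma entry_sum_closed:
  assumes I: "finite I" and m: "\<And>j. j \<in> I \<Longrightarrow> m j \<in> N" and M: "M \<in> carrier_mat k k"
    and eq: "\<And>r s. r < k \<Longrightarrow> s < k \<Longrightarrow> M $$ (r, s) = (\<Sum>j\<in>I. a j * m j $$ (r, s))"
    and N: "N \<subseteq> carrier_mat k k" "0\<^sub>m k k \<in> N" "\<And>A B. A \<in> N \<Longrightarrow> B \<in> N \<Longrightarrow> A + B \<in> N"
      "\<And>c A. A \<in> N \<Longrightarrow> c \<cdot>\<^sub>m A \<in> N"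
  shows "(M :: 'a::field mat) \<in> N"
proof -
  have "\<exists>S\<in>N. \<forall>r<k. \<forall>s<k. S $$ (r, s) = (\<Sum>j\<in>I. a j * m j $$ (r, s))"
    using I m
  proof (induction I rule: finite_induct)
    case empty
    then show ?case using N(2) by (intro bexI[of _ "0\<^sub>m k k"]) auto
  next
    case (insert j I)
    then obtain S where S: "S \<in> N" "\<forall>r<k. \<forall>s<k. S $$ (r, s) = (\<Sum>j\<in>I. a j * m j $$ (r, s))" by auto
    have "m j \<in> carrier_mat k k" "S \<in> carrier_mat k k" using insert S N by auto
    then show ?case using insert S by (intro bexI[of _ "a j \<cdot>\<^sub>m m j + S"] N(3,4)) auto
  qed
  then obtain S where S: "S \<in> N" "\<forall>r<k. \<forall>s<k. S $$ (r, s) = (\<Sum>j\<in>I. a j * m j $$ (r, s))" by blast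
  moreover have "M = S" using M S N(1) by (intro eq_matI) (auto simp: eq subset_iff)
  ultimately show ?thesis by simp
qed

lemma traceless_expand:
  assumes x: "x \<in> carrier_mat k k" and tr: "mtr k x = 0" and rs: "r < k" "s < k"
  shows "x $$ (r, s) = (\<Sum>\<beta>\<in>fb_index k. x $$ \<beta> * fb k (fst \<beta>) (snd \<beta>) $$ (r, s))"
proof -
  let ?l = "k - 1"
  let ?A = "{..<k} \<times> {..<k}"
  have idx: "?A = insert (?l, ?l) (fb_index k)" "(?l, ?l) \<notin> fb_index k" using rs by (auto simp: fb_index_def)
  have "(\<Sum>\<beta>\<in>?A. x $$ \<beta> * fb k (fst \<beta>) (snd \<beta>) $$ (r, s)) =
     (\<Sum>\<beta>\<in>?A. (if \<beta> = (r, s) then x $$ \<beta> else 0)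
        - (if fst \<beta> = snd \<beta> then x $$ \<beta> else 0) * (if r = ?l \<and> s = ?l then 1 else 0))"
  proof (rule sum.cong[OF refl])
    fix \<beta> :: "nat \<times> nat"
    obtain a b where \<beta>: "\<beta> = (a, b)" by fastforce
    define P Q where "P \<longleftrightarrow> r = a \<and> s = b" and "Q \<longleftrightarrow> r = ?l \<and> s = ?l"
    have "fb k a b $$ (r, s) = (if P then 1 else 0) - (if a = b \<and> Q then 1 else (0::'a))"
      using fb_entry[OF rs, of a b] by (simp add: P_def Q_def)
    moreover have "\<beta> = (r, s) \<longleftrightarrow> P" by (auto simp: \<beta> P_def)
    ultimately show "x $$ \<beta> * fb k (fst \<beta>) (snd \<beta>) $$ (r, s) = (if \<beta> = (r, s) then x $$ \<beta> else 0)
        - (if fst \<beta> = snd \<beta> then x $$ \<beta> else 0) * (if r = ?l \<and> s = ?l then 1 else 0)"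
      unfolding Q_def[symmetric] by (simp add: \<beta>)
  qed
  also have "\<dots> = x $$ (r, s) - (\<Sum>\<beta>\<in>?A. if fst \<beta> = snd \<beta> then x $$ \<beta> else 0) * (if r = ?l \<and> s = ?l then 1 else 0)"
    using rs by (simp add: sum_subtractf sum_distrib_right)
  also have "(\<Sum>\<beta>\<in>?A. if fst \<beta> = snd \<beta> then x $$ \<beta> else 0) = mtr k x"
  proof -
    have "(\<Sum>\<beta>\<in>?A. if fst \<beta> = snd \<beta> then x $$ \<beta> else 0) = (\<Sum>(a, b)\<in>?A. if a = b then x $$ (a, b) else 0)"
      by (intro sum.cong refl) auto
    then show ?thesis by (simp add: mtr_def flip: sum.cartesian_product)
  qed
  finally have "(\<Sum>\<beta>\<in>?A. x $$ \<beta> * fb k (fst \<beta>) (snd \<beta>) $$ (r, s)) = x $$ (r, s)"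
    using tr by simp
  moreover have "fb k ?l ?l $$ (r, s) = (0::'a)" using rs by (simp add: fb_entry)
  ultimately show ?thesis using finite_fb_index idx by simp
qed

text \<open>
  \<open>sl\<^sub>k\<close> is generated, as an ideal of itself, by any \<open>e\<^sub>p\<^sub>q\<close> with \<open>p \<noteq> q\<close>: commutators with matrix units
  move the row index, the column index, and turn \<open>e\<^sub>a\<^sub>b\<close> into a multiple of \<open>e\<^sub>b\<^sub>a\<close>. The last move is needed
  for \<open>k = 2\<close> and brings in a factor 2.
\<close>

lemma traceless_generated:
  fixes N :: "'a::field_char_0 mat set"
  assumes N: "N \<subseteq> carrier_mat k k" "0\<^sub>m k k \<in> N" "\<And>A B. A \<in> N \<Longrightarrow> B \<in> N \<Longrightarrow> A + B \<in> N"
      "\<And>c A. A \<in> N \<Longrightarrow> c \<cdot>\<^sub>m A \<in> N"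
    and ad: "\<And>c A. c \<in> carrier_mat k k \<Longrightarrow> A \<in> N \<Longrightarrow> c * A - A * c \<in> N"
    and start: "eu k p q \<in> N" "p < k" "q < k" "p \<noteq> q"
    and x: "x \<in> carrier_mat k k" "mtr k x = 0"
  shows "x \<in> N"
proof -
  have neg: "0\<^sub>m k k - eu k a b = (-1) \<cdot>\<^sub>m (eu k a b :: 'a mat)" for a b by (intro eq_matI) auto
  have sub0: "eu k a b - 0\<^sub>m k k = (eu k a b :: 'a mat)" for a b by (intro eq_matI) auto
  have un: "(-1) \<cdot>\<^sub>m A \<in> N \<Longrightarrow> A \<in> N" for A
  proof -
    assume "(-1) \<cdot>\<^sub>m A \<in> N"
    then have "(-1) \<cdot>\<^sub>m ((-1) \<cdot>\<^sub>m A) \<in> N" by (rule N(4))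
    also have "(-1) \<cdot>\<^sub>m ((-1) \<cdot>\<^sub>m A) = A" by auto
    finally show "A \<in> N" .
  qed
  have row: "eu k r b \<in> N" if "eu k a b \<in> N" "a < k" "b < k" "r < k" "a \<noteq> b" "r \<noteq> b" for a b r
    using ad[OF eu_carrier[of k r a] that(1)] that by (cases "r = a") (simp_all add: mult_eu sub0)
  have col: "eu k a s \<in> N" if "eu k a b \<in> N" "a < k" "b < k" "s < k" "a \<noteq> b" "s \<noteq> a" for a b s
    using ad[OF eu_carrier[of k b s] that(1)] that by (cases "s = b") (simp_all add: mult_eu neg un)
  have diag: "eu k b b - eu k a a \<in> N" if "eu k a b \<in> N" "a < k" "b < k" for a b
    using ad[OF eu_carrier[of k b a] that(1)] that by (simp add: mult_eu)
  have flip: "eu k b a \<in> N" if "eu k a b \<in> N" "a < k" "b < k" "a \<noteq> b" for a b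
  proof -
    have "eu k b a * (eu k b b - eu k a a) - (eu k b b - eu k a a) * eu k b a \<in> N"
      by (rule ad[OF eu_carrier diag[OF that(1,2,3)]])
    also have "eu k b a * (eu k b b - eu k a a) - (eu k b b - eu k a a) * eu k b a = (-2) \<cdot>\<^sub>m (eu k b a :: 'a mat)"
      using that by (simp add: mult_minus_distrib_mat[of _ k k _ k] minus_mult_distrib_mat[of _ k k _ _ k] mult_eu)
        (intro eq_matI, auto)
    finally have "(-1/2) \<cdot>\<^sub>m ((-2) \<cdot>\<^sub>m eu k b a) \<in> N" by (rule N(4))
    also have "(-1/2) \<cdot>\<^sub>m ((-2) \<cdot>\<^sub>m eu k b a) = (eu k b a :: 'a mat)" by (intro eq_matI) auto
    finally show ?thesis .
  qed
  have off: "eu k r s \<in> N" if "r < k" "s < k" "r \<noteq> s" for r s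
  proof (cases "r = q")
    case False
    then show ?thesis using col[OF row[OF start(1), of r], of s] start that by auto
  next
    case True
    then show ?thesis using col[OF flip[OF start(1)], of s] start that by auto
  qed
  have fb: "fb k (fst \<beta>) (snd \<beta>) \<in> N" if "\<beta> \<in> fb_index k" for \<beta>
  proof -
    obtain r s where b: "\<beta> = (r, s)" by fastforce
    have "r < k" "s < k" using that by (auto simp: b fb_index_def)
    then show ?thesis using off[of r s] diag[OF off[of "k - 1" r]] that by (auto simp: b fb_def fb_index_def)
  qed
  show ?thesis
    by (rule entry_sum_closed[OF finite_fb_index fb x(1) traceless_expand[OF x] N]) simp_all
qed

text \<open>The entries of the traceless part of \<open>x\<close>.\<close>

definition co :: "nat \<Rightarrow> 'a::field mat \<Rightarrow> nat \<Rightarrow> nat \<Rightarrow> 'a" where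
  "co k x r s = x $$ (r, s) - (if r = s then mtr k x / of_nat k else 0)"

lemma realized_zero: "realized k (\<lambda>x. 0\<^sub>m k k)"
  by (rule realized_cong[OF realized_smult[OF realized_id, of k 0]]) auto

text \<open>
  The operator \<open>(ad e\<^sub>s\<^sub>r)\<^sup>2\<close> is \<open>x \<mapsto> -2 x\<^sub>r\<^sub>s e\<^sub>s\<^sub>r\<close>, which has rank one. Composing it with inner derivations
  moves its value \<open>e\<^sub>s\<^sub>r\<close> to any other matrix in \<open>sl\<^sub>k\<close>. This takes the place of the density theorem for
  the irreducible module \<open>sl\<^sub>k\<close>.
\<close>

lemma realized_rank_one_unit:
  assumes rs: "r < k" "s < k" "r \<noteq> s" and b: "b \<in> carrier_mat k k" "mtr k b = 0"
  shows "realized k (\<lambda>x. x $$ (r, s) \<cdot>\<^sub>m (b :: 'a::field_char_0 mat))"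
proof -
  define N where "N = {b \<in> carrier_mat k k. realized k (\<lambda>x. x $$ (r, s) \<cdot>\<^sub>m (b :: 'a mat))}"
  have "b \<in> N"
  proof (rule traceless_generated)
    have "realized k (\<lambda>x. (-1/2) \<cdot>\<^sub>m (eu k s r * (eu k s r * x - x * eu k s r) - (eu k s r * x - x * eu k s r) * eu k s r))"
      by (intro realized_smult realized_comp[OF realized_ad[OF eu_carrier] realized_ad[OF eu_carrier]])
    then have "realized k (\<lambda>x. x $$ (r, s) \<cdot>\<^sub>m (eu k s r :: 'a mat))"
    proof (rule realized_cong)
      fix x :: "'a mat" assume x: "x \<in> carrier_mat k k"
      show "(-1/2) \<cdot>\<^sub>m (eu k s r * (eu k s r * x - x * eu k s r) - (eu k s r * x - x * eu k s r) * eu k s r) =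
          x $$ (r, s) \<cdot>\<^sub>m eu k s r"
      proof (rule eq_matI)
        fix i j assume "i < dim_row (x $$ (r, s) \<cdot>\<^sub>m eu k s r)" "j < dim_col (x $$ (r, s) \<cdot>\<^sub>m eu k s r)"
        then have ij: "i < k" "j < k" by auto
        have c: "eu k s r * x - x * eu k s r \<in> carrier_mat k k" using x by (simp add: minus_carrier_mat)
        show "((-1/2) \<cdot>\<^sub>m (eu k s r * (eu k s r * x - x * eu k s r) - (eu k s r * x - x * eu k s r) * eu k s r)) $$ (i, j) =
            (x $$ (r, s) \<cdot>\<^sub>m eu k s r) $$ (i, j)"
          using x c ij rs by (simp add: eu_mult_entry del: index_mult_mat(1))
      qed (use x in auto)
    qed
    then show "eu k s r \<in> N" by (simp add: N_def)
  next
    fix c A :: "'a mat" assume c: "c \<in> carrier_mat k k" and A: "A \<in> N"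
    have "realized k (\<lambda>x. c * (x $$ (r, s) \<cdot>\<^sub>m A) - (x $$ (r, s) \<cdot>\<^sub>m A) * c)"
      using A by (intro realized_comp[OF realized_ad[OF c]]) (simp add: N_def)
    then show "c * A - A * c \<in> N"
      using c A by (simp add: N_def commutator_closed commutator_smult_right[of _ k])
  next
    fix A B assume "A \<in> N" "B \<in> N"
    then show "A + B \<in> N"
      using realized_add[of k "\<lambda>x. x $$ (r, s) \<cdot>\<^sub>m A" "\<lambda>x. x $$ (r, s) \<cdot>\<^sub>m B"]
      by (simp add: N_def add_smult_distrib_left_mat[of _ k k])
  next
    fix c and A :: "'a mat" assume "A \<in> N"
    moreover have "c \<cdot>\<^sub>m (a \<cdot>\<^sub>m A) = a \<cdot>\<^sub>m (c \<cdot>\<^sub>m A)" for a by (intro eq_matI) auto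
    ultimately show "c \<cdot>\<^sub>m A \<in> N"
      using realized_smult[of k "\<lambda>x. x $$ (r, s) \<cdot>\<^sub>m A" c] by (simp add: N_def)
  next
    have "a \<cdot>\<^sub>m 0\<^sub>m k k = 0\<^sub>m k k" for a :: 'a by (intro eq_matI) auto
    then show "0\<^sub>m k k \<in> N" by (simp add: N_def realized_zero)
  qed (use rs b in \<open>auto simp: N_def\<close>)
  then show ?thesis by (simp add: N_def)
qed

lemma realized_sum:
  fixes w :: "'i \<Rightarrow> 'a::field mat \<Rightarrow> 'a mat"
  assumes "finite I" "\<And>j. j \<in> I \<Longrightarrow> realized k (w j)"
    "\<And>x. x \<in> carrier_mat k k \<Longrightarrow> W x \<in> carrier_mat k k"
    "\<And>x r s. x \<in> carrier_mat k k \<Longrightarrow> r < k \<Longrightarrow> s < k \<Longrightarrow> W x $$ (r, s) = (\<Sum>j\<in>I. w j x $$ (r, s))"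
  shows "realized k W"
proof -
  have "\<exists>V. realized k V \<and> (\<forall>x\<in>carrier_mat k k. \<forall>r<k. \<forall>s<k. V x $$ (r, s) = (\<Sum>j\<in>I. w j x $$ (r, s)))"
    using assms(1,2)
  proof (induction I rule: finite_induct)
    case empty
    then show ?case using realized_zero by (intro exI[of _ "\<lambda>x. 0\<^sub>m k k"]) auto
  next
    case (insert j I)
    then obtain V where V: "realized k V" "\<forall>x\<in>carrier_mat k k. \<forall>r<k. \<forall>s<k. V x $$ (r, s) = (\<Sum>j\<in>I. w j x $$ (r, s))"
      by auto
    have "realized k (w j)" using insert by simp
    then show ?case
      using insert V
      by (intro exI[of _ "\<lambda>x. w j x + V x"] conjI realized_add)
         (auto simp: carrier_matD[OF realized_closed[OF V(1)]] carrier_matD[OF realized_closed[OF \<open>realized k (w j)\<close>]])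
  qed
  then obtain V where V: "realized k V" "\<forall>x\<in>carrier_mat k k. \<forall>r<k. \<forall>s<k. V x $$ (r, s) = (\<Sum>j\<in>I. w j x $$ (r, s))"
    by blast
  show ?thesis
  proof (rule realized_cong[OF V(1)])
    fix x :: "'a mat" assume x: "x \<in> carrier_mat k k"
    show "V x = W x" using x V realized_closed[OF V(1) x] assms(3)[OF x] by (intro eq_matI) (auto simp: assms(4))
  qed
qed

text \<open>
  For a diagonal coordinate, \<open>x\<^sub>r\<^sub>r - x\<^sub>t\<^sub>t\<close> is the \<open>(t, r)\<close> entry of \<open>e\<^sub>t\<^sub>r x - x e\<^sub>t\<^sub>r\<close>, and the average of these
  differences over \<open>t\<close> is the diagonal entry of the traceless part.
\<close>

lemma realized_rank_one:
  assumes rs: "r < k" "s < k" and b: "b \<in> carrier_mat k k" "mtr k b = 0"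
  shows "realized k (\<lambda>x. co k x r s \<cdot>\<^sub>m (b :: 'a::field_char_0 mat))"
proof (cases "r = s")
  case False
  then show ?thesis using realized_rank_one_unit[OF rs False b] by (simp add: co_def)
next
  case True
  have diff: "realized k (\<lambda>x. (x $$ (r, r) - x $$ (t, t)) \<cdot>\<^sub>m b)" if t: "t < k" for t
  proof (cases "t = r")
    case True
    then show ?thesis by (intro realized_cong[OF realized_zero]) (use b in auto)
  next
    case False
    have "realized k (\<lambda>x. (eu k t r * x - x * eu k t r) $$ (t, r) \<cdot>\<^sub>m b)"
      using realized_comp[OF realized_rank_one_unit[OF t rs(1) False b] realized_ad[OF eu_carrier[of k t r]]] .
    then show ?thesis
      by (rule realized_cong) (use t rs in \<open>simp add: eu_mult_entry carrier_matD del: index_mult_mat(1)\<close>)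
  qed
  show ?thesis
  proof (rule realized_sum[of "{..<k}"])
    show "realized k (\<lambda>x. (1 / of_nat k) \<cdot>\<^sub>m ((x $$ (r, r) - x $$ (t, t)) \<cdot>\<^sub>m b))" if "t \<in> {..<k}" for t
      using that by (intro realized_smult diff) simp
    fix x :: "'a mat" and i j assume "x \<in> carrier_mat k k" "i < k" "j < k"
    have "(\<Sum>t<k. ((1 / of_nat k) \<cdot>\<^sub>m ((x $$ (r, r) - x $$ (t, t)) \<cdot>\<^sub>m b)) $$ (i, j)) =
        (\<Sum>t<k. (1 / of_nat k * b $$ (i, j)) * (x $$ (r, r) - x $$ (t, t)))"
      using b \<open>i < k\<close> \<open>j < k\<close> by (intro sum.cong refl) (auto simp: carrier_matD)
    also have "\<dots> = (1 / of_nat k * b $$ (i, j)) * (\<Sum>t<k. x $$ (r, r) - x $$ (t, t))"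
      by (rule sum_distrib_left[symmetric])
    also have "(\<Sum>t<k. x $$ (r, r) - x $$ (t, t)) = of_nat k * x $$ (r, r) - mtr k x"
      by (simp add: sum_subtractf mtr_def)
    also have "(1 / of_nat k * b $$ (i, j)) * (of_nat k * x $$ (r, r) - mtr k x) = co k x r s * b $$ (i, j)"
      using True rs by (simp add: co_def field_simps)
    finally show "(co k x r s \<cdot>\<^sub>m b) $$ (i, j) =
        (\<Sum>t<k. ((1 / of_nat k) \<cdot>\<^sub>m ((x $$ (r, r) - x $$ (t, t)) \<cdot>\<^sub>m b)) $$ (i, j))"
      using b \<open>i < k\<close> \<open>j < k\<close> by (simp add: carrier_matD)
  qed (use b in auto)
qed

definition cent :: "nat \<Rightarrow> 'a::field mat \<Rightarrow> 'a mat" where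
  "cent k x = (mtr k x / of_nat k) \<cdot>\<^sub>m 1\<^sub>m k"

text \<open>
  The projection onto the scalars is the identity minus the projection onto \<open>sl\<^sub>k\<close>, and the latter is a
  sum of the rank one operators above.
\<close>

lemma realized_cent:
  assumes k: "0 < k"
  shows "realized k (cent k :: 'a::field_char_0 mat \<Rightarrow> 'a mat)"
proof -
  have tr1: "mtr k (1\<^sub>m k) = of_nat k" by (simp add: mtr_def)
  have trx: "mtr k (x - cent k x) = 0" if "x \<in> carrier_mat k k" for x :: "'a mat"
  proof -
    have "x - cent k x = x + (-1) \<cdot>\<^sub>m cent k x" using that by (intro eq_matI) (auto simp: cent_def)
    moreover have "cent k x \<in> carrier_mat k k" by (simp add: cent_def)
    ultimately show ?thesis using that k
      by (simp add: mtr_add mtr_smult) (simp add: cent_def mtr_smult tr1)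
  qed
  have "realized k (\<lambda>x :: 'a mat. x - cent k x)"
  proof (rule realized_sum[OF finite_fb_index])
    show "realized k (\<lambda>x. co k x (fst \<beta>) (snd \<beta>) \<cdot>\<^sub>m (fb k (fst \<beta>) (snd \<beta>) :: 'a mat))" if "\<beta> \<in> fb_index k" for \<beta>
      using that mtr_fb[OF that] by (intro realized_rank_one) (auto simp: fb_index_def)
    fix x :: "'a mat" and r s assume x: "x \<in> carrier_mat k k" and rs: "r < k" "s < k"
    have c: "x - cent k x \<in> carrier_mat k k" using x by (simp add: cent_def minus_carrier_mat)
    have e: "(x - cent k x) $$ \<beta> = co k x (fst \<beta>) (snd \<beta>)" if "\<beta> \<in> fb_index k" for \<beta>
      using that x by (auto simp: fb_index_def cent_def co_def)
    show "(x - cent k x) $$ (r, s) =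
        (\<Sum>\<beta>\<in>fb_index k. (co k x (fst \<beta>) (snd \<beta>) \<cdot>\<^sub>m fb k (fst \<beta>) (snd \<beta>)) $$ (r, s))"
      using traceless_expand[OF c trx[OF x] rs] rs
      by (simp add: e) (intro sum.cong refl, auto simp: carrier_matD[OF fb_carrier])
  qed (simp add: cent_def minus_carrier_mat)
  then have "realized k (\<lambda>x :: 'a mat. x + (-1) \<cdot>\<^sub>m (x - cent k x))"
    by (intro realized_add realized_id realized_smult)
  then show ?thesis
    by (rule realized_cong) (intro eq_matI, auto simp: cent_def)
qed

section \<open>Algebras with an action of matrix units\<close>

text \<open>
  \<open>D p q\<close> stands for the action of \<open>e\<^sub>p\<^sub>q\<close>. A family \<open>T\<close> is the family of values at the matrix units of an
  equivariant linear map from \<open>M\<^sub>k\<close>; the right-hand side is the value at \<open>[e\<^sub>p\<^sub>q, e\<^sub>i\<^sub>j]\<close>. An equivariant map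
  from \<open>sl\<^sub>k\<close> is extended by 0 at the identity matrix.
\<close>

definition lu_hom :: "nat \<Rightarrow> (nat \<Rightarrow> nat \<Rightarrow> 'b \<Rightarrow> 'b::ab_group_add) \<Rightarrow> (nat \<Rightarrow> nat \<Rightarrow> 'b) \<Rightarrow> bool" where
  "lu_hom k D T \<longleftrightarrow> (\<forall>p<k. \<forall>q<k. \<forall>i<k. \<forall>j<k.
     D p q (T i j) = (if q = i then T p j else 0) - (if j = p then T i q else 0))"

definition lu_inv :: "nat \<Rightarrow> (nat \<Rightarrow> nat \<Rightarrow> 'b \<Rightarrow> 'b::ab_group_add) \<Rightarrow> 'b \<Rightarrow> bool" where
  "lu_inv k D z \<longleftrightarrow> (\<forall>p<k. \<forall>q<k. D p q z = 0)"

text \<open>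
  What is used of the algebra \<open>A/J\<close>. The assumption \<open>D_idem\<close> is what remains of the condition that the
  kernel of \<open>\<phi>\<close> acts as zero: for a diagonal idempotent \<open>e\<close> the operator \<open>ad e\<close> on \<open>M\<^sub>k\<close> equals its cube.
  The last four assumptions are the identities, with invariants and equivariant maps in place of the
  variables.
\<close>

locale lu_core = vector_space scale
  for scale :: "'a::field_char_0 \<Rightarrow> 'b::ab_group_add \<Rightarrow> 'b" +
  fixes mul :: "'b \<Rightarrow> 'b \<Rightarrow> 'b" (infixr "\<star>" 70) and D :: "nat \<Rightarrow> nat \<Rightarrow> 'b \<Rightarrow> 'b" and k :: nat
  assumes k2: "2 \<le> k"
    and mul_add_left: "(x + y) \<star> z = x \<star> z + y \<star> z"
    and mul_add_right: "z \<star> (x + y) = z \<star> x + z \<star> y"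
    and mul_scale_left: "scale c x \<star> y = scale c (x \<star> y)"
    and mul_scale_right: "x \<star> scale c y = scale c (x \<star> y)"
    and mul_assoc: "(x \<star> y) \<star> z = x \<star> (y \<star> z)"
    and D_add: "D p q (x + y) = D p q x + D p q y"
    and D_scale: "D p q (scale c x) = scale c (D p q x)"
    and D_mul: "D p q (x \<star> y) = D p q x \<star> y + x \<star> D p q y"
    and D_idem: "N \<subseteq> {..<k} \<Longrightarrow>
      (\<Sum>i\<in>N. D i i (\<Sum>i\<in>N. D i i (\<Sum>i\<in>N. D i i x))) = (\<Sum>i\<in>N. D i i x)"
    and ident1: "lu_inv k D z \<Longrightarrow> lu_inv k D z' \<Longrightarrow> z \<star> z' = z' \<star> z"
    and ident2: "lu_inv k D z \<Longrightarrow> lu_hom k D v \<Longrightarrow> z \<star> v 0 1 = v 0 1 \<star> z"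
    and ident3: "lu_hom k D v \<Longrightarrow> lu_hom k D w \<Longrightarrow> v 0 1 \<star> w 1 0 = w 0 1 \<star> v 1 0"
    and ident4: "3 \<le> k \<Longrightarrow> lu_hom k D v \<Longrightarrow> lu_hom k D w \<Longrightarrow> v 0 1 \<star> w 2 0 = 0"
begin

abbreviation "ehom \<equiv> lu_hom k D"
abbreviation "invt \<equiv> lu_inv k D"

lemma mul_zero_left [simp]: "0 \<star> x = 0" using mul_add_left[of 0 0 x] by simp
lemma mul_zero_right [simp]: "x \<star> 0 = 0" using mul_add_right[of x 0 0] by simp
lemma D_zero [simp]: "D p q 0 = 0" using D_add[of p q 0 0] by simp
lemma mul_minus_left: "(- x) \<star> y = - (x \<star> y)"
  using mul_add_left[of x "- x" y] by (simp add: eq_neg_iff_add_eq_0 add.commute)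
lemma mul_minus_right: "y \<star> (- x) = - (y \<star> x)"
  using mul_add_right[of y x "- x"] by (simp add: eq_neg_iff_add_eq_0 add.commute)
lemma D_minus: "D p q (- x) = - D p q x"
  using D_add[of p q x "- x"] by (simp add: eq_neg_iff_add_eq_0 add.commute)
lemma mul_diff_left: "(x - y) \<star> z = x \<star> z - y \<star> z"
  using mul_add_left[of x "- y" z] by (simp add: mul_minus_left)
lemma mul_diff_right: "z \<star> (x - y) = z \<star> x - z \<star> y"
  using mul_add_right[of z x "- y"] by (simp add: mul_minus_right)
lemma D_diff: "D p q (x - y) = D p q x - D p q y"
  using D_add[of p q x "- y"] by (simp add: D_minus)
lemma mul_sum_left: "sum f I \<star> y = (\<Sum>i\<in>I. f i \<star> y)"
  by (induction I rule: infinite_finite_induct) (simp_all add: mul_add_left)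
lemma mul_sum_right: "y \<star> sum f I = (\<Sum>i\<in>I. y \<star> f i)"
  by (induction I rule: infinite_finite_induct) (simp_all add: mul_add_right)

lemmas bil = mul_add_left mul_add_right mul_minus_left mul_minus_right mul_diff_left mul_diff_right
  D_mul D_add D_diff D_minus

lemma homD: "ehom T \<Longrightarrow> p < k \<Longrightarrow> q < k \<Longrightarrow> i < k \<Longrightarrow> j < k \<Longrightarrow>
    D p q (T i j) = (if q = i then T p j else 0) - (if j = p then T i q else 0)"
  by (simp add: lu_hom_def)

lemma invD: "invt z \<Longrightarrow> p < k \<Longrightarrow> q < k \<Longrightarrow> D p q z = 0"
  by (simp add: lu_inv_def)

lemma double_zero:
  assumes "x + x = (0::'b)" shows "x = 0"
proof -
  have "scale 2 x = x + x" using scale_left_distrib[of 1 1 x] by simp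
  then show ?thesis using assms by simp
qed

lemma neg_self [simp]: "- x = x \<longleftrightarrow> x = (0::'b)" "x = - x \<longleftrightarrow> x = (0::'b)"
  using double_zero[of x] by (auto simp: eq_neg_iff_add_eq_0) (metis add.right_inverse)

lemma scale_if: "scale (if P then c else 0) x = (if P then scale c x else 0)"
  by simp

lemma ij_lt: "0 < k" "Suc 0 < k" using k2 by auto

text \<open>
  The derivation attached to the idempotent supported on \<open>{i, p}\<close> multiplies both factors by 1, hence
  the product by 2; but a derivation that equals its cube has no eigenvalue 2.
\<close>

lemma weight_zero:
  assumes v: "ehom v" and w: "ehom w" and lt: "i < k" "j < k" "p < k" "q < k"
    and ne: "i \<noteq> j" "p \<noteq> q" "j \<noteq> p" "i \<noteq> q"
  shows "v i j \<star> w p q = 0"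
proof -
  let ?N = "{i, p}" and ?x = "v i j \<star> w p q"
  define d where "d x = (\<Sum>l\<in>?N. D l l x)" for x
  have d_add: "d (x + y) = d x + d y" for x y by (simp add: d_def D_add sum.distrib)
  have "d (v i j) = v i j"
    using lt ne by (cases "i = p") (simp_all add: d_def homD[OF v])
  moreover have "d (w p q) = w p q"
    using lt ne by (cases "i = p") (simp_all add: d_def homD[OF w])
  moreover have "d (x \<star> y) = d x \<star> y + x \<star> d y" for x y
    by (simp add: d_def D_mul sum.distrib mul_sum_left mul_sum_right)
  ultimately have dx: "d ?x = ?x + ?x" by simp
  have "d (d (d ?x)) = d ?x"
    unfolding d_def by (rule D_idem) (use lt in auto)
  then have "(?x + ?x + (?x + ?x)) + (?x + ?x + (?x + ?x)) = ?x + ?x"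
    by (simp add: dx d_add)
  then have "(?x + ?x + ?x) + (?x + ?x + ?x) = 0" by (simp add: algebra_simps)
  then have "?x + ?x + ?x = 0" by (rule double_zero)
  moreover have "scale 3 ?x = ?x + ?x + ?x"
    using scale_left_distrib[of 2 1 ?x] scale_left_distrib[of 1 1 ?x] by simp
  ultimately show ?thesis by simp
qed

text \<open>
  The products \<open>v(e\<^sub>i\<^sub>j) w(e\<^sub>p\<^sub>i)\<close> have the weight of \<open>e\<^sub>p\<^sub>j\<close>, so that weights cannot show that they vanish;
  identity (4) does so for one triple of indices. The symmetric group does not act on \<open>A/J\<close>. The next
  lemmas change the triple by applying derivations to the relation for all \<open>v\<close> and \<open>w\<close>.
\<close>

definition loop_zero :: "nat \<Rightarrow> nat \<Rightarrow> nat \<Rightarrow> bool" where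
  "loop_zero i j p \<longleftrightarrow> i < k \<and> j < k \<and> p < k \<and> i \<noteq> j \<and> i \<noteq> p \<and> j \<noteq> p \<and>
     (\<forall>v w. ehom v \<longrightarrow> ehom w \<longrightarrow> v i j \<star> w p i = 0)"

lemma loop_zeroD: "loop_zero i j p \<Longrightarrow> ehom v \<Longrightarrow> ehom w \<Longrightarrow> v i j \<star> w p i = 0"
  by (simp add: loop_zero_def)

lemma loop_equal:
  assumes X: "loop_zero i j p" and v: "ehom v" and w: "ehom w"
  shows "v i j \<star> w j i = v i p \<star> w p i"
proof -
  have "D j p (v i j \<star> w p i) = 0" using loop_zeroD[OF X v w] by simp
  then show ?thesis using X by (simp add: loop_zero_def bil homD[OF v] homD[OF w])
qed

lemma loop_swap: assumes X: "loop_zero i j p" shows "loop_zero i p j"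
proof -
  have "v i p \<star> w j i = 0" if v: "ehom v" and w: "ehom w" for v w
  proof -
    have "D j p (v i j \<star> w j i - v i p \<star> w p i) = 0" using loop_equal[OF X v w] by simp
    then have "- (v i p \<star> w j i + v i p \<star> w j i) = 0"
      using X by (simp add: loop_zero_def bil homD[OF v] homD[OF w])
    then show ?thesis by simp
  qed
  then show ?thesis using X by (simp add: loop_zero_def)
qed

lemma loop_rotate: assumes X: "loop_zero i j p" shows "loop_zero j i p"
proof -
  have "v j i \<star> w p j = 0" if v: "ehom v" and w: "ehom w" for v w
  proof -
    note s = loop_zero_def bil homD[OF v] homD[OF w]
    have "D j i (v i j \<star> w p i) = 0" using loop_zeroD[OF X v w] by simp
    then have a: "(v j j - v i i) \<star> w p i = 0" using X by (simp add: s)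
    then have "D i j ((v j j - v i i) \<star> w p i) = 0" by simp
    then have "v i j \<star> w p i + v i j \<star> w p i - (v j j - v i i) \<star> w p j = 0"
      using X by (simp add: s algebra_simps)
    then have b: "(v j j - v i i) \<star> w p j = 0" using loop_zeroD[OF X v w] by simp
    then have "D j i ((v j j - v i i) \<star> w p j) = 0" by simp
    then have "- (v j i \<star> w p j + v j i \<star> w p j) - (v j j - v i i) \<star> w p i = 0"
      using X by (simp add: s algebra_simps)
    then show ?thesis using a by simp
  qed
  then show ?thesis using X by (simp add: loop_zero_def)
qed

lemma loop_replace:
  assumes X: "loop_zero i j p" and a: "a < k" "a \<noteq> i" "a \<noteq> p" shows "loop_zero i a p"
proof (cases "a = j")
  case False
  have "v i a \<star> w p i = 0" if v: "ehom v" and w: "ehom w" for v w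
  proof -
    have "D j a (v i j \<star> w p i) = 0" using loop_zeroD[OF X v w] by simp
    then show ?thesis using X a False by (simp add: loop_zero_def bil homD[OF v] homD[OF w])
  qed
  then show ?thesis using X a by (simp add: loop_zero_def)
qed (use X in simp)

lemma loop_zero_all:
  assumes "i < k" "j < k" "p < k" "i \<noteq> j" "i \<noteq> p" "j \<noteq> p"
  shows "loop_zero i j p"
proof -
  have k3: "3 \<le> k" using assms by linarith
  then have X0: "loop_zero 0 1 2" using ident4 by (simp add: loop_zero_def)
  obtain j' p' where X1: "loop_zero i j' p'"
  proof (cases "i = 2")
    case True
    with that[of 0 1] X0 show ?thesis by (blast dest: loop_swap loop_rotate)
  next
    case False
    show ?thesis
    proof (cases "i = 0")
      case True with that X0 show ?thesis by blast
    next
      case i0: False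
      show ?thesis
      proof (cases "i = 1")
        case True with that loop_rotate[OF X0] show ?thesis by blast
      next
        case False
        with loop_replace[OF loop_rotate[OF X0], of i] \<open>i \<noteq> 2\<close> assms(1) have "loop_zero 1 i 2" by blast
        with that show ?thesis by (blast dest: loop_rotate)
      qed
    qed
  qed
  obtain p'' where X2: "loop_zero i j p''"
  proof (cases "j = p'")
    case True with that loop_swap[OF X1] show ?thesis by blast
  next
    case False with that loop_replace[OF X1, of j] assms show ?thesis by blast
  qed
  have "loop_zero i p j" using loop_replace[OF loop_swap[OF X2], of p] assms by blast
  then show ?thesis by (rule loop_swap)
qed

lemma disjoint_zero:
  assumes v: "ehom v" and w: "ehom w" and lt: "i < k" "j < k" "p < k" "q < k"
    and ne: "i \<noteq> j" "p \<noteq> q" "j \<noteq> p"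
  shows "v i j \<star> w p q = 0"
proof (cases "q = i")
  case True
  then show ?thesis using loop_zeroD[OF loop_zero_all, of i j p v w] assms by auto
qed (use weight_zero assms in auto)

text \<open>
  The equivariant map with \<open>v(a) w(b) = S v w (ab)\<close>. At \<open>e\<^sub>i\<^sub>i\<close> it has to be \<open>v(e\<^sub>i\<^sub>j) w(e\<^sub>j\<^sub>i)\<close> for any \<open>j \<noteq> i\<close>,
  and the smallest such \<open>j\<close> is chosen. At \<open>e\<^sub>i\<^sub>l\<close> with \<open>i \<noteq> l\<close> it has to be \<open>v(e\<^sub>i\<^sub>i - e\<^sub>l\<^sub>l) w(e\<^sub>i\<^sub>l)\<close>; the product
  \<open>v(e\<^sub>i\<^sub>j) w(e\<^sub>j\<^sub>l)\<close> would need a third index, which does not exist for \<open>k = 2\<close>.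
\<close>

definition S :: "(nat \<Rightarrow> nat \<Rightarrow> 'b) \<Rightarrow> (nat \<Rightarrow> nat \<Rightarrow> 'b) \<Rightarrow> nat \<Rightarrow> nat \<Rightarrow> 'b" where
  "S v w i l = (if i = l then v i (if i = 0 then 1 else 0) \<star> w (if i = 0 then 1 else 0) i
     else (v i i - v l l) \<star> w i l)"

context
  fixes v w assumes v: "ehom v" and w: "ehom w"
begin

lemmas vw = bil homD[OF v] homD[OF w]

text \<open>
  This and the following relations come from one derivation applied to a product that is already known.
  Diagonal units occur only in differences, since only their values on \<open>sl\<^sub>k\<close> are determined.
\<close>

lemma diag_zero1:
  assumes "i < k" "j < k" "q < k" "i \<noteq> j" "i \<noteq> q" "j \<noteq> q"
  shows "(v q q - v j j) \<star> w i q = 0"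
proof -
  have "D q j (v j q \<star> w i q) = 0" using disjoint_zero[OF v w, of j q i q] assms by simp
  then have "(v q q - v j j) \<star> w i q - v j q \<star> w i j = 0" using assms by (simp add: vw)
  then show ?thesis using disjoint_zero[OF v w, of j q i j] assms by simp
qed

lemma unit_unit:
  assumes "i < k" "j < k" "l < k" "i \<noteq> j" "i \<noteq> l" "j \<noteq> l"
  shows "v i j \<star> w j l = S v w i l" "(v i i - v j j) \<star> w i l = S v w i l"
proof -
  have "D j i (v i j \<star> w i l) = 0" using disjoint_zero[OF v w, of i j i l] assms by simp
  then have a: "v i j \<star> w j l = (v i i - v j j) \<star> w i l"
    using assms by (simp add: vw algebra_simps)
  have "(v i i - v j j) \<star> w i l = (v i i - v l l) \<star> w i l + (v l l - v j j) \<star> w i l"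
    by (simp add: bil)
  then show "(v i i - v j j) \<star> w i l = S v w i l"
    using diag_zero1[of i j l] assms by (simp add: S_def)
  then show "v i j \<star> w j l = S v w i l" using a by simp
qed

lemma left_diag:
  assumes "i < k" "j < k" "l < k" "i \<noteq> j" "i \<noteq> l"
  shows "(v i i - v j j) \<star> w i l = S v w i l"
  using unit_unit(2)[of i j l] assms by (cases "j = l") (auto simp: S_def)

lemma left_diag_zero:
  assumes "i < k" "l < k" "a < k" "b < k" "i \<noteq> l" "a \<noteq> i" "b \<noteq> i"
  shows "(v a a - v b b) \<star> w i l = 0"
proof -
  have "(v a a - v b b) \<star> w i l = (v i i - v b b) \<star> w i l - (v i i - v a a) \<star> w i l"
    by (simp add: bil)
  then show ?thesis using left_diag[of i b l] left_diag[of i a l] assms by simp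
qed

lemma loop_S:
  assumes "i < k" "j < k" "i \<noteq> j"
  shows "v i j \<star> w j i = S v w i i"
proof -
  let ?o = "if i = 0 then 1 else 0 :: nat"
  have o: "?o < k" "?o \<noteq> i" using ij_lt by auto
  show ?thesis
  proof (cases "j = ?o")
    case True then show ?thesis by (simp add: S_def)
  next
    case False
    then have "loop_zero i j ?o" using assms o by (intro loop_zero_all) auto
    from loop_equal[OF this v w] show ?thesis by (simp add: S_def)
  qed
qed

lemma right_diag:
  assumes "i < k" "j < k" "l < k" "i \<noteq> l" "j \<noteq> l"
  shows "v i l \<star> (w l l - w j j) = S v w i l"
proof (cases "j = i")
  case True
  have "D l i (v i l \<star> w i l) = 0" using disjoint_zero[OF v w, of i l i l] assms by simp
  then have "(v l l - v i i) \<star> w i l + v i l \<star> (w l l - w i i) = 0"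
    using assms by (simp add: vw)
  then show ?thesis using True assms by (simp add: S_def bil algebra_simps)
next
  case False
  have "D l j (v i l \<star> w j l) = 0" using disjoint_zero[OF v w, of i l j l] assms by simp
  then have "v i l \<star> (w l l - w j j) = v i j \<star> w j l"
    using assms False by (simp add: vw algebra_simps)
  then show ?thesis using unit_unit(1)[of i j l] assms False by simp
qed

lemma right_diag_zero:
  assumes "i < k" "l < k" "a < k" "b < k" "i \<noteq> l" "a \<noteq> l" "b \<noteq> l"
  shows "v i l \<star> (w a a - w b b) = 0"
proof -
  have "v i l \<star> (w a a - w b b) = v i l \<star> (w l l - w b b) - v i l \<star> (w l l - w a a)"
    by (simp add: bil)
  then show ?thesis using right_diag[of i b l] right_diag[of i a l] assms by simp
qed

text \<open>
  Both sides of \<open>v(e\<^sub>i\<^sub>l) w(e\<^sub>l\<^sub>l - e\<^sub>i\<^sub>i) = v(e\<^sub>i\<^sub>i - e\<^sub>l\<^sub>l) w(e\<^sub>i\<^sub>l)\<close> are hit by \<open>D l i\<close>; the unknown product appears once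
  on either side with opposite signs.
\<close>

lemma diag_square:
  assumes "i < k" "l < k" "i \<noteq> l"
  shows "(v i i - v l l) \<star> (w i i - w l l) = S v w i i + S v w l l"
proof -
  let ?Y = "(v i i - v l l) \<star> (w i i - w l l)"
  have "D l i (v i l \<star> (w l l - w i i)) = D l i ((v i i - v l l) \<star> w i l)"
    using right_diag[of i i l] left_diag[of i l l] assms by simp
  then have "?Y - (v i l \<star> w l i + v i l \<star> w l i) = v l i \<star> w i l + v l i \<star> w i l - ?Y"
    using assms by (simp add: vw algebra_simps)
  then have "(?Y - S v w i i - S v w l l) + (?Y - S v w i i - S v w l l) = 0"
    using loop_S[of i l] loop_S[of l i] assms by (simp add: algebra_simps)
  from double_zero[OF this] show ?thesis by (simp add: algebra_simps)
qed

text \<open>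
  \<open>S v w\<close> is written as a product in a way adapted to the derivation, using that \<open>e\<^sub>i\<^sub>i\<close> admits every
  intermediate index.
\<close>

lemma S_hom: "ehom (S v w)"
  unfolding lu_hom_def
proof (intro allI impI)
  fix p q i l assume lt: "p < k" "q < k" "i < k" "l < k"
  show "D p q (S v w i l) = (if q = i then S v w p l else 0) - (if l = p then S v w i q else 0)"
  proof (cases "i = l")
    case True
    have e: "S v w i i = v i j \<star> w j i" if "j < k" "j \<noteq> i" for j using loop_S[of i j] that lt by simp
    obtain o' where o': "o' < k" "o' \<noteq> i" using ij_lt by (cases "i = 0") auto
    consider "p = i" "q = i" | "q = i" "p \<noteq> i" | "p = i" "q \<noteq> i" | "p \<noteq> i" "q \<noteq> i" by blast
    then show ?thesis
    proof cases
      case 1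
      have "D i i (S v w i i) = 0" using lt o' by (subst e[OF o']) (simp add: vw)
      then show ?thesis using 1 True by simp
    next
      case 2
      have "D p q (S v w i i) = (v p p - v i i) \<star> w p i"
        using 2 lt by (subst e[of p]) (simp_all add: vw)
      then show ?thesis using 2 True left_diag[of p i i] lt by simp
    next
      case 3
      have "D p q (S v w i i) = v i q \<star> (w i i - w q q)"
        using 3 lt by (subst e[of q]) (simp_all add: vw)
      also have "\<dots> = - (v i q \<star> (w q q - w i i))" by (simp add: bil)
      finally show ?thesis using 3 True right_diag[of i i q] lt by simp
    next
      case 4
      have "D p q (S v w i i) = 0"
        using 4 lt disjoint_zero[OF v w, of i q p i] by (subst e[of p]) (auto simp: vw)
      then show ?thesis using 4 True by simp
    qed
  next
    case il: False
    have e: "S v w i l = (v i i - v l l) \<star> w i l" using il by (simp add: S_def)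
    note dz = disjoint_zero[OF v w]
    consider "q = i" "p = l" | "q = i" "p = i" | "q = i" "p \<noteq> i" "p \<noteq> l" | "p = l" "q = l"
      | "p = l" "q \<noteq> i" "q \<noteq> l" | "q \<noteq> i" "p \<noteq> l" by blast
    then show ?thesis
    proof cases
      case 1
      have "D p q (S v w i l) = v l i \<star> w i l + v l i \<star> w i l - (v i i - v l l) \<star> (w i i - w l l)"
        unfolding e using 1 lt il by (simp add: vw algebra_simps)
      then show ?thesis using 1 diag_square[of i l] loop_S[of l i] lt il by simp
    next
      case 2
      have "D p q (S v w i l) = (v i i - v l l) \<star> w i l"
        unfolding e using 2 lt il by (simp add: vw)
      then show ?thesis using 2 il e by simp
    next
      case 3
      have "D p q (S v w i l) = v p i \<star> w i l + (v i i - v l l) \<star> w p l"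
        unfolding e using 3 lt il by (simp add: vw)
      then show ?thesis using 3 unit_unit(1)[of p i l] left_diag_zero[of p l i l] lt il by simp
    next
      case 4
      have "D p q (S v w i l) = - ((v i i - v l l) \<star> w i l)"
        unfolding e using 4 lt il by (simp add: vw)
      then show ?thesis using 4 il e by simp
    next
      case 5
      have "D p q (S v w i l) = v l q \<star> w i l - (v i i - v l l) \<star> w i q"
        unfolding e using 5 lt il by (simp add: vw)
      then show ?thesis using 5 dz[of l q i l] left_diag[of i l q] lt il by auto
    next
      case 6
      have "D p q (S v w i l) = 0"
        unfolding e using 6 lt il dz[of i q i l] dz[of p l i l] by (auto simp: vw)
      then show ?thesis using 6 by auto
    qed
  qed
qed

lemma prod_unit_unit:
  assumes "i < k" "j < k" "p < k" "q < k" "i \<noteq> j" "p \<noteq> q"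
  shows "v i j \<star> w p q = (if j = p then S v w i q else 0)"
  using disjoint_zero[OF v w, of i j p q] unit_unit(1)[of i j q] loop_S[of i j] assms by auto

lemma prod_diag_unit:
  assumes "i < k" "j < k" "p < k" "q < k" "i \<noteq> j" "p \<noteq> q"
  shows "(v i i - v j j) \<star> w p q = (if i = p then S v w p q else 0) - (if j = p then S v w p q else 0)"
proof (cases "j = p")
  case True
  have "(v i i - v j j) \<star> w p q = - ((v j j - v i i) \<star> w p q)" by (simp add: bil)
  then show ?thesis using True left_diag[of j i q] assms by auto
next
  case False
  then show ?thesis using left_diag[of i j q] left_diag_zero[of p q i j] assms by auto
qed

lemma prod_unit_diag:
  assumes "i < k" "j < k" "p < k" "q < k" "i \<noteq> j" "p \<noteq> q"
  shows "v i j \<star> (w p p - w q q) = (if j = p then S v w i j else 0) - (if j = q then S v w i j else 0)"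
proof (cases "j = q")
  case True
  have "v i j \<star> (w p p - w q q) = - (v i j \<star> (w q q - w p p))" by (simp add: bil)
  then show ?thesis using True right_diag[of i p j] assms by auto
next
  case False
  then show ?thesis using right_diag[of i q j] right_diag_zero[of i j p q] assms by auto
qed

lemma prod_diag_diag:
  assumes "i < k" "j < k" "p < k" "q < k" "i \<noteq> j" "p \<noteq> q"
  shows "(v i i - v j j) \<star> (w p p - w q q) =
    (if i = p then S v w i i else 0) - (if i = q then S v w i i else 0)
    - ((if j = p then S v w j j else 0) - (if j = q then S v w j j else 0))"
proof -
  note Sd = homD[OF S_hom]
  have dw: "D j i (w p p) = (if i = p then w j i else 0) - (if p = j then w j i else 0)"
    "D j i (w q q) = (if i = q then w j i else 0) - (if q = j then w j i else 0)"
    using assms by (auto simp: homD[OF w])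
  have "D j i (v i j \<star> (w p p - w q q)) =
      (v j j - v i i) \<star> (w p p - w q q) + v i j \<star> (D j i (w p p) - D j i (w q q))"
    using assms by (simp add: D_mul D_diff homD[OF v])
  moreover have "D j i (v i j \<star> (w p p - w q q)) =
      D j i ((if j = p then S v w i j else 0) - (if j = q then S v w i j else 0))"
    using prod_unit_diag[OF assms] by simp
  moreover have "D j i ((if j = p then S v w i j else 0) - (if j = q then S v w i j else 0)) =
      (if j = p then S v w j j - S v w i i else 0) - (if j = q then S v w j j - S v w i i else 0)"
    using assms by (simp add: D_diff Sd)
  ultimately have "(v j j - v i i) \<star> (w p p - w q q) + v i j \<star> ((if i = p then w j i else 0) - (if p = j then w j i else 0)
       - ((if i = q then w j i else 0) - (if q = j then w j i else 0))) =
      (if j = p then S v w j j - S v w i i else 0) - (if j = q then S v w j j - S v w i i else 0)"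
    by (simp only: dw)
  then have "(v i i - v j j) \<star> (w p p - w q q) = v i j \<star> ((if i = p then w j i else 0) - (if p = j then w j i else 0)
       - ((if i = q then w j i else 0) - (if q = j then w j i else 0))) -
      ((if j = p then S v w j j - S v w i i else 0) - (if j = q then S v w j j - S v w i i else 0))"
    by (simp add: mul_diff_left algebra_simps)
  also have "\<dots> = (if i = p then S v w i i else 0) - (if i = q then S v w i i else 0)
    - ((if j = p then S v w j j else 0) - (if j = q then S v w j j else 0))"
    using loop_S[of i j] assms by (auto simp: bil)
  finally show ?thesis .
qed

end

text \<open>
  \<open>e\<^sub>1\<^sub>1\<close> generates \<open>M\<^sub>k\<close> as an \<open>L\<close>-module.
\<close>

lemma hom_zero_of_diag:
  assumes T: "ehom T" and z: "T 0 0 = 0" and ij: "i < k" "j < k"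
  shows "T i j = 0"
proof -
  have row: "T 0 j = 0" if "j < k" for j
  proof (cases "j = 0")
    case False
    have "D 0 j (T 0 0) = 0" using z by simp
    then show ?thesis using False that ij_lt by (simp add: homD[OF T])
  qed (simp add: z)
  show ?thesis
  proof (cases "i = 0")
    case False
    have "D i 0 (T 0 j) = 0" using row ij by simp
    then show ?thesis using False ij ij_lt z by (simp add: homD[OF T] split: if_splits)
  qed (use row ij in simp)
qed

text \<open>Identity (3) is the equality at \<open>e\<^sub>1\<^sub>1\<close>.\<close>

lemma S_sym:
  assumes v: "ehom v" and w: "ehom w" and ij: "i < k" "j < k"
  shows "S v w i j = S w v i j"
proof -
  let ?T = "\<lambda>i j. S v w i j - S w v i j"
  have "ehom ?T"
    using S_hom[OF v w] S_hom[OF w v] by (auto simp: lu_hom_def D_diff)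
  moreover have "?T 0 0 = 0" using ident3[OF v w] by (simp add: S_def)
  ultimately show ?thesis using hom_zero_of_diag[of ?T i j] ij by simp
qed

text \<open>
  \<open>e\<^sub>1\<^sub>2\<close> generates \<open>sl\<^sub>k\<close> as an \<open>L\<close>-module, so that the map vanishes on traceless matrices.
\<close>

lemma hom_zero_of_unit:
  assumes T: "ehom T" and z: "T 0 1 = 0" and ij: "i < k" "j < k" "i \<noteq> j"
  shows "T i j = 0" "T i i = T j j"
proof -
  note s = homD[OF T] ij_lt D_diff
  have lt1: "1 < k" using k2 by simp
  have "D 1 0 (T 0 1) = 0" using z by simp
  then have a: "T 1 1 - T 0 0 = 0" using lt1 by (simp add: s)
  then have "D 1 0 (T 1 1 - T 0 0) = 0" by simp
  then have "- (T 1 0 + T 1 0) = 0" using lt1 by (simp add: s algebra_simps)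
  then have b: "T 1 0 = 0" by simp
  have c1: "T i 1 = 0" if "i < k" "i \<noteq> 1" for i
  proof (cases "i = 0")
    case False
    have "D i 0 (T 0 1) = 0" using z by simp
    then show ?thesis using False that lt1 by (simp add: s)
  qed (use z in simp)
  have c0: "T i 0 = 0" if "i < k" "i \<noteq> 0" for i
  proof (cases "i = 1")
    case False
    have "D i 1 (T 1 0) = 0" using b by simp
    then show ?thesis using False that lt1 by (simp add: s)
  qed (use b in simp)
  have off: "T i j = 0" if "i < k" "j < k" "i \<noteq> j" for i j
  proof (cases "j \<le> 1")
    case True then show ?thesis using c0[of i] c1[of i] that by (cases "j = 0") (auto simp: le_Suc_eq)
  next
    case False
    define a where "a = (if i = 0 then 1 else 0 :: nat)"
    have "T i a = 0" using c0[of i] c1[of i] that by (auto simp: a_def)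
    then have "D a j (T i a) = 0" by simp
    then show ?thesis using False that lt1 by (auto simp: s a_def split: if_splits)
  qed
  show "T i j = 0" using off ij by blast
  then have "D j i (T i j) = 0" by simp
  then show "T i i = T j j" using ij by (simp add: s)
qed

text \<open>
  Identity (2) is the equality at \<open>e\<^sub>1\<^sub>2\<close> of two equivariant maps.
\<close>

lemma inv_commute:
  assumes z: "invt z" and v: "ehom v" and ij: "i < k" "j < k" "i \<noteq> j"
  shows "z \<star> v i j = v i j \<star> z" "z \<star> (v i i - v j j) = (v i i - v j j) \<star> z"
proof -
  let ?T = "\<lambda>i j. z \<star> v i j - v i j \<star> z"
  have T: "ehom ?T"
    using v by (auto simp: lu_hom_def bil invD[OF z])
  have "?T 0 1 = 0" using ident2[OF z v] by simp
  from hom_zero_of_unit[OF T this ij] show "z \<star> v i j = v i j \<star> z"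
    "z \<star> (v i i - v j j) = (v i i - v j j) \<star> z" by (simp_all add: bil algebra_simps)
qed

lemma hom_mul_inv: "invt z \<Longrightarrow> ehom v \<Longrightarrow> ehom (\<lambda>i j. v i j \<star> z)"
  "invt z \<Longrightarrow> ehom v \<Longrightarrow> ehom (\<lambda>i j. z \<star> v i j)"
  by (auto simp: lu_hom_def bil invD)

lemma inv_mul: "invt z \<Longrightarrow> invt z' \<Longrightarrow> invt (z \<star> z')"
  by (simp add: lu_inv_def bil)

text \<open>
  If the second factor is itself of the form \<open>S u u'\<close>, the product rule holds on all of \<open>M\<^sub>k\<close> and not just
  on \<open>sl\<^sub>k\<close>: a diagonal value \<open>T(e\<^sub>p\<^sub>p)\<close> is a product \<open>u(e\<^sub>p\<^sub>m) u'(e\<^sub>m\<^sub>p)\<close>, and associativity lets \<open>v\<close> act on its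
  first factor.
\<close>

lemma prod_S_unit:
  assumes v: "ehom v" and u: "ehom u" "ehom u'" and lt: "i < k" "j < k" "p < k" "q < k" and ne: "i \<noteq> j"
  defines "T \<equiv> S u u'"
  shows "v i j \<star> T p q = (if j = p then S v T i q else 0)"
proof -
  have T: "ehom T" unfolding T_def by (rule S_hom[OF u])
  have off: "v i j \<star> T p p = 0" if "p < k" "p \<noteq> j" for p
  proof -
    define m where "m = (if p = 0 then 1 else 0 :: nat)"
    have m: "m < k" "m \<noteq> p" using ij_lt by (auto simp: m_def)
    have "T p p = u p m \<star> u' m p" using loop_S[OF u, of p m] m that by (simp add: T_def)
    then have "v i j \<star> T p p = (v i j \<star> u p m) \<star> u' m p" by (simp add: mul_assoc)
    then show ?thesis using prod_unit_unit[OF v u(1), of i j p m] that lt ne m by simp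
  qed
  show ?thesis
  proof (cases "p = q")
    case False
    then show ?thesis using prod_unit_unit[OF v T, of i j p q] lt ne by simp
  next
    case True
    show ?thesis
    proof (cases "p = j")
      case pj: True
      have "v i j \<star> T j j = v i j \<star> (T j j - T i i) + v i j \<star> T i i" by (simp add: bil)
      then show ?thesis using pj True off[of i] prod_unit_diag[OF v T, of i j j i] lt ne by simp
    qed (use True off[of p] lt in simp)
  qed
qed

lemma prod_S_diag:
  assumes v: "ehom v" and u: "ehom u" "ehom u'" and lt: "i < k" "j < k" "p < k" "q < k" and ne: "i \<noteq> j"
  defines "T \<equiv> S u u'"
  shows "(v i i - v j j) \<star> T p q = (if i = p then S v T p q else 0) - (if j = p then S v T p q else 0)"
proof -
  have T: "ehom T" unfolding T_def by (rule S_hom[OF u])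
  show ?thesis
  proof (cases "p = q")
    case False
    then show ?thesis using prod_diag_unit[OF v T, of i j p q] lt ne by simp
  next
    case True
    define m where "m = (if p = 0 then 1 else 0 :: nat)"
    have m: "m < k" "m \<noteq> p" "p \<noteq> m" using ij_lt by (auto simp: m_def)
    have Tpp: "T p p = u p m \<star> u' m p" using loop_S[OF u, of p m] m lt by (simp add: T_def)
    have Tmp: "T m p = (u m m - u p p) \<star> u' m p" using m by (simp add: T_def S_def)
    have "S v T p p = v p m \<star> T m p" using loop_S[OF v T, of p m] m lt by simp
    also have "\<dots> = (v p m \<star> (u m m - u p p)) \<star> u' m p" by (simp add: Tmp mul_assoc)
    also have "v p m \<star> (u m m - u p p) = S v u p m"
      using prod_unit_diag[OF v u(1), of p m m p] m lt by simp
    finally have S: "S v T p p = S v u p m \<star> u' m p" .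
    have "(v i i - v j j) \<star> T p p = ((v i i - v j j) \<star> u p m) \<star> u' m p" by (simp add: Tpp mul_assoc)
    also have "(v i i - v j j) \<star> u p m = (if i = p then S v u p m else 0) - (if j = p then S v u p m else 0)"
      using m lt ne by (intro prod_diag_unit[OF v u(1)])
    finally show ?thesis
      using True S ne by (auto simp: mul_minus_left)
  qed
qed

section \<open>Words as functions of the product of matrices\<close>

text \<open>
  The value at \<open>M\<close> of the linear map with values \<open>T i j\<close> at the matrix units.
\<close>

definition app :: "(nat \<Rightarrow> nat \<Rightarrow> 'b) \<Rightarrow> 'a mat \<Rightarrow> 'b" where
  "app T M = (\<Sum>i<k. \<Sum>j<k. scale (M $$ (i, j)) (T i j))"

text \<open>
  The value of \<open>v\<close> at the basis matrix \<open>fb k p q\<close> of \<open>sl\<^sub>k\<close>, written without division or \<^term>\<open>app\<close>.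
\<close>

definition bval :: "(nat \<Rightarrow> nat \<Rightarrow> 'b) \<Rightarrow> nat \<times> nat \<Rightarrow> 'b" where
  "bval v \<beta> = (if fst \<beta> = snd \<beta> then v (fst \<beta>) (fst \<beta>) - v (k - 1) (k - 1) else v (fst \<beta>) (snd \<beta>))"

abbreviation bmat :: "nat \<times> nat \<Rightarrow> 'a mat" where
  "bmat \<beta> \<equiv> fb k (fst \<beta>) (snd \<beta>)"

lemma app_cong: "(\<And>i j. i < k \<Longrightarrow> j < k \<Longrightarrow> T i j = T' i j) \<Longrightarrow> app T M = app T' M"
  by (simp add: app_def)

lemma app_bmat: "\<beta> \<in> fb_index k \<Longrightarrow> app T (bmat \<beta>) = bval T \<beta>"
proof -
  assume b: "\<beta> \<in> fb_index k"
  obtain p q where pq: "\<beta> = (p, q)" by fastforce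
  have lt: "p < k" "q < k" using b by (auto simp: pq fb_index_def)
  have eu: "(\<Sum>i<k. \<Sum>j<k. scale (if i = a \<and> j = b then 1 else 0) (T i j)) = T a b" if "a < k" "b < k" for a b
  proof -
    have "(\<Sum>i<k. \<Sum>j<k. scale (if i = a \<and> j = b then 1 else 0) (T i j)) =
        (\<Sum>i<k. if i = a then (\<Sum>j<k. if j = b then T i j else 0) else 0)"
    proof (rule sum.cong[OF refl])
      fix i
      show "(\<Sum>j<k. scale (if i = a \<and> j = b then 1 else 0) (T i j)) =
          (if i = a then (\<Sum>j<k. if j = b then T i j else 0) else 0)"
        by (cases "i = a") (simp_all add: scale_if)
    qed
    then show ?thesis using that by simp
  qed
  show ?thesis
  proof (cases "p = q")
    case True
    have "app T (bmat \<beta>) = (\<Sum>i<k. \<Sum>j<k. scale (if i = p \<and> j = p then 1 else 0) (T i j)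
        - scale (if i = k - 1 \<and> j = k - 1 then 1 else 0) (T i j))"
      unfolding app_def using True
      by (intro sum.cong refl) (simp add: pq fb_entry scale_left_diff_distrib)
    also have "\<dots> = T p p - T (k - 1) (k - 1)"
      using eu[of p p] eu[of "k - 1" "k - 1"] lt ij_lt by (simp add: sum_subtractf)
    finally show ?thesis using True by (simp add: pq bval_def)
  next
    case False
    have "app T (bmat \<beta>) = (\<Sum>i<k. \<Sum>j<k. scale (if i = p \<and> j = q then 1 else 0) (T i j))"
      unfolding app_def using False by (intro sum.cong refl) (simp add: pq fb_entry)
    then show ?thesis using eu[of p q] lt False by (simp add: pq bval_def)
  qed
qed

lemma app_bmat_mult:
  assumes b: "(p, q) \<in> fb_index k" and M: "M \<in> carrier_mat k k"
  shows "app T (fb k p q * M) = (if p = q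
    then (\<Sum>j<k. scale (M $$ (p, j)) (T p j)) - (\<Sum>j<k. scale (M $$ (k - 1, j)) (T (k - 1) j))
    else (\<Sum>j<k. scale (M $$ (q, j)) (T p j)))"
proof -
  have lt: "p < k" "q < k" "k - 1 < k" using b by (auto simp: fb_index_def)
  have row: "(\<Sum>i<k. \<Sum>j<k. scale (if i = a then M $$ (c, j) else 0) (T i j)) = (\<Sum>j<k. scale (M $$ (c, j)) (T a j))"
    if "a < k" for a c
  proof -
    have "(\<Sum>i<k. \<Sum>j<k. scale (if i = a then M $$ (c, j) else 0) (T i j)) =
       (\<Sum>i<k. if i = a then (\<Sum>j<k. scale (M $$ (c, j)) (T i j)) else 0)"
      by (rule sum.cong[OF refl]) simp
    then show ?thesis using that by simp
  qed
  show ?thesis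
  proof (cases "p = q")
    case True
    have "fb k p q * M = eu k p p * M - eu k (k - 1) (k - 1) * M"
      using True M by (simp add: fb_def minus_mult_distrib_mat[of _ k k])
    then have "app T (fb k p q * M) = (\<Sum>i<k. \<Sum>j<k. scale (if i = p then M $$ (p, j) else 0) (T i j)
        - scale (if i = k - 1 then M $$ (k - 1, j) else 0) (T i j))"
      unfolding app_def using M lt
      by (intro sum.cong refl) (simp add: eu_mult_entry scale_left_diff_distrib del: index_mult_mat(1))
    then show ?thesis using row[of p p] row[of "k - 1" "k - 1"] lt True by (simp add: sum_subtractf)
  next
    case False
    then have "app T (fb k p q * M) = (\<Sum>i<k. \<Sum>j<k. scale (if i = p then M $$ (q, j) else 0) (T i j))"
      unfolding app_def using M lt by (intro sum.cong refl) (simp add: eu_mult_entry fb_def del: index_mult_mat(1))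
    then show ?thesis using row[of p q] lt False by simp
  qed
qed

text \<open>
  The product rule \<open>v(a) w(b) = S v w (ab)\<close>, in the basis of \<open>sl\<^sub>k\<close>.
\<close>

lemma bval_bval:
  assumes v: "ehom v" and w: "ehom w" and b: "\<beta> \<in> fb_index k" and g: "\<gamma> \<in> fb_index k"
  shows "bval v \<beta> \<star> bval w \<gamma> = app (S v w) (bmat \<beta> * bmat \<gamma>)"
proof -
  obtain p q r s where pq: "\<beta> = (p, q)" and rs: "\<gamma> = (r, s)" by (metis surj_pair)
  let ?l = "k - 1"
  have lt: "p < k" "q < k" "r < k" "s < k" "?l < k" using b g by (auto simp: pq rs fb_index_def)
  have ne: "p = q \<Longrightarrow> p \<noteq> ?l" "r = s \<Longrightarrow> r \<noteq> ?l" using b g by (auto simp: pq rs fb_index_def)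
  have row: "(\<Sum>j<k. scale ((fb k r s :: 'a mat) $$ (a, j)) (f j)) =
     (if r = s then (if a = r then f a else 0) - (if a = ?l then f a else 0) else (if a = r then f s else 0))"
    if "a < k" for a and f :: "nat \<Rightarrow> 'b"
  proof -
    have "(\<Sum>j<k. scale ((fb k r s :: 'a mat) $$ (a, j)) (f j)) =
      (\<Sum>j<k. (if j = s then (if a = r then f j else 0) else 0) - (if j = ?l then (if r = s \<and> a = ?l then f j else 0) else 0))"
      using that by (intro sum.cong refl) (auto simp: fb_entry scale_left_diff_distrib)
    also have "\<dots> = (if a = r then f s else 0) - (if r = s \<and> a = ?l then f ?l else 0)"
      using lt by (simp add: sum_subtractf)
    finally show ?thesis by auto
  qed
  note P = prod_unit_unit[OF v w] prod_diag_unit[OF v w] prod_unit_diag[OF v w] prod_diag_diag[OF v w]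
  have b': "(p, q) \<in> fb_index k" using b pq by simp
  have "app (S v w) (bmat \<beta> * bmat \<gamma>) = (if p = q
    then (\<Sum>j<k. scale ((fb k r s :: 'a mat) $$ (p, j)) (S v w p j)) - (\<Sum>j<k. scale ((fb k r s :: 'a mat) $$ (?l, j)) (S v w ?l j))
    else (\<Sum>j<k. scale ((fb k r s :: 'a mat) $$ (q, j)) (S v w p j)))"
    unfolding pq rs fst_conv snd_conv by (rule app_bmat_mult[OF b' fb_carrier])
  then show ?thesis
    using lt ne by (simp add: row) (auto simp: pq rs bval_def P)
qed

lemma bval_app_S:
  assumes v: "ehom v" and u: "ehom u" "ehom u'" and b: "\<beta> \<in> fb_index k" and M: "M \<in> carrier_mat k k"
  shows "bval v \<beta> \<star> app (S u u') M = app (S v (S u u')) (bmat \<beta> * M)"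
proof -
  obtain p q where pq: "\<beta> = (p, q)" by fastforce
  let ?l = "k - 1" and ?T = "S v (S u u')"
  have lt: "p < k" "q < k" "?l < k" using b by (auto simp: pq fb_index_def)
  have ne: "p = q \<Longrightarrow> p \<noteq> ?l" using b by (auto simp: pq fb_index_def)
  have b': "(p, q) \<in> fb_index k" using b pq by simp
  have exp: "bval v \<beta> \<star> app (S u u') M = (\<Sum>i<k. \<Sum>j<k. scale (M $$ (i, j)) (bval v \<beta> \<star> S u u' i j))"
    by (simp add: app_def mul_sum_right mul_scale_right)
  show ?thesis
  proof (cases "p = q")
    case True
    have "(\<Sum>i<k. \<Sum>j<k. scale (M $$ (i, j)) (bval v \<beta> \<star> S u u' i j)) =
       (\<Sum>i<k. (if i = p then (\<Sum>j<k. scale (M $$ (i, j)) (?T i j)) else 0) - (if i = ?l then (\<Sum>j<k. scale (M $$ (i, j)) (?T i j)) else 0))"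
      using lt ne True
      by (intro sum.cong refl) (auto simp: pq bval_def prod_S_diag[OF v u] sum_negf scale_right_diff_distrib)
    also have "\<dots> = (\<Sum>j<k. scale (M $$ (p, j)) (?T p j)) - (\<Sum>j<k. scale (M $$ (?l, j)) (?T ?l j))"
      using lt by (simp add: sum_subtractf)
    finally show ?thesis unfolding exp using app_bmat_mult[OF b' M] True by (simp add: pq)
  next
    case False
    have "(\<Sum>i<k. \<Sum>j<k. scale (M $$ (i, j)) (bval v \<beta> \<star> S u u' i j)) =
       (\<Sum>i<k. if i = q then (\<Sum>j<k. scale (M $$ (i, j)) (?T p j)) else 0)"
      using lt False by (intro sum.cong refl) (auto simp: pq bval_def prod_S_unit[OF v u])
    also have "\<dots> = (\<Sum>j<k. scale (M $$ (q, j)) (?T p j))"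
      using lt by simp
    finally show ?thesis unfolding exp using app_bmat_mult[OF b' M] False by (simp add: pq)
  qed
qed

lemma bval_hom_mul: "bval (\<lambda>i j. z \<star> v i j) \<beta> = z \<star> bval v \<beta>" "bval (\<lambda>i j. v i j \<star> z) \<beta> = bval v \<beta> \<star> z"
  by (simp_all add: bval_def bil)

lemma app_mul: "app (\<lambda>i j. z \<star> T i j) M = z \<star> app T M"
  by (simp add: app_def mul_sum_right mul_scale_right)

lemma inv_bval:
  assumes "invt z" "ehom v" "\<beta> \<in> fb_index k"
  shows "z \<star> bval v \<beta> = bval v \<beta> \<star> z"
proof -
  have "fst \<beta> < k" "snd \<beta> < k" "k - 1 < k" "fst \<beta> = snd \<beta> \<Longrightarrow> fst \<beta> \<noteq> k - 1"
    using assms(3) by (auto simp: fb_index_def)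
  then show ?thesis unfolding bval_def
    using inv_commute(1)[OF assms(1,2)] inv_commute(2)[OF assms(1,2)] by auto
qed

end

text \<open>
  Words in letters \<open>(t, \<beta>)\<close>. The label \<open>t\<close> stands for an invariant or for an equivariant map, and \<open>\<beta>\<close>
  indexes the basis matrix at which the map is taken. An invariant has the identity as its matrix.
\<close>

locale lu_words = lu_core scale mul D k
  for scale :: "'a::field_char_0 \<Rightarrow> 'b::ab_group_add \<Rightarrow> 'b" and mul (infixr "\<star>" 70) and D k +
  fixes is_inv :: "'t \<Rightarrow> bool" and zz :: "'t \<Rightarrow> 'b" and vv :: "'t \<Rightarrow> nat \<Rightarrow> nat \<Rightarrow> 'b"
  assumes zz_inv: "is_inv t \<Longrightarrow> lu_inv k D (zz t)"
    and vv_hom: "\<not> is_inv t \<Longrightarrow> lu_hom k D (vv t)"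
begin

definition valid :: "('t \<times> nat \<times> nat) list \<Rightarrow> bool" where
  "valid ws \<longleftrightarrow> (\<forall>x\<in>set ws. \<not> is_inv (fst x) \<longrightarrow> snd x \<in> fb_index k)"

definition ival :: "'t \<times> nat \<times> nat \<Rightarrow> 'b" where
  "ival x = (if is_inv (fst x) then zz (fst x) else bval (vv (fst x)) (snd x))"

definition imat :: "'t \<times> nat \<times> nat \<Rightarrow> 'a mat" where
  "imat x = (if is_inv (fst x) then 1\<^sub>m k else bmat (snd x))"

fun wval :: "('t \<times> nat \<times> nat) list \<Rightarrow> 'b" where
  "wval [] = 0"
| "wval [x] = ival x"
| "wval (x # y # ws) = ival x \<star> wval (y # ws)"

definition wmat :: "('t \<times> nat \<times> nat) list \<Rightarrow> 'a mat" where
  "wmat ws = foldr (\<lambda>x M. imat x * M) ws (1\<^sub>m k)"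

lemma imat_carrier [simp]: "imat x \<in> carrier_mat k k"
  by (simp add: imat_def)

lemma wmat_carrier [simp]: "wmat ws \<in> carrier_mat k k"
  unfolding wmat_def by (induction ws) (simp_all add: mult_carrier_mat[of _ k k])

lemma wmat_Cons: "wmat (x # ws) = imat x * wmat ws"
  by (simp add: wmat_def)

lemma wval_Cons: "ws \<noteq> [] \<Longrightarrow> wval (x # ws) = ival x \<star> wval ws"
  by (cases ws) auto

lemma valid_Cons: "valid (x # ws) \<longleftrightarrow> (\<not> is_inv (fst x) \<longrightarrow> snd x \<in> fb_index k) \<and> valid ws"
  by (simp add: valid_def)

text \<open>
  The three cases correspond to zero, one, and at least two letters that are not invariants. In the
  second case only the restriction to \<open>sl\<^sub>k\<close> of the map is determined by the labels, whereas a product of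
  two equivariant maps determines a map on all of \<open>M\<^sub>k\<close>, so that further letters can be absorbed with
  \<open>bval_app_S\<close>.
\<close>

lemma word_shape:
  assumes "ts \<noteq> []"
  shows "(\<exists>Z. invt Z \<and> (\<forall>ws. valid ws \<and> map fst ws = ts \<longrightarrow> wval ws = Z \<and> wmat ws = 1\<^sub>m k)) \<or>
    (\<exists>w. ehom w \<and> (\<forall>ws. valid ws \<and> map fst ws = ts \<longrightarrow>
       (\<exists>\<beta>\<in>fb_index k. wval ws = bval w \<beta> \<and> wmat ws = bmat \<beta>))) \<or>
    (\<exists>u u'. ehom u \<and> ehom u' \<and> (\<forall>ws. valid ws \<and> map fst ws = ts \<longrightarrow> wval ws = app (S u u') (wmat ws)))"
  using assms
proof (induction ts)
  case (Cons t ts)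
  show ?case
  proof (cases "ts = []")
    case True
    show ?thesis
    proof (cases "is_inv t")
      case inv: True
      have "\<forall>ws. valid ws \<and> map fst ws = t # ts \<longrightarrow> wval ws = zz t \<and> wmat ws = 1\<^sub>m k"
        using True inv by (auto simp: ival_def imat_def wmat_def)
      then show ?thesis using zz_inv[OF inv] by blast
    next
      case inv: False
      have "\<forall>ws. valid ws \<and> map fst ws = t # ts \<longrightarrow>
         (\<exists>\<beta>\<in>fb_index k. wval ws = bval (vv t) \<beta> \<and> wmat ws = bmat \<beta>)"
        using True inv by (auto simp: ival_def imat_def wmat_def valid_def right_mult_one_mat[of _ k k])
      then show ?thesis using vv_hom[OF inv] by blast
    qed
  next
    case ts: False
    have split: "\<exists>\<beta> vs. ws = (t, \<beta>) # vs \<and> valid vs \<and> map fst vs = ts \<and> vs \<noteq> [] \<and> (\<not> is_inv t \<longrightarrow> \<beta> \<in> fb_index k)"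
      if "valid ws" "map fst ws = t # ts" for ws
      using that ts by (cases ws) (auto simp: valid_Cons)
    from Cons.IH[OF ts] consider
      (a) Z where "invt Z" "\<And>ws. valid ws \<Longrightarrow> map fst ws = ts \<Longrightarrow> wval ws = Z \<and> wmat ws = 1\<^sub>m k"
      | (b) w where "ehom w" "\<And>ws. valid ws \<Longrightarrow> map fst ws = ts \<Longrightarrow>
           (\<exists>\<beta>\<in>fb_index k. wval ws = bval w \<beta> \<and> wmat ws = bmat \<beta>)"
      | (c) u u' where "ehom u" "ehom u'" "\<And>ws. valid ws \<Longrightarrow> map fst ws = ts \<Longrightarrow> wval ws = app (S u u') (wmat ws)"
      by blast
    then show ?thesis
    proof cases
      case a
      show ?thesis
      proof (cases "is_inv t")
        case inv: True
        have "wval ws = zz t \<star> Z \<and> wmat ws = 1\<^sub>m k" if ws: "valid ws" "map fst ws = t # ts" for ws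
        proof -
          obtain \<beta> vs where vs: "ws = (t, \<beta>) # vs" "valid vs" "map fst vs = ts" "vs \<noteq> []" using split[OF ws] by blast
          show ?thesis using a(2)[OF vs(2,3)] vs inv by (simp add: wval_Cons wmat_Cons ival_def imat_def)
        qed
        then show ?thesis using inv_mul[OF zz_inv[OF inv] a(1)]
          by (intro disjI1 exI[of _ "zz t \<star> Z"]) auto
      next
        case inv: False
        have "\<exists>\<beta>\<in>fb_index k. wval ws = bval (\<lambda>i j. vv t i j \<star> Z) \<beta> \<and> wmat ws = bmat \<beta>"
          if ws: "valid ws" "map fst ws = t # ts" for ws
        proof -
          obtain \<beta> vs where vs: "ws = (t, \<beta>) # vs" "valid vs" "map fst vs = ts" "vs \<noteq> []" "\<beta> \<in> fb_index k"
            using split[OF ws] inv by blast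
          show ?thesis using a(2)[OF vs(2,3)] vs inv
            by (intro bexI[of _ \<beta>])
               (simp_all add: wval_Cons wmat_Cons ival_def imat_def bval_hom_mul right_mult_one_mat[of _ k k])
        qed
        then show ?thesis using hom_mul_inv(1)[OF a(1) vv_hom[OF inv]]
          by (intro disjI2[OF disjI1] exI[of _ "\<lambda>i j. vv t i j \<star> Z"]) auto
      qed
    next
      case b
      show ?thesis
      proof (cases "is_inv t")
        case inv: True
        have "\<exists>\<beta>\<in>fb_index k. wval ws = bval (\<lambda>i j. zz t \<star> w i j) \<beta> \<and> wmat ws = bmat \<beta>"
          if ws: "valid ws" "map fst ws = t # ts" for ws
        proof -
          obtain \<beta> vs where vs: "ws = (t, \<beta>) # vs" "valid vs" "map fst vs = ts" "vs \<noteq> []"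
            using split[OF ws] inv by blast
          obtain \<gamma> where "\<gamma> \<in> fb_index k" "wval vs = bval w \<gamma>" "wmat vs = bmat \<gamma>" using b(2)[OF vs(2,3)] by blast
          then show ?thesis using vs inv
            by (intro bexI[of _ \<gamma>])
               (simp_all add: wval_Cons wmat_Cons ival_def imat_def bval_hom_mul left_mult_one_mat[of _ k k])
        qed
        then show ?thesis using hom_mul_inv(2)[OF zz_inv[OF inv] b(1)]
          by (intro disjI2[OF disjI1] exI[of _ "\<lambda>i j. zz t \<star> w i j"]) auto
      next
        case inv: False
        have "wval ws = app (S (vv t) w) (wmat ws)" if ws: "valid ws" "map fst ws = t # ts" for ws
        proof -
          obtain \<beta> vs where vs: "ws = (t, \<beta>) # vs" "valid vs" "map fst vs = ts" "vs \<noteq> []" "\<beta> \<in> fb_index k"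
            using split[OF ws] inv by blast
          obtain \<gamma> where "\<gamma> \<in> fb_index k" "wval vs = bval w \<gamma>" "wmat vs = bmat \<gamma>" using b(2)[OF vs(2,3)] by blast
          then show ?thesis using vs inv bval_bval[OF vv_hom[OF inv] b(1), of \<beta> \<gamma>]
            by (simp add: wval_Cons wmat_Cons ival_def imat_def)
        qed
        then show ?thesis using vv_hom[OF inv] b(1)
          by (intro disjI2[OF disjI2] exI[of _ "vv t"] exI[of _ w]) auto
      qed
    next
      case c
      show ?thesis
      proof (cases "is_inv t")
        case inv: True
        have e: "app (S (\<lambda>i j. zz t \<star> u i j) u') M = zz t \<star> app (S u u') M" for M
          unfolding app_mul[symmetric] by (rule app_cong) (simp add: S_def mul_assoc bil)
        have "wval ws = app (S (\<lambda>i j. zz t \<star> u i j) u') (wmat ws)" if ws: "valid ws" "map fst ws = t # ts" for ws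
        proof -
          obtain \<beta> vs where vs: "ws = (t, \<beta>) # vs" "valid vs" "map fst vs = ts" "vs \<noteq> []"
            using split[OF ws] inv by blast
          show ?thesis using c(3)[OF vs(2,3)] vs inv
            by (simp add: e wval_Cons wmat_Cons ival_def imat_def left_mult_one_mat[of _ k k])
        qed
        then show ?thesis using hom_mul_inv(2)[OF zz_inv[OF inv] c(1)] c(2)
          by (intro disjI2[OF disjI2] exI[of _ "\<lambda>i j. zz t \<star> u i j"] exI[of _ u']) auto
      next
        case inv: False
        have "wval ws = app (S (vv t) (S u u')) (wmat ws)" if ws: "valid ws" "map fst ws = t # ts" for ws
        proof -
          obtain \<beta> vs where vs: "ws = (t, \<beta>) # vs" "valid vs" "map fst vs = ts" "vs \<noteq> []" "\<beta> \<in> fb_index k"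
            using split[OF ws] inv by blast
          then show ?thesis using c(3)[OF vs(2,3)] inv bval_app_S[OF vv_hom[OF inv] c(1,2), of \<beta> "wmat vs"]
            by (simp add: wval_Cons wmat_Cons ival_def imat_def)
        qed
        then show ?thesis using vv_hom[OF inv] S_hom[OF c(1,2)]
          by (intro disjI2[OF disjI2] exI[of _ "vv t"] exI[of _ "S u u'"]) auto
      qed
    qed
  qed
qed simp

lemma word_value:
  assumes "ts \<noteq> []"
  shows "\<exists>T. \<forall>ws. valid ws \<and> map fst ws = ts \<longrightarrow> wval ws = app T (wmat ws)"
proof -
  consider (a) Z where "\<And>ws. valid ws \<Longrightarrow> map fst ws = ts \<Longrightarrow> wval ws = Z \<and> wmat ws = 1\<^sub>m k"
    | (b) w where "\<And>ws. valid ws \<Longrightarrow> map fst ws = ts \<Longrightarrow> (\<exists>\<beta>\<in>fb_index k. wval ws = bval w \<beta> \<and> wmat ws = bmat \<beta>)"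
    | (c) u u' where "\<And>ws. valid ws \<Longrightarrow> map fst ws = ts \<Longrightarrow> wval ws = app (S u u') (wmat ws)"
    using word_shape[OF assms] by blast
  then show ?thesis
  proof cases
    case a
    \<comment> \<open>any linear map with value \<open>Z\<close> at the identity matrix will do\<close>
    have "app (\<lambda>i j. if i = 0 \<and> j = 0 then Z else 0) (1\<^sub>m k) = Z"
    proof -
      have "app (\<lambda>i j. if i = 0 \<and> j = 0 then Z else 0) (1\<^sub>m k) = (\<Sum>i<k. if i = 0 then (\<Sum>j<k. if j = 0 then Z else 0) else 0)"
        unfolding app_def
      proof (rule sum.cong[OF refl])
        fix i assume "i \<in> {..<k}"
        then show "(\<Sum>j<k. scale (1\<^sub>m k $$ (i, j)) (if i = 0 \<and> j = 0 then Z else 0)) =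
            (if i = 0 then (\<Sum>j<k. if j = 0 then Z else 0) else 0)"
        proof (cases "i = 0")
          case True
          have "scale (1\<^sub>m k $$ (0, j)) (if j = 0 then Z else 0) = (if j = 0 then Z else 0)" if "j < k" for j
            using that by simp
          then show ?thesis using True by (simp add: sum.cong[OF refl, of "{..<k}"])
        qed simp
      qed
      then show ?thesis using ij_lt by simp
    qed
    then show ?thesis using a by (intro exI[of _ "\<lambda>i j. if i = 0 \<and> j = 0 then Z else 0"]) auto
  next
    case b
    then show ?thesis using app_bmat by (intro exI[of _ w]) fastforce
  next
    case c
    then show ?thesis by blast
  qed
qed

text \<open>
  Two adjacent letters exchange their labels but keep their matrices, by the symmetry of \<open>S\<close>; a letter
  that is an invariant is exchanged as a whole.
\<close>

lemma swap_items:
  assumes "valid [x, y]"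
  shows "\<exists>x' y'. valid [x', y'] \<and> fst x' = fst y \<and> fst y' = fst x \<and>
    ival x \<star> ival y = ival x' \<star> ival y' \<and> imat x * imat y = imat x' * imat y'"
proof (cases "is_inv (fst x) \<or> is_inv (fst y)")
  case True
  have "ival x \<star> ival y = ival y \<star> ival x"
    using True assms ident1[OF zz_inv zz_inv] inv_bval[OF zz_inv vv_hom]
    by (auto simp: ival_def valid_def)
  moreover have "imat x * imat y = imat y * imat x"
    using True by (auto simp: imat_def left_mult_one_mat[of _ k k] right_mult_one_mat[of _ k k])
  ultimately show ?thesis using assms by (intro exI[of _ y] exI[of _ x]) (auto simp: valid_def)
next
  case False
  then have hx: "ehom (vv (fst x))" and hy: "ehom (vv (fst y))"
    and b: "snd x \<in> fb_index k" "snd y \<in> fb_index k"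
    using vv_hom assms by (auto simp: valid_def)
  have "ival x \<star> ival y = app (S (vv (fst x)) (vv (fst y))) (bmat (snd x) * bmat (snd y))"
    using False bval_bval[OF hx hy b] by (simp add: ival_def)
  also have "\<dots> = app (S (vv (fst y)) (vv (fst x))) (bmat (snd x) * bmat (snd y))"
    by (rule app_cong) (rule S_sym[OF hx hy])
  also have "\<dots> = ival (fst y, snd x) \<star> ival (fst x, snd y)"
    using False bval_bval[OF hy hx b] by (simp add: ival_def)
  finally show ?thesis using assms False
    by (intro exI[of _ "(fst y, snd x)"] exI[of _ "(fst x, snd y)"]) (auto simp: valid_def imat_def)
qed

lemma bring_to_front:
  assumes "valid ws" "t \<in> fst ` set ws"
  shows "\<exists>y r. valid (y # r) \<and> fst y = t \<and> mset (map fst (y # r)) = mset (map fst ws) \<and>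
    wval (y # r) = wval ws \<and> wmat (y # r) = wmat ws"
  using assms
proof (induction ws)
  case (Cons x ws)
  show ?case
  proof (cases "fst x = t")
    case True then show ?thesis using Cons.prems by blast
  next
    case False
    then have "t \<in> fst ` set ws" "valid ws" using Cons.prems by (auto simp: valid_Cons)
    then obtain y r where y: "valid (y # r)" "fst y = t" "mset (map fst (y # r)) = mset (map fst ws)"
      "wval (y # r) = wval ws" "wmat (y # r) = wmat ws" using Cons.IH by blast
    have "ws \<noteq> []" using y(3) by auto
    have "valid [x, y]" using Cons.prems y(1) by (auto simp: valid_def)
    then obtain x' y' where x': "valid [x', y']" "fst x' = fst y" "fst y' = fst x"
      "ival x \<star> ival y = ival x' \<star> ival y'" "imat x * imat y = imat x' * imat y'" using swap_items by blast
    have "wval (x' # y' # r) = wval (x # y # r)"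
      using x'(4) by (cases "r = []") (simp_all add: wval_Cons flip: mul_assoc)
    also have "\<dots> = wval (x # ws)" using y(4) \<open>ws \<noteq> []\<close> by (simp add: wval_Cons)
    finally have 1: "wval (x' # y' # r) = wval (x # ws)" .
    have "wmat (x' # y' # r) = (imat x' * imat y') * wmat r"
      by (simp add: wmat_Cons assoc_mult_mat[of _ k k _ k _ k])
    also have "\<dots> = imat x * wmat (y # r)"
      by (simp add: x'(5)[symmetric] wmat_Cons assoc_mult_mat[of _ k k _ k _ k])
    finally have 2: "wmat (x' # y' # r) = wmat (x # ws)" unfolding y(5) wmat_Cons[of x ws] .
    have "valid (x' # y' # r)" using x'(1) y(1) by (simp add: valid_def)
    moreover have "mset (map fst (x' # y' # r)) = mset (map fst (x # ws))" using x'(2,3) y(3) by simp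
    ultimately show ?thesis using 1 2 x'(2) y(2) by metis
  qed
qed simp

lemma reorder_word:
  assumes "valid ws" "mset (map fst ws) = mset ts"
  shows "\<exists>vs. valid vs \<and> map fst vs = ts \<and> wval vs = wval ws \<and> wmat vs = wmat ws"
  using assms
proof (induction ts arbitrary: ws)
  case (Cons t ts)
  have "t \<in> fst ` set ws"
    using Cons.prems(2) by (metis list.set_intros(1) list.set_map set_mset_mset)
  then obtain y r where y: "valid (y # r)" "fst y = t" "mset (map fst (y # r)) = mset (map fst ws)"
      "wval (y # r) = wval ws" "wmat (y # r) = wmat ws" using bring_to_front Cons.prems(1) by blast
  have "mset (map fst r) = mset ts" "valid r" using y Cons.prems(2) by (auto simp: valid_Cons)
  then obtain vs where vs: "valid vs" "map fst vs = ts" "wval vs = wval r" "wmat vs = wmat r"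
    using Cons.IH by blast
  have "wval (y # vs) = wval (y # r)"
  proof (cases "r = []")
    case True
    then have "ts = []" using \<open>mset (map fst r) = mset ts\<close> by simp
    then show ?thesis using True vs by simp
  next
    case False
    then have "ts \<noteq> []" using \<open>mset (map fst r) = mset ts\<close> by auto
    then have "vs \<noteq> []" using vs by auto
    then show ?thesis using False vs by (simp add: wval_Cons)
  qed
  then show ?case using y vs
    by (intro exI[of _ "y # vs"]) (simp add: valid_Cons wmat_Cons)
qed simp

text \<open>
  Sorting the labels into a fixed order changes neither the value of a word nor the product of its
  matrices, so that the linear map belonging to that order serves all words with the same labels.
\<close>

lemma word_value_mset:
  assumes "M \<noteq> {#}"
  shows "\<exists>T. \<forall>ws. valid ws \<and> mset (map fst ws) = M \<longrightarrow> wval ws = app T (wmat ws)"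
proof -
  obtain ts where ts: "mset ts = M" using ex_mset by blast
  then have "ts \<noteq> []" using assms by auto
  then obtain T where T: "\<And>ws. valid ws \<Longrightarrow> map fst ws = ts \<Longrightarrow> wval ws = app T (wmat ws)"
    using word_value by blast
  have "wval ws = app T (wmat ws)" if "valid ws" "mset (map fst ws) = M" for ws
    using reorder_word[of ws ts] that ts T by metis
  then show ?thesis by blast
qed

end

section \<open>The operators of the identities\<close>

lemma (in nalg) alg_ideal_INT:
  "(\<And>i. i \<in> I \<Longrightarrow> alg_ideal A (K i)) \<Longrightarrow> alg_ideal A (carrier A \<inter> (\<Inter>i\<in>I. K i))"
  by (simp add: alg_ideal_def)

lemma mat_unit_eu: "mat_unit k (Suc p) (Suc q) = eu k p q"
  by (simp add: mat_unit_def eu_def)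

lemma mat_unit_numerals:
  "mat_unit k 1 2 = eu k 0 1" "mat_unit k 2 1 = eu k 1 0" "mat_unit k 3 1 = eu k 2 0"
  using mat_unit_eu[of k 0 1] mat_unit_eu[of k 1 0] mat_unit_eu[of k 2 0]
  by (simp_all add: numeral_2_eq_2 numeral_3_eq_3)

lemma basis_S_cases:
  assumes "c \<in> basis_S k"
  obtains (unit) p q where "p < k" "q < k" "p \<noteq> q" "c = eu k p q"
    | (diag) p where "Suc p < k" "c = eu k p p - eu k (Suc p) (Suc p)"
proof -
  consider i j where "c = mat_unit k i j" "i \<in> {1..k}" "j \<in> {1..k}" "i \<noteq> j"
    | i where "c = mat_unit k i i - mat_unit k (i + 1) (i + 1)" "1 \<le> i" "i < k"
    using assms unfolding basis_S_def by blast
  then show ?thesis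
  proof cases
    case 1
    obtain p q where "i = Suc p" "j = Suc q" using 1(2,3) by (cases i; cases j) auto
    then show ?thesis using 1 unit[of p q] by (auto simp: mat_unit_eu)
  next
    case 2
    obtain p where "i = Suc p" using 2(2) by (cases i) auto
    then show ?thesis using 2 diag[of p] by (simp add: mat_unit_eu)
  qed
qed

lemma basis_S_unit: "p < k \<Longrightarrow> q < k \<Longrightarrow> p \<noteq> q \<Longrightarrow> eu k p q \<in> basis_S k"
  unfolding basis_S_def by (rule UnI1, rule CollectI, rule exI[of _ "Suc p"], rule exI[of _ "Suc q"]) (simp add: mat_unit_eu)

lemma basis_S_diag: "Suc p < k \<Longrightarrow> eu k p p - eu k (Suc p) (Suc p) \<in> basis_S k"
  unfolding basis_S_def by (rule UnI2) (auto intro!: exI[of _ "Suc p"] simp: mat_unit_eu)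

text \<open>Row and column indices are to be read as numerals.\<close>

declare One_nat_def [simp del]

lemma mtr_eu: "p < k \<Longrightarrow> mtr k (eu k p q) = (if p = q then 1 else 0)"
proof -
  assume p: "p < k"
  have "mtr k (eu k p q :: 'a mat) = (\<Sum>i<k. if i = p then (if p = q then 1 else 0) else 0)"
    unfolding mtr_def by (intro sum.cong refl) auto
  then show ?thesis using p by simp
qed

lemma mtr_minus: "x \<in> carrier_mat k k \<Longrightarrow> y \<in> carrier_mat k k \<Longrightarrow> mtr k (x - y) = mtr k x - mtr k y"
  by (auto simp: mtr_def sum_subtractf)

lemma basis_S_traceless: "c \<in> basis_S k \<Longrightarrow> mtr k c = 0 \<and> c \<in> carrier_mat k k"
  by (elim basis_S_cases) (simp_all add: mtr_eu mtr_minus minus_carrier_mat)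

text \<open>
  The scalar \<open>1\<close> is of use here because \<open>k\<close> is invertible: \<open>k e\<^sub>0\<^sub>0\<close> is \<open>1\<close> minus differences of diagonal
  units.
\<close>

lemma basis_M_spans:
  fixes N :: "'a::field_char_0 mat set"
  assumes N: "N \<subseteq> carrier_mat k k" "0\<^sub>m k k \<in> N" "\<And>A B. A \<in> N \<Longrightarrow> B \<in> N \<Longrightarrow> A + B \<in> N"
      "\<And>c A. A \<in> N \<Longrightarrow> c \<cdot>\<^sub>m A \<in> N"
    and basis: "basis_M k \<subseteq> N" and k: "0 < k" and x: "x \<in> carrier_mat k k"
  shows "x \<in> N"
proof -
  have diag: "eu k p p - eu k 0 0 \<in> N" if "p < k" for p
    using that
  proof (induction p)
    case 0
    have e: "eu k 0 0 - eu k 0 0 = (0\<^sub>m k k :: 'a mat)" by (intro eq_matI) auto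
    show ?case unfolding e by (rule N(2))
  next
    case (Suc p)
    have "eu k p p - eu k (Suc p) (Suc p) \<in> N" using basis basis_S_diag[OF Suc.prems] by (auto simp: basis_M_def)
    then have "(eu k p p - eu k 0 0) + (-1) \<cdot>\<^sub>m (eu k p p - eu k (Suc p) (Suc p)) \<in> N"
      using Suc by (intro N(3,4)) auto
    also have "(eu k p p - eu k 0 0) + (-1) \<cdot>\<^sub>m (eu k p p - eu k (Suc p) (Suc p)) = eu k (Suc p) (Suc p) - (eu k 0 0 :: 'a mat)"
      by (intro eq_matI) auto
    finally show ?case .
  qed
  have "1\<^sub>m k - of_nat k \<cdot>\<^sub>m eu k 0 0 \<in> N"
  proof (rule entry_sum_closed[OF _ _ _ _ N, of "{..<k}" "\<lambda>p. eu k p p - eu k 0 0" _ "\<lambda>_. 1"])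
    fix r s assume rs: "r < k" "s < k"
    have "(\<Sum>j<k. 1 * (eu k j j - eu k 0 0) $$ (r, s)) =
        (\<Sum>j<k. (if j = r then (if r = s then 1 else 0) else 0) - (if r = 0 \<and> s = 0 then 1 else (0::'a)))"
      using rs by (intro sum.cong refl) auto
    then show "(1\<^sub>m k - of_nat k \<cdot>\<^sub>m eu k 0 0) $$ (r, s) = (\<Sum>j<k. 1 * (eu k j j - eu k 0 0) $$ (r, s) :: 'a)"
      using rs by (simp add: sum_subtractf)
  qed (use diag in auto)
  moreover have "1\<^sub>m k \<in> N" using basis by (simp add: basis_M_def)
  ultimately have "(1 / of_nat k) \<cdot>\<^sub>m (1\<^sub>m k + (-1) \<cdot>\<^sub>m (1\<^sub>m k - of_nat k \<cdot>\<^sub>m eu k 0 0)) \<in> N"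
    by (intro N(3,4)) auto
  also have "(1 / of_nat k) \<cdot>\<^sub>m (1\<^sub>m k + (-1) \<cdot>\<^sub>m (1\<^sub>m k - of_nat k \<cdot>\<^sub>m eu k 0 0)) = (eu k 0 0 :: 'a mat)"
    using k by (intro eq_matI) auto
  finally have e0: "eu k 0 0 \<in> N" .
  have unit: "eu k p q \<in> N" if "p < k" "q < k" for p q
  proof (cases "p = q")
    case True
    have "(eu k p p - eu k 0 0) + eu k 0 0 \<in> N" using diag[OF that(1)] e0 by (rule N(3))
    also have "(eu k p p - eu k 0 0) + eu k 0 0 = (eu k p p :: 'a mat)" by (intro eq_matI) auto
    finally show ?thesis using True by simp
  next
    case False
    then show ?thesis using basis basis_S_unit[OF that] by (auto simp: basis_M_def)
  qed
  show ?thesis using x by (induction x rule: mat_induct) (use N unit in auto)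
qed

text \<open>
  The description defining \<^const>\<open>phi_ab\<close> is unique as \<open>basis_M k\<close> spans. This is all that is needed to
  identify the operators of the identities.
\<close>

lemma phi_ab_eqI:
  fixes f :: "'a::field_char_0 mat \<Rightarrow> 'a mat"
  assumes f: "f \<in> lin_maps (mat_alg k) (mat_alg k)" "f a = b" and a: "a \<in> basis_M k"
    and z: "\<And>c. c \<in> basis_M k \<Longrightarrow> c \<noteq> a \<Longrightarrow> f c = 0\<^sub>m k k" and k: "0 < k"
  shows "phi_ab k a b = f"
  unfolding phi_ab_def
proof (rule the_equality)
  show "f \<in> lin_maps (mat_alg k) (mat_alg k) \<and> f a = b \<and> (\<forall>c\<in>basis_M k - {a}. f c = 0\<^sub>m k k)"
    using f z by auto
  fix g assume g: "g \<in> lin_maps (mat_alg k) (mat_alg k) \<and> g a = b \<and> (\<forall>c\<in>basis_M k - {a}. g c = 0\<^sub>m k k)"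
  then have gl: "g \<in> lin_maps (mat_alg k) (mat_alg k)" by blast
  note lins = lin_add[OF f(1), simplified] lin_add[OF gl, simplified] lin_smult[OF f(1), simplified]
    lin_smult[OF gl, simplified] lin_zero[OF f(1) mat_alg_nalg mat_alg_nalg, simplified]
    lin_zero[OF gl mat_alg_nalg mat_alg_nalg, simplified]
  have bc: "c \<in> carrier_mat k k" if "c \<in> basis_M k" for c :: "'a mat"
    using that basis_S_traceless[of c k] by (auto simp: basis_M_def)
  have fg: "f c = g c" if "c \<in> basis_M k" for c
    using that z[of c] f(2) g by (cases "c = a") auto
  have on: "x \<in> {x \<in> carrier_mat k k. f x = g x}" if "x \<in> carrier_mat k k" for x
    by (rule basis_M_spans[OF _ _ _ _ _ k that]) (auto simp: lins bc fg)
  have ext: "h x = undefined" if "h \<in> lin_maps (mat_alg k) (mat_alg k)" "x \<notin> carrier_mat k k"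
    for x and h :: "'a mat \<Rightarrow> 'a mat"
    using that(1) PiE_arb[of h "carrier_mat k k" _ x] that(2) unfolding lin_maps_def mat_alg_sel by blast
  show "g = f"
  proof
    fix x show "g x = f x"
      using on[of x] ext[OF f(1), of x] ext[OF gl, of x] by (cases "x \<in> carrier_mat k k") auto
  qed
qed

text \<open>
  The operator \<open>\<phi>\<^sub>a\<^sub>b\<close> for \<open>a = e\<^sub>1\<^sub>2\<close>: all other elements of the basis have entry 0 at the position of
  \<open>e\<^sub>1\<^sub>2\<close>.
\<close>

definition pick12 :: "'a::field mat \<Rightarrow> 'a mat \<Rightarrow> 'a mat" where
  "pick12 b x = x $$ (0, 1) \<cdot>\<^sub>m b"

lemma cent_carrier [simp]: "cent k x \<in> carrier_mat k k"
  by (simp add: cent_def)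

lemma mtr_one: "mtr k (1\<^sub>m k) = of_nat k"
  by (simp add: mtr_def)

lemma phi_ab_gg: "0 < k \<Longrightarrow> phi_ab k (1\<^sub>m k) (1\<^sub>m k) = restrict (cent k) (carrier_mat k k :: 'a::field_char_0 mat set)"
proof (rule phi_ab_eqI)
  have "(a + b) / c \<cdot>\<^sub>m 1\<^sub>m k = a / c \<cdot>\<^sub>m 1\<^sub>m k + b / c \<cdot>\<^sub>m 1\<^sub>m k"
    "(a * b) / c \<cdot>\<^sub>m 1\<^sub>m k = a \<cdot>\<^sub>m (b / c \<cdot>\<^sub>m 1\<^sub>m k)" for a b c :: 'a
    by (intro eq_matI; simp add: add_divide_distrib)+
  then show "restrict (cent k) (carrier_mat k k :: 'a mat set) \<in> lin_maps (mat_alg k) (mat_alg k)"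
    by (auto simp: lin_maps_def mtr_add mtr_smult cent_def)
  assume "0 < k"
  then show "restrict (cent k) (carrier_mat k k :: 'a mat set) (1\<^sub>m k) = 1\<^sub>m k"
    by (simp add: cent_def mtr_one) (intro eq_matI, auto)
next
  fix c :: "'a mat" assume "c \<in> basis_M k" "c \<noteq> 1\<^sub>m k"
  then have "c \<in> basis_S k" by (simp add: basis_M_def)
  then show "restrict (cent k) (carrier_mat k k) c = 0\<^sub>m k k"
    using basis_S_traceless[of c k] by (simp add: cent_def) (intro eq_matI, auto)
qed (simp_all add: basis_M_def)

lemma phi_ab_e12:
  assumes k: "2 \<le> k" and b: "b \<in> carrier_mat k k"
  shows "phi_ab k (mat_unit k 1 2) b = restrict (pick12 b) (carrier_mat k k :: 'a::field_char_0 mat set)"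
  unfolding mat_unit_numerals
proof (rule phi_ab_eqI)
  have "a * c \<cdot>\<^sub>m b = a \<cdot>\<^sub>m (c \<cdot>\<^sub>m b)" for a c :: 'a by (intro eq_matI) auto
  then show "restrict (pick12 b) (carrier_mat k k :: 'a mat set) \<in> lin_maps (mat_alg k) (mat_alg k)"
    using b k by (auto simp: lin_maps_def pick12_def add_smult_distrib_right_mat[of _ k k] dest!: carrier_matD)
  show "restrict (pick12 b) (carrier_mat k k) (eu k 0 1) = b"
    using k b by (simp add: pick12_def) (intro eq_matI, auto)
  show "(eu k 0 1 :: 'a mat) \<in> basis_M k" using k basis_S_unit[of 0 k 1, where ?'a = 'a] by (simp add: basis_M_def)
  fix c :: "'a mat" assume c: "c \<in> basis_M k" "c \<noteq> eu k 0 1"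
  then have "c = 1\<^sub>m k \<or> c \<in> basis_S k" by (auto simp: basis_M_def)
  then have "c \<in> carrier_mat k k \<and> c $$ (0, 1) = 0"
    using c(2) k by (auto elim!: basis_S_cases simp: minus_carrier_mat)
  then show "restrict (pick12 b) (carrier_mat k k) c = 0\<^sub>m k k"
    using b by (simp add: pick12_def) (intro eq_matI, auto)
qed (use k in simp)

lemma realized_pick12:
  "2 \<le> k \<Longrightarrow> b \<in> carrier_mat k k \<Longrightarrow> mtr k b = 0 \<Longrightarrow> realized k (pick12 (b :: 'a::field_char_0 mat))"
  using realized_rank_one_unit[of 0 k 1 b] by (simp add: pick12_def[abs_def])

definition lift_op :: "nat \<Rightarrow> ('a::field mat \<Rightarrow> 'a mat) \<Rightarrow> ('a, 'a mat \<Rightarrow> 'a mat) uea" where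
  "lift_op k w = (SOME u. u \<in> carrier (Uk k) \<and> (\<forall>x\<in>carrier_mat k k. phi k u x = w x))"

lemma lift_op:
  assumes "realized k w"
  shows "lift_op k w \<in> carrier (Uk k)" "x \<in> carrier_mat k k \<Longrightarrow> phi k (lift_op k w) x = w x"
proof -
  have "\<exists>u. u \<in> carrier (Uk k) \<and> (\<forall>x\<in>carrier_mat k k. phi k u x = w x)"
    using assms unfolding realized_def by blast
  from someI_ex[OF this] show "lift_op k w \<in> carrier (Uk k)"
    "x \<in> carrier_mat k k \<Longrightarrow> phi k (lift_op k w) x = w x" unfolding lift_op_def by blast+
qed

text \<open>
  The element \<open>f\<^sup>w\<close> for an operator \<open>w\<close> in \<open>\<phi>(U(L))\<close>; it does not depend on the element chosen in
  \<^const>\<open>lift_op\<close> (\<open>opact_eq\<close>).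
\<close>

definition opact :: "nat \<Rightarrow> ('a::field mat \<Rightarrow> 'a mat) \<Rightarrow> 'a flu \<Rightarrow> 'a flu" where
  "opact k w f = uea_act (FU k) (LU_act k) (lift_op k w) f"

abbreviation gen :: "nat \<Rightarrow> nat \<Rightarrow> 'a::field flu" where
  "gen k i \<equiv> free_LU_var k i \<one>\<^bsub>Uk k\<^esub>"

lemma gen_closed: "gen k i \<in> carrier (FU k)"
  by (intro LU_var_closed uea_one_closed der_mat_closed)

lemma opact_eq:
  assumes "u \<in> carrier (Uk k)" "\<And>x. x \<in> carrier_mat k k \<Longrightarrow> phi k u x = w x" "f \<in> carrier (FU k)"
  shows "opact k w f = uea_act (FU k) (LU_act k) u f"
proof -
  have "realized k w" using assms by (auto simp: realized_def)
  from lift_op[OF this] show ?thesis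
    unfolding opact_def using assms by (intro LU_act_cong) auto
qed

lemma free_LU_pow_opact:
  assumes w: "realized k w"
  shows "free_LU_pow k i (restrict w (carrier_mat k k)) = opact k w (gen k i)"
proof -
  have "phi k (lift_op k w) = restrict w (carrier_mat k k)"
    using lift_op(2)[OF w] by (subst phi_restrict[symmetric]) (auto simp: restrict_def)
  then have ex: "\<exists>u. u \<in> carrier (Uk k) \<and> phi k u = restrict w (carrier_mat k k)"
    using lift_op(1)[OF w] by blast
  define u where "u = (SOME u. u \<in> carrier (Uk k) \<and> phi k u = restrict w (carrier_mat k k))"
  have u: "u \<in> carrier (Uk k)" "phi k u = restrict w (carrier_mat k k)"
    using someI_ex[OF ex] unfolding u_def by blast+
  have "free_LU_pow k i (restrict w (carrier_mat k k)) = free_LU_var k i u"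
    unfolding free_LU_pow_def u_def ..
  also have "\<dots> = uea_act (FU k) (LU_act k) u (gen k i)" by (rule LU_var_eq_act[OF u(1)])
  also have "\<dots> = opact k w (gen k i)"
    by (rule opact_eq[symmetric]) (use u gen_closed in auto)
  finally show ?thesis .
qed

context
  fixes k :: nat and w :: "'a::field mat \<Rightarrow> 'a mat"
  assumes w: "realized k w"
begin

lemma opact_closed: "f \<in> carrier (FU k) \<Longrightarrow> opact k w f \<in> carrier (FU k)"
  unfolding opact_def by (intro lie_rep.act_closed[OF FU_rep] lift_op[OF w])

lemma opact_var: "opact k w (gen k i) = free_LU_var k i (lift_op k w)"
  unfolding opact_def by (rule LU_var_eq_act[symmetric, OF lift_op(1)[OF w]])

lemma opact_hom:
  assumes "\<And>i u. u \<in> carrier (Uk k) \<Longrightarrow> \<psi> (free_LU_var k i u) = uea_act (FU k) (LU_act k) u (f i)"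
  shows "\<psi> (opact k w (gen k i)) = opact k w (f i)"
  unfolding opact_var unfolding opact_def by (rule assms[OF lift_op(1)[OF w]])

lemma opact_eval:
  assumes "\<And>i u. u \<in> carrier (Uk k) \<Longrightarrow> \<psi> (free_LU_var k i u) = phi k u (b i)" "b i \<in> carrier_mat k k"
  shows "\<psi> (opact k w (gen k i)) = w (b i)"
  using assms(1)[OF lift_op(1)[OF w]] lift_op(2)[OF w assms(2)] by (simp add: opact_var)

lemma opact_comp:
  assumes v: "realized k v" and f: "f \<in> carrier (FU k)"
  shows "opact k v (opact k w f) = opact k (\<lambda>x. v (w x)) f"
proof -
  interpret U: nalg "Uk k" by (rule uea_nalg[OF der_mat_closed])
  have "opact k (\<lambda>x. v (w x)) f = uea_act (FU k) (LU_act k) (lift_op k v \<otimes>\<^bsub>Uk k\<^esub> lift_op k w) f"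
    by (rule opact_eq)
       (use lift_op[OF w] lift_op[OF v] f realized_closed[OF w] in \<open>auto simp: phi_mult\<close>)
  also have "\<dots> = opact k v (opact k w f)"
    unfolding opact_def by (rule lie_rep.act_mult[OF FU_rep f lift_op(1)[OF v] lift_op(1)[OF w]])
  finally show ?thesis ..
qed

lemma opact_derivation:
  assumes d: "d \<in> derivations (mat_alg k)" and f: "f \<in> carrier (FU k)"
  shows "LU_act k d (opact k w f) = opact k (\<lambda>x. d (w x)) f"
proof -
  interpret U: nalg "Uk k" by (rule uea_nalg[OF der_mat_closed])
  have i: "uea_inj (der_mat k) d \<in> carrier (Uk k)" using d by (intro uea_inj_closed der_mat_closed) simp
  have "opact k (\<lambda>x. d (w x)) f = uea_act (FU k) (LU_act k) (uea_inj (der_mat k) d \<otimes>\<^bsub>Uk k\<^esub> lift_op k w) f"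
    by (rule opact_eq)
       (use lift_op[OF w] f i d realized_closed[OF w] in \<open>auto simp: phi_mult phi_inj\<close>)
  also have "\<dots> = uea_act (FU k) (LU_act k) (uea_inj (der_mat k) d) (opact k w f)"
    unfolding opact_def by (rule lie_rep.act_mult[OF FU_rep f i lift_op(1)[OF w]])
  also have "\<dots> = LU_act k d (opact k w f)"
    using d by (intro lie_rep.act_inj[OF FU_rep]) (simp_all add: opact_closed f)
  finally show ?thesis ..
qed

lemma opact_lincomb:
  assumes v: "realized k v" "realized k v'" and f: "f \<in> carrier (FU k)"
    and eq: "\<And>x. x \<in> carrier_mat k k \<Longrightarrow> w x = a \<cdot>\<^sub>m v x + a' \<cdot>\<^sub>m v' x"
  shows "opact k w f = a \<odot>\<^bsub>FU k\<^esub> opact k v f \<oplus>\<^bsub>FU k\<^esub> a' \<odot>\<^bsub>FU k\<^esub> opact k v' f"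
proof -
  interpret U: nalg "Uk k" by (rule uea_nalg[OF der_mat_closed])
  interpret F: lie_rep "FU k" "der_mat k" "LU_act k" by (rule FU_rep)
  have "opact k w f = uea_act (FU k) (LU_act k) (a \<odot>\<^bsub>Uk k\<^esub> lift_op k v \<oplus>\<^bsub>Uk k\<^esub> a' \<odot>\<^bsub>Uk k\<^esub> lift_op k v') f"
    by (rule opact_eq)
       (use lift_op[OF v(1)] lift_op[OF v(2)] f eq in \<open>auto simp: phi_add phi_smult\<close>)
  then show ?thesis
    using lift_op[OF v(1)] lift_op[OF v(2)] f by (simp add: F.act_add F.act_smult opact_def)
qed

end

lemma opact_cong:
  assumes "realized k w" "\<And>x. x \<in> carrier_mat k k \<Longrightarrow> w x = v x" "f \<in> carrier (FU k)"
  shows "opact k w f = opact k v f"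
  using lift_op[OF assms(1)] assms(2,3) by (subst (2) opact_eq[of "lift_op k w"]) (auto simp: opact_def)

lemma opact_zero:
  assumes "\<And>x. x \<in> carrier_mat k k \<Longrightarrow> w x = 0\<^sub>m k k" "f \<in> carrier (FU k)"
  shows "opact k w f = \<zero>\<^bsub>FU k\<^esub>"
proof -
  interpret F: nalg "FU k" by (rule free_LU_nalg)
  have r: "realized k w" by (rule realized_cong[OF realized_zero]) (simp add: assms)
  have "opact k w f = 0 \<odot>\<^bsub>FU k\<^esub> opact k w f \<oplus>\<^bsub>FU k\<^esub> 0 \<odot>\<^bsub>FU k\<^esub> opact k w f"
    by (rule opact_lincomb[OF r r r assms(2)]) (auto simp: assms(1))
  then show ?thesis using opact_closed[OF r assms(2)] by simp
qed

section \<open>The identities at arbitrary elements\<close>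

text \<open>
  The four identities with arbitrary elements \<open>f, g\<close> of the free algebra in place of the variables, so
  that the effect of a substitution can be stated.
\<close>

definition idt1 :: "nat \<Rightarrow> 'a::field flu \<Rightarrow> 'a flu \<Rightarrow> 'a flu" where
  "idt1 k f g = commutator (FU k) (opact k (cent k) f) (opact k (cent k) g)"

definition idt2 :: "nat \<Rightarrow> 'a::field flu \<Rightarrow> 'a flu \<Rightarrow> 'a flu" where
  "idt2 k f g = commutator (FU k) (opact k (cent k) f) (opact k (pick12 (eu k 0 1)) g)"

definition idt3 :: "nat \<Rightarrow> 'a::field flu \<Rightarrow> 'a flu \<Rightarrow> 'a flu" where
  "idt3 k f g = opact k (pick12 (eu k 0 1)) f \<otimes>\<^bsub>FU k\<^esub> opact k (pick12 (eu k 1 0)) g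
     \<ominus>\<^bsub>FU k\<^esub> opact k (pick12 (eu k 0 1)) g \<otimes>\<^bsub>FU k\<^esub> opact k (pick12 (eu k 1 0)) f"

definition idt4 :: "nat \<Rightarrow> 'a::field flu \<Rightarrow> 'a flu \<Rightarrow> 'a flu" where
  "idt4 k f g = opact k (pick12 (eu k 0 1)) f \<otimes>\<^bsub>FU k\<^esub> opact k (pick12 (eu k 2 0)) g"

definition idt_sum :: "nat \<Rightarrow> 'a::field flu \<Rightarrow> 'a flu \<Rightarrow> 'a flu" where
  "idt_sum k f g = idt1 k f g \<oplus>\<^bsub>FU k\<^esub> idt2 k f g \<oplus>\<^bsub>FU k\<^esub> idt3 k f g
     \<oplus>\<^bsub>FU k\<^esub> (if k \<ge> 3 then idt4 k f g else \<zero>\<^bsub>FU k\<^esub>)"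

context
  fixes k :: nat
  assumes k2: "2 \<le> k"
begin

lemma rc: "realized k (cent k :: 'a::field_char_0 mat \<Rightarrow> 'a mat)"
  using k2 by (intro realized_cent) simp

lemma rp: "p < k \<Longrightarrow> p \<noteq> q \<Longrightarrow> realized k (pick12 (eu k p q) :: 'a::field_char_0 mat \<Rightarrow> 'a mat)"
  using k2 by (intro realized_pick12) (simp_all add: mtr_eu)

lemma r12: "realized k (pick12 (eu k 0 1) :: 'a::field_char_0 mat \<Rightarrow> 'a mat)"
    "realized k (pick12 (eu k 1 0) :: 'a::field_char_0 mat \<Rightarrow> 'a mat)"
    "3 \<le> k \<Longrightarrow> realized k (pick12 (eu k 2 0) :: 'a::field_char_0 mat \<Rightarrow> 'a mat)"
  using k2 by (intro rp; simp)+

lemma identities_idt: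
  "identity1 k x y = (idt1 k (gen k x) (gen k y) :: 'a::field_char_0 flu)"
  "identity2 k x y = (idt2 k (gen k x) (gen k y) :: 'a flu)"
  "identity3 k x y = (idt3 k (gen k x) (gen k y) :: 'a flu)"
  "3 \<le> k \<Longrightarrow> identity4 k x y = (idt4 k (gen k x) (gen k y) :: 'a flu)"
proof -
  have gg: "var_gg k i = (opact k (cent k) (gen k i) :: 'a flu)" for i
    using k2 by (simp add: phi_ab_gg free_LU_pow_opact[OF rc])
  have e: "free_LU_pow k i (phi_ab k (eu k 0 1) (eu k p q)) = (opact k (pick12 (eu k p q)) (gen k i) :: 'a flu)"
    if "p < k" "p \<noteq> q" for i p q
    using that by (simp add: phi_ab_e12[OF k2, unfolded mat_unit_numerals] free_LU_pow_opact[OF rp])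
  note e' = e[of 0 1] e[of 1 0] e[of 2 0]
  show "identity1 k x y = (idt1 k (gen k x) (gen k y) :: 'a::field_char_0 flu)"
    "identity2 k x y = (idt2 k (gen k x) (gen k y) :: 'a flu)"
    "identity3 k x y = (idt3 k (gen k x) (gen k y) :: 'a flu)"
    "3 \<le> k \<Longrightarrow> identity4 k x y = (idt4 k (gen k x) (gen k y) :: 'a flu)"
    using k2 unfolding identity1_def identity2_def identity3_def identity4_def idt1_def idt2_def idt3_def idt4_def
      gg mat_unit_numerals
    by (simp_all add: e')
qed

lemma idt_closed:
  assumes "f \<in> carrier (FU k)" "g \<in> carrier (FU k)"
  shows "idt1 k f g \<in> carrier (FU k :: ('a::field_char_0, _) module)" "idt2 k f g \<in> carrier (FU k)" "idt3 k f g \<in> carrier (FU k)"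
    "3 \<le> k \<Longrightarrow> idt4 k f g \<in> carrier (FU k)"
proof -
  interpret F: nalg "FU k :: ('a, _) module" by (rule free_LU_nalg)
  show "idt1 k f g \<in> carrier (FU k :: ('a::field_char_0, _) module)" "idt2 k f g \<in> carrier (FU k)" "idt3 k f g \<in> carrier (FU k)"
    "3 \<le> k \<Longrightarrow> idt4 k f g \<in> carrier (FU k)"
    using assms by (simp_all add: idt1_def idt2_def idt3_def idt4_def commutator_def opact_closed[OF rc]
      opact_closed[OF r12(1)] opact_closed[OF r12(2)] opact_closed[OF r12(3)])
qed

lemma idt_hom:
  assumes h: "\<psi> \<in> alg_hom (FU k) (FU k)" and f: "\<And>i. f i \<in> carrier (FU k)"
    and v: "\<And>i u. u \<in> carrier (Uk k) \<Longrightarrow> \<psi> (free_LU_var k i u) = uea_act (FU k) (LU_act k) u (f i)"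
  shows "\<psi> (idt1 k (gen k x) (gen k y)) = (idt1 k (f x) (f y) :: 'a::field_char_0 flu)"
    "\<psi> (idt2 k (gen k x) (gen k y)) = idt2 k (f x) (f y)"
    "\<psi> (idt3 k (gen k x) (gen k y)) = idt3 k (f x) (f y)"
    "3 \<le> k \<Longrightarrow> \<psi> (idt4 k (gen k x) (gen k y)) = idt4 k (f x) (f y)"
    "\<psi> (idt_sum k (gen k x) (gen k y)) = idt_sum k (f x) (f y)"
proof -
  interpret F: nalg "FU k :: ('a, _) module" by (rule free_LU_nalg)
  note hl = lin_diff[OF hom_lin[OF h] F.nalg_axioms F.nalg_axioms] hom_mult[OF h] lin_add[OF hom_lin[OF h]]
    lin_zero[OF hom_lin[OF h] F.nalg_axioms F.nalg_axioms]
  note s = commutator_def hl opact_closed[OF rc] opact_closed[OF r12(1)] opact_closed[OF r12(2)]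
    opact_closed[OF r12(3)] gen_closed opact_hom[OF rc v] opact_hom[OF r12(1) v] opact_hom[OF r12(2) v]
    opact_hom[OF r12(3) v]
  show 1: "\<psi> (idt1 k (gen k x) (gen k y)) = idt1 k (f x) (f y)"
    and 2: "\<psi> (idt2 k (gen k x) (gen k y)) = idt2 k (f x) (f y)"
    and 3: "\<psi> (idt3 k (gen k x) (gen k y)) = idt3 k (f x) (f y)"
    and 4: "3 \<le> k \<Longrightarrow> \<psi> (idt4 k (gen k x) (gen k y)) = idt4 k (f x) (f y)"
    by (simp_all add: idt1_def idt2_def idt3_def idt4_def s)
  show "\<psi> (idt_sum k (gen k x) (gen k y)) = idt_sum k (f x) (f y)"
    using 1 2 3 4 by (simp add: idt_sum_def hl idt_closed gen_closed)
qed

text \<open>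
  The endomorphism with \<open>x \<mapsto> f\<close> and \<open>y \<mapsto> g\<close> commutes with \<open>L\<close> and so preserves \<open>J\<close>. Since \<open>x\<close> and \<open>y\<close> are
  distinct, \<open>f\<close> and \<open>g\<close> are arbitrary.
\<close>

lemma T_ideal_substitute:
  assumes J: "TLU_ideal k (J :: 'a::field_char_0 flu set)" and xy: "x \<noteq> y"
    and f: "f \<in> carrier (FU k)" and g: "g \<in> carrier (FU k)"
  shows "idt1 k (gen k x) (gen k y) \<in> J \<Longrightarrow> idt1 k f g \<in> J"
    "idt2 k (gen k x) (gen k y) \<in> J \<Longrightarrow> idt2 k f g \<in> J"
    "idt3 k (gen k x) (gen k y) \<in> J \<Longrightarrow> idt3 k f g \<in> J"
    "3 \<le> k \<Longrightarrow> idt4 k (gen k x) (gen k y) \<in> J \<Longrightarrow> idt4 k f g \<in> J"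
    "idt_sum k (gen k x) (gen k y) \<in> J \<Longrightarrow> idt_sum k f g \<in> J"
proof -
  define a where "a i = (if i = x then f else g)" for i
  have a: "a i \<in> carrier (FU k)" for i using f g by (simp add: a_def)
  have "\<exists>h\<in>alg_hom (FU k) (FU k). \<forall>i. \<forall>u\<in>carrier (Uk k). h (free_LU_var k i u) = uea_act (FU k) (LU_act k) u (a i)"
    by (rule free_LU_universal[OF FU_rep]) (rule a, rule LU_ker_act)
  then obtain \<psi> where h: "\<psi> \<in> alg_hom (FU k) (FU k)"
    and v: "\<And>i u. u \<in> carrier (Uk k) \<Longrightarrow> \<psi> (free_LU_var k i u) = uea_act (FU k) (LU_act k) u (a i)"
    by blast
  have "\<psi> (free_LU_act k d e) = free_LU_act k d (\<psi> e)" if "d \<in> carrier (der_mat k)" "e \<in> carrier (FU k)" for d e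
    using LU_hom_equivariant[OF FU_rep h a v, of d e] that lin_closed[OF hom_lin[OF h] that(2)]
    by (simp add: LU_act_def)
  then have sub: "\<psi> e \<in> J" if "e \<in> J" for e using J h that unfolding TLU_ideal_def by blast
  have axy: "a x = f" "a y = g" using xy by (simp_all add: a_def)
  note hom = idt_hom[OF h a v, of x y, unfolded axy]
  show "idt1 k (gen k x) (gen k y) \<in> J \<Longrightarrow> idt1 k f g \<in> J"
    "idt2 k (gen k x) (gen k y) \<in> J \<Longrightarrow> idt2 k f g \<in> J"
    "idt3 k (gen k x) (gen k y) \<in> J \<Longrightarrow> idt3 k f g \<in> J"
    "3 \<le> k \<Longrightarrow> idt4 k (gen k x) (gen k y) \<in> J \<Longrightarrow> idt4 k f g \<in> J"
    "idt_sum k (gen k x) (gen k y) \<in> J \<Longrightarrow> idt_sum k f g \<in> J"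
    using sub hom by metis+
qed

text \<open>
  Let \<open>c\<close> be the projection onto the scalars and \<open>p\<close> the projection onto the line of \<open>e\<^sub>1\<^sub>2\<close>. They are
  orthogonal idempotents, so that substituting \<open>(x\<^sup>c, y\<^sup>c)\<close> leaves (1), \<open>(x\<^sup>c, y\<^sup>p)\<close> leaves (2), and
  \<open>(x\<^sup>p, y\<^sup>p)\<close> leaves (3) plus (4). Finally \<open>ad e\<^sub>3\<^sub>3\<close> kills \<open>e\<^sub>1\<^sub>2\<close> and \<open>e\<^sub>2\<^sub>1\<close> and fixes \<open>e\<^sub>3\<^sub>1\<close>, so that it sends
  (3) plus (4) to (4).
\<close>

lemma idt_sum_split:
  assumes J: "TLU_ideal k (J :: 'a::field_char_0 flu set)" and xy: "x \<noteq> y"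
    and sum: "idt_sum k (gen k x) (gen k y) \<in> J"
  shows "idt1 k (gen k x) (gen k y) \<in> J \<and> idt2 k (gen k x) (gen k y) \<in> J \<and> idt3 k (gen k x) (gen k y) \<in> J \<and>
    (3 \<le> k \<longrightarrow> idt4 k (gen k x) (gen k y) \<in> J)"
proof -
  interpret F: nalg "FU k :: ('a, _) module" by (rule free_LU_nalg)
  let ?c = "opact k (cent k)" and ?p = "opact k (pick12 (eu k 0 1))"
  let ?X = "gen k x :: 'a flu" and ?Y = "gen k y :: 'a flu"
  note cl = opact_closed[OF rc] opact_closed[OF r12(1)] opact_closed[OF r12(2)] opact_closed[OF r12(3)] gen_closed
  have k0: "0 < k" "1 < k" using k2 by auto
  have cc: "?c (?c f) = ?c f" if "f \<in> carrier (FU k)" for f :: "'a flu"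
  proof -
    have "?c (?c f) = opact k (\<lambda>x. cent k (cent k x)) f" by (rule opact_comp[OF rc rc that])
    also have "\<dots> = ?c f"
      by (rule opact_cong[OF realized_comp[OF rc rc] _ that])
         (use k0 in \<open>simp add: cent_def mtr_smult mtr_one\<close>)
    finally show ?thesis .
  qed
  have cp: "?c (opact k (pick12 b) f) = \<zero>\<^bsub>FU k\<^esub>"
    if "f \<in> carrier (FU k)" "b \<in> carrier_mat k k" "mtr k b = 0" for f :: "'a flu" and b
  proof -
    have "?c (opact k (pick12 b) f) = opact k (\<lambda>x. cent k (pick12 b x)) f"
      by (rule opact_comp[OF realized_pick12[OF k2 that(2,3)] rc that(1)])
    also have "\<dots> = \<zero>\<^bsub>FU k\<^esub>"
      by (rule opact_zero[OF _ that(1)])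
         (use that in \<open>simp add: cent_def pick12_def mtr_smult\<close>, intro eq_matI, auto)
    finally show ?thesis .
  qed
  have pc: "opact k (pick12 b) (?c f) = \<zero>\<^bsub>FU k\<^esub>"
    if "f \<in> carrier (FU k)" "b \<in> carrier_mat k k" "mtr k b = 0" for f :: "'a flu" and b
  proof -
    have "opact k (pick12 b) (?c f) = opact k (\<lambda>x. pick12 b (cent k x)) f"
      by (rule opact_comp[OF rc realized_pick12[OF k2 that(2,3)] that(1)])
    also have "\<dots> = \<zero>\<^bsub>FU k\<^esub>"
      by (rule opact_zero[OF _ that(1)])
         (use that k0 in \<open>simp add: cent_def pick12_def\<close>, intro eq_matI, auto)
    finally show ?thesis .
  qed
  have pp: "opact k (pick12 b) (?p f) = opact k (pick12 b) f"
    if "f \<in> carrier (FU k)" "b \<in> carrier_mat k k" "mtr k b = 0" for f :: "'a flu" and b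
  proof -
    have "opact k (pick12 b) (?p f) = opact k (\<lambda>x. pick12 b (pick12 (eu k 0 1) x)) f"
      by (rule opact_comp[OF r12(1) realized_pick12[OF k2 that(2,3)] that(1)])
    also have "\<dots> = opact k (pick12 b) f"
      by (rule opact_cong[OF realized_comp[OF realized_pick12[OF k2 that(2,3)] r12(1)] _ that(1)])
         (use k0 in \<open>simp add: pick12_def\<close>)
    finally show ?thesis .
  qed
  have tr: "mtr k (eu k 0 1) = (0::'a)" "mtr k (eu k 1 0) = (0::'a)" "3 \<le> k \<Longrightarrow> mtr k (eu k 2 0) = (0::'a)"
    using k0 by (simp_all add: mtr_eu)
  note cpe = cp[OF _ eu_carrier tr(1)] cp[OF _ eu_carrier tr(2)]
  note pce = pc[OF _ eu_carrier tr(1)] pc[OF _ eu_carrier tr(2)] pc[OF _ eu_carrier tr(3)]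
  note ppe = pp[OF _ eu_carrier tr(1)] pp[OF _ eu_carrier tr(2)] pp[OF _ eu_carrier tr(3)]
  have self: "a \<ominus>\<^bsub>FU k\<^esub> a = \<zero>\<^bsub>FU k\<^esub>" if "a \<in> carrier (FU k)" for a :: "'a flu" using that by (simp add: a_minus_def F.r_neg)
  note simps = idt_sum_def idt1_def idt2_def idt3_def idt4_def commutator_def cc cpe pce ppe cl self
  have "idt_sum k (?c ?X) (?c ?Y) \<in> J" by (rule T_ideal_substitute(5)[OF J xy _ _ sum]) (simp_all add: cl)
  also have "idt_sum k (?c ?X) (?c ?Y) = idt1 k ?X ?Y" by (simp add: simps)
  finally have 1: "idt1 k ?X ?Y \<in> J" .
  have "idt_sum k (?c ?X) (?p ?Y) \<in> J" by (rule T_ideal_substitute(5)[OF J xy _ _ sum]) (simp_all add: cl)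
  also have "idt_sum k (?c ?X) (?p ?Y) = idt2 k ?X ?Y" by (simp add: simps)
  finally have 2: "idt2 k ?X ?Y \<in> J" .
  have "idt_sum k (?p ?X) (?p ?Y) \<in> J" by (rule T_ideal_substitute(5)[OF J xy _ _ sum]) (simp_all add: cl)
  also have "idt_sum k (?p ?X) (?p ?Y) = idt3 k ?X ?Y \<oplus>\<^bsub>FU k\<^esub> (if 3 \<le> k then idt4 k ?X ?Y else \<zero>\<^bsub>FU k\<^esub>)"
    by (simp add: simps)
  finally have 34: "idt3 k ?X ?Y \<oplus>\<^bsub>FU k\<^esub> (if 3 \<le> k then idt4 k ?X ?Y else \<zero>\<^bsub>FU k\<^esub>) \<in> J" .
  show ?thesis
  proof (cases "3 \<le> k")
    case False
    then show ?thesis using 1 2 34 by (simp add: idt_closed gen_closed)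
  next
    case k3: True
    let ?d = "ad k (eu k 2 2) :: 'a mat \<Rightarrow> 'a mat"
    have d: "?d \<in> derivations (mat_alg k)" by (rule ad_derivation) simp
    have dL: "?d \<in> carrier (der_mat k)" using d by simp
    interpret R: lie_rep "FU k :: ('a, _) module" "der_mat k" "LU_act k" by (rule FU_rep)
    note D = R.rho_der[OF dL]
    have dw: "LU_act k ?d (opact k (pick12 b) f) = opact k (\<lambda>x. ?d (pick12 b x)) f"
      if "b \<in> carrier_mat k k" "mtr k b = 0" "f \<in> carrier (FU k)" for b f
      by (rule opact_derivation[OF realized_pick12[OF k2 that(1,2)] d that(3)])
    have db: "?d (pick12 b x) = x $$ (0, 1) \<cdot>\<^sub>m (eu k 2 2 * b - b * eu k 2 2)" if "b \<in> carrier_mat k k" for b x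
      using that by (simp add: ad_apply pick12_def commutator_smult_right[of _ k])
    have z: "c \<cdot>\<^sub>m (0\<^sub>m k k - 0\<^sub>m k k) = 0\<^sub>m k k" for c :: 'a by (intro eq_matI) auto
    have d12: "LU_act k ?d (?p f) = \<zero>\<^bsub>FU k\<^esub>" if "f \<in> carrier (FU k)" for f
      unfolding dw[OF eu_carrier tr(1) that] using k3 k0
      by (intro opact_zero that) (simp add: db mult_eu z)
    have d21: "LU_act k ?d (opact k (pick12 (eu k 1 0)) f) = \<zero>\<^bsub>FU k\<^esub>" if "f \<in> carrier (FU k)" for f
      unfolding dw[OF eu_carrier tr(2) that] using k3 k0
      by (intro opact_zero that) (simp add: db mult_eu z)
    have d31: "LU_act k ?d (opact k (pick12 (eu k 2 0)) f) = opact k (pick12 (eu k 2 0)) f" if "f \<in> carrier (FU k)" for f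
    proof -
      have m: "eu k 2 0 - 0\<^sub>m k k = (eu k 2 0 :: 'a mat)" by (intro eq_matI) auto
      have "?d (pick12 (eu k 2 0) x) = pick12 (eu k 2 0) x" for x
        using k3 by (simp add: db mult_eu m) (simp add: pick12_def)
      then show ?thesis unfolding dw[OF eu_carrier tr(3)[OF k3] that] by simp
    qed
    note Dl = lin_add[OF der_lin[OF D]] lin_diff[OF der_lin[OF D] F.nalg_axioms F.nalg_axioms] der_mult[OF D]
    have "free_LU_act k ?d (idt3 k ?X ?Y \<oplus>\<^bsub>FU k\<^esub> idt4 k ?X ?Y) \<in> J"
      using J dL 34 k3 unfolding TLU_ideal_def by auto
    also have "free_LU_act k ?d (idt3 k ?X ?Y \<oplus>\<^bsub>FU k\<^esub> idt4 k ?X ?Y) = LU_act k ?d (idt3 k ?X ?Y \<oplus>\<^bsub>FU k\<^esub> idt4 k ?X ?Y)"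
      using k3 by (simp add: LU_act_def idt_closed gen_closed)
    also have "\<dots> = idt4 k ?X ?Y"
      using k3 by (simp add: Dl idt_closed gen_closed) (simp add: idt3_def idt4_def Dl cl d12 d21 d31 self)
    finally have 4: "idt4 k ?X ?Y \<in> J" .
    have "(idt3 k ?X ?Y \<oplus>\<^bsub>FU k\<^esub> idt4 k ?X ?Y) \<oplus>\<^bsub>FU k\<^esub> (-1) \<odot>\<^bsub>FU k\<^esub> idt4 k ?X ?Y \<in> J"
      using J 34 4 k3 unfolding TLU_ideal_def alg_ideal_def by auto
    also have "(idt3 k ?X ?Y \<oplus>\<^bsub>FU k\<^esub> idt4 k ?X ?Y) \<oplus>\<^bsub>FU k\<^esub> (-1) \<odot>\<^bsub>FU k\<^esub> idt4 k ?X ?Y = idt3 k ?X ?Y"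
      using k3 by (simp add: idt_closed gen_closed F.a_assoc F.r_neg flip: F.minus_smult)
    finally show ?thesis using 1 2 4 by simp
  qed
qed

section \<open>The identities of the matrix algebra\<close>

lemma Id_T_ideal: "TLU_ideal k (Id_LU_mat k :: 'a::field_char_0 flu set)"
proof -
  interpret R: lie_rep "FU k :: ('a, _) module" "der_mat k" "LU_act k" by (rule FU_rep)
  interpret M: lie_rep "mat_alg k :: ('a, _) module" "der_mat k" "\<lambda>d. d" by (rule mat_rep)
  let ?ev = "\<lambda>\<psi> b. \<psi> \<in> alg_hom (FU k :: ('a, _) module) (mat_alg k) \<and> (\<forall>i. b i \<in> carrier_mat k k) \<and>
    (\<forall>i. \<forall>u\<in>carrier (Uk k). \<psi> (free_LU_var k i u) = uea_act (mat_alg k) (\<lambda>d. d) u (b i))"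
  have Id: "f \<in> Id_LU_mat k \<longleftrightarrow> f \<in> carrier (FU k) \<and> (\<forall>\<psi> b. ?ev \<psi> b \<longrightarrow> \<psi> f = 0\<^sub>m k k)" for f :: "'a flu"
    unfolding Id_LU_mat_def LU_identities_def by auto
  have "alg_ideal (FU k) (Id_LU_mat k :: 'a flu set)"
  proof -
    have K: "alg_ideal (FU k) {x \<in> carrier (FU k). \<psi> x = 0\<^sub>m k k}" if "?ev \<psi> b" for \<psi> b
      using hom_kernel_ideal[OF R.nalg_axioms M.nalg_axioms, of \<psi>] that by simp
    have "alg_ideal (FU k) (carrier (FU k) \<inter>
        (\<Inter>\<psi>\<in>{\<psi>. \<exists>b. ?ev \<psi> b}. {x \<in> carrier (FU k :: ('a, _) module). \<psi> x = 0\<^sub>m k k}))"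
      by (rule R.alg_ideal_INT) (use K in blast)
    moreover have "C \<inter> (\<Inter>\<psi>\<in>{\<psi>. \<exists>b. E \<psi> b}. {x \<in> C. \<psi> x = z}) = {f \<in> C. \<forall>\<psi> b. E \<psi> b \<longrightarrow> \<psi> f = z}"
      for C :: "'a flu set" and E :: "('a flu \<Rightarrow> 'a mat) \<Rightarrow> (nat \<Rightarrow> 'a mat) \<Rightarrow> bool" and z
      by auto
    moreover have "Id_LU_mat k = {f \<in> carrier (FU k :: ('a, _) module). \<forall>\<psi> b. ?ev \<psi> b \<longrightarrow> \<psi> f = 0\<^sub>m k k}"
      by (rule Set.set_eqI) (simp only: Id mem_Collect_eq)
    ultimately show ?thesis by (simp only:)
  qed
  moreover have "free_LU_act k d f \<in> Id_LU_mat k" if d: "d \<in> carrier (der_mat k)" and f: "f \<in> Id_LU_mat k"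
    for d and f :: "'a flu"
  proof -
    have fc: "f \<in> carrier (FU k)" using f by (simp add: Id)
    have e: "free_LU_act k d f = LU_act k d f" using fc by (simp add: LU_act_def)
    have "\<psi> (LU_act k d f) = 0\<^sub>m k k" if "?ev \<psi> b" for \<psi> b
    proof -
      have "\<psi> (LU_act k d f) = d (\<psi> f)"
        by (rule LU_hom_equivariant[OF mat_rep _ _ _ _ fc, of \<psi> b]) (use that d in auto)
      also have "\<psi> f = 0\<^sub>m k k" using f that by (auto simp: Id)
      also have "d (0\<^sub>m k k) = 0\<^sub>m k k" using lin_zero[OF der_lin mat_alg_nalg mat_alg_nalg, of d] d by simp
      finally show ?thesis .
    qed
    then show ?thesis using R.rho_closed[OF d fc] by (auto simp: Id e)
  qed
  moreover have "\<Psi> f \<in> Id_LU_mat k"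
    if h: "\<Psi> \<in> alg_hom (FU k) (FU k)" and eq: "\<And>d f. d \<in> carrier (der_mat k) \<Longrightarrow> f \<in> carrier (FU k) \<Longrightarrow>
           \<Psi> (free_LU_act k d f) = free_LU_act k d (\<Psi> f)" and f: "f \<in> Id_LU_mat k"
    for \<Psi> and f :: "'a flu"
  proof -
    note hl = lin_closed[OF hom_lin[OF h]] lin_add[OF hom_lin[OF h]] lin_smult[OF hom_lin[OF h]] hom_mult[OF h]
    have fc: "f \<in> carrier (FU k)" using f by (simp add: Id)
    have "\<psi> (\<Psi> f) = 0\<^sub>m k k" if ev: "?ev \<psi> b" for \<psi> b
    proof -
      have p: "\<psi> \<in> alg_hom (FU k) (mat_alg k)" and b: "\<And>i. b i \<in> carrier (mat_alg k)"
        and pv: "\<And>i u. u \<in> carrier (Uk k) \<Longrightarrow> \<psi> (free_LU_var k i u) = uea_act (mat_alg k) (\<lambda>d. d) u (b i)"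
        using ev by auto
      note pl = lin_closed[OF hom_lin[OF p]] lin_add[OF hom_lin[OF p]] lin_smult[OF hom_lin[OF p]] hom_mult[OF p]
      define c where "c i = \<psi> (\<Psi> (gen k i))" for i
      have cc: "c i \<in> carrier_mat k k" for i using pl(1)[OF hl(1)[OF gen_closed]] by (simp add: c_def)
      define \<chi> where "\<chi> = restrict (\<lambda>x. \<psi> (\<Psi> x)) (carrier (FU k))"
      have "\<chi> \<in> alg_hom (FU k) (mat_alg k)"
        unfolding \<chi>_def by (rule alg_homI[OF _ _ _ _ R.nalg_axioms]) (use pl hl in auto)
      moreover have "\<chi> (free_LU_var k i u) = uea_act (mat_alg k) (\<lambda>d. d) u (c i)" if u: "u \<in> carrier (Uk k)" for i u
      proof -
        have "\<Psi> (uea_act (FU k) (LU_act k) u (gen k i)) = uea_act (FU k) (LU_act k) u (\<Psi> (gen k i))"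
          by (rule act_natural[OF FU_rep FU_rep hom_lin[OF h] _ u gen_closed])
             (use eq hl(1) in \<open>auto simp: LU_act_def\<close>)
        moreover have "\<psi> (uea_act (FU k) (LU_act k) u (\<Psi> (gen k i))) = uea_act (mat_alg k) (\<lambda>d. d) u (c i)"
          unfolding c_def
        proof (rule act_natural[OF FU_rep mat_rep hom_lin[OF p] _ u hl(1)[OF gen_closed]])
          fix d :: "'a mat \<Rightarrow> 'a mat" and g :: "'a flu" assume "d \<in> carrier (der_mat k)" "g \<in> carrier (FU k)"
          then show "\<psi> (LU_act k d g) = d (\<psi> g)"
            by (intro LU_hom_equivariant[OF mat_rep p b pv]) auto
        qed
        ultimately show ?thesis using LU_var_eq_act[OF u, of i] R.act_closed[OF gen_closed u, of i] by (simp add: \<chi>_def)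
      qed
      ultimately have "?ev \<chi> c" using cc by blast
      then have "\<chi> f = 0\<^sub>m k k" by (rule conjunct2[OF Id[THEN iffD1, OF f], rule_format])
      then show ?thesis using fc by (simp add: \<chi>_def)
    qed
    then show ?thesis using hl(1)[OF fc] by (auto simp: Id)
  qed
  ultimately show ?thesis unfolding TLU_ideal_def by blast
qed

lemma idt_in_Id:
  "idt1 k (gen k x) (gen k y) \<in> (Id_LU_mat k :: 'a::field_char_0 flu set)"
  "idt2 k (gen k x) (gen k y) \<in> (Id_LU_mat k :: 'a flu set)"
  "idt3 k (gen k x) (gen k y) \<in> (Id_LU_mat k :: 'a flu set)"
  "3 \<le> k \<Longrightarrow> idt4 k (gen k x) (gen k y) \<in> (Id_LU_mat k :: 'a flu set)"
proof -
  interpret F: nalg "FU k :: ('a, _) module" by (rule free_LU_nalg)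
  let ?ev = "\<lambda>\<psi> b. \<psi> \<in> alg_hom (FU k :: ('a, _) module) (mat_alg k) \<and> (\<forall>i. b i \<in> carrier_mat k k) \<and>
    (\<forall>i. \<forall>u\<in>carrier (Uk k). \<psi> (free_LU_var k i u) = uea_act (mat_alg k) (\<lambda>d. d) u (b i))"
  have Id: "f \<in> Id_LU_mat k" if "f \<in> carrier (FU k)" "\<And>\<psi> b. ?ev \<psi> b \<Longrightarrow> \<psi> f = 0\<^sub>m k k" for f :: "'a flu"
    using that unfolding Id_LU_mat_def LU_identities_def by auto
  have k0: "0 < k" "1 < k" using k2 by auto
  have cm: "cent k a * b = b * cent k a" if "b \<in> carrier_mat k k" for a b :: "'a mat"
    using that by (simp add: cent_def mult_smult_distrib[of _ k k _ k] mult_smult_assoc_mat[of _ k k _ k])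
  have pm: "pick12 (eu k p q) a * pick12 (eu k r s) b = (a $$ (0, 1) * b $$ (0, 1)) \<cdot>\<^sub>m (eu k p q * eu k r s)"
    for a b :: "'a mat" and p q r s
  proof -
    have "c \<cdot>\<^sub>m (d \<cdot>\<^sub>m A) = (c * d) \<cdot>\<^sub>m A" for c d :: 'a and A by (intro eq_matI) auto
    then show ?thesis
      by (simp add: pick12_def mult_smult_distrib[of _ k k _ k] mult_smult_assoc_mat[of _ k k _ k] mult.commute)
  qed
  have pc: "pick12 (eu k p q) a \<in> carrier_mat k k" for p q and a :: "'a mat" by (simp add: pick12_def)
  have self: "A - A = 0\<^sub>m k k" if "A \<in> carrier_mat k k" for A :: "'a mat" using that by (intro eq_matI) auto
  have vals: "\<psi> (idt1 k (gen k x) (gen k y)) = 0\<^sub>m k k \<and> \<psi> (idt2 k (gen k x) (gen k y)) = 0\<^sub>m k k \<and>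
     \<psi> (idt3 k (gen k x) (gen k y)) = 0\<^sub>m k k \<and> (3 \<le> k \<longrightarrow> \<psi> (idt4 k (gen k x) (gen k y)) = 0\<^sub>m k k)"
    if ev: "?ev \<psi> b" for \<psi> b
  proof -
    have h: "\<psi> \<in> alg_hom (FU k) (mat_alg k)" and b: "\<And>i. b i \<in> carrier_mat k k"
      and v: "\<And>i u. u \<in> carrier (Uk k) \<Longrightarrow> \<psi> (free_LU_var k i u) = phi k u (b i)"
      using ev by (auto simp: phi_def)
    note hl = lin_diff[OF hom_lin[OF h] F.nalg_axioms mat_alg_nalg] hom_mult[OF h, simplified]
    note s = commutator_def hl opact_closed[OF rc] opact_closed[OF r12(1)] opact_closed[OF r12(2)]
      opact_closed[OF r12(3)] gen_closed opact_eval[OF rc v b] opact_eval[OF r12(1) v b] opact_eval[OF r12(2) v b]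
      opact_eval[OF r12(3) v b]
    have mc: "A * B \<in> carrier_mat k k" if "A \<in> carrier_mat k k" "B \<in> carrier_mat k k" for A B :: "'a mat"
      using that by (rule mult_carrier_mat)
    have "c \<cdot>\<^sub>m 0\<^sub>m k k = 0\<^sub>m k k" for c :: 'a by (intro eq_matI) auto
    then show ?thesis
      using k0 by (simp add: idt1_def idt2_def idt3_def idt4_def s mat_alg_minus mc pc self pm mult_eu mult.commute
        cm[OF cent_carrier, of "b x" "b y"] cm[OF pc, of "b x"])
  qed
  show "idt1 k (gen k x) (gen k y) \<in> (Id_LU_mat k :: 'a flu set)"
    "idt2 k (gen k x) (gen k y) \<in> (Id_LU_mat k :: 'a flu set)"
    "idt3 k (gen k x) (gen k y) \<in> (Id_LU_mat k :: 'a flu set)"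
    "3 \<le> k \<Longrightarrow> idt4 k (gen k x) (gen k y) \<in> (Id_LU_mat k :: 'a flu set)"
    using vals by (auto intro!: Id idt_closed gen_closed)
qed

end

section \<open>Independence of monomials and quotients as vector spaces\<close>

text \<open>
  The monomials are multiplicative functions of \<open>\<xi>\<close>, and the proof is Dedekind's for characters. If the
  exponents of \<open>M1\<close> and \<open>M0\<close> at \<open>t\<close> differ, replacing \<open>\<xi> t\<close> by \<open>2 \<xi> t\<close> multiplies the two monomials by
  different powers of 2, and a combination of the two relations eliminates \<open>M0\<close> but not \<open>M1\<close>.
\<close>

lemma monomials_independent:
  fixes a :: "'t multiset \<Rightarrow> 'a::field_char_0"
  assumes "finite Ms" "\<And>\<xi>. (\<Sum>M\<in>Ms. a M * prod_mset (image_mset \<xi> M)) = 0" "M \<in> Ms"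
  shows "a M = 0"
  using assms
proof (induction Ms arbitrary: a M rule: finite_induct)
  case (insert M0 Ms)
  let ?c = "\<lambda>M \<xi>. prod_mset (image_mset \<xi> M) :: 'a"
  have mult: "?c M (\<lambda>t. \<xi> t * \<eta> t) = ?c M \<xi> * ?c M \<eta>" for M and \<xi> \<eta> :: "'t \<Rightarrow> 'a"
    by (rule prod_mset.distrib)
  have Ms: "a M1 = 0" if M1: "M1 \<in> Ms" for M1
  proof -
    have "M1 \<noteq> M0" using insert M1 by auto
    then obtain t where t: "count M1 t \<noteq> count M0 t" by (auto simp: multiset_eq_iff)
    define \<eta> where "\<eta> s = (if s = t then 2 else 1 :: 'a)" for s
    have val: "?c M \<eta> = 2 ^ count M t" for M
      by (induction M) (auto simp: \<eta>_def)
    have inj: "(2::'a) ^ m = 2 ^ n \<longleftrightarrow> m = n" for m n :: nat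
    proof -
      have "(2::'a) ^ m = of_nat (2 ^ m)" "(2::'a) ^ n = of_nat (2 ^ n)" by simp_all
      then show ?thesis by (simp only: of_nat_eq_iff) simp
    qed
    have ne: "?c M1 \<eta> - ?c M0 \<eta> \<noteq> 0" using t by (simp add: val inj)
    define a' where "a' M = a M * (?c M \<eta> - ?c M0 \<eta>)" for M
    have "(\<Sum>M\<in>Ms. a' M * ?c M \<xi>) = 0" for \<xi>
    proof -
      have 1: "(\<Sum>M\<in>insert M0 Ms. a M * ?c M (\<lambda>t. \<xi> t * \<eta> t)) = 0"
        and 2: "(\<Sum>M\<in>insert M0 Ms. a M * ?c M \<xi>) = 0" by (rule insert.prems(1))+
      have "(\<Sum>M\<in>Ms. a' M * ?c M \<xi>) = (\<Sum>M\<in>insert M0 Ms. a' M * ?c M \<xi>)"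
        using insert.hyps by (simp add: a'_def)
      also have "\<dots> = (\<Sum>M\<in>insert M0 Ms. a M * ?c M (\<lambda>t. \<xi> t * \<eta> t) - ?c M0 \<eta> * (a M * ?c M \<xi>))"
        unfolding mult by (intro sum.cong refl) (simp add: a'_def algebra_simps)
      also have "\<dots> = 0" by (simp only: sum_subtractf sum_distrib_left[symmetric] 1 2) simp
      finally show ?thesis .
    qed
    then have "a' M1 = 0" using insert.IH M1 by blast
    then show ?thesis using ne by (simp add: a'_def)
  qed
  have "(\<Sum>M\<in>insert M0 Ms. a M * ?c M (\<lambda>_. 1)) = 0" by (rule insert.prems(1))
  then have "a M0 = 0" using insert.hyps Ms by simp
  then show ?case using Ms insert.prems(2) by auto
qed simp

lemma (in vector_space) projection_with_kernel:
  assumes K: "subspace K"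
  shows "\<exists>\<pi>. (\<forall>x y. \<pi> (x + y) = \<pi> x + \<pi> y) \<and> (\<forall>c x. \<pi> (scale c x) = scale c (\<pi> x)) \<and>
    (\<forall>x. \<pi> x = 0 \<longleftrightarrow> x \<in> K) \<and> (\<forall>x. x - \<pi> x \<in> K)"
proof -
  interpret vector_space_pair scale scale ..
  obtain B where B: "B \<subseteq> K" "independent B" "K \<subseteq> span B"
    using maximal_independent_subset[of K] by blast
  have sB: "span B = K" using B span_minimal[OF B(1) K] by blast
  let ?C = "extend_basis B"
  have C: "independent ?C" "span ?C = UNIV"
    using independent_extend_basis[OF B(2)] span_extend_basis[OF B(2)] by auto
  obtain \<pi> where lin: "Vector_Spaces.linear scale scale \<pi>"
    and val: "\<And>x. x \<in> ?C \<Longrightarrow> \<pi> x = (if x \<in> B then 0 else x)"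
    using linear_independent_extend[OF C(1), of "\<lambda>x. if x \<in> B then 0 else x"] by blast
  interpret l: Vector_Spaces.linear scale scale \<pi> by (rule lin)
  have diff: "x - \<pi> x \<in> K" for x
  proof -
    have "x \<in> span ?C" using C by simp
    then show ?thesis
    proof (induction rule: span_induct_alt)
      case base then show ?case using subspace_0[OF K] by (simp add: l.zero)
    next
      case (step c x y)
      have "x - \<pi> x \<in> K" using step(1) B(1) subspace_0[OF K] by (auto simp: val)
      then have "scale c (x - \<pi> x) + (y - \<pi> y) \<in> K"
        using step by (intro subspace_add[OF K] subspace_scale[OF K])
      also have "scale c (x - \<pi> x) + (y - \<pi> y) = scale c x + y - \<pi> (scale c x + y)"
        by (simp add: l.add l.scale scale_right_diff_distrib)
      finally show ?case .
    qed
  qed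
  have ker: "\<pi> x = 0" if "x \<in> K" for x
  proof -
    have "x \<in> span B" using that sB by simp
    then show ?thesis
    proof (induction rule: span_induct_alt)
      case (step c x y)
      then have "\<pi> x = 0" using val[of x] extend_basis_superset[OF B(2)] by auto
      then show ?case using step by (simp add: l.add l.scale)
    qed (simp add: l.zero)
  qed
  have "\<pi> x = 0 \<longleftrightarrow> x \<in> K" for x using ker diff[of x] by auto
  then show ?thesis using diff by (intro exI[of _ \<pi>]) (auto simp: l.add l.scale)
qed

text \<open>
  A model of the quotient of \<open>F\<close> by \<open>J\<close> inside a vector space that is a type. The coset of \<open>f\<close> is
  represented by \<open>\<theta> f\<close>, the image of any preimage of \<open>f\<close> under a projection whose kernel is the preimage
  of \<open>J\<close>; the map \<open>\<sigma>\<close> leads back.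
\<close>

lemma (in vector_space) quotient_section:
  fixes F :: "('a, 'v) module" and \<sigma> :: "'b \<Rightarrow> 'v"
  assumes F: "nalg F" and J: "alg_ideal F J"
    and sc: "\<And>a. \<sigma> a \<in> carrier F" and sa: "\<And>a b. \<sigma> (a + b) = \<sigma> a \<oplus>\<^bsub>F\<^esub> \<sigma> b"
    and ss: "\<And>c a. \<sigma> (scale c a) = c \<odot>\<^bsub>F\<^esub> \<sigma> a" and sur: "\<And>f. f \<in> carrier F \<Longrightarrow> \<exists>a. \<sigma> a = f"
  shows "\<exists>\<theta>. (\<forall>f\<in>carrier F. \<forall>g\<in>carrier F. \<theta> (f \<oplus>\<^bsub>F\<^esub> g) = \<theta> f + \<theta> g) \<and>
     (\<forall>c. \<forall>f\<in>carrier F. \<theta> (c \<odot>\<^bsub>F\<^esub> f) = scale c (\<theta> f)) \<and>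
     (\<forall>f\<in>carrier F. \<theta> f = 0 \<longleftrightarrow> f \<in> J) \<and> (\<forall>f\<in>carrier F. \<theta> (\<sigma> (\<theta> f)) = \<theta> f)"
proof -
  interpret F: nalg F by fact
  have s0: "\<sigma> 0 = \<zero>\<^bsub>F\<^esub>" using ss[of 0 0] sc[of 0] by simp
  have "subspace {a. \<sigma> a \<in> J}"
    using J by (auto simp: subspace_def s0 sa ss alg_ideal_def)
  \<comment> \<open>\<open>\<theta>\<close> is well defined because \<open>\<pi>\<close> kills the kernel of \<open>\<sigma>\<close>\<close>
  from projection_with_kernel[OF this] obtain \<pi>
    where pa: "\<And>x y. \<pi> (x + y) = \<pi> x + \<pi> y" and ps: "\<And>c x. \<pi> (scale c x) = scale c (\<pi> x)"
      and pk: "\<And>x. \<pi> x = 0 \<longleftrightarrow> \<sigma> x \<in> J" and pd: "\<And>x. \<sigma> (x - \<pi> x) \<in> J" by auto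
  have pm: "\<pi> (x - y) = \<pi> x - \<pi> y" for x y
    using pa[of "x - y" y] by (simp add: algebra_simps)
  define \<theta> where "\<theta> f = \<pi> (SOME a. \<sigma> a = f)" for f
  have ts: "\<theta> (\<sigma> a) = \<pi> a" for a
  proof -
    define b where "b = (SOME b. \<sigma> b = \<sigma> a)"
    have b: "\<sigma> b = \<sigma> a" unfolding b_def by (rule someI) (rule refl)
    have "b - a = b + scale (-1) a" by simp
    then have "\<sigma> (b - a) = \<sigma> b \<oplus>\<^bsub>F\<^esub> (-1) \<odot>\<^bsub>F\<^esub> \<sigma> a" by (simp only: sa ss)
    also have "\<dots> = \<zero>\<^bsub>F\<^esub>" using sc[of a] by (simp add: b F.r_neg flip: F.minus_smult)
    also have "\<dots> \<in> J" using J by (simp add: alg_ideal_def)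
    finally have "\<pi> (b - a) = 0" by (simp add: pk)
    then show ?thesis by (simp add: \<theta>_def b_def[symmetric] pm)
  qed
  have ex: "\<exists>a. f = \<sigma> a" if "f \<in> carrier F" for f using sur[OF that] by blast
  have 1: "\<theta> (f \<oplus>\<^bsub>F\<^esub> g) = \<theta> f + \<theta> g" if "f \<in> carrier F" "g \<in> carrier F" for f g
    using ex[OF that(1)] ex[OF that(2)] by (auto simp: ts pa simp flip: sa)
  have 2: "\<theta> (c \<odot>\<^bsub>F\<^esub> f) = scale c (\<theta> f)" if "f \<in> carrier F" for f c
    using ex[OF that] by (auto simp: ts ps simp flip: ss)
  have 3: "\<theta> f = 0 \<longleftrightarrow> f \<in> J" if "f \<in> carrier F" for f
    using ex[OF that] by (auto simp: ts pk)
  have 4: "\<theta> (\<sigma> (\<theta> f)) = \<theta> f" if f: "f \<in> carrier F" for f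
  proof -
    obtain a where a: "f = \<sigma> a" using ex[OF f] by blast
    have "\<pi> (a - \<pi> a) = 0" using pd by (simp add: pk)
    then show ?thesis by (simp add: a ts pm)
  qed
  show ?thesis using 1 2 3 4 by (intro exI[of _ \<theta>]) blast
qed

lemma vector_space_scl: "vector_space (scl :: 'a::field \<Rightarrow> ('w \<Rightarrow>\<^sub>0 'a) \<Rightarrow> _)"
  by (rule vector_space.intro; intro poly_mapping_eqI; simp add: lookup_add algebra_simps)

section \<open>The free algebra is spanned by words in the coordinates of its variables\<close>

lemma
  assumes "finite I" "\<And>j. j \<in> I \<Longrightarrow> m j \<in> carrier_mat k k"
  shows mat_finsum_carrier: "(\<Oplus>\<^bsub>mat_alg k\<^esub>j\<in>I. a j \<cdot>\<^sub>m m j) \<in> carrier_mat k k"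
    and mat_finsum_entry: "r < k \<Longrightarrow> s < k \<Longrightarrow>
      (\<Oplus>\<^bsub>mat_alg k\<^esub>j\<in>I. a j \<cdot>\<^sub>m m j) $$ (r, s) = (\<Sum>j\<in>I. a j * (m j :: 'a::field mat) $$ (r, s))"
proof -
  interpret M: nalg "mat_alg k :: ('a, 'a mat) module" by (rule mat_alg_nalg)
  have "(\<Oplus>\<^bsub>mat_alg k\<^esub>j\<in>I. a j \<cdot>\<^sub>m m j) \<in> carrier_mat k k \<and> (\<forall>r<k. \<forall>s<k.
      (\<Oplus>\<^bsub>mat_alg k\<^esub>j\<in>I. a j \<cdot>\<^sub>m m j) $$ (r, s) = (\<Sum>j\<in>I. a j * m j $$ (r, s)))"
    using assms
  proof (induction I rule: finite_induct)
    case (insert i I)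
    have "(\<lambda>j. a j \<cdot>\<^sub>m m j) \<in> I \<rightarrow> carrier (mat_alg k)" "a i \<cdot>\<^sub>m m i \<in> carrier (mat_alg k)"
      using insert by auto
    then have "(\<Oplus>\<^bsub>mat_alg k\<^esub>j\<in>insert i I. a j \<cdot>\<^sub>m m j) = a i \<cdot>\<^sub>m m i + (\<Oplus>\<^bsub>mat_alg k\<^esub>j\<in>I. a j \<cdot>\<^sub>m m j)"
      using insert.hyps by (simp add: M.finsum_insert)
    moreover have mi: "m i \<in> carrier_mat k k"
      using insert by auto
    ultimately show ?case using insert by (auto simp: carrier_matD(1,2)[OF mi] carrier_matD)
  qed simp
  then show "(\<Oplus>\<^bsub>mat_alg k\<^esub>j\<in>I. a j \<cdot>\<^sub>m m j) \<in> carrier_mat k k"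
    "r < k \<Longrightarrow> s < k \<Longrightarrow> (\<Oplus>\<^bsub>mat_alg k\<^esub>j\<in>I. a j \<cdot>\<^sub>m m j) $$ (r, s) = (\<Sum>j\<in>I. a j * m j $$ (r, s))"
    by blast+
qed

text \<open>
  A label consists of a variable and of a coordinate on \<open>M\<^sub>k\<close>: \<open>None\<close> is the scalar part, \<open>Some (r, s)\<close> an
  entry of the traceless part.
\<close>

type_synonym tok = "nat \<times> (nat \<times> nat) option"

text \<open>
  The operator of a letter: the projection onto the scalars, or a coordinate times a basis matrix of
  \<open>sl\<^sub>k\<close>.
\<close>

definition item_op :: "nat \<Rightarrow> tok \<times> nat \<times> nat \<Rightarrow> 'a::field mat \<Rightarrow> 'a mat" where
  "item_op k x = (case snd (fst x) of None \<Rightarrow> cent k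
     | Some \<alpha> \<Rightarrow> (\<lambda>y. co k y (fst \<alpha>) (snd \<alpha>) \<cdot>\<^sub>m fb k (fst (snd x)) (snd (snd x))))"

definition items :: "nat \<Rightarrow> (tok \<times> nat \<times> nat) set" where
  "items k = {x. case snd (fst x) of None \<Rightarrow> True | Some \<alpha> \<Rightarrow> \<alpha> \<in> fb_index k \<and> snd x \<in> fb_index k}"

definition item_elt :: "nat \<Rightarrow> tok \<times> nat \<times> nat \<Rightarrow> 'a::field flu" where
  "item_elt k x = opact k (item_op k x) (gen k (fst (fst x)))"

lemma realized_item:
  assumes "x \<in> items k" "0 < k"
  shows "realized k (item_op k x :: 'a::field_char_0 mat \<Rightarrow> _)"
proof (cases "snd (fst x)")
  case None
  then show ?thesis using realized_cent[OF assms(2)] by (simp add: item_op_def)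
next
  case (Some \<alpha>)
  then have "\<alpha> \<in> fb_index k" "snd x \<in> fb_index k" using assms by (auto simp: items_def)
  then show ?thesis using Some mtr_fb[of "snd x" k]
    by (auto simp: item_op_def fb_index_def intro!: realized_rank_one)
qed

lemma item_elt_closed: "x \<in> items k \<Longrightarrow> 0 < k \<Longrightarrow> (item_elt k x :: 'a::field_char_0 flu) \<in> carrier (FU k)"
  unfolding item_elt_def by (intro opact_closed realized_item gen_closed)

lemma word_closed:
  assumes ws: "set ws \<subseteq> items k" and k: "0 < k"
  shows "prodl (FU k) (item_elt k) ws \<in> carrier (FU k :: ('a::field_char_0, _) module)"
proof -
  interpret F: nalg "FU k :: ('a, _) module" by (rule free_LU_nalg)
  show ?thesis by (rule F.prodl_closed) (rule item_elt_closed[OF subsetD[OF ws] k])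
qed

text \<open>
  The operators of the letters span \<open>\<phi>(U(L))\<close>: an operator that preserves the scalars and \<open>sl\<^sub>k\<close> is given
  by a scalar and a matrix of coefficients.
\<close>

lemma phi_coordinates:
  assumes u: "u \<in> carrier (Uk k :: ('a::field_char_0, _) module)" and k: "0 < k"
    and x: "x \<in> carrier_mat k k" and g: "phi k u (1\<^sub>m k) = \<gamma> \<cdot>\<^sub>m 1\<^sub>m k" and rs: "r < k" "s < k"
  shows "phi k u x $$ (r, s) = \<gamma> * cent k x $$ (r, s) +
    (\<Sum>(\<alpha>, \<beta>)\<in>fb_index k \<times> fb_index k. phi k u (fb k (fst \<alpha>) (snd \<alpha>)) $$ \<beta> *
      (co k x (fst \<alpha>) (snd \<alpha>) \<cdot>\<^sub>m fb k (fst \<beta>) (snd \<beta>)) $$ (r, s))"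
proof -
  let ?y = "x - cent k x"
  let ?f = "\<lambda>\<alpha>. fb k (fst \<alpha>) (snd \<alpha>) :: 'a mat"
  have y: "?y \<in> carrier_mat k k" by (simp add: minus_carrier_mat)
  have tr: "mtr k ?y = 0" using x k by (simp add: mtr_minus) (simp add: cent_def mtr_smult mtr_one)
  have co: "?y $$ \<alpha> = co k x (fst \<alpha>) (snd \<alpha>)" if "\<alpha> \<in> fb_index k" for \<alpha>
    using that x by (auto simp: fb_index_def cent_def co_def)
  define Y where "Y = (\<Oplus>\<^bsub>mat_alg k\<^esub>\<alpha>\<in>fb_index k. co k x (fst \<alpha>) (snd \<alpha>) \<cdot>\<^sub>m ?f \<alpha>)"
  have Yc: "Y \<in> carrier_mat k k" unfolding Y_def by (rule mat_finsum_carrier[OF finite_fb_index]) simp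
  have "Y $$ (i, j) = ?y $$ (i, j)" if "i < k" "j < k" for i j
    unfolding Y_def traceless_expand[OF y tr that]
    by (subst mat_finsum_entry[OF finite_fb_index _ that]) (auto intro!: sum.cong simp: co)
  then have yY: "?y = Y" using y Yc by (intro eq_matI) auto
  have "phi k u Y = (\<Oplus>\<^bsub>mat_alg k\<^esub>\<alpha>\<in>fb_index k. co k x (fst \<alpha>) (snd \<alpha>) \<cdot>\<^sub>m phi k u (?f \<alpha>))"
    unfolding Y_def
    by (rule linear_finsum[OF mat_alg_nalg mat_alg_nalg finite_fb_index, where m = ?f, simplified])
       (auto simp: phi_closed u phi_add_right phi_smult_right)
  then have "phi k u ?y $$ (r, s) = (\<Sum>\<alpha>\<in>fb_index k. co k x (fst \<alpha>) (snd \<alpha>) * phi k u (?f \<alpha>) $$ (r, s))"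
    unfolding yY using mat_finsum_entry[OF finite_fb_index _ rs, where m = "\<lambda>\<alpha>. phi k u (?f \<alpha>)"] phi_closed[OF fb_carrier u]
    by simp
  also have "\<dots> = (\<Sum>\<alpha>\<in>fb_index k. \<Sum>\<beta>\<in>fb_index k. phi k u (?f \<alpha>) $$ \<beta> * (co k x (fst \<alpha>) (snd \<alpha>) \<cdot>\<^sub>m ?f \<beta>) $$ (r, s))"
  proof (rule sum.cong[OF refl])
    fix \<alpha> assume a: "\<alpha> \<in> fb_index k"
    have t: "mtr k (phi k u (?f \<alpha>)) = 0" using phi_structure[OF u k] by (simp add: mtr_fb[OF a])
    show "co k x (fst \<alpha>) (snd \<alpha>) * phi k u (?f \<alpha>) $$ (r, s) =
        (\<Sum>\<beta>\<in>fb_index k. phi k u (?f \<alpha>) $$ \<beta> * (co k x (fst \<alpha>) (snd \<alpha>) \<cdot>\<^sub>m ?f \<beta>) $$ (r, s))"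
      unfolding traceless_expand[OF phi_closed[OF fb_carrier u] t rs]
      using rs by (simp add: sum_distrib_left carrier_matD[OF fb_carrier] mult.left_commute)
  qed
  also have "\<dots> = (\<Sum>(\<alpha>, \<beta>)\<in>fb_index k \<times> fb_index k. phi k u (?f \<alpha>) $$ \<beta> * (co k x (fst \<alpha>) (snd \<alpha>) \<cdot>\<^sub>m ?f \<beta>) $$ (r, s))"
    by (simp add: sum.cartesian_product)
  finally have 1: "phi k u ?y $$ (r, s) = \<dots>" .
  have "x = cent k x + ?y" using x by (intro eq_matI) (auto simp: cent_def)
  then have "phi k u x = phi k u (cent k x + ?y)" by (rule arg_cong)
  also have "\<dots> = phi k u (cent k x) + phi k u ?y"
    by (rule phi_add_right[OF u cent_carrier y])
  finally have "phi k u x = phi k u (cent k x) + phi k u ?y" .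
  moreover have "phi k u (cent k x) = \<gamma> \<cdot>\<^sub>m cent k x"
    unfolding cent_def using phi_smult_right[OF u one_carrier_mat] g by (simp add: mult.commute) (intro eq_matI, auto)
  ultimately show ?thesis
    using 1 rs phi_closed[OF y u] by (simp add: carrier_matD[OF cent_carrier])
qed

lemma words_span:
  assumes k: "0 < k" and f: "f \<in> carrier (FU k :: ('a::field_char_0, _) module)"
  shows "\<exists>p\<in>carrier (free_nonunital_alg (items k)). f = lext (FU k) (prodl (FU k) (item_elt k)) p"
proof -
  interpret F: nalg "FU k :: ('a, _) module" by (rule free_LU_nalg)
  let ?N = "free_nonunital_alg (items k) :: ('a, _) module"
  interpret N: nalg ?N by (rule free_nonunital_nalg)
  let ?e = "lext (FU k) (prodl (FU k) (item_elt k))"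
  define e where "e = restrict ?e (carrier ?N)"
  have e: "e \<in> alg_hom ?N (FU k)"
    unfolding e_def by (rule F.lext_prodl_hom) (rule item_elt_closed[OF _ k])
  note el = lin_closed[OF hom_lin[OF e]] lin_add[OF hom_lin[OF e]] lin_smult[OF hom_lin[OF e]] hom_mult[OF e]
  define R where "R = e ` carrier ?N"
  have Rz: "\<zero>\<^bsub>FU k\<^esub> \<in> R" using lin_zero[OF hom_lin[OF e] N.nalg_axioms F.nalg_axioms] N.zero_closed
    unfolding R_def by (metis imageI)
  have Ra: "a \<oplus>\<^bsub>FU k\<^esub> b \<in> R" if "a \<in> R" "b \<in> R" for a b
    using that unfolding R_def by (auto simp: el(2)[symmetric] simp del: free_alg_sel)
  have Rs: "c \<odot>\<^bsub>FU k\<^esub> a \<in> R" if "a \<in> R" for a c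
    using that unfolding R_def by (auto simp: el(3)[symmetric] simp del: free_alg_sel)
  have Rm: "a \<otimes>\<^bsub>FU k\<^esub> b \<in> R" if "a \<in> R" "b \<in> R" for a b
    using that unfolding R_def by (auto simp: el(4)[symmetric] simp del: free_alg_sel)
  have Ri: "item_elt k x \<in> R" if "x \<in> items k" for x
  proof -
    have lc: "letter x \<in> carrier ?N" by (rule letter_closed(2)[OF that])
    have "e (letter x) = item_elt k x"
      using lc F.lext_prodl_letter[of "item_elt k" x] item_elt_closed[OF that k]
      by (simp add: e_def)
    then show ?thesis unfolding R_def using lc by (metis imageI)
  qed
  have Rc: "R \<subseteq> carrier (FU k)" unfolding R_def using el(1) by blast
  have Rsum: "(\<Oplus>\<^bsub>FU k\<^esub>j\<in>I. a j \<odot>\<^bsub>FU k\<^esub> m j) \<in> R" if "finite I" "\<And>j. j \<in> I \<Longrightarrow> m j \<in> R"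
    for I :: "((nat \<times> nat) \<times> nat \<times> nat) option set" and a m
    using that
  proof (induction I rule: finite_induct)
    case (insert i I)
    have "(\<lambda>j. a j \<odot>\<^bsub>FU k\<^esub> m j) \<in> I \<rightarrow> carrier (FU k)" "a i \<odot>\<^bsub>FU k\<^esub> m i \<in> carrier (FU k)"
      using insert Rc by auto
    then show ?case using insert by (simp add: F.finsum_insert Ra Rs)
  qed (simp add: Rz)
  have var: "free_LU_var k i u \<in> R" if u: "u \<in> carrier (Uk k)" for i u
  proof -
    obtain \<gamma> where g: "phi k u (1\<^sub>m k) = \<gamma> \<cdot>\<^sub>m 1\<^sub>m k" using phi_structure[OF u k] by blast
    let ?I = "insert None (Some ` (fb_index k \<times> fb_index k))"
    \<comment> \<open>the second component of the letter for the scalar part is arbitrary\<close>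
    define it where "it j = (case j of None \<Rightarrow> ((i, None), (0, 0)) | Some (\<alpha>, \<beta>) \<Rightarrow> ((i, Some \<alpha>), \<beta>))"
      for j :: "((nat \<times> nat) \<times> nat \<times> nat) option"
    define a where "a j = (case j of None \<Rightarrow> \<gamma> | Some (\<alpha>, \<beta>) \<Rightarrow> phi k u (fb k (fst \<alpha>) (snd \<alpha>)) $$ \<beta>)"
      for j :: "((nat \<times> nat) \<times> nat \<times> nat) option"
    have iti: "it j \<in> items k" if "j \<in> ?I" for j
      using that by (auto simp: it_def items_def)
    have fst_it: "fst (fst (it j)) = i" for j by (auto simp: it_def split: option.splits)
    note lo = lift_op[OF realized_item[OF iti k]]
    have fin: "finite ?I" using finite_fb_index by simp
    have "free_LU_var k i u = (\<Oplus>\<^bsub>FU k\<^esub>j\<in>?I. a j \<odot>\<^bsub>FU k\<^esub> free_LU_var k i (lift_op k (item_op k (it j))))"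
    proof (rule LU_var_lincomb[OF fin lo(1) u])
      fix b :: "'a mat" and r s assume b: "b \<in> carrier_mat k k" and rs: "r < k" "s < k"
      have "(\<Sum>j\<in>?I. a j * phi k (lift_op k (item_op k (it j))) b $$ (r, s)) = (\<Sum>j\<in>?I. a j * item_op k (it j) b $$ (r, s))"
        using lo(2)[OF _ b] by (intro sum.cong refl) auto
      also have "\<dots> = a None * item_op k (it None) b $$ (r, s) +
          (\<Sum>j\<in>fb_index k \<times> fb_index k. a (Some j) * item_op k (it (Some j)) b $$ (r, s))"
        using finite_fb_index by (subst sum.insert) (auto simp: sum.reindex)
      also have "\<dots> = phi k u b $$ (r, s)"
        unfolding phi_coordinates[OF u k b g rs]
        by (simp add: a_def it_def item_op_def case_prod_unfold)
      finally show "phi k u b $$ (r, s) = (\<Sum>j\<in>?I. a j * phi k (lift_op k (item_op k (it j))) b $$ (r, s))" ..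
    qed
    also have "\<dots> \<in> R"
    proof (rule Rsum[OF fin])
      fix j assume j: "j \<in> ?I"
      have "free_LU_var k i (lift_op k (item_op k (it j))) = (item_elt k (it j) :: 'a flu)"
        unfolding item_elt_def fst_it by (rule opact_var[OF realized_item[OF iti[OF j] k], symmetric])
      then show "free_LU_var k i (lift_op k (item_op k (it j))) \<in> R" using Ri[OF iti[OF j]] by simp
    qed
    finally show ?thesis .
  qed
  have "f \<in> R"
    using f by (induction f rule: free_LU_induct) (auto intro: Rz var Ra Rs Rm)
  then show ?thesis unfolding R_def e_def by auto
qed

section \<open>An identity of matrices follows from the four identities\<close>

lemma ad_add:
  assumes "c \<in> carrier_mat k k" "d \<in> carrier_mat k k"
  shows "ad k (c + d) = ad k c \<oplus>\<^bsub>der_mat k\<^esub> ad k d"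
  using assms by (auto simp: ad_def fun_eq_iff restrict_def commutator_add_left[of _ k])

lemma ad_smult:
  assumes "c \<in> carrier_mat k k"
  shows "ad k (a \<cdot>\<^sub>m c) = a \<odot>\<^bsub>der_mat k\<^esub> ad k c"
proof -
  have "(a \<cdot>\<^sub>m c) * x - x * (a \<cdot>\<^sub>m c) = a \<cdot>\<^sub>m (c * x - x * c)" if "x \<in> carrier_mat k k" for x
  proof -
    have "(a \<cdot>\<^sub>m c) * x = a \<cdot>\<^sub>m (c * x)" "x * (a \<cdot>\<^sub>m c) = a \<cdot>\<^sub>m (x * c)"
      using assms that by (simp_all add: mult_smult_distrib[of _ k k _ k] mult_smult_assoc_mat[of _ k k _ k])
    then show ?thesis using assms that
      by (intro eq_matI) (auto simp: right_diff_distrib simp del: index_mult_mat(1))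
  qed
  then show ?thesis using assms by (auto simp: ad_def fun_eq_iff restrict_def)
qed

text \<open>
  \<open>A/J\<close> as a vector space on a type. Sums over index sets and scalar multiples are then those of the type,
  and the locale \<open>lu_core\<close> can be interpreted. \<open>\<theta> f\<close> represents the class of \<open>f\<close>; the type may contain
  further elements \<open>a\<close>, and the operations treat them as \<open>\<theta> (\<sigma> a)\<close>.
\<close>

locale T_model = vector_space scale
  for scale :: "'a::field_char_0 \<Rightarrow> 'e::ab_group_add \<Rightarrow> 'e" +
  fixes k :: nat and J :: "'a flu set" and \<sigma> :: "'e \<Rightarrow> 'a flu" and \<theta> :: "'a flu \<Rightarrow> 'e"
  assumes k2: "2 \<le> k" and T_ideal: "TLU_ideal k J"
    and sigma_closed [simp]: "\<sigma> a \<in> carrier (FU k)"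
    and sigma_add: "\<sigma> (a + b) = \<sigma> a \<oplus>\<^bsub>FU k\<^esub> \<sigma> b"
    and sigma_scale: "\<sigma> (scale c a) = c \<odot>\<^bsub>FU k\<^esub> \<sigma> a"
    and theta_add: "f \<in> carrier (FU k) \<Longrightarrow> g \<in> carrier (FU k) \<Longrightarrow> \<theta> (f \<oplus>\<^bsub>FU k\<^esub> g) = \<theta> f + \<theta> g"
    and theta_scale: "f \<in> carrier (FU k) \<Longrightarrow> \<theta> (c \<odot>\<^bsub>FU k\<^esub> f) = scale c (\<theta> f)"
    and theta_zero_iff: "f \<in> carrier (FU k) \<Longrightarrow> \<theta> f = 0 \<longleftrightarrow> f \<in> J"
    and theta_sigma: "f \<in> carrier (FU k) \<Longrightarrow> \<theta> (\<sigma> (\<theta> f)) = \<theta> f"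
    and idt: "f \<in> carrier (FU k) \<Longrightarrow> g \<in> carrier (FU k) \<Longrightarrow> idt1 k f g \<in> J"
      "f \<in> carrier (FU k) \<Longrightarrow> g \<in> carrier (FU k) \<Longrightarrow> idt2 k f g \<in> J"
      "f \<in> carrier (FU k) \<Longrightarrow> g \<in> carrier (FU k) \<Longrightarrow> idt3 k f g \<in> J"
      "3 \<le> k \<Longrightarrow> f \<in> carrier (FU k) \<Longrightarrow> g \<in> carrier (FU k) \<Longrightarrow> idt4 k f g \<in> J"
begin

sublocale F: lie_rep "FU k :: ('a, _) module" "der_mat k" "LU_act k"
  by (rule FU_rep)

lemma J_ideal: "alg_ideal (FU k) J"
  using T_ideal by (simp add: TLU_ideal_def)

lemma k0: "0 < k" "1 < k"
  using k2 by auto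

lemma theta_diff: "f \<in> carrier (FU k) \<Longrightarrow> g \<in> carrier (FU k) \<Longrightarrow> \<theta> (f \<ominus>\<^bsub>FU k\<^esub> g) = \<theta> f - \<theta> g"
  by (simp add: F.diff_smult theta_add theta_scale)

lemma theta_eq_iff: "f \<in> carrier (FU k) \<Longrightarrow> g \<in> carrier (FU k) \<Longrightarrow> \<theta> f = \<theta> g \<longleftrightarrow> f \<ominus>\<^bsub>FU k\<^esub> g \<in> J"
  using theta_zero_iff[of "f \<ominus>\<^bsub>FU k\<^esub> g"] by (simp add: theta_diff)

lemma theta_cong_mult:
  assumes c: "f \<in> carrier (FU k)" "f' \<in> carrier (FU k)" "g \<in> carrier (FU k)" "g' \<in> carrier (FU k)"
    and eq: "\<theta> f = \<theta> f'" "\<theta> g = \<theta> g'"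
  shows "\<theta> (f \<otimes>\<^bsub>FU k\<^esub> g) = \<theta> (f' \<otimes>\<^bsub>FU k\<^esub> g')"
proof -
  have "(f \<ominus>\<^bsub>FU k\<^esub> f') \<otimes>\<^bsub>FU k\<^esub> g \<in> J" "f' \<otimes>\<^bsub>FU k\<^esub> (g \<ominus>\<^bsub>FU k\<^esub> g') \<in> J"
    using J_ideal c eq theta_eq_iff by (auto simp: alg_ideal_def)
  then have "\<theta> ((f \<ominus>\<^bsub>FU k\<^esub> f') \<otimes>\<^bsub>FU k\<^esub> g) = 0" "\<theta> (f' \<otimes>\<^bsub>FU k\<^esub> (g \<ominus>\<^bsub>FU k\<^esub> g')) = 0"
    using c by (simp_all add: theta_zero_iff)
  then show ?thesis
    using c by (simp add: F.diff_smult F.l_distr F.r_distr F.smult_mult_l F.smult_mult_r theta_add theta_scale)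
qed

lemma theta_cong_act:
  assumes d: "d \<in> derivations (mat_alg k)" and c: "f \<in> carrier (FU k)" "g \<in> carrier (FU k)" and eq: "\<theta> f = \<theta> g"
  shows "\<theta> (LU_act k d f) = \<theta> (LU_act k d g)"
proof -
  have dL: "d \<in> carrier (der_mat k)" using d by simp
  note D = der_lin[OF F.rho_der[OF dL]]
  have j: "f \<ominus>\<^bsub>FU k\<^esub> g \<in> J" using eq c by (simp add: theta_eq_iff)
  have "free_LU_act k d (f \<ominus>\<^bsub>FU k\<^esub> g) \<in> J"
    using T_ideal j dL unfolding TLU_ideal_def by blast
  then have "LU_act k d (f \<ominus>\<^bsub>FU k\<^esub> g) \<in> J" using c by (simp add: LU_act_def)
  then have "\<theta> (LU_act k d f \<ominus>\<^bsub>FU k\<^esub> LU_act k d g) = 0"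
    using c by (simp add: lin_diff[OF D F.nalg_axioms F.nalg_axioms] theta_zero_iff lin_closed[OF D])
  then show ?thesis using c by (simp add: theta_diff lin_closed[OF D])
qed

definition mul :: "'e \<Rightarrow> 'e \<Rightarrow> 'e" where
  "mul a b = \<theta> (\<sigma> a \<otimes>\<^bsub>FU k\<^esub> \<sigma> b)"

definition DD :: "('a mat \<Rightarrow> 'a mat) \<Rightarrow> 'e \<Rightarrow> 'e" where
  "DD d a = \<theta> (LU_act k d (\<sigma> a))"

definition D :: "nat \<Rightarrow> nat \<Rightarrow> 'e \<Rightarrow> 'e" where
  "D p q = DD (ad k (eu k p q))"

lemma act_closed': "d \<in> derivations (mat_alg k) \<Longrightarrow> f \<in> carrier (FU k) \<Longrightarrow> LU_act k d (f :: 'a flu) \<in> carrier (FU k)"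
  using F.rho_closed[of d f] by simp

lemma theta_mult: "f \<in> carrier (FU k) \<Longrightarrow> g \<in> carrier (FU k) \<Longrightarrow> \<theta> (f \<otimes>\<^bsub>FU k\<^esub> g) = mul (\<theta> f) (\<theta> g)"
  unfolding mul_def by (rule theta_cong_mult) (simp_all add: theta_sigma)

lemma theta_act: "d \<in> derivations (mat_alg k) \<Longrightarrow> f \<in> carrier (FU k) \<Longrightarrow> \<theta> (LU_act k d f) = DD d (\<theta> f)"
  unfolding DD_def by (rule theta_cong_act) (simp_all add: theta_sigma)

lemma mul_theta_sigma: "mul (\<theta> (\<sigma> a)) b = mul a b" "mul a (\<theta> (\<sigma> b)) = mul a b"
  unfolding mul_def by (rule theta_cong_mult; simp add: theta_sigma)+

lemma DD_add: "d \<in> derivations (mat_alg k) \<Longrightarrow> DD d (a + b) = DD d a + DD d b"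
  using F.rho_der[of d] by (simp add: DD_def sigma_add lin_add[OF der_lin] theta_add act_closed')

lemma DD_scale: "d \<in> derivations (mat_alg k) \<Longrightarrow> DD d (scale c a) = scale c (DD d a)"
  using F.rho_der[of d] by (simp add: DD_def sigma_scale lin_smult[OF der_lin] theta_scale act_closed')

lemma DD_sum: "d \<in> derivations (mat_alg k) \<Longrightarrow> DD d (sum f I) = (\<Sum>i\<in>I. DD d (f i))"
proof -
  assume d: "d \<in> derivations (mat_alg k)"
  have "DD d 0 = 0" using DD_scale[OF d, of 0 0] by simp
  then show ?thesis by (induction I rule: infinite_finite_induct) (simp_all add: DD_add[OF d])
qed

lemma DD_ad_add: "c \<in> carrier_mat k k \<Longrightarrow> d \<in> carrier_mat k k \<Longrightarrow> DD (ad k (c + d)) a = DD (ad k c) a + DD (ad k d) a"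
  using F.rho_add[of "ad k c" "ad k d" "\<sigma> a"]
  by (simp only: DD_def ad_add derivation_algebra_sel(1) ad_derivation sigma_closed theta_add act_closed' simp_thms)

lemma DD_ad_smult: "c \<in> carrier_mat k k \<Longrightarrow> DD (ad k (r \<cdot>\<^sub>m c)) a = scale r (DD (ad k c) a)"
  using F.rho_smult[of "ad k c" "\<sigma> a" r]
  by (simp only: DD_def ad_smult derivation_algebra_sel(1) ad_derivation sigma_closed theta_scale act_closed' simp_thms)

definition ext :: "(nat \<Rightarrow> nat \<Rightarrow> 'e) \<Rightarrow> 'a mat \<Rightarrow> 'e" where
  "ext T M = (\<Sum>i<k. \<Sum>j<k. scale (M $$ (i, j)) (T i j))"

lemma ext_add: "A \<in> carrier_mat k k \<Longrightarrow> B \<in> carrier_mat k k \<Longrightarrow> ext T (A + B) = ext T A + ext T B"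
  by (simp add: ext_def scale_left_distrib sum.distrib)

lemma ext_smult: "A \<in> carrier_mat k k \<Longrightarrow> ext T (c \<cdot>\<^sub>m A) = scale c (ext T A)"
  by (simp add: ext_def scale_sum_right)

lemma ext_eu: "p < k \<Longrightarrow> q < k \<Longrightarrow> ext T (eu k p q) = T p q"
proof -
  assume pq: "p < k" "q < k"
  have "ext T (eu k p q) = (\<Sum>i<k. if i = p then (\<Sum>j<k. if j = q then T i j else 0) else 0)"
    unfolding ext_def
  proof (rule sum.cong[OF refl])
    fix i assume i: "i \<in> {..<k}"
    have "(\<Sum>j<k. scale ((eu k p q :: 'a mat) $$ (i, j)) (T i j)) = (\<Sum>j<k. if i = p then (if j = q then T i j else 0) else 0)"
      using i by (intro sum.cong refl) auto
    then show "(\<Sum>j<k. scale ((eu k p q :: 'a mat) $$ (i, j)) (T i j)) = (if i = p then (\<Sum>j<k. if j = q then T i j else 0) else 0)"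
      by simp
  qed
  then show ?thesis using pq by simp
qed

text \<open>
  Equivariance under the matrix units, which is what \<^const>\<open>lu_hom\<close> states, extends to all matrices by
  linearity.
\<close>

lemma DD_ext:
  assumes T: "lu_hom k D T" and c: "c \<in> carrier_mat k k" and b: "b \<in> carrier_mat k k"
  shows "DD (ad k c) (ext T b) = ext T (c * b - b * c)"
  using c
proof (induction c rule: mat_induct)
  case (unit a p q)
  have d: "ad k (eu k p q) \<in> derivations (mat_alg k)" by (rule ad_derivation) simp
  have "D p q (ext T b) = (\<Sum>i<k. \<Sum>j<k. scale (b $$ (i, j)) (D p q (T i j)))"
    by (simp add: ext_def D_def DD_sum[OF d] DD_scale[OF d])
  also have "\<dots> = (\<Sum>i<k. (if i = q then (\<Sum>j<k. scale (b $$ (i, j)) (T p j)) else 0)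
      - (\<Sum>j<k. if j = p then scale (b $$ (i, j)) (T i q) else 0))"
  proof (rule sum.cong[OF refl])
    fix i assume i: "i \<in> {..<k}"
    have "(\<Sum>j<k. scale (b $$ (i, j)) (D p q (T i j))) =
        (\<Sum>j<k. (if i = q then scale (b $$ (i, j)) (T p j) else 0) - (if j = p then scale (b $$ (i, j)) (T i q) else 0))"
      using T i unit by (intro sum.cong refl) (auto simp: lu_hom_def scale_right_diff_distrib)
    then show "(\<Sum>j<k. scale (b $$ (i, j)) (D p q (T i j))) = (if i = q then (\<Sum>j<k. scale (b $$ (i, j)) (T p j)) else 0)
      - (\<Sum>j<k. if j = p then scale (b $$ (i, j)) (T i q) else 0)"
      by (simp add: sum_subtractf)
  qed
  also have "\<dots> = (\<Sum>j<k. scale (b $$ (q, j)) (T p j)) - (\<Sum>i<k. scale (b $$ (i, p)) (T i q))"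
    using unit by (simp add: sum_subtractf)
  finally have l: "D p q (ext T b) = \<dots>" .
  have "ext T (eu k p q * b - b * eu k p q) =
      (\<Sum>i<k. (if i = p then (\<Sum>j<k. scale (b $$ (q, j)) (T i j)) else 0) - (\<Sum>j<k. if j = q then scale (b $$ (i, p)) (T i j) else 0))"
    unfolding ext_def
  proof (rule sum.cong[OF refl])
    fix i assume i: "i \<in> {..<k}"
    have "(\<Sum>j<k. scale ((eu k p q * b - b * eu k p q) $$ (i, j)) (T i j)) =
        (\<Sum>j<k. (if i = p then scale (b $$ (q, j)) (T i j) else 0) - (if j = q then scale (b $$ (i, p)) (T i j) else 0))"
      using i unit b by (intro sum.cong refl)
        (auto simp: eu_mult_entry scale_left_diff_distrib simp del: index_mult_mat(1))
    then show "(\<Sum>j<k. scale ((eu k p q * b - b * eu k p q) $$ (i, j)) (T i j)) =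
        (if i = p then (\<Sum>j<k. scale (b $$ (q, j)) (T i j)) else 0) - (\<Sum>j<k. if j = q then scale (b $$ (i, p)) (T i j) else 0)"
      by (simp add: sum_subtractf)
  qed
  also have "\<dots> = (\<Sum>j<k. scale (b $$ (q, j)) (T p j)) - (\<Sum>i<k. scale (b $$ (i, p)) (T i q))"
    using unit by (simp add: sum_subtractf)
  finally have r: "ext T (eu k p q * b - b * eu k p q) = D p q (ext T b)" using l by simp
  have "(a \<cdot>\<^sub>m eu k p q) * b - b * (a \<cdot>\<^sub>m eu k p q) = a \<cdot>\<^sub>m (eu k p q * b - b * eu k p q)"
  proof -
    have "(a \<cdot>\<^sub>m eu k p q) * b = a \<cdot>\<^sub>m (eu k p q * b)" "b * (a \<cdot>\<^sub>m eu k p q) = a \<cdot>\<^sub>m (b * eu k p q)"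
      using b by (simp_all add: mult_smult_distrib[of _ k k _ k] mult_smult_assoc_mat[of _ k k _ k])
    then show ?thesis using b
      by (intro eq_matI) (auto simp: right_diff_distrib simp del: index_mult_mat(1))
  qed
  then show ?case
    using b r by (simp add: DD_ad_smult ext_smult commutator_closed D_def[symmetric])
next
  case (add A B)
  then show ?case using b
    by (simp add: DD_ad_add commutator_add_left[of _ k] ext_add commutator_closed)
next
  case zero
  have "ad k (0\<^sub>m k k) = ad k (0 \<cdot>\<^sub>m (eu k 0 0 :: 'a mat))" by (rule arg_cong[of _ _ "ad k"]) (intro eq_matI, auto)
  then have "DD (ad k (0\<^sub>m k k)) (ext T b) = 0" by (simp add: DD_ad_smult)
  moreover have "0\<^sub>m k k * b - b * 0\<^sub>m k k = 0 \<cdot>\<^sub>m b" using b by (intro eq_matI) auto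
  ultimately show ?case using b by (simp add: ext_smult)
qed

text \<open>
  An equivariant map turns the action of \<open>u\<close> on \<open>A/J\<close> into the operator \<open>\<phi>(u)\<close> on matrices. In this way
  substituting values of such a map into the identities evaluates the operators occurring in them.
\<close>

lemma act_ext:
  assumes T: "lu_hom k D T" and u: "u \<in> carrier (Uk k)" and b: "b \<in> carrier_mat k k"
  shows "\<theta> (uea_act (FU k) (LU_act k) u (\<sigma> (ext T b))) = \<theta> (\<sigma> (ext T (phi k u b)))"
  using der_mat_closed u
proof (induction u rule: uea_induct)
  case one
  then show ?case using b by (simp add: F.act_one phi_one)
next
  case (inj d v)
  have d: "d \<in> derivations (mat_alg k)" using inj by simp
  then obtain c where c: "c \<in> carrier_mat k k" "d = ad k c" using derivation_inner k0 by blast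
  let ?f = "uea_act (FU k) (LU_act k) v (\<sigma> (ext T b))"
  have f: "?f \<in> carrier (FU k)" using inj by (simp add: F.act_closed)
  have p: "phi k v b \<in> carrier_mat k k" using inj b by (simp add: phi_closed)
  have "\<theta> (uea_act (FU k) (LU_act k) (uea_inj (der_mat k) d \<otimes>\<^bsub>Uk k\<^esub> v) (\<sigma> (ext T b))) = \<theta> (LU_act k d ?f)"
    using inj f by (simp add: F.act_mult uea_inj_closed[OF der_mat_closed] F.act_inj)
  also have "\<dots> = \<theta> (LU_act k d (\<sigma> (ext T (phi k v b))))"
    by (rule theta_cong_act[OF d f]) (simp_all add: inj)
  also have e: "\<dots> = ext T (c * phi k v b - phi k v b * c)"
    using DD_ext[OF T c(1) p] by (simp add: DD_def c)
  finally have 1: "\<theta> (uea_act (FU k) (LU_act k) (uea_inj (der_mat k) d \<otimes>\<^bsub>Uk k\<^esub> v) (\<sigma> (ext T b))) =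
    ext T (c * phi k v b - phi k v b * c)" .
  have "\<theta> (\<sigma> (ext T (c * phi k v b - phi k v b * c))) = ext T (c * phi k v b - phi k v b * c)"
    unfolding e[symmetric] by (rule theta_sigma) (simp add: act_closed'[OF d])
  moreover have "phi k (uea_inj (der_mat k) d \<otimes>\<^bsub>Uk k\<^esub> v) b = c * phi k v b - phi k v b * c"
    using inj b d c p by (simp add: phi_mult phi_inj uea_inj_closed[OF der_mat_closed] ad_apply)
  ultimately show ?case using 1 by simp
next
  case (add v w)
  then show ?case using b
    by (simp add: F.act_add phi_add theta_add F.act_closed ext_add phi_closed sigma_add)
next
  case (smult c v)
  then show ?case using b
    by (simp add: F.act_smult phi_smult theta_scale F.act_closed ext_smult phi_closed sigma_scale)
qed

lemma DD_inv:
  assumes z: "lu_inv k D z" and c: "c \<in> carrier_mat k k"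
  shows "DD (ad k c) z = 0"
  using c
proof (induction c rule: mat_induct)
  case zero
  have "ad k (0\<^sub>m k k) = ad k (0 \<cdot>\<^sub>m (eu k 0 0 :: 'a mat))" by (rule arg_cong[of _ _ "ad k"]) (intro eq_matI, auto)
  then show ?case by (simp add: DD_ad_smult)
next
  case (unit a p q)
  then show ?case using z by (simp add: DD_ad_smult lu_inv_def D_def[symmetric])
qed (simp add: DD_ad_add)

text \<open>
  On an invariant, \<open>u\<close> acts by the scalar by which \<open>\<phi>(u)\<close> acts on the identity matrix.
\<close>

lemma act_inv:
  assumes z: "lu_inv k D z" and u: "u \<in> carrier (Uk k)"
  shows "\<exists>\<gamma>. phi k u (1\<^sub>m k) = \<gamma> \<cdot>\<^sub>m 1\<^sub>m k \<and> \<theta> (uea_act (FU k) (LU_act k) u (\<sigma> z)) = scale \<gamma> (\<theta> (\<sigma> z))"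
  using der_mat_closed u
proof (induction u rule: uea_induct)
  case one
  have "1\<^sub>m k = (1::'a) \<cdot>\<^sub>m 1\<^sub>m k" by auto
  then show ?case by (intro exI[of _ 1]) (simp add: F.act_one phi_one)
next
  case (inj d v)
  have d: "d \<in> derivations (mat_alg k)" using inj by simp
  then obtain c where c: "c \<in> carrier_mat k k" "d = ad k c" using derivation_inner k0 by blast
  from inj obtain \<gamma> where g: "phi k v (1\<^sub>m k) = \<gamma> \<cdot>\<^sub>m 1\<^sub>m k"
    "\<theta> (uea_act (FU k) (LU_act k) v (\<sigma> z)) = scale \<gamma> (\<theta> (\<sigma> z))" by blast
  let ?f = "uea_act (FU k) (LU_act k) v (\<sigma> z)"
  have f: "?f \<in> carrier (FU k)" using inj by (simp add: F.act_closed)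
  have "\<theta> (uea_act (FU k) (LU_act k) (uea_inj (der_mat k) d \<otimes>\<^bsub>Uk k\<^esub> v) (\<sigma> z)) = \<theta> (LU_act k d ?f)"
    using inj f by (simp add: F.act_mult uea_inj_closed[OF der_mat_closed] F.act_inj)
  also have "\<dots> = \<theta> (LU_act k d (\<sigma> (scale \<gamma> z)))"
    by (rule theta_cong_act[OF d f]) (simp_all add: g sigma_scale theta_scale)
  also have "\<dots> = 0"
    using DD_scale[OF d, of \<gamma> z] DD_inv[OF z c(1)] by (simp add: DD_def c)
  finally have 1: "\<theta> (uea_act (FU k) (LU_act k) (uea_inj (der_mat k) d \<otimes>\<^bsub>Uk k\<^esub> v) (\<sigma> z)) = 0" .
  have "phi k (uea_inj (der_mat k) d \<otimes>\<^bsub>Uk k\<^esub> v) (1\<^sub>m k) = c * (\<gamma> \<cdot>\<^sub>m 1\<^sub>m k) - (\<gamma> \<cdot>\<^sub>m 1\<^sub>m k) * c"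
    using inj d c g by (simp add: phi_mult phi_inj uea_inj_closed[OF der_mat_closed] ad_apply)
  also have "\<dots> = 0 \<cdot>\<^sub>m 1\<^sub>m k"
    using c by (simp add: commutator_smult_right[of _ k]) (intro eq_matI, auto)
  finally show ?case using 1 by (intro exI[of _ 0]) simp
next
  case (add v w)
  then obtain \<gamma> \<delta> where g: "phi k v (1\<^sub>m k) = \<gamma> \<cdot>\<^sub>m 1\<^sub>m k" "phi k w (1\<^sub>m k) = \<delta> \<cdot>\<^sub>m 1\<^sub>m k"
    "\<theta> (uea_act (FU k) (LU_act k) v (\<sigma> z)) = scale \<gamma> (\<theta> (\<sigma> z))"
    "\<theta> (uea_act (FU k) (LU_act k) w (\<sigma> z)) = scale \<delta> (\<theta> (\<sigma> z))" by blast
  have "\<gamma> \<cdot>\<^sub>m 1\<^sub>m k + \<delta> \<cdot>\<^sub>m 1\<^sub>m k = (\<gamma> + \<delta>) \<cdot>\<^sub>m (1\<^sub>m k :: 'a mat)" by (intro eq_matI) auto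
  then show ?case using add g
    by (intro exI[of _ "\<gamma> + \<delta>"]) (simp add: phi_add F.act_add theta_add F.act_closed scale_left_distrib)
next
  case (smult a v)
  then obtain \<gamma> where g: "phi k v (1\<^sub>m k) = \<gamma> \<cdot>\<^sub>m 1\<^sub>m k"
    "\<theta> (uea_act (FU k) (LU_act k) v (\<sigma> z)) = scale \<gamma> (\<theta> (\<sigma> z))" by blast
  have "a \<cdot>\<^sub>m (\<gamma> \<cdot>\<^sub>m 1\<^sub>m k) = (a * \<gamma>) \<cdot>\<^sub>m (1\<^sub>m k :: 'a mat)" by (intro eq_matI) auto
  then show ?case using smult g
    by (intro exI[of _ "a * \<gamma>"]) (simp add: phi_smult F.act_smult theta_scale F.act_closed)
qed

lemma cent_one: "cent k (1\<^sub>m k) = (1\<^sub>m k :: 'a mat)"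
  using k0 by (simp add: cent_def mtr_one) (intro eq_matI, auto)

lemma theta_cent_inv:
  assumes z: "lu_inv k D z"
  shows "\<theta> (opact k (cent k) (\<sigma> z)) = \<theta> (\<sigma> z)"
proof -
  note lo = lift_op[OF rc[OF k2, where ?'a = 'a]]
  obtain \<gamma> where g: "phi k (lift_op k (cent k)) (1\<^sub>m k) = \<gamma> \<cdot>\<^sub>m 1\<^sub>m k"
    "\<theta> (uea_act (FU k) (LU_act k) (lift_op k (cent k)) (\<sigma> z)) = scale \<gamma> (\<theta> (\<sigma> z))"
    using act_inv[OF z lo(1)] by blast
  have "1\<^sub>m k = \<gamma> \<cdot>\<^sub>m 1\<^sub>m k" using g(1) lo(2)[OF one_carrier_mat] cent_one by simp
  then have "1\<^sub>m k $$ (0, 0) = (\<gamma> \<cdot>\<^sub>m 1\<^sub>m k) $$ (0, 0)" by simp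
  then have "\<gamma> = 1" using k0 by simp
  then show ?thesis using g(2) by (simp add: opact_def)
qed

lemma theta_pick_hom:
  assumes v: "lu_hom k D v" and pq: "p < k" "q < k" "p \<noteq> q"
  shows "\<theta> (opact k (pick12 (eu k p q)) (\<sigma> (v 0 1))) = \<theta> (\<sigma> (v p q))"
proof -
  note lo = lift_op[OF rp[OF k2 pq(1,3), where ?'a = 'a]]
  have "\<theta> (uea_act (FU k) (LU_act k) (lift_op k (pick12 (eu k p q))) (\<sigma> (ext v (eu k 0 1)))) =
      \<theta> (\<sigma> (ext v (phi k (lift_op k (pick12 (eu k p q))) (eu k 0 1))))"
    by (rule act_ext[OF v lo(1)]) simp
  also have "phi k (lift_op k (pick12 (eu k p q))) (eu k 0 1) = pick12 (eu k p q) (eu k 0 1 :: 'a mat)"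
    by (rule lo(2)) simp
  also have "pick12 (eu k p q) (eu k 0 1) = (eu k p q :: 'a mat)"
    using k0 by (simp add: pick12_def) (intro eq_matI, auto)
  finally show ?thesis using pq k0 by (simp add: opact_def ext_eu)
qed

lemma opact_cent_closed: "f \<in> carrier (FU k) \<Longrightarrow> opact k (cent k) (f :: 'a flu) \<in> carrier (FU k)"
  by (rule opact_closed[OF rc[OF k2]])

lemma opact_pick_closed:
  "f \<in> carrier (FU k) \<Longrightarrow> p < k \<Longrightarrow> p \<noteq> q \<Longrightarrow> opact k (pick12 (eu k p q)) (f :: 'a flu) \<in> carrier (FU k)"
  by (rule opact_closed[OF rp[OF k2]])

lemmas opact_cl = opact_cent_closed opact_pick_closed

lemma theta_idt:
  "f \<in> carrier (FU k) \<Longrightarrow> g \<in> carrier (FU k) \<Longrightarrow> \<theta> (idt1 k f g) = 0"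
  "f \<in> carrier (FU k) \<Longrightarrow> g \<in> carrier (FU k) \<Longrightarrow> \<theta> (idt2 k f g) = 0"
  "f \<in> carrier (FU k) \<Longrightarrow> g \<in> carrier (FU k) \<Longrightarrow> \<theta> (idt3 k f g) = 0"
  "3 \<le> k \<Longrightarrow> f \<in> carrier (FU k) \<Longrightarrow> g \<in> carrier (FU k) \<Longrightarrow> \<theta> (idt4 k f g) = 0"
  by (simp_all add: theta_zero_iff idt_closed[OF k2] idt)

lemma D_der: "ad k (eu k p q) \<in> derivations (mat_alg k)"
  by (rule ad_derivation) simp

text \<open>
  For a diagonal idempotent with support \<open>N\<close>, the operator \<open>ad\<close> multiplies the entry at \<open>(r, s)\<close> by
  \<open>[r \<in> N] - [s \<in> N]\<close>, a number equal to its cube. The kernel of \<open>\<phi>\<close> acts as zero, so that the relation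
  holds on \<open>A/J\<close>.
\<close>

lemma idempotent_cube:
  assumes N: "N \<subseteq> {..<k}"
  shows "(\<Sum>i\<in>N. D i i (\<Sum>i\<in>N. D i i (\<Sum>i\<in>N. D i i x))) = (\<Sum>i\<in>N. D i i x)"
proof -
  interpret U: nalg "Uk k :: ('a, _) module" by (rule uea_nalg[OF der_mat_closed])
  have fin: "finite N" using N finite_subset by blast
  have "\<exists>u\<in>carrier (Uk k). (\<forall>b\<in>carrier_mat k k. \<forall>r<k. \<forall>s<k.
        phi k u b $$ (r, s) = ((if r \<in> N then 1 else 0) - (if s \<in> N then 1 else 0)) * b $$ (r, s)) \<and>
      (\<forall>f\<in>carrier (FU k). \<theta> (uea_act (FU k) (LU_act k) u f) = (\<Sum>i\<in>N. \<theta> (LU_act k (ad k (eu k i i)) f)))"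
    using fin N
  proof (induction N rule: finite_induct)
    case empty
    have z: "phi k \<zero>\<^bsub>Uk k\<^esub> b = 0 \<cdot>\<^sub>m phi k \<zero>\<^bsub>Uk k\<^esub> b" if "b \<in> carrier_mat k k" for b :: "'a mat"
      using phi_smult[OF that U.zero_closed, of 0] by simp
    have "phi k \<zero>\<^bsub>Uk k\<^esub> b $$ (r, s) = 0" if "b \<in> carrier_mat k k" "r < k" "s < k" for b :: "'a mat" and r s
      by (subst z[OF that(1)]) (use phi_closed[OF that(1) U.zero_closed] that in simp)
    moreover have "\<theta> (uea_act (FU k) (LU_act k) \<zero>\<^bsub>Uk k\<^esub> f) = 0" if "f \<in> carrier (FU k)" for f
    proof -
      have "uea_act (FU k) (LU_act k) \<zero>\<^bsub>Uk k\<^esub> f = 0 \<odot>\<^bsub>FU k\<^esub> uea_act (FU k) (LU_act k) \<zero>\<^bsub>Uk k\<^esub> f"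
        using F.act_smult[OF that U.zero_closed, of 0] by simp
      also have "\<theta> \<dots> = 0" using that by (subst theta_scale) (simp_all add: F.act_closed)
      finally show ?thesis .
    qed
    ultimately show ?case by (intro bexI[of _ "\<zero>\<^bsub>Uk k\<^esub>"]) auto
  next
    case (insert i N)
    then obtain u where u: "u \<in> carrier (Uk k)"
      "\<And>b r s. b \<in> carrier_mat k k \<Longrightarrow> r < k \<Longrightarrow> s < k \<Longrightarrow>
         phi k u b $$ (r, s) = ((if r \<in> N then 1 else 0) - (if s \<in> N then 1 else 0)) * b $$ (r, s)"
      "\<And>f. f \<in> carrier (FU k) \<Longrightarrow> \<theta> (uea_act (FU k) (LU_act k) u f) = (\<Sum>i\<in>N. \<theta> (LU_act k (ad k (eu k i i)) f))"
      by auto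
    let ?d = "ad k (eu k i i) :: 'a mat \<Rightarrow> 'a mat"
    let ?w = "uea_inj (der_mat k) ?d"
    have w: "?w \<in> carrier (Uk k)" by (rule uea_inj_closed[OF der_mat_closed]) (simp add: D_der)
    have "phi k (?w \<oplus>\<^bsub>Uk k\<^esub> u) b $$ (r, s) =
        ((if r \<in> insert i N then 1 else 0) - (if s \<in> insert i N then 1 else 0)) * b $$ (r, s)"
      if b: "b \<in> carrier_mat k k" and rs: "r < k" "s < k" for b :: "'a mat" and r s
    proof -
      have "phi k (?w \<oplus>\<^bsub>Uk k\<^esub> u) b = (eu k i i * b - b * eu k i i) + phi k u b"
        using b w u(1) by (simp add: phi_add phi_inj D_der ad_apply)
      then have "phi k (?w \<oplus>\<^bsub>Uk k\<^esub> u) b $$ (r, s) = (eu k i i * b) $$ (r, s) - (b * eu k i i) $$ (r, s) + phi k u b $$ (r, s)"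
        using phi_closed[OF b u(1)] b rs by (simp del: index_mult_mat(1))
      then show ?thesis using b rs insert by (auto simp: eu_mult_entry u(2) simp del: index_mult_mat(1))
    qed
    moreover have "\<theta> (uea_act (FU k) (LU_act k) (?w \<oplus>\<^bsub>Uk k\<^esub> u) f) = (\<Sum>i\<in>insert i N. \<theta> (LU_act k (ad k (eu k i i)) f))"
      if "f \<in> carrier (FU k)" for f
      using that w u(1) insert by (simp add: F.act_add theta_add F.act_closed u(3) F.act_inj D_der act_closed')
    ultimately show ?case using w u(1) by (intro bexI[of _ "?w \<oplus>\<^bsub>Uk k\<^esub> u"]) auto
  qed
  then obtain u where u: "u \<in> carrier (Uk k)"
    and pu: "\<And>b r s. b \<in> carrier_mat k k \<Longrightarrow> r < k \<Longrightarrow> s < k \<Longrightarrow>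
         phi k u b $$ (r, s) = ((if r \<in> N then 1 else 0) - (if s \<in> N then 1 else 0)) * b $$ (r, s)"
    and tu: "\<And>f. f \<in> carrier (FU k) \<Longrightarrow> \<theta> (uea_act (FU k) (LU_act k) u f) = (\<Sum>i\<in>N. \<theta> (LU_act k (ad k (eu k i i)) f))"
    by auto
  let ?A = "uea_act (FU k) (LU_act k) u"
  have Ac: "?A f \<in> carrier (FU k)" if "f \<in> carrier (FU k)" for f using u that by (simp add: F.act_closed)
  have dt: "(\<Sum>i\<in>N. D i i (\<theta> f)) = \<theta> (?A f)" if "f \<in> carrier (FU k)" for f
    using that by (simp add: tu D_def theta_act D_der)
  have dx: "(\<Sum>i\<in>N. D i i x) = \<theta> (?A (\<sigma> x))"
    by (simp add: tu D_def DD_def)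
  have pc: "phi k u b \<in> carrier_mat k k" if "b \<in> carrier_mat k k" for b using phi_closed[OF that u] .
  have "?A (?A (?A (\<sigma> x))) = uea_act (FU k) (LU_act k) (u \<otimes>\<^bsub>Uk k\<^esub> (u \<otimes>\<^bsub>Uk k\<^esub> u)) (\<sigma> x)"
    using u by (simp add: F.act_mult F.act_closed)
  also have "\<dots> = ?A (\<sigma> x)"
  proof (rule LU_act_cong)
    fix b :: "'a mat" assume b: "b \<in> carrier_mat k k"
    have "phi k u (phi k u (phi k u b)) = phi k u b"
      using pc[OF b] pc[OF pc[OF b]] pc[OF pc[OF pc[OF b]]]
      by (intro eq_matI) (auto simp: pu[OF pc[OF pc[OF b]]] pu[OF pc[OF b]] pu[OF b])
    then show "phi k (u \<otimes>\<^bsub>Uk k\<^esub> (u \<otimes>\<^bsub>Uk k\<^esub> u)) b = phi k u b"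
      using u b by (simp add: phi_mult)
  qed (use u in auto)
  finally show ?thesis by (simp add: dx dt Ac)
qed

sublocale core: lu_core scale mul D k
proof
  show "2 \<le> k" by (rule k2)
  fix x y z :: 'e and c p q
  show "mul (x + y) z = mul x z + mul y z" "mul z (x + y) = mul z x + mul z y"
    "mul (scale c x) y = scale c (mul x y)" "mul x (scale c y) = scale c (mul x y)"
    by (simp_all add: mul_def sigma_add sigma_scale F.l_distr F.r_distr F.smult_mult_l F.smult_mult_r theta_add theta_scale)
  have "mul (mul x y) z = mul (\<theta> (\<sigma> x \<otimes>\<^bsub>FU k\<^esub> \<sigma> y)) (\<theta> (\<sigma> z))" by (simp add: mul_theta_sigma mul_def[of x y])
  also have "\<dots> = \<theta> (\<sigma> x \<otimes>\<^bsub>FU k\<^esub> (\<sigma> y \<otimes>\<^bsub>FU k\<^esub> \<sigma> z))" by (simp add: F.m_assoc flip: theta_mult)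
  also have "\<dots> = mul (\<theta> (\<sigma> x)) (\<theta> (\<sigma> y \<otimes>\<^bsub>FU k\<^esub> \<sigma> z))" by (simp add: theta_mult)
  also have "\<dots> = mul x (mul y z)" by (simp add: mul_theta_sigma mul_def[of y z])
  finally show "mul (mul x y) z = mul x (mul y z)" .
  show "D p q (x + y) = D p q x + D p q y" "D p q (scale c x) = scale c (D p q x)"
    by (simp_all add: D_def DD_add DD_scale D_der)
  let ?d = "ad k (eu k p q) :: 'a mat \<Rightarrow> 'a mat"
  have "D p q (mul x y) = \<theta> (LU_act k ?d (\<sigma> x \<otimes>\<^bsub>FU k\<^esub> \<sigma> y))"
    by (simp add: D_def mul_def theta_act D_der)
  also have "\<dots> = \<theta> (LU_act k ?d (\<sigma> x) \<otimes>\<^bsub>FU k\<^esub> \<sigma> y \<oplus>\<^bsub>FU k\<^esub> \<sigma> x \<otimes>\<^bsub>FU k\<^esub> LU_act k ?d (\<sigma> y))"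
    using F.rho_der[of ?d] by (simp add: der_mult D_der)
  also have "\<dots> = mul (D p q x) (\<theta> (\<sigma> y)) + mul (\<theta> (\<sigma> x)) (D p q y)"
    by (simp add: theta_add theta_mult act_closed' D_der) (simp add: D_def DD_def)
  finally show "D p q (mul x y) = mul (D p q x) y + mul x (D p q y)" by (simp add: mul_theta_sigma)
next
  fix N x assume "N \<subseteq> {..<k}"
  then show "(\<Sum>i\<in>N. D i i (\<Sum>i\<in>N. D i i (\<Sum>i\<in>N. D i i x))) = (\<Sum>i\<in>N. D i i x)" by (rule idempotent_cube)
next
  fix z z' assume z: "lu_inv k D z" "lu_inv k D z'"
  have "0 = \<theta> (idt1 k (\<sigma> z) (\<sigma> z'))" by (simp add: theta_idt)
  also have "\<dots> = mul z z' - mul z' z"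
    by (simp add: idt1_def commutator_def theta_diff theta_mult opact_cl theta_cent_inv[OF z(1)] theta_cent_inv[OF z(2)] mul_theta_sigma)
  finally show "mul z z' = mul z' z" by simp
next
  fix z v assume z: "lu_inv k D z" and v: "lu_hom k D v"
  have "0 = \<theta> (idt2 k (\<sigma> z) (\<sigma> (v 0 1)))" by (simp add: theta_idt)
  also have "\<dots> = mul z (v 0 1) - mul (v 0 1) z"
    using k0 opact_cl(2)[of _ 0 1] theta_pick_hom[OF v, of 0 1]
    by (simp add: idt2_def commutator_def theta_diff theta_mult opact_cl(1) theta_cent_inv[OF z] mul_theta_sigma)
  finally show "mul z (v 0 1) = mul (v 0 1) z" by simp
next
  fix v w assume v: "lu_hom k D v" and w: "lu_hom k D w"
  have "0 = \<theta> (idt3 k (\<sigma> (v 0 1)) (\<sigma> (w 0 1)))" by (simp add: theta_idt)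
  also have "\<dots> = mul (v 0 1) (w 1 0) - mul (w 0 1) (v 1 0)"
    using k0 opact_cl(2)[of _ 0 1] opact_cl(2)[of _ 1 0] theta_pick_hom[OF v, of 0 1] theta_pick_hom[OF w, of 0 1]
      theta_pick_hom[OF v, of 1 0] theta_pick_hom[OF w, of 1 0]
    by (simp add: idt3_def theta_diff theta_mult mul_theta_sigma)
  finally show "mul (v 0 1) (w 1 0) = mul (w 0 1) (v 1 0)" by simp
next
  fix v w assume k3: "3 \<le> k" and v: "lu_hom k D v" and w: "lu_hom k D w"
  have "0 = \<theta> (idt4 k (\<sigma> (v 0 1)) (\<sigma> (w 0 1)))" using k3 by (simp add: theta_idt)
  also have "\<dots> = mul (v 0 1) (w 2 0)"
    using k0 k3 opact_cl(2)[of _ 0 1] opact_cl(2)[of _ 2 0] theta_pick_hom[OF v, of 0 1]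
      theta_pick_hom[OF w, of 2 0]
    by (simp add: idt4_def theta_mult mul_theta_sigma)
  finally show "mul (v 0 1) (w 2 0) = 0" by simp
qed

definition tok_inv :: "tok \<Rightarrow> bool" where
  "tok_inv t \<longleftrightarrow> snd t = None"

definition tok_z :: "tok \<Rightarrow> 'e" where
  "tok_z t = \<theta> (opact k (cent k) (gen k (fst t)))"

text \<open>
  The traceless part of the matrix unit. An equivariant map from \<open>sl\<^sub>k\<close> becomes an equivariant family
  indexed by all matrix units when it is composed with the projection.
\<close>

definition eo :: "nat \<Rightarrow> nat \<Rightarrow> 'a mat" where
  "eo p q = (if p = q then eu k p p - (1 / of_nat k) \<cdot>\<^sub>m 1\<^sub>m k else eu k p q)"

lemma eo_carrier [simp]: "eo p q \<in> carrier_mat k k"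
  by (simp add: eo_def minus_carrier_mat)

lemma mtr_eo: "p < k \<Longrightarrow> mtr k (eo p q) = 0"
  using k0 by (simp add: eo_def mtr_minus mtr_eu mtr_smult mtr_one)

text \<open>
  The value 0 for labels outside the index set makes the family equivariant for every label.
\<close>

definition tok_v :: "tok \<Rightarrow> nat \<Rightarrow> nat \<Rightarrow> 'e" where
  "tok_v t p q = (case snd t of None \<Rightarrow> 0 | Some \<alpha> \<Rightarrow>
     if \<alpha> \<in> fb_index k then \<theta> (opact k (\<lambda>x. co k x (fst \<alpha>) (snd \<alpha>) \<cdot>\<^sub>m eo p q) (gen k (fst t))) else 0)"

lemma tok_z_inv: "lu_inv k D (tok_z t)"
  unfolding lu_inv_def
proof (intro allI impI)
  fix p q assume "p < k" "q < k"
  let ?d = "ad k (eu k p q) :: 'a mat \<Rightarrow> 'a mat"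
  have "D p q (tok_z t) = \<theta> (LU_act k ?d (opact k (cent k) (gen k (fst t))))"
    by (simp add: tok_z_def D_def theta_act D_der opact_cl gen_closed)
  also have "LU_act k ?d (opact k (cent k) (gen k (fst t))) = opact k (\<lambda>x. ?d (cent k x)) (gen k (fst t))"
    by (rule opact_derivation[OF rc[OF k2] D_der gen_closed])
  also have "\<dots> = \<zero>\<^bsub>FU k\<^esub>"
  proof (rule opact_zero[OF _ gen_closed])
    fix x :: "'a mat"
    have "eu k p q * 1\<^sub>m k - 1\<^sub>m k * eu k p q = (0\<^sub>m k k :: 'a mat)"
      by (simp add: right_mult_one_mat[of _ k k] left_mult_one_mat[of _ k k])
    then have "?d (cent k x) = (mtr k x / of_nat k) \<cdot>\<^sub>m 0\<^sub>m k k"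
      by (simp add: ad_apply) (simp add: cent_def commutator_smult_right[of _ k] minus_r_inv_mat[of _ k k])
    also have "\<dots> = 0\<^sub>m k k" by (intro eq_matI) auto
    finally show "?d (cent k x) = 0\<^sub>m k k" .
  qed
  also have "\<theta> \<zero>\<^bsub>FU k\<^esub> = 0" using J_ideal by (simp add: theta_zero_iff alg_ideal_def)
  finally show "D p q (tok_z t) = 0" .
qed

text \<open>
  For a fixed coordinate, the class of \<open>f\<^sup>w\<close> is linear in the matrix \<open>c\<close> of the rank one operator \<open>w\<close>.
\<close>

lemma theta_rank_one_lincomb:
  assumes a: "\<alpha> \<in> fb_index k" and b: "b \<in> carrier_mat k k" "mtr k b = 0" and b': "b' \<in> carrier_mat k k" "mtr k b' = 0"
    and c: "c \<in> carrier_mat k k" "mtr k c = 0"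
    and eq: "c = s \<cdot>\<^sub>m b + s' \<cdot>\<^sub>m b'" and f: "f \<in> carrier (FU k)"
  shows "\<theta> (opact k (\<lambda>x. co k x (fst \<alpha>) (snd \<alpha>) \<cdot>\<^sub>m c) f) =
    scale s (\<theta> (opact k (\<lambda>x. co k x (fst \<alpha>) (snd \<alpha>) \<cdot>\<^sub>m b) f)) + scale s' (\<theta> (opact k (\<lambda>x. co k x (fst \<alpha>) (snd \<alpha>) \<cdot>\<^sub>m b') f))"
proof -
  have lt: "fst \<alpha> < k" "snd \<alpha> < k" using a by (auto simp: fb_index_def)
  note r = realized_rank_one[OF lt]
  have "opact k (\<lambda>x. co k x (fst \<alpha>) (snd \<alpha>) \<cdot>\<^sub>m c) f =
      s \<odot>\<^bsub>FU k\<^esub> opact k (\<lambda>x. co k x (fst \<alpha>) (snd \<alpha>) \<cdot>\<^sub>m b) f \<oplus>\<^bsub>FU k\<^esub> s' \<odot>\<^bsub>FU k\<^esub> opact k (\<lambda>x. co k x (fst \<alpha>) (snd \<alpha>) \<cdot>\<^sub>m b') f"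
  proof (rule opact_lincomb[OF r[OF c] r[OF b] r[OF b'] f])
    fix x :: "'a mat"
    show "co k x (fst \<alpha>) (snd \<alpha>) \<cdot>\<^sub>m c = s \<cdot>\<^sub>m (co k x (fst \<alpha>) (snd \<alpha>) \<cdot>\<^sub>m b) + s' \<cdot>\<^sub>m (co k x (fst \<alpha>) (snd \<alpha>) \<cdot>\<^sub>m b')"
      unfolding eq using b b' by (intro eq_matI) (auto simp: algebra_simps)
  qed
  then show ?thesis
    using opact_closed[OF r[OF b] f] opact_closed[OF r[OF b'] f] by (simp add: theta_add theta_scale)
qed

lemma tok_v_hom: "lu_hom k D (tok_v t)"
proof (cases "\<exists>\<alpha>\<in>fb_index k. snd t = Some \<alpha>")
  case False
  then have "tok_v t = (\<lambda>_ _. 0)" by (auto simp: fun_eq_iff tok_v_def split: option.splits)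
  moreover have "D p q 0 = 0" for p q using DD_scale[OF D_der, of p q 0 0] by (simp add: D_def)
  ultimately show ?thesis by (simp add: lu_hom_def)
next
  case True
  then obtain \<alpha> where a: "\<alpha> \<in> fb_index k" "snd t = Some \<alpha>" by blast
  let ?g = "gen k (fst t) :: 'a flu"
  let ?T = "\<lambda>b. \<theta> (opact k (\<lambda>x. co k x (fst \<alpha>) (snd \<alpha>) \<cdot>\<^sub>m b) ?g)"
  have v: "tok_v t p q = ?T (eo p q)" for p q using a by (simp add: tok_v_def)
  have lt: "fst \<alpha> < k" "snd \<alpha> < k" using a by (auto simp: fb_index_def)
  note r = realized_rank_one[OF lt]
  show ?thesis
    unfolding lu_hom_def
  proof (intro allI impI)
    fix p q i j assume ij: "p < k" "q < k" "i < k" "j < k"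
    let ?d = "ad k (eu k p q) :: 'a mat \<Rightarrow> 'a mat"
    let ?c = "eu k p q * eo i j - eo i j * eu k p q"
    let ?s = "if q = i then 1 else (0::'a)" and ?s' = "if j = p then -1 else (0::'a)"
    have "D p q (tok_v t i j) = \<theta> (LU_act k ?d (opact k (\<lambda>x. co k x (fst \<alpha>) (snd \<alpha>) \<cdot>\<^sub>m eo i j) ?g))"
      unfolding v using ij by (simp add: D_def theta_act D_der opact_closed r mtr_eo gen_closed)
    also have "LU_act k ?d (opact k (\<lambda>x. co k x (fst \<alpha>) (snd \<alpha>) \<cdot>\<^sub>m eo i j) ?g) =
        opact k (\<lambda>x. ?d (co k x (fst \<alpha>) (snd \<alpha>) \<cdot>\<^sub>m eo i j)) ?g"
      using ij by (intro opact_derivation r D_der gen_closed) (simp_all add: mtr_eo)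
    also have "(\<lambda>x. ?d (co k x (fst \<alpha>) (snd \<alpha>) \<cdot>\<^sub>m eo i j)) = (\<lambda>x. co k x (fst \<alpha>) (snd \<alpha>) \<cdot>\<^sub>m ?c)"
      by (simp add: fun_eq_iff ad_apply commutator_smult_right[of _ k])
    also have "?T ?c = scale ?s (?T (eo p j)) + scale ?s' (?T (eo i q))"
    proof (rule theta_rank_one_lincomb[OF a(1) _ _ _ _ _ _ _ gen_closed])
      show "?c = ?s \<cdot>\<^sub>m eo p j + ?s' \<cdot>\<^sub>m eo i q"
      proof (rule eq_matI)
        fix x y assume "x < dim_row (?s \<cdot>\<^sub>m eo p j + ?s' \<cdot>\<^sub>m eo i q)" "y < dim_col (?s \<cdot>\<^sub>m eo p j + ?s' \<cdot>\<^sub>m eo i q)"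
        then have xy: "x < k" "y < k" using eo_carrier[of i q] by auto
        have eoe: "eo a b $$ (x, y) = (if x = a \<and> y = b then 1 else 0) - (if a = b \<and> x = y then 1 / of_nat k else 0)"
          if "x < k" "y < k" for a b x y using that by (auto simp: eo_def)
        have "?c $$ (x, y) = (eu k p q * eo i j) $$ (x, y) - (eo i j * eu k p q) $$ (x, y)"
          by (rule index_minus_mat(1)) (use xy in \<open>simp_all add: carrier_matD[OF eo_carrier]\<close>)
        also have "\<dots> = (if x = p then eo i j $$ (q, y) else 0) - (if y = q then eo i j $$ (x, p) else 0)"
          using xy ij by (simp add: eu_mult_entry del: index_mult_mat(1))
        also have "\<dots> = (?s \<cdot>\<^sub>m eo p j + ?s' \<cdot>\<^sub>m eo i q) $$ (x, y)"
          using xy ij carrier_matD[OF eo_carrier[of p j]] carrier_matD[OF eo_carrier[of i q]] by (auto simp: eoe)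
        finally show "?c $$ (x, y) = (?s \<cdot>\<^sub>m eo p j + ?s' \<cdot>\<^sub>m eo i q) $$ (x, y)" .
      qed (simp_all add: carrier_matD[OF eo_carrier])
      show "mtr k ?c = 0" by (rule mtr_commutator) simp_all
      show "?c \<in> carrier_mat k k" by (rule commutator_closed) simp_all
    qed (use ij in \<open>simp_all add: mtr_eo\<close>)
    finally show "D p q (tok_v t i j) = (if q = i then tok_v t p j else 0) - (if j = p then tok_v t i q else 0)"
      by (simp add: v)
  qed
qed

sublocale words: lu_words scale mul D k tok_inv tok_z tok_v
  by unfold_locales (rule tok_z_inv, rule tok_v_hom)

lemma theta_item:
  assumes x: "x \<in> items k"
  shows "\<theta> (item_elt k x) = words.ival x"
proof (cases "snd (fst x)")
  case None
  then show ?thesis by (simp add: words.ival_def tok_inv_def tok_z_def item_elt_def item_op_def)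
next
  case (Some \<alpha>)
  then have a: "\<alpha> \<in> fb_index k" and b: "snd x \<in> fb_index k" using x by (auto simp: items_def)
  obtain p q where pq: "snd x = (p, q)" by fastforce
  have lt: "p < k" "q < k" "k - 1 < k" using b by (auto simp: pq fb_index_def)
  let ?g = "gen k (fst (fst x)) :: 'a flu"
  have v: "tok_v (fst x) i j = \<theta> (opact k (\<lambda>x. co k x (fst \<alpha>) (snd \<alpha>) \<cdot>\<^sub>m eo i j) ?g)" for i j
    using a Some by (simp add: tok_v_def)
  have "\<theta> (item_elt k x) = \<theta> (opact k (\<lambda>x. co k x (fst \<alpha>) (snd \<alpha>) \<cdot>\<^sub>m fb k p q) ?g)"
    using Some pq by (simp add: item_elt_def item_op_def)
  also have "\<dots> = core.bval (tok_v (fst x)) (p, q)"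
  proof (cases "p = q")
    case False
    then show ?thesis by (simp add: core.bval_def v fb_def eo_def)
  next
    case True
    have "\<theta> (opact k (\<lambda>x. co k x (fst \<alpha>) (snd \<alpha>) \<cdot>\<^sub>m fb k p q) ?g) =
        scale 1 (tok_v (fst x) p p) + scale (-1) (tok_v (fst x) (k - 1) (k - 1))"
      unfolding v
    proof (rule theta_rank_one_lincomb[OF a _ _ _ _ _ _ _ gen_closed])
      show "fb k p q = 1 \<cdot>\<^sub>m eo p p + (- 1) \<cdot>\<^sub>m eo (k - 1) (k - 1)"
        unfolding True by (intro eq_matI) (auto simp: fb_def eo_def)
      show "mtr k (fb k p q) = (0 :: 'a)" using mtr_fb[OF b] by (simp add: pq)
    qed (use lt in \<open>simp_all add: mtr_eo\<close>)
    then show ?thesis using True by (simp add: core.bval_def)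
  qed
  finally show ?thesis using Some by (simp add: words.ival_def tok_inv_def pq)
qed

lemma theta_word:
  assumes "ws \<noteq> []" "set ws \<subseteq> items k"
  shows "\<theta> (prodl (FU k) (item_elt k) ws) = words.wval ws"
  using assms
proof (induction ws)
  case (Cons x ws)
  then have x: "x \<in> items k" and ws: "set ws \<subseteq> items k" by simp_all
  show ?case
  proof (cases "ws = []")
    case True
    then show ?thesis using x by (simp add: theta_item words.wval_Cons)
  next
    case False
    then show ?thesis
      using Cons.IH ws
      by (simp add: theta_item[OF x] F.prodl_Cons words.wval_Cons theta_mult
          item_elt_closed[OF x k0(1)] word_closed[OF ws k0(1)])
  qed
qed simp

lemma theta_finsum:
  assumes "finite I" "\<And>j. j \<in> I \<Longrightarrow> m j \<in> carrier (FU k)"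
  shows "\<theta> (\<Oplus>\<^bsub>FU k\<^esub>j\<in>I. a j \<odot>\<^bsub>FU k\<^esub> m j) = (\<Sum>j\<in>I. scale (a j) (\<theta> (m j)))"
  using assms
proof (induction I rule: finite_induct)
  case empty
  then show ?case using J_ideal by (simp add: theta_zero_iff alg_ideal_def)
next
  case (insert i I)
  have "(\<lambda>j. a j \<odot>\<^bsub>FU k\<^esub> m j) \<in> I \<rightarrow> carrier (FU k)" "a i \<odot>\<^bsub>FU k\<^esub> m i \<in> carrier (FU k)"
    using insert by auto
  then show ?case using insert by (simp add: F.finsum_insert theta_add theta_scale F.finsum_closed)
qed

text \<open>
  The matrix to be substituted for the variable \<open>i\<close>: its coordinate with label \<open>(i, c)\<close> is \<open>\<xi> (i, c)\<close>.
\<close>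

definition coord_mat :: "(tok \<Rightarrow> 'a) \<Rightarrow> nat \<Rightarrow> 'a mat" where
  "coord_mat \<xi> i = \<xi> (i, None) \<cdot>\<^sub>m 1\<^sub>m k +
     (\<Oplus>\<^bsub>mat_alg k\<^esub>\<alpha>\<in>fb_index k. \<xi> (i, Some \<alpha>) \<cdot>\<^sub>m fb k (fst \<alpha>) (snd \<alpha>))"

lemma coord_mat_carrier: "coord_mat \<xi> i \<in> carrier_mat k k"
  unfolding coord_mat_def by (intro add_carrier_mat mat_finsum_carrier[OF finite_fb_index]) simp

lemma coord_mat_entry:
  assumes rs: "r < k" "s < k"
  shows "coord_mat \<xi> i $$ (r, s) = (if r = s then \<xi> (i, None) else 0) +
    (\<Sum>\<alpha>\<in>fb_index k. \<xi> (i, Some \<alpha>) * fb k (fst \<alpha>) (snd \<alpha>) $$ (r, s))"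
proof -
  have "(\<Oplus>\<^bsub>mat_alg k\<^esub>\<alpha>\<in>fb_index k. \<xi> (i, Some \<alpha>) \<cdot>\<^sub>m fb k (fst \<alpha>) (snd \<alpha>)) \<in> carrier_mat k k"
    by (rule mat_finsum_carrier[OF finite_fb_index]) simp
  moreover have "(\<Oplus>\<^bsub>mat_alg k\<^esub>\<alpha>\<in>fb_index k. \<xi> (i, Some \<alpha>) \<cdot>\<^sub>m fb k (fst \<alpha>) (snd \<alpha>)) $$ (r, s) =
      (\<Sum>\<alpha>\<in>fb_index k. \<xi> (i, Some \<alpha>) * fb k (fst \<alpha>) (snd \<alpha>) $$ (r, s))"
    by (rule mat_finsum_entry[OF finite_fb_index _ rs]) simp
  ultimately show ?thesis unfolding coord_mat_def using rs by simp
qed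

lemma mtr_coord_mat: "mtr k (coord_mat \<xi> i) = of_nat k * \<xi> (i, None)"
proof -
  have "mtr k (coord_mat \<xi> i) = (\<Sum>r<k. \<xi> (i, None) + (\<Sum>\<alpha>\<in>fb_index k. \<xi> (i, Some \<alpha>) * fb k (fst \<alpha>) (snd \<alpha>) $$ (r, r)))"
    unfolding mtr_def by (intro sum.cong refl) (simp add: coord_mat_entry)
  also have "\<dots> = of_nat k * \<xi> (i, None) + (\<Sum>\<alpha>\<in>fb_index k. \<xi> (i, Some \<alpha>) * mtr k (fb k (fst \<alpha>) (snd \<alpha>)))"
    by (simp add: sum.distrib mtr_def sum_distrib_left) (rule sum.swap)
  also have "(\<Sum>\<alpha>\<in>fb_index k. \<xi> (i, Some \<alpha>) * mtr k (fb k (fst \<alpha>) (snd \<alpha>))) = 0"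
    by (rule sum.neutral) (simp add: mtr_fb)
  finally show ?thesis by simp
qed

lemma co_coord_mat:
  assumes a: "\<alpha> \<in> fb_index k"
  shows "co k (coord_mat \<xi> i) (fst \<alpha>) (snd \<alpha>) = \<xi> (i, Some \<alpha>)"
proof -
  have lt: "fst \<alpha> < k" "snd \<alpha> < k" using a by (auto simp: fb_index_def)
  have "(\<Sum>\<beta>\<in>fb_index k. \<xi> (i, Some \<beta>) * fb k (fst \<beta>) (snd \<beta>) $$ (fst \<alpha>, snd \<alpha>)) =
      (\<Sum>\<beta>\<in>fb_index k. if \<beta> = \<alpha> then \<xi> (i, Some \<beta>) else 0)"
  proof (rule sum.cong[OF refl])
    fix \<beta> :: "nat \<times> nat"
    have "(fb k (fst \<beta>) (snd \<beta>) :: 'a mat) $$ (fst \<alpha>, snd \<alpha>) = (if \<beta> = \<alpha> then 1 else 0)"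
      using a by (subst fb_entry[OF lt]) (auto simp: fb_index_def prod_eq_iff)
    then show "\<xi> (i, Some \<beta>) * fb k (fst \<beta>) (snd \<beta>) $$ (fst \<alpha>, snd \<alpha>) = (if \<beta> = \<alpha> then \<xi> (i, Some \<beta>) else 0)"
      by simp
  qed
  also have "\<dots> = \<xi> (i, Some \<alpha>)" using a finite_fb_index by simp
  finally have "coord_mat \<xi> i $$ (fst \<alpha>, snd \<alpha>) = (if fst \<alpha> = snd \<alpha> then \<xi> (i, None) else 0) + \<xi> (i, Some \<alpha>)"
    using coord_mat_entry[OF lt, of \<xi> i] by simp
  then show ?thesis using k0 by (simp add: co_def mtr_coord_mat)
qed

text \<open>
  Evaluation turns a letter into the scalar belonging to its label times the matrix of the letter.
\<close>

lemma item_coord_mat: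
  assumes x: "x \<in> items k"
  shows "item_op k x (coord_mat \<xi> (fst (fst x))) = \<xi> (fst x) \<cdot>\<^sub>m words.imat x"
proof (cases "snd (fst x)")
  case None
  then have e: "fst x = (fst (fst x), None)" by (metis prod.collapse)
  show ?thesis using None k0 e
    by (simp add: item_op_def words.imat_def tok_inv_def cent_def mtr_coord_mat)
next
  case (Some \<alpha>)
  then have a: "\<alpha> \<in> fb_index k" using x by (auto simp: items_def)
  have e: "fst x = (fst (fst x), Some \<alpha>)" using Some by (metis prod.collapse)
  show ?thesis using Some e co_coord_mat[OF a, of \<xi> "fst (fst x)"]
    by (simp add: item_op_def words.imat_def tok_inv_def)
qed

text \<open>
  Group the words of \<open>f\<close> by the multisets of their labels. The evaluations at the matrices
  \<open>coord_mat \<xi>\<close> show that in each group the combination of products of matrices is zero, and the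
  class of the group modulo \<open>J\<close> is a linear function of this combination.
\<close>

lemma identities_in_T_ideal:
  assumes f: "f \<in> Id_LU_mat k"
  shows "f \<in> J"
proof -
  have fc: "f \<in> carrier (FU k)" using f by (simp add: Id_LU_mat_def LU_identities_def)
  obtain p where pc: "p \<in> carrier (free_nonunital_alg (items k))"
    and fp: "f = lext (FU k) (prodl (FU k) (item_elt k)) p"
    using words_span[OF k0(1) fc] by blast
  let ?K = "Poly_Mapping.keys p" and ?c = "Poly_Mapping.lookup p"
  let ?M = "\<lambda>w. mset (map fst w)"
  let ?m = "\<lambda>\<xi> w. prod_mset (image_mset \<xi> (?M w)) :: 'a"
  have K: "w \<noteq> []" "set w \<subseteq> items k" if "w \<in> ?K" for w
    using pc that by (auto simp: free_nonunital_alg_eq)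
  have wc: "prodl (FU k) (item_elt k) w \<in> carrier (FU k :: ('a, _) module)" if "w \<in> ?K" for w
    by (rule word_closed[OF K(2)[OF that] k0(1)])
  have eval: "(\<Sum>w\<in>?K. ?c w * (?m \<xi> w * words.wmat w $$ (r, s))) = 0" if rs: "r < k" "s < k" for \<xi> r s
  proof -
    have "\<exists>h\<in>alg_hom (FU k) (mat_alg k). \<forall>i. \<forall>u\<in>carrier (Uk k). h (free_LU_var k i u) = uea_act (mat_alg k) (\<lambda>d. d) u (coord_mat \<xi> i)"
      by (rule free_LU_universal[OF mat_rep])
         (simp_all add: coord_mat_carrier ker_phi_def phi_def)
    then obtain h where h: "h \<in> alg_hom (FU k) (mat_alg k)"
      and hv: "\<And>i u. u \<in> carrier (Uk k) \<Longrightarrow> h (free_LU_var k i u) = uea_act (mat_alg k) (\<lambda>d. d) u (coord_mat \<xi> i)" by blast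
    have "h f = 0\<^sub>m k k"
    proof -
      have "coord_mat \<xi> \<in> UNIV \<rightarrow> carrier (mat_alg k)" using coord_mat_carrier by auto
      moreover have "\<forall>b\<in>UNIV \<rightarrow> carrier (mat_alg k). \<forall>\<psi>\<in>alg_hom (FU k) (mat_alg k).
          (\<forall>i. \<forall>u\<in>carrier (Uk k). \<psi> (free_LU_var k i u) = uea_act (mat_alg k) (\<lambda>d. d) u (b i)) \<longrightarrow>
          \<psi> f = 0\<^sub>m k k"
        using f by (simp add: Id_LU_mat_def LU_identities_def)
      ultimately show ?thesis using h hv by blast
    qed
    have hx: "h (item_elt k x) = \<xi> (fst x) \<cdot>\<^sub>m words.imat x" if "x \<in> items k" for x
    proof -
      have "h (opact k (item_op k x) (gen k (fst (fst x)))) = item_op k x (coord_mat \<xi> (fst (fst x)))"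
        by (rule opact_eval[where b = "coord_mat \<xi>", OF realized_item[OF that k0(1)]])
           (simp_all add: hv phi_def coord_mat_carrier)
      then show ?thesis using item_coord_mat[OF that, of \<xi>] by (simp add: item_elt_def)
    qed
    have hw: "h (prodl (FU k) (item_elt k) w) = ?m \<xi> w \<cdot>\<^sub>m words.wmat w" if "w \<noteq> []" "set w \<subseteq> items k" for w
      using that
    proof (induction w)
      case (Cons x w)
      have xi: "x \<in> items k" using Cons by simp
      show ?case
      proof (cases "w = []")
        case True
        then show ?thesis using hx[OF xi] by (simp add: words.wmat_def right_mult_one_mat[of _ k k])
      next
        case False
        have c: "prodl (FU k) (item_elt k) w \<in> carrier (FU k :: ('a, _) module)"
          by (rule word_closed[OF _ k0(1)]) (use Cons in simp)
        have "h (prodl (FU k) (item_elt k) (x # w)) = h (item_elt k x) * h (prodl (FU k) (item_elt k) w)"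
          using False hom_mult[OF h item_elt_closed[OF xi k0(1)] c] by (simp add: F.prodl_Cons)
        also have "\<dots> = (\<xi> (fst x) \<cdot>\<^sub>m words.imat x) * (?m \<xi> w \<cdot>\<^sub>m words.wmat w)"
          using hx[OF xi] Cons False by simp
        also have "\<dots> = (\<xi> (fst x) * ?m \<xi> w) \<cdot>\<^sub>m (words.imat x * words.wmat w)"
        proof -
          have "a \<cdot>\<^sub>m (b \<cdot>\<^sub>m A) = (a * b) \<cdot>\<^sub>m A" for a b :: 'a and A by (intro eq_matI) auto
          then show ?thesis
            by (simp add: mult_smult_distrib[of _ k k _ k] mult_smult_assoc_mat[of _ k k _ k] mult.commute)
        qed
        finally show ?thesis by (simp add: words.wmat_Cons)
      qed
    qed simp
    have "h f = (\<Oplus>\<^bsub>mat_alg k\<^esub>w\<in>?K. ?c w \<odot>\<^bsub>mat_alg k\<^esub> h (prodl (FU k) (item_elt k) w))"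
      unfolding fp lext_def
      by (rule linear_finsum[OF F.nalg_axioms mat_alg_nalg])
         (simp_all add: wc lin_closed[OF hom_lin[OF h], simplified] lin_add[OF hom_lin[OF h], simplified] lin_smult[OF hom_lin[OF h], simplified])
    then have "h f $$ (r, s) = (\<Sum>w\<in>?K. ?c w * h (prodl (FU k) (item_elt k) w) $$ (r, s))"
      using mat_finsum_entry[OF finite_keys[of p] _ rs, where m = "\<lambda>w. h (prodl (FU k) (item_elt k) w)"]
        lin_closed[OF hom_lin[OF h] wc] by simp
    also have "\<dots> = (\<Sum>w\<in>?K. ?c w * (?m \<xi> w * words.wmat w $$ (r, s)))"
      using rs K by (intro sum.cong refl) (simp add: hw carrier_matD[OF words.wmat_carrier])
    finally show ?thesis using \<open>h f = 0\<^sub>m k k\<close> rs by simp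
  qed
  have coeff: "(\<Sum>w\<in>{w \<in> ?K. ?M w = M}. ?c w * words.wmat w $$ (r, s)) = 0"
    if rs: "r < k" "s < k" and M: "M \<in> ?M ` ?K" for M r s
  proof -
    have "(\<Sum>N\<in>?M ` ?K. (\<Sum>w\<in>{w \<in> ?K. ?M w = N}. ?c w * words.wmat w $$ (r, s)) * prod_mset (image_mset \<xi> N)) = 0" for \<xi>
    proof -
      have "0 = (\<Sum>w\<in>?K. ?c w * (?m \<xi> w * words.wmat w $$ (r, s)))" using eval[OF rs] by simp
      also have "\<dots> = (\<Sum>N\<in>?M ` ?K. \<Sum>w\<in>{w \<in> ?K. ?M w = N}. ?c w * (?m \<xi> w * words.wmat w $$ (r, s)))"
        by (rule sum.image_gen) simp
      also have "\<dots> = (\<Sum>N\<in>?M ` ?K. (\<Sum>w\<in>{w \<in> ?K. ?M w = N}. ?c w * words.wmat w $$ (r, s)) * prod_mset (image_mset \<xi> N))"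
        unfolding sum_distrib_right
      proof (intro sum.cong refl)
        fix N w assume "w \<in> {w \<in> ?K. ?M w = N}"
        then have "?M w = N" by blast
        then show "?c w * (?m \<xi> w * words.wmat w $$ (r, s)) = ?c w * words.wmat w $$ (r, s) * prod_mset (image_mset \<xi> N)"
          by (simp only: mult.assoc mult.commute[of "prod_mset _"])
      qed
      finally show ?thesis by simp
    qed
    then show ?thesis by (rule monomials_independent[OF finite_imageI[OF finite_keys] _ M])
  qed
  have "\<theta> f = (\<Sum>w\<in>?K. scale (?c w) (words.wval w))"
    unfolding fp lext_def using wc by (simp add: theta_finsum theta_word K)
  also have "\<dots> = (\<Sum>M\<in>?M ` ?K. \<Sum>w\<in>{w \<in> ?K. ?M w = M}. scale (?c w) (words.wval w))"
    by (rule sum.image_gen) simp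
  also have "\<dots> = 0"
  proof (rule sum.neutral, rule ballI)
    fix M assume M: "M \<in> ?M ` ?K"
    then have "M \<noteq> {#}" using K by auto
    then obtain T where T: "\<And>ws. words.valid ws \<Longrightarrow> ?M ws = M \<Longrightarrow> words.wval ws = core.app T (words.wmat ws)"
      using words.word_value_mset by blast
    have valid: "words.valid w" if "w \<in> ?K" for w
      using K(2)[OF that] by (force simp: words.valid_def items_def tok_inv_def split: option.splits)
    let ?W = "{w \<in> ?K. ?M w = M}"
    have "(\<Sum>w\<in>?W. scale (?c w) (words.wval w)) =
        (\<Sum>w\<in>?W. \<Sum>i<k. \<Sum>j<k. scale (?c w * words.wmat w $$ (i, j)) (T i j))"
      by (intro sum.cong refl) (simp add: T valid core.app_def scale_sum_right)
    also have "\<dots> = (\<Sum>i<k. \<Sum>w\<in>?W. \<Sum>j<k. scale (?c w * words.wmat w $$ (i, j)) (T i j))"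
      by (rule sum.swap)
    also have "\<dots> = (\<Sum>i<k. \<Sum>j<k. \<Sum>w\<in>?W. scale (?c w * words.wmat w $$ (i, j)) (T i j))"
      by (intro sum.cong refl) (rule sum.swap)
    also have "\<dots> = 0"
    proof (rule sum.neutral, rule ballI, rule sum.neutral, rule ballI)
      fix i j assume "i \<in> {..<k}" "j \<in> {..<k}"
      then have ij: "i < k" "j < k" by simp_all
      have "(\<Sum>w\<in>?W. scale (?c w * words.wmat w $$ (i, j)) (T i j)) =
          scale (\<Sum>w\<in>?W. ?c w * words.wmat w $$ (i, j)) (T i j)"
        by (rule scale_sum_left[symmetric])
      also have "\<dots> = 0" unfolding coeff[OF ij M] by simp
      finally show "(\<Sum>w\<in>?W. scale (?c w * words.wmat w $$ (i, j)) (T i j)) = 0" .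
    qed
    finally show "(\<Sum>w\<in>?W. scale (?c w) (words.wval w)) = 0" .
  qed
  finally show ?thesis using theta_zero_iff[OF fc] by simp
qed

end

text \<open>
  The type of the model is that of formal combinations of words in letters. It surjects onto the free
  algebra; words containing something that is not a letter are sent to zero.
\<close>

lemma Id_subset_T_ideal:
  fixes J :: "'a::field_char_0 flu set"
  assumes k2: "2 \<le> k" and J: "TLU_ideal k J" and xy: "x \<noteq> y"
    and idt: "idt1 k (gen k x) (gen k y) \<in> J" "idt2 k (gen k x) (gen k y) \<in> J"
      "idt3 k (gen k x) (gen k y) \<in> J" "3 \<le> k \<Longrightarrow> idt4 k (gen k x) (gen k y) \<in> J"
  shows "Id_LU_mat k \<subseteq> J"
proof -
  interpret F: nalg "FU k :: ('a, _) module" by (rule free_LU_nalg)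
  interpret V: vector_space "scl :: 'a \<Rightarrow> ((tok \<times> nat \<times> nat) list \<Rightarrow>\<^sub>0 'a) \<Rightarrow> _" by (rule vector_space_scl)
  define t where "t w = (if w \<noteq> [] \<and> set w \<subseteq> items k then prodl (FU k) (item_elt k) w else \<zero>\<^bsub>FU k\<^esub> :: 'a flu)" for w
  define \<sigma> where "\<sigma> = lext (FU k) t"
  have k0: "0 < k" using k2 by simp
  have tc: "t w \<in> carrier (FU k)" for w
    by (simp add: t_def word_closed k0)
  have s1: "\<sigma> a \<in> carrier (FU k)" and s2: "\<sigma> (a + b) = \<sigma> a \<oplus>\<^bsub>FU k\<^esub> \<sigma> b" and s3: "\<sigma> (scl c a) = c \<odot>\<^bsub>FU k\<^esub> \<sigma> a"
    for a b c unfolding \<sigma>_def by (simp_all add: F.lext_closed F.lext_add F.lext_scl tc)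
  have sur: "\<exists>a. \<sigma> a = f" if f: "f \<in> carrier (FU k)" for f
  proof -
    obtain p where p: "p \<in> carrier (free_nonunital_alg (items k))" "f = lext (FU k) (prodl (FU k) (item_elt k)) p"
      using words_span[OF k0 f] by blast
    have "lext (FU k) t p = lext (FU k) (prodl (FU k) (item_elt k)) p"
      unfolding lext_def
    proof (rule F.finsum_cong')
      fix w assume "w \<in> Poly_Mapping.keys p"
      then have "w \<noteq> []" "set w \<subseteq> items k" using p(1) by (auto simp: free_nonunital_alg_eq)
      then show "Poly_Mapping.lookup p w \<odot>\<^bsub>FU k\<^esub> t w =
          Poly_Mapping.lookup p w \<odot>\<^bsub>FU k\<^esub> prodl (FU k) (item_elt k) w"
        by (simp add: t_def)
    next
      show "(\<lambda>w. Poly_Mapping.lookup p w \<odot>\<^bsub>FU k\<^esub> prodl (FU k) (item_elt k) w) \<in> Poly_Mapping.keys p \<rightarrow> carrier (FU k)"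
      proof
        fix w assume "w \<in> Poly_Mapping.keys p"
        then have "w \<noteq> []" "set w \<subseteq> items k" using p(1) by (auto simp: free_nonunital_alg_eq)
        then show "Poly_Mapping.lookup p w \<odot>\<^bsub>FU k\<^esub> prodl (FU k) (item_elt k) w \<in> carrier (FU k)"
          by (simp add: word_closed k0 F.smult_closed)
      qed
    qed simp
    then show ?thesis using p by (auto simp: \<sigma>_def)
  qed
  have Ji: "alg_ideal (FU k) J" using J by (simp add: TLU_ideal_def)
  obtain \<theta> where th: "\<forall>f\<in>carrier (FU k). \<forall>g\<in>carrier (FU k). \<theta> (f \<oplus>\<^bsub>FU k\<^esub> g) = \<theta> f + \<theta> g"
     "\<forall>c. \<forall>f\<in>carrier (FU k). \<theta> (c \<odot>\<^bsub>FU k\<^esub> f) = scl c (\<theta> f)"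
     "\<forall>f\<in>carrier (FU k). \<theta> f = 0 \<longleftrightarrow> f \<in> J" "\<forall>f\<in>carrier (FU k). \<theta> (\<sigma> (\<theta> f)) = \<theta> f"
    using V.quotient_section[OF F.nalg_axioms Ji s1 s2 s3 sur] by blast
  interpret T_model scl k J \<sigma> \<theta>
    by unfold_locales (use k2 J s1 s2 s3 th T_ideal_substitute[OF k2 J xy] idt in auto)
  show ?thesis using identities_in_T_ideal by blast
qed

theorem theorem4p2p1:
  fixes k x y :: nat
  assumes "k \<ge> 2" and "x \<noteq> y"
  shows "(Id_LU_mat k :: 'a::field_char_0 flu set) =
           TLU_ideal_gen k ({identity1 k x y, identity2 k x y, identity3 k x y} \<union>
             (if k \<ge> 3 then {identity4 k x y} else {})) \<and>
         (Id_LU_mat k :: 'a flu set) =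
           TLU_ideal_gen k
             {identity1 k x y \<oplus>\<^bsub>free_LU_alg k\<^esub> identity2 k x y \<oplus>\<^bsub>free_LU_alg k\<^esub> identity3 k x y
               \<oplus>\<^bsub>free_LU_alg k\<^esub> (if k \<ge> 3 then identity4 k x y else \<zero>\<^bsub>free_LU_alg k\<^esub>)}"
proof -
  note k2 = assms(1)
  let ?X = "gen k x :: 'a flu" and ?Y = "gen k y :: 'a flu"
  let ?S = "{identity1 k x y, identity2 k x y, identity3 k x y} \<union> (if k \<ge> 3 then {identity4 k x y} else {}) :: 'a flu set"
  note id = identities_idt[OF k2]
  have sum: "identity1 k x y \<oplus>\<^bsub>free_LU_alg k\<^esub> identity2 k x y \<oplus>\<^bsub>free_LU_alg k\<^esub> identity3 k x y
      \<oplus>\<^bsub>free_LU_alg k\<^esub> (if k \<ge> 3 then identity4 k x y else \<zero>\<^bsub>free_LU_alg k\<^esub>) = (idt_sum k ?X ?Y :: 'a flu)"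
    by (simp add: idt_sum_def id)
  have S: "?S \<subseteq> Id_LU_mat k"
    using idt_in_Id[OF k2] by (auto simp: id)
  have ideal: "alg_ideal (free_LU_alg k) (Id_LU_mat k :: 'a flu set)"
    by (rule conjunct1[OF Id_T_ideal[OF k2, unfolded TLU_ideal_def]])
  have sumI: "idt_sum k ?X ?Y \<in> Id_LU_mat k"
  proof -
    have add: "f \<oplus>\<^bsub>FU k\<^esub> g \<in> Id_LU_mat k" if "f \<in> Id_LU_mat k" "g \<in> Id_LU_mat k" for f g :: "'a flu"
      using ideal that by (simp add: alg_ideal_def)
    have zero: "\<zero>\<^bsub>FU k\<^esub> \<in> (Id_LU_mat k :: 'a flu set)" using ideal by (simp add: alg_ideal_def)
    show ?thesis unfolding idt_sum_def by (simp add: add zero idt_in_Id[OF k2])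
  qed
  have "Id_LU_mat k = TLU_ideal_gen k ?S"
    unfolding TLU_ideal_gen_def
  proof (intro equalityI Inter_greatest)
    fix J :: "'a flu set" assume "J \<in> {J. TLU_ideal k J \<and> ?S \<subseteq> J}"
    then show "Id_LU_mat k \<subseteq> J"
      by (intro Id_subset_T_ideal[OF k2 _ assms(2)]) (auto simp: id[symmetric])
  qed (use S Id_T_ideal[OF k2] in blast)
  moreover have "Id_LU_mat k = TLU_ideal_gen k {idt_sum k ?X ?Y}"
    unfolding TLU_ideal_gen_def
  proof (intro equalityI Inter_greatest)
    fix J :: "'a flu set" assume "J \<in> {J. TLU_ideal k J \<and> {idt_sum k ?X ?Y} \<subseteq> J}"
    then have J: "TLU_ideal k J" "idt_sum k ?X ?Y \<in> J" by auto
    show "Id_LU_mat k \<subseteq> J"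
      using idt_sum_split[OF k2 J(1) assms(2) J(2)] by (intro Id_subset_T_ideal[OF k2 J(1) assms(2)]) auto
  qed (use sumI Id_T_ideal[OF k2] in blast)
  ultimately show ?thesis by (simp only: sum)
qed

end
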